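(* The following hold. (1) If a countable group $G$ is amenable, then $G\in\mathcal{A}$. (2) For all countable groups $G,H$: both $G\in\mathcal{A}$ and $H\in\mathcal{A}$ if and only if $G\times H\in\mathcal{A}$. (3) For all countable groups $G,H$: if $G,H\in\mathcal{A}$ then $G*H\in\mathcal{A}$. However, there exist countable groups $G,H$ with $G*H\in\mathcal{A}$ for which it is not the case that both $G$ and $H$ are in $\mathcal{A}$. (4) There exist countable groups $G,H\in\mathcal{A}$ and a semidirect product $G\rtimes H$ (with $G$ normal) such that $G\rtimes H\notin\mathcal{A}$; one can even take $G=\mathbf{Z}^2$. (5) Every countable group embeds into a group in $\mathcal{A}$. (6) Let $G,H$ be countable groups with $H<G$ a co-amenable subgroup. If $H\in\mathcal{A}$ then $G\in\mathcal{A}$. However, there exist a countable group $G\in\mathcal{A}$ and a co-amenable countable subgroup $H<G$ with $H\notin\mathcal{A}$; one can even take $G$ of the form $G=H\rtimes\mathbf{Z}$. (7) If a countable group $G$ has Kazhdan's property (T), then $G\notin\mathcal{A}$. (8) Let $G$ be a countable group and let $H\triangleleft G$ be a normal subgroup that is not of finite exponent. If the pair $(H,G)$ has the relative property (T), then $G\notin\mathcal{A}$. (9) R. Thompson's group $F$ is in $\mathcal{A}$; every non-amenable Tarski monster is not in $\mathcal{A}$.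
   Context: "Countable" always means of cardinality $\aleph_0$ (in particular infinite). An action of a group $G$ on a set $X$ is called amenable if there is an invariant mean on $X$, i.e. a $G$-invariant map $\mu$ from the collection of all subsets of $X$ to $[0,1]$ such that $\mu(A\cup B)=\mu(A)+\mu(B)$ whenever $A\cap B=\varnothing$, and $\mu(X)=1$. A group is amenable if its action on itself by left multiplication is amenable. The class $\mathcal{A}$ is the class of all countable groups $G$ that admit a faithful transitive amenable action on some set. A subgroup $H<G$ is co-amenable if the $G$-action on $G/H$ is amenable. The pair $(H,G)$ has the relative property (T) (Kazhdan–Margulis) if every unitary representation of $G$ that almost has invariant vectors has a non-zero $H$-invariant vector; $G$ has Kazhdan's property (T) if $(G,G)$ has relative property (T). A group $H$ has finite exponent if there is an integer $m\geq 1$ with $h^m=e$ for all $h\in H$. R. Thompson's group $F$ is the group of orientation-preserving piecewise linear homeomorphisms of the unit interval with finitely many breakpoints, all at dyadic rationals, and with all slopes powers of $2$. A Tarski monster is a non-cyclic group all of whose proper subgroups are cyclic. *)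

theory Defs
  imports "HOL-Analysis.Analysis" "HOL-Algebra.Algebra"
begin

section \<open>Amenable actions and the class \<open>\<A>\<close>\<close>

definition countable_group :: "('a, 'c) monoid_scheme \<Rightarrow> bool" where
  "countable_group G \<longleftrightarrow> group G \<and> countable (carrier G) \<and> infinite (carrier G)"

text \<open>The value of a mean outside the subsets of \<^term>\<open>E\<close> is irrelevant. Since \<open>\<mu> E = 1\<close> and
  \<open>\<mu> {} = 0\<close>, an amenable action is an action on a non-empty set.\<close>

definition invariant_mean ::
  "('a, 'c) monoid_scheme \<Rightarrow> 'x set \<Rightarrow> ('a \<Rightarrow> 'x \<Rightarrow> 'x) \<Rightarrow> ('x set \<Rightarrow> real) \<Rightarrow> bool" where
  "invariant_mean G E \<phi> \<mu> \<longleftrightarrow>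
     (\<forall>A. A \<subseteq> E \<longrightarrow> 0 \<le> \<mu> A \<and> \<mu> A \<le> 1) \<and>
     (\<forall>A B. A \<subseteq> E \<and> B \<subseteq> E \<and> A \<inter> B = {} \<longrightarrow> \<mu> (A \<union> B) = \<mu> A + \<mu> B) \<and>
     \<mu> E = 1 \<and>
     (\<forall>g\<in>carrier G. \<forall>A. A \<subseteq> E \<longrightarrow> \<mu> (\<phi> g ` A) = \<mu> A)"

definition amenable_action ::
  "('a, 'c) monoid_scheme \<Rightarrow> 'x set \<Rightarrow> ('a \<Rightarrow> 'x \<Rightarrow> 'x) \<Rightarrow> bool" where
  "amenable_action G E \<phi> \<longleftrightarrow> group_action G E \<phi> \<and> (\<exists>\<mu>. invariant_mean G E \<phi> \<mu>)"

definition amenable_group :: "('a, 'c) monoid_scheme \<Rightarrow> bool" where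
  "amenable_group G \<longleftrightarrow>
     group G \<and> amenable_action G (carrier G) (\<lambda>g. \<lambda>x\<in>carrier G. g \<otimes>\<^bsub>G\<^esub> x)"

definition co_amenable :: "'a set \<Rightarrow> ('a, 'c) monoid_scheme \<Rightarrow> bool" where
  "co_amenable H G \<longleftrightarrow>
     subgroup H G \<and> amenable_action G (lcosets\<^bsub>G\<^esub> H) (\<lambda>g. \<lambda>C\<in>lcosets\<^bsub>G\<^esub> H. g <#\<^bsub>G\<^esub> C)"

text \<open>A set on which a countable group acts transitively is countable, so there is no loss in
  taking it to be a set of natural numbers; see \<open>class_AI\<close> below.\<close>

definition class_A :: "('a, 'c) monoid_scheme \<Rightarrow> bool" where
  "class_A G \<longleftrightarrow> countable_group G \<and>
     (\<exists>(E :: nat set) \<phi>. faithful_action G E \<phi> \<and> transitive_action G E \<phi> \<and> amenable_action G E \<phi>)"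

lemma class_AI:
  fixes E :: "'x set"
  assumes G: "countable_group G"
    and f: "faithful_action G E \<phi>" and t: "transitive_action G E \<phi>" and a: "amenable_action G E \<phi>"
  shows "class_A G"
proof -
  interpret faithful_action G E \<phi> by fact
  interpret t: transitive_action G E \<phi> by fact
  from a obtain \<mu> where \<mu>: "invariant_mean G E \<phi> \<mu>"
    by (auto simp: amenable_action_def)
  have "E \<subseteq> (\<lambda>g. \<phi> g x) ` carrier G" if "x \<in> E" for x
    using t.unique_orbit[OF that] by fastforce
  then have "countable E"
    using G unfolding countable_group_def
    by (metis countable_empty countable_image countable_subset equals0I)
  then obtain f :: "'x \<Rightarrow> nat" where inj: "inj_on f E"
    by (auto simp: countable_def)
  define Y where "Y = f ` E"
  define r where "r = inv_into E f"
  have rf [simp]: "r (f x) = x" if "x \<in> E" for x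
    using that inj by (simp add: r_def)
  have fY [simp]: "f x \<in> Y" if "x \<in> E" for x
    using that by (simp add: Y_def)
  define \<psi> where "\<psi> = (\<lambda>g. \<lambda>y\<in>Y. f (\<phi> g (r y)))"
  have \<phi>E [simp]: "\<phi> g x \<in> E" if "g \<in> carrier G" "x \<in> E" for g x
    using that element_image by blast
  have \<psi>f [simp]: "\<psi> g (f x) = f (\<phi> g x)" if "x \<in> E" for g x
    using that by (simp add: \<psi>_def)
  have grp: "group G"
    using G by (simp add: countable_group_def)
  have bij: "\<psi> g \<in> Bij Y" if g: "g \<in> carrier G" for g
  proof -
    have "inj_on (\<psi> g) Y"
      using inj inj_prop[OF g] g unfolding Y_def inj_on_def by (metis (no_types, lifting) \<phi>E imageE \<psi>f)
    moreover have "\<psi> g ` Y = Y"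
    proof -
      have "\<psi> g ` Y = f ` (\<phi> g ` E)"
        by (auto simp: Y_def image_image)
      then show ?thesis
        using surj_prop[OF g] by (simp add: Y_def)
    qed
    ultimately show ?thesis
      by (auto simp: Bij_def bij_betw_def \<psi>_def)
  qed
  have act: "group_action G Y \<psi>"
  proof (unfold group_action_def, rule group_hom.intro[OF grp group_BijGroup])
    have "\<psi> (g \<otimes>\<^bsub>G\<^esub> h) = compose Y (\<psi> g) (\<psi> h)" if "g \<in> carrier G" "h \<in> carrier G" for g h
    proof (rule extensionalityI)
      show "\<psi> (g \<otimes>\<^bsub>G\<^esub> h) y = compose Y (\<psi> g) (\<psi> h) y" if "y \<in> Y" for y
        using that \<open>g \<in> carrier G\<close> \<open>h \<in> carrier G\<close>
        by (auto simp: Y_def compose_def composition_rule)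
    qed (auto simp: \<psi>_def compose_def)
    then show "group_hom_axioms G (BijGroup Y) \<psi>"
      using bij by (auto simp: group_hom_axioms_def hom_def BijGroup_def)
  qed
  have "faithful_action G Y \<psi>"
  proof (intro faithful_action.intro act faithful_action_axioms.intro inj_onI)
    fix g h assume gh: "g \<in> carrier G" "h \<in> carrier G" "\<psi> g = \<psi> h"
    have "\<phi> g = \<phi> h"
    proof (rule extensionalityI)
      show "\<phi> g \<in> extensional E" "\<phi> h \<in> extensional E"
        using gh bij_prop0 Bij_imp_extensional by blast+
      show "\<phi> g x = \<phi> h x" if "x \<in> E" for x
        using gh that inj \<psi>f by (metis \<phi>E inj_onD)
    qed
    then show "g = h"
      using faithful gh by (auto dest: inj_onD)
  qed
  moreover have "transitive_action G Y \<psi>"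
  proof (intro transitive_action.intro act transitive_action_axioms.intro)
    fix y z assume "y \<in> Y" "z \<in> Y"
    then obtain x x' where "x \<in> E" "x' \<in> E" "y = f x" "z = f x'"
      by (auto simp: Y_def)
    with t.unique_orbit[of x x'] show "\<exists>g\<in>carrier G. \<psi> g y = z"
      by auto
  qed
  moreover have "invariant_mean G Y \<psi> (\<lambda>A. \<mu> (r ` A))"
  proof -
    have sub: "r ` A \<subseteq> E" if "A \<subseteq> Y" for A
      using that by (auto simp: Y_def)
    have rY: "r ` Y = E"
      by (auto simp: Y_def image_image)
    have dis: "r ` A \<inter> r ` B = {}" if "A \<subseteq> Y" "B \<subseteq> Y" "A \<inter> B = {}" for A B
    proof -
      have "inj_on r Y"
        by (auto simp: Y_def inj_on_def)
      then show ?thesis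
        using that by (metis image_empty inj_on_image_Int)
    qed
    have inv: "r ` (\<psi> g ` A) = \<phi> g ` (r ` A)" if "A \<subseteq> Y" "g \<in> carrier G" for g A
      unfolding image_image
    proof (rule image_cong[OF refl])
      fix y assume "y \<in> A"
      with that obtain x where "x \<in> E" "y = f x"
        by (auto simp: Y_def)
      then show "r (\<psi> g y) = \<phi> g (r y)"
        using that by simp
    qed
    show ?thesis
      using \<mu> sub dis inv unfolding invariant_mean_def by (simp add: image_Un rY)
  qed
  ultimately show ?thesis
    using G act unfolding class_A_def amenable_action_def by blast
qed


section \<open>Products\<close>

text \<open>The underlying set of \<open>G \<rtimes> H\<close> is \<open>G \<times> H\<close>; the normal factor is the first one.\<close>

definition semidirect_product ::
  "('a, 'c) monoid_scheme \<Rightarrow> ('b, 'd) monoid_scheme \<Rightarrow> ('b \<Rightarrow> 'a \<Rightarrow> 'a) \<Rightarrow> ('a \<times> 'b) monoid" where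
  "semidirect_product G H \<theta> =
     \<lparr>carrier = carrier G \<times> carrier H,
      monoid.mult = (\<lambda>(g, h) (g', h'). (g \<otimes>\<^bsub>G\<^esub> \<theta> h g', h \<otimes>\<^bsub>H\<^esub> h')),
      one = (\<one>\<^bsub>G\<^esub>, \<one>\<^bsub>H\<^esub>)\<rparr>"

lemma semidirect_product_group:
  assumes "group G" "group H" and \<theta>: "\<theta> \<in> hom H (AutoGroup G)"
  shows "group (semidirect_product G H \<theta>)"
proof -
  interpret G: group G by fact
  interpret H: group H by fact
  interpret \<theta>: group_hom H "AutoGroup G" \<theta>
    using assms G.AutoGroup by (simp add: group_hom_def group_hom_axioms_def)
  have aut: "\<theta> h \<in> auto G" if "h \<in> carrier H" for h
    using \<theta>.hom_closed[OF that] by (simp add: AutoGroup_def)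
  have closed [simp]: "\<theta> h g \<in> carrier G" if "h \<in> carrier H" "g \<in> carrier G" for h g
    using aut[OF that(1)] that(2) by (auto simp: auto_def hom_def)
  have mult [simp]: "\<theta> h (g \<otimes>\<^bsub>G\<^esub> g') = \<theta> h g \<otimes>\<^bsub>G\<^esub> \<theta> h g'"
    if "h \<in> carrier H" "g \<in> carrier G" "g' \<in> carrier G" for h g g'
    using aut[OF that(1)] that(2,3) by (auto simp: auto_def hom_def)
  have one [simp]: "\<theta> \<one>\<^bsub>H\<^esub> g = g" if "g \<in> carrier G" for g
    using \<theta>.hom_one that by (simp add: AutoGroup_def BijGroup_def)
  have comp [simp]: "\<theta> (h \<otimes>\<^bsub>H\<^esub> h') g = \<theta> h (\<theta> h' g)"
    if "h \<in> carrier H" "h' \<in> carrier H" "g \<in> carrier G" for h h' g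
    using \<theta>.hom_mult[OF that(1,2)] aut[OF that(1)] aut[OF that(2)] that(3)
    by (simp add: AutoGroup_def BijGroup_def auto_def compose_def)
  have inv: "\<exists>y\<in>carrier G \<times> carrier H. (case y of (g, h) \<Rightarrow> \<lambda>(g', h'). (g \<otimes>\<^bsub>G\<^esub> \<theta> h g', h \<otimes>\<^bsub>H\<^esub> h')) (g, h)
      = (\<one>\<^bsub>G\<^esub>, \<one>\<^bsub>H\<^esub>)" if "g \<in> carrier G" "h \<in> carrier H" for g h
    using that by (intro bexI[of _ "(inv\<^bsub>G\<^esub> \<theta> (inv\<^bsub>H\<^esub> h) g, inv\<^bsub>H\<^esub> h)"])
      (auto simp del: \<theta>.hom_inv simp flip: comp)
  show ?thesis
    unfolding semidirect_product_def
    by (rule groupI) (use inv in \<open>auto simp: G.m_assoc H.m_assoc simp del: \<theta>.hom_mult \<theta>.hom_one\<close>)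
qed

text \<open>The free product consists of the reduced words: finite sequences of non-trivial elements
  taken alternately from the two factors. Words are multiplied by concatenation followed by
  reduction; \<open>free_product_step\<close> multiplies a reduced word by one letter from the left.\<close>

definition reduced_words ::
  "('a, 'c) monoid_scheme \<Rightarrow> ('b, 'd) monoid_scheme \<Rightarrow> ('a + 'b) list set" where
  "reduced_words G H =
     {w. set w \<subseteq> Inl ` (carrier G - {\<one>\<^bsub>G\<^esub>}) \<union> Inr ` (carrier H - {\<one>\<^bsub>H\<^esub>}) \<and>
         successively (\<lambda>k l. isl k \<noteq> isl l) w}"

definition push_letter ::
  "('a, 'c) monoid_scheme \<Rightarrow> ('b, 'd) monoid_scheme \<Rightarrow> 'a + 'b \<Rightarrow> ('a + 'b) list \<Rightarrow> ('a + 'b) list" where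
  "push_letter G H l w = (if l = Inl \<one>\<^bsub>G\<^esub> \<or> l = Inr \<one>\<^bsub>H\<^esub> then w else l # w)"

definition free_product_step ::
  "('a, 'c) monoid_scheme \<Rightarrow> ('b, 'd) monoid_scheme \<Rightarrow> 'a + 'b \<Rightarrow> ('a + 'b) list \<Rightarrow> ('a + 'b) list" where
  "free_product_step G H l w =
     (case (l, w) of
        (Inl g, Inl g' # w') \<Rightarrow> push_letter G H (Inl (g \<otimes>\<^bsub>G\<^esub> g')) w'
      | (Inr h, Inr h' # w') \<Rightarrow> push_letter G H (Inr (h \<otimes>\<^bsub>H\<^esub> h')) w'
      | _ \<Rightarrow> push_letter G H l w)"

definition free_product ::
  "('a, 'c) monoid_scheme \<Rightarrow> ('b, 'd) monoid_scheme \<Rightarrow> ('a + 'b) list monoid" where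
  "free_product G H =
     \<lparr>carrier = reduced_words G H,
      monoid.mult = (\<lambda>u v. foldr (free_product_step G H) u v),
      one = []\<rparr>"

lemma free_product_group:
  assumes "group G" "group H"
  shows "group (free_product G H)"
proof -
  interpret G: group G by fact
  interpret H: group H by fact
  let ?s = "free_product_step G H" and ?R = "reduced_words G H"
  let ?L = "Inl ` carrier G \<union> Inr ` carrier H"
  have R_Cons:
    "l # w \<in> ?R \<longleftrightarrow> l \<in> ?L \<and> l \<noteq> Inl \<one>\<^bsub>G\<^esub> \<and>
      l \<noteq> Inr \<one>\<^bsub>H\<^esub> \<and> w \<in> ?R \<and> (w = [] \<or> isl l \<noteq> isl (hd w))" for l w
    by (cases w; cases l) (auto simp: reduced_words_def)
  have step_R: "?s l w \<in> ?R" if "l \<in> ?L" "w \<in> ?R" for l w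
    using that by (cases w; cases l; cases "hd w")
      (auto simp: free_product_step_def push_letter_def R_Cons split: sum.splits list.splits)
  have step_one: "?s (Inl \<one>\<^bsub>G\<^esub>) w = w" "?s (Inr \<one>\<^bsub>H\<^esub>) w = w" if "w \<in> ?R" for w
    using that by (cases w; cases "hd w"; auto simp: free_product_step_def push_letter_def R_Cons)+
  have step_l: "?s (Inl g) (?s (Inl g') w) = ?s (Inl (g \<otimes>\<^bsub>G\<^esub> g')) w"
    if "w \<in> ?R" "g \<in> carrier G" "g' \<in> carrier G" for g g' w
  proof (cases w)
    case Nil then show ?thesis using that by (auto simp: free_product_step_def push_letter_def)
  next
    case (Cons l w')
    show ?thesis
    proof (cases l)
      case (Inl a)
      have a: "a \<in> carrier G" using that Cons Inl by (auto simp: R_Cons)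
      have w': "w' = [] \<or> (\<exists>b w''. w' = Inr b # w'')"
        using that Cons Inl by (cases w'; cases "hd w'") (auto simp: R_Cons)
      have "g \<otimes>\<^bsub>G\<^esub> g' \<otimes>\<^bsub>G\<^esub> a = g" if "g' \<otimes>\<^bsub>G\<^esub> a = \<one>\<^bsub>G\<^esub>"
        using that \<open>g \<in> carrier G\<close> \<open>g' \<in> carrier G\<close> a by (simp add: G.m_assoc)
      then show ?thesis
        using Cons Inl w' that a by (auto simp: free_product_step_def push_letter_def G.m_assoc)
    qed (use Cons that in \<open>auto simp: free_product_step_def push_letter_def\<close>)
  qed
  have step_r: "?s (Inr g) (?s (Inr g') w) = ?s (Inr (g \<otimes>\<^bsub>H\<^esub> g')) w"
    if "w \<in> ?R" "g \<in> carrier H" "g' \<in> carrier H" for g g' w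
  proof (cases w)
    case Nil then show ?thesis using that by (auto simp: free_product_step_def push_letter_def)
  next
    case (Cons l w')
    show ?thesis
    proof (cases l)
      case (Inr a)
      have a: "a \<in> carrier H" using that Cons Inr by (auto simp: R_Cons)
      have w': "w' = [] \<or> (\<exists>b w''. w' = Inl b # w'')"
        using that Cons Inr by (cases w'; cases "hd w'") (auto simp: R_Cons)
      have "g \<otimes>\<^bsub>H\<^esub> g' \<otimes>\<^bsub>H\<^esub> a = g" if "g' \<otimes>\<^bsub>H\<^esub> a = \<one>\<^bsub>H\<^esub>"
        using that \<open>g \<in> carrier H\<close> \<open>g' \<in> carrier H\<close> a by (simp add: H.m_assoc)
      then show ?thesis
        using Cons Inr w' that a by (auto simp: free_product_step_def push_letter_def H.m_assoc)
    qed (use Cons that in \<open>auto simp: free_product_step_def push_letter_def\<close>)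
  qed
  have letters: "l \<in> ?L" if "w \<in> ?R" "l \<in> set w" for l w
    using that by (auto simp: reduced_words_def)
  have foldr_R: "foldr ?s u v \<in> ?R" if "set u \<subseteq> ?L" "v \<in> ?R" for u v
    using that by (induction u) (auto intro: step_R)
  have foldr_step: "foldr ?s (?s l u) v = ?s l (foldr ?s u v)"
    if "l \<in> ?L" "u \<in> ?R" "v \<in> ?R" for l u v
  proof -
    have push: "foldr ?s (push_letter G H k x) v = ?s k (foldr ?s x v)" if "k \<in> ?L" "set x \<subseteq> ?L" for k x
      using step_one foldr_R[OF that(2) \<open>v \<in> ?R\<close>] by (auto simp: push_letter_def)
    have subL: "set u \<subseteq> ?L" using letters that by blast
    show ?thesis
    proof (cases u)
      case Nil then show ?thesis using push[OF that(1), of "[]"]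
        by (auto simp: free_product_step_def split: sum.splits)
    next
      case (Cons k x)
      have x: "k \<in> ?L" "set x \<subseteq> ?L" using subL Cons by auto
      note fx = foldr_R[OF x(2) \<open>v \<in> ?R\<close>]
      show ?thesis
      proof (cases l; cases k)
        fix g g' assume "l = Inl g" "k = Inl g'"
        then show ?thesis using Cons x that fx push[of "Inl (g \<otimes>\<^bsub>G\<^esub> g')" x] step_l[OF fx, of g g']
          by (simp add: free_product_step_def[of G H "Inl g" "Inl g' # x"]) (auto simp: image_iff)
      next
        fix g g' assume "l = Inr g" "k = Inr g'"
        then show ?thesis using Cons x that fx push[of "Inr (g \<otimes>\<^bsub>H\<^esub> g')" x] step_r[OF fx, of g g']
          by (simp add: free_product_step_def[of G H "Inr g" "Inr g' # x"]) (auto simp: image_iff)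
      next
        fix g g' assume "l = Inl g" "k = Inr g'"
        then show ?thesis using Cons push[OF that(1) subL]
          by (simp add: free_product_step_def[of G H "Inl g" "Inr g' # x"])
      next
        fix g g' assume "l = Inr g" "k = Inl g'"
        then show ?thesis using Cons push[OF that(1) subL]
          by (simp add: free_product_step_def[of G H "Inr g" "Inl g' # x"])
      qed
    qed
  qed
  have assoc: "foldr ?s (foldr ?s u v) w = foldr ?s u (foldr ?s v w)"
    if "set u \<subseteq> ?L" "v \<in> ?R" "w \<in> ?R" for u v w
    using that by (induction u) (auto simp: foldr_step foldr_R)
  have inv: "\<exists>v. set v \<subseteq> ?L \<and> foldr ?s v u = []" if "u \<in> ?R" for u
    using that
  proof (induction u)
    case Nil then show ?case by (intro exI[of _ "[]"]) auto
  next
    case (Cons l u)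
    then obtain v where v: "set v \<subseteq> ?L" "foldr ?s v u = []" by (auto simp: R_Cons)
    show ?case
    proof (cases l)
      case (Inl a)
      with Cons(2) have "?s (Inl (inv\<^bsub>G\<^esub> a)) (l # u) = u" "a \<in> carrier G"
        by (auto simp: R_Cons free_product_step_def push_letter_def)
      with v show ?thesis by (intro exI[of _ "v @ [Inl (inv\<^bsub>G\<^esub> a)]"]) auto
    next
      case (Inr a)
      with Cons(2) have "?s (Inr (inv\<^bsub>H\<^esub> a)) (l # u) = u" "a \<in> carrier H"
        by (auto simp: R_Cons free_product_step_def push_letter_def)
      with v show ?thesis by (intro exI[of _ "v @ [Inr (inv\<^bsub>H\<^esub> a)]"]) auto
    qed
  qed
  have Nil_R: "[] \<in> ?R" by (simp add: reduced_words_def)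
  show ?thesis
    unfolding free_product_def
  proof (rule groupI; simp)
    fix x assume x: "x \<in> ?R"
    obtain v where v: "set v \<subseteq> ?L" "foldr ?s v x = []" using inv[OF x] by auto
    have "foldr ?s (foldr ?s v []) x = []" using assoc[OF v(1) Nil_R x] v by simp
    then show "\<exists>y\<in>?R. foldr ?s y x = []" using foldr_R[OF v(1) Nil_R] by blast
  next
    fix x y assume "x \<in> ?R" "y \<in> ?R" then show "foldr ?s x y \<in> ?R" using foldr_R letters by blast
  next
    fix x y z assume "x \<in> ?R" "y \<in> ?R" "z \<in> ?R"
    then show "foldr ?s (foldr ?s x y) z = foldr ?s x (foldr ?s y z)" using assoc letters by blast
  next
    show "[] \<in> ?R" by (rule Nil_R)
  qed
qed


section \<open>Property (T)\<close>

definition complex_field :: "complex ring" where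
  "complex_field = \<lparr>carrier = UNIV, monoid.mult = (*), one = 1, ring.zero = 0, add = (+)\<rparr>"

text \<open>Complex vector spaces are modules over the field of complex numbers; the \<open>mult\<close> and
  \<open>one\<close> fields inherited from the record of modules play no role. The inner product is linear in
  its first argument.\<close>

record 'v inner_product_space = "(complex, 'v) module" +
  cinner :: "'v \<Rightarrow> 'v \<Rightarrow> complex"

definition cnorm :: "('v, 'z) inner_product_space_scheme \<Rightarrow> 'v \<Rightarrow> real" where
  "cnorm V x = sqrt (Re (cinner V x x))"

definition complex_hilbert_space :: "('v, 'z) inner_product_space_scheme \<Rightarrow> bool" where
  "complex_hilbert_space V \<longleftrightarrow>
     Module.module complex_field V \<and>
     (\<forall>x\<in>carrier V. \<forall>y\<in>carrier V. \<forall>z\<in>carrier V.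
        cinner V (x \<oplus>\<^bsub>V\<^esub> y) z = cinner V x z + cinner V y z) \<and>
     (\<forall>a. \<forall>x\<in>carrier V. \<forall>y\<in>carrier V. cinner V (a \<odot>\<^bsub>V\<^esub> x) y = a * cinner V x y) \<and>
     (\<forall>x\<in>carrier V. \<forall>y\<in>carrier V. cinner V y x = cnj (cinner V x y)) \<and>
     (\<forall>x\<in>carrier V. x \<noteq> \<zero>\<^bsub>V\<^esub> \<longrightarrow> 0 < Re (cinner V x x)) \<and>
     (\<forall>s :: nat \<Rightarrow> 'v. range s \<subseteq> carrier V \<and>
        (\<forall>\<epsilon>>0. \<exists>N. \<forall>m\<ge>N. \<forall>n\<ge>N. cnorm V (s m \<ominus>\<^bsub>V\<^esub> s n) < \<epsilon>) \<longrightarrow>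
        (\<exists>x\<in>carrier V. (\<lambda>n. cnorm V (s n \<ominus>\<^bsub>V\<^esub> x)) \<longlonglongrightarrow> 0))"

definition unitary_representation ::
  "('a, 'c) monoid_scheme \<Rightarrow> ('v, 'z) inner_product_space_scheme \<Rightarrow> ('a \<Rightarrow> 'v \<Rightarrow> 'v) \<Rightarrow> bool" where
  "unitary_representation G V \<pi> \<longleftrightarrow>
     complex_hilbert_space V \<and> group_action G (carrier V) \<pi> \<and>
     (\<forall>g\<in>carrier G.
        (\<forall>x\<in>carrier V. \<forall>y\<in>carrier V. \<pi> g (x \<oplus>\<^bsub>V\<^esub> y) = \<pi> g x \<oplus>\<^bsub>V\<^esub> \<pi> g y) \<and>
        (\<forall>a. \<forall>x\<in>carrier V. \<pi> g (a \<odot>\<^bsub>V\<^esub> x) = a \<odot>\<^bsub>V\<^esub> \<pi> g x) \<and>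
        (\<forall>x\<in>carrier V. \<forall>y\<in>carrier V. cinner V (\<pi> g x) (\<pi> g y) = cinner V x y))"

text \<open>The groups are discrete, so compact subsets are the finite ones.\<close>

definition almost_invariant_vectors ::
  "('a, 'c) monoid_scheme \<Rightarrow> ('v, 'z) inner_product_space_scheme \<Rightarrow> ('a \<Rightarrow> 'v \<Rightarrow> 'v) \<Rightarrow> bool" where
  "almost_invariant_vectors G V \<pi> \<longleftrightarrow>
     (\<forall>Q \<epsilon>. finite Q \<and> Q \<subseteq> carrier G \<and> 0 < \<epsilon> \<longrightarrow>
        (\<exists>v\<in>carrier V. v \<noteq> \<zero>\<^bsub>V\<^esub> \<and> (\<forall>g\<in>Q. cnorm V (\<pi> g v \<ominus>\<^bsub>V\<^esub> v) < \<epsilon> * cnorm V v)))"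

text \<open>Quantifying over all Hilbert spaces needs a fixed type for their elements. The type
  \<^typ>\<open>nat \<Rightarrow> complex\<close> has the cardinality of the continuum, so up to isomorphism the quantifier
  ranges over all Hilbert spaces of at most that cardinality, in particular over all separable
  ones. For a countable group this is every unitary representation that matters: if one has almost
  invariant vectors, choosing such vectors for each finite set and each \<open>1/n\<close> generates a separable
  subrepresentation with almost invariant vectors, and an invariant vector of the latter is one of
  the former.\<close>

definition relative_property_T :: "'a set \<Rightarrow> ('a, 'c) monoid_scheme \<Rightarrow> bool" where
  "relative_property_T H G \<longleftrightarrow>
     (\<forall>(V :: (nat \<Rightarrow> complex) inner_product_space) \<pi>.
        unitary_representation G V \<pi> \<and> almost_invariant_vectors G V \<pi> \<longrightarrow>
        (\<exists>v\<in>carrier V. v \<noteq> \<zero>\<^bsub>V\<^esub> \<and> (\<forall>h\<in>H. \<pi> h v = v)))"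

definition property_T :: "('a, 'c) monoid_scheme \<Rightarrow> bool" where
  "property_T G \<longleftrightarrow> relative_property_T (carrier G) G"

definition finite_exponent :: "('a, 'c) monoid_scheme \<Rightarrow> bool" where
  "finite_exponent H \<longleftrightarrow> (\<exists>m\<ge>1::nat. \<forall>h\<in>carrier H. h [^]\<^bsub>H\<^esub> m = \<one>\<^bsub>H\<^esub>)"


section \<open>Thompson's group \<open>F\<close> and Tarski monsters\<close>

definition dyadic :: "real set" where
  "dyadic = {real_of_int k / 2 ^ n | k n. True}"

text \<open>The breakpoints lie in the finite set \<open>B\<close>: the map is affine on every interval without
  points of \<open>B\<close> in its interior.\<close>

definition thompson_carrier :: "(real \<Rightarrow> real) set" where
  "thompson_carrier =
     {f \<in> extensional {0..1}.
        (\<exists>f'. homeomorphism {0..1} {0..1} f f') \<and> strict_mono_on {0..1} f \<and>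
        (\<exists>B. finite B \<and> B \<subseteq> dyadic \<and>
           (\<forall>a b. 0 \<le> a \<and> a < b \<and> b \<le> 1 \<and> {a<..<b} \<inter> B = {} \<longrightarrow>
              (\<exists>(k::int) c. \<forall>t\<in>{a..b}. f t = 2 powi k * t + c)))}"

definition thompson_F :: "(real \<Rightarrow> real) monoid" where
  "thompson_F = BijGroup {0..1} \<lparr>carrier := thompson_carrier\<rparr>"

definition tarski_monster :: "'a monoid \<Rightarrow> bool" where
  "tarski_monster G \<longleftrightarrow> group G \<and> \<not> cyclic_group G \<and>
     (\<forall>K. subgroup K G \<and> K \<noteq> carrier G \<longrightarrow> cyclic_group (G\<lparr>carrier := K\<rparr>))"

end

theory Submission
  imports Defs
begin

text \<open>
  An action of a countable group on a countable set has an invariant mean if and only if it has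
  Folner sets, so most arguments concern almost invariant finite sets. They lift along equivariant
  maps when the point stabilizers of the base act amenably on the fibres: this settles co-amenable
  subgroups and shows that a Tarski monster in the class is amenable, its proper subgroups being
  cyclic. A sequence of points that every group element eventually shifts has long Folner intervals:
  for Thompson's group these are the points \<open>2 powi k\<close> near \<open>0\<close>, for wreath products with \<open>\<int>\<close> they
  are cosets. Every countable group embeds into its wreath product with \<open>\<int>\<close>.

  Conversely, Folner sets are almost invariant vectors of the permutation representation, where
  property (T) yields a finite orbit. Two shears with parameter 3 generate a group acting on \<open>\<int>\<^sup>2\<close>
  without a suitable invariant mean on the dual torus or on the projective line. The resulting
  semidirect product \<open>K\<close> of \<open>\<int>\<^sup>2\<close> with the free group on two generators is not in the class but has
  that free group as a quotient, so the free product of two copies of \<open>K\<close> is in the class; and since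
  \<open>K\<close> is a direct factor of its direct sum over \<open>\<int>\<close>, the direct sum is not in the class, while its
  extension by the shift is.
\<close>

section \<open>Ultrafilters and limits\<close>

text \<open>The free group on two generators is itself in the class, so non-amenability of the
  acting group cannot expel the semidirect product; the contradiction must come from how it moves
  Z^2 and its characters. A Folner set is finite, so it is analysed with the characters of (Z/N)^2
  for a large odd N, and spectral measures become finite sums. The parameter 3 comes from ping-pong
  on the cones |y| <= |x| and |x| <= |y| without the origin: the matching shear by 3 and its inverse
  send a cone to two sets disjoint from it and from each other, boundary lines included. Each cone
  then carries at most a third of an invariant mass, while the two together carry all of it. For
  almost invariant sets the bound survives with small errors, and the explicit constants only
  control these. Folner sets are what is lifted along equivariant maps, because finite sets can
  simply be multiplied, whereas iterating means would require integrating functions. Means are used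
  where single points have to be ignored, as in the gluing for free products.\<close>

definition ultra :: "nat filter \<Rightarrow> bool" where
  "ultra U \<longleftrightarrow> U \<noteq> bot \<and> U \<le> sequentially \<and>
     (\<forall>P. eventually P U \<or> eventually (\<lambda>n. \<not> P n) U)"

text \<open>Zorn's lemma on the proper filters below \<open>sequentially\<close>, with the order
  reversed so that a maximal element is a minimal filter. Such a filter decides every predicate:
  cutting it down to the predicate yields \<open>bot\<close> or the filter itself.\<close>

lemma ex_ultra: "\<exists>U. ultra U"
proof -
  define A where "A = {F :: nat filter. F \<noteq> bot \<and> F \<le> sequentially}"
  define P where "P = (\<lambda>F G :: nat filter. G \<le> F)"
  have po: "partial_order_on A (relation_of P A)"
    by (rule partial_order_on_relation_ofI) (auto simp: P_def)
  have "\<exists>M\<in>A. \<forall>F\<in>A. P M F \<longrightarrow> F = M"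
  proof (rule predicate_Zorn[OF po])
    fix C assume C: "C \<in> Chains (relation_of P A)"
    then have CA: "C \<subseteq> A" and ch: "\<And>F G. F \<in> C \<Longrightarrow> G \<in> C \<Longrightarrow> F \<le> G \<or> G \<le> F"
      unfolding Chains_def relation_of_def P_def by auto
    show "\<exists>u\<in>A. \<forall>a\<in>C. P a u"
    proof (cases "C = {}")
      case True
      then show ?thesis by (auto simp: A_def intro: exI[of _ sequentially])
    next
      case False
      \<comment> \<open>A chain is a filter base, so its infimum is improper only if one of its
        members is.\<close>
      have "\<not> eventually (\<lambda>_. False) (Inf C)"
      proof (subst eventually_Inf_base[OF False])
        show "\<exists>x\<in>C. x \<le> inf F G" if "F \<in> C" "G \<in> C" for F G
          using ch[OF that] that by (metis inf.absorb1 inf.absorb2 order_refl)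
        show "\<not> (\<exists>b\<in>C. \<forall>\<^sub>F x in b. False)"
          using CA by (auto simp: A_def eventually_False)
      qed
      then have "Inf C \<noteq> bot" by (auto simp: eventually_False)
      moreover have "Inf C \<le> sequentially"
        using False CA by (auto simp: A_def intro: Inf_lower2)
      ultimately show ?thesis
        by (intro bexI[of _ "Inf C"]) (auto simp: A_def P_def Inf_lower)
    qed
  qed
  then obtain M where M: "M \<noteq> bot" "M \<le> sequentially"
    and max: "\<And>F. F \<noteq> bot \<Longrightarrow> F \<le> M \<Longrightarrow> F = M"
    unfolding A_def P_def using order.trans by blast
  have "eventually Q M \<or> eventually (\<lambda>n. \<not> Q n) M" for Q
  proof (cases "inf M (principal {x. Q x}) = bot")
    case True
    then show ?thesis
      by (simp flip: eventually_False add: eventually_inf_principal)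
  next
    case False
    then have "inf M (principal {x. Q x}) = M" by (intro max) auto
    then have "M \<le> principal {x. Q x}" by (metis inf.cobounded2)
    then show ?thesis by (simp add: le_principal)
  qed
  with M show ?thesis unfolding ultra_def by blast
qed

text \<open>A finite union of sets lies in an ultrafilter only if one of them does; this replaces
  passing to a subsequence on which \<open>h\<close> is constant.\<close>

lemma ultra_finite_choice:
  assumes U: "ultra U" and "finite S" and "eventually (\<lambda>n. h n \<in> S) U"
  shows "\<exists>a\<in>S. eventually (\<lambda>n. h n = a) U"
  using assms(2,3)
proof (induction S)
  case empty
  then show ?case using U by (simp add: ultra_def trivial_limit_def)
next
  case (insert a S)
  show ?case
  proof (cases "eventually (\<lambda>n. h n = a) U")
    case False
    then have "eventually (\<lambda>n. h n \<noteq> a) U" using U unfolding ultra_def by blast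
    with insert.prems have "eventually (\<lambda>n. h n \<in> S) U" by eventually_elim auto
    with insert.IH show ?thesis by auto
  qed auto
qed

text \<open>Compactness gives a cluster point. Along an ultrafilter a cluster point is a limit,
  since otherwise the complement of one of its neighbourhoods would be in the filter.\<close>

lemma ultra_limit:
  fixes a :: "nat \<Rightarrow> real"
  assumes U: "ultra U" and ab: "\<And>n. a n \<in> {0..1}"
  shows "\<exists>l\<in>{0..1}. (a \<longlongrightarrow> l) U"
proof -
  have "filtermap a U \<noteq> bot" using U by (simp add: ultra_def filtermap_bot_iff)
  moreover have "eventually (\<lambda>x. x \<in> {0..1}) (filtermap a U)"
    using ab by (auto simp: eventually_filtermap)
  ultimately obtain l where l: "l \<in> {0..1}" and ne: "inf (nhds l) (filtermap a U) \<noteq> bot"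
    using compact_Icc[of "0::real" 1] unfolding compact_filter by metis
  have "(a \<longlongrightarrow> l) U"
  proof (rule topological_tendstoI)
    fix S :: "real set" assume S: "open S" "l \<in> S"
    show "eventually (\<lambda>n. a n \<in> S) U"
    proof (rule ccontr)
      assume "\<not> ?thesis"
      then have "eventually (\<lambda>n. a n \<notin> S) U" using U unfolding ultra_def by blast
      then have "eventually (\<lambda>x. x \<notin> S) (filtermap a U)" by (simp add: eventually_filtermap)
      moreover have "eventually (\<lambda>x. x \<in> S) (nhds l)" using S by (metis eventually_nhds)
      ultimately have "eventually (\<lambda>_. False) (inf (nhds l) (filtermap a U))"
        unfolding eventually_inf by blast
      with ne show False by (simp add: eventually_False)
    qed
  qed
  with l show ?thesis by blast
qed

section \<open>Marriage theorem\<close>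

text \<open>Induction in the style of Halmos and Vaughan. If a proper non-empty \<open>J\<close> is
  tight, match \<open>J\<close>, and then the rest outside the neighbours of \<open>J\<close>. If
  there is no such \<open>J\<close>, any single choice leaves enough room for the others.\<close>

lemma hall_finite:
  assumes "finite I" and "\<And>i. i \<in> I \<Longrightarrow> finite (A i)"
    and "\<And>J. J \<subseteq> I \<Longrightarrow> card J \<le> card (\<Union>i\<in>J. A i)"
  shows "\<exists>f. inj_on f I \<and> (\<forall>i\<in>I. f i \<in> A i)"
  using assms
proof (induction "card I" arbitrary: I A rule: less_induct)
  case less
  note fin = less.prems(1) and finA = less.prems(2) and hall = less.prems(3)
  consider (empty) "I = {}" | (tight) J where "J \<subset> I" "J \<noteq> {}" "card J = card (\<Union>i\<in>J. A i)"
    | (loose) "I \<noteq> {}" "\<And>J. J \<subset> I \<Longrightarrow> J \<noteq> {} \<Longrightarrow> card J < card (\<Union>i\<in>J. A i)"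
    using hall by (metis le_neq_implies_less psubset_imp_subset)
  then show ?case
  proof cases
    case empty
    then show ?thesis by auto
  next
    case (loose)
    then obtain i where i: "i \<in> I" by auto
    have "card {i} \<le> card (\<Union>j\<in>{i}. A j)" using i by (intro hall) auto
    then obtain a where a: "a \<in> A i" by (cases "A i = {}") auto
    have "\<exists>f. inj_on f (I - {i}) \<and> (\<forall>j\<in>I - {i}. f j \<in> A j - {a})"
    proof (rule less.hyps)
      show "card (I - {i}) < card I" using fin i by (meson card_Diff1_less)
      fix J assume J: "J \<subseteq> I - {i}"
      show "card J \<le> card (\<Union>j\<in>J. A j - {a})"
      proof (cases "J = {}")
        case False
        have "card J < card (\<Union>j\<in>J. A j)" using J i by (intro loose(2)[OF _ False]) auto
        moreover have "(\<Union>j\<in>J. A j - {a}) = (\<Union>j\<in>J. A j) - {a}" by auto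
        moreover have "finite (\<Union>j\<in>J. A j)" using J fin finA by (auto intro: finite_subset)
        ultimately show ?thesis
          by (cases "a \<in> (\<Union>j\<in>J. A j)") (simp_all add: card_Diff_singleton_if)
      qed auto
    qed (use fin finA in auto)
    then obtain f where f: "inj_on f (I - {i})" "\<And>j. j \<in> I - {i} \<Longrightarrow> f j \<in> A j - {a}"
      by blast
    have "inj_on (f(i := a)) I"
      using f by (auto simp: inj_on_def)
    with f a show ?thesis by (intro exI[of _ "f(i := a)"]) auto
  next
    case (tight J)
    have finJ: "finite J" using tight fin by (auto intro: finite_subset)
    have "\<exists>f. inj_on f J \<and> (\<forall>j\<in>J. f j \<in> A j)"
    proof (rule less.hyps)
      show "card J < card I" using tight(1) fin by (simp add: psubset_card_mono)
    qed (use tight(1) finA hall finJ in auto)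
    then obtain f where f: "inj_on f J" "\<And>j. j \<in> J \<Longrightarrow> f j \<in> A j" by blast
    let ?U = "\<Union>j\<in>J. A j"
    have finU: "finite ?U" using finJ tight finA by auto
    have "\<exists>g. inj_on g (I - J) \<and> (\<forall>j\<in>I - J. g j \<in> A j - ?U)"
    proof (rule less.hyps)
      show "card (I - J) < card I"
        using tight fin by (intro psubset_card_mono) auto
      fix K assume K: "K \<subseteq> I - J"
      have finK: "finite K" using K fin by (auto intro: finite_subset)
      have "card J + card K = card (J \<union> K)"
        using K finJ finK by (subst card_Un_disjoint) auto
      also have "\<dots> \<le> card (\<Union>j\<in>J \<union> K. A j)" using K tight by (intro hall) auto
      also have "(\<Union>j\<in>J \<union> K. A j) = ?U \<union> (\<Union>j\<in>K. A j - ?U)" by auto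
      also have "card \<dots> \<le> card ?U + card (\<Union>j\<in>K. A j - ?U)" by (rule card_Un_le)
      finally show "card K \<le> card (\<Union>j\<in>K. A j - ?U)" using tight by simp
    qed (use fin finA in auto)
    then obtain g where g: "inj_on g (I - J)" "\<And>j. j \<in> I - J \<Longrightarrow> g j \<in> A j - ?U" by blast
    define h where "h j = (if j \<in> J then f j else g j)" for j
    have "inj_on h I"
    proof (rule inj_onI)
      fix x y assume xy: "x \<in> I" "y \<in> I" "h x = h y"
      show "x = y"
        using xy f g by (cases "x \<in> J"; cases "y \<in> J"; simp add: h_def; (metis DiffI inj_on_eq_iff | (metis Diff_iff UN_I)))
    qed
    moreover have "h j \<in> A j" if "j \<in> I" for j
      using f g that by (auto simp: h_def)
    ultimately show ?thesis by blast
  qed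
qed

text \<open>A compactness argument: match each finite initial segment and take the limit of the
  matchings along an ultrafilter, which exists because every \<open>A i\<close> is finite.\<close>

lemma hall_countable:
  assumes I: "countable I" and finA: "\<And>i. i \<in> I \<Longrightarrow> finite (A i)"
    and hall: "\<And>J. finite J \<Longrightarrow> J \<subseteq> I \<Longrightarrow> card J \<le> card (\<Union>i\<in>J. A i)"
  shows "\<exists>f. inj_on f I \<and> (\<forall>i\<in>I. f i \<in> A i)"
proof -
  obtain U where U: "ultra U" using ex_ultra by blast
  define K where "K n = {i \<in> I. to_nat_on I i < n}" for n
  have finK: "finite (K n)" for n
  proof -
    have "inj_on (to_nat_on I) (K n)" using I by (auto simp: K_def inj_on_def)
    moreover have "to_nat_on I ` K n \<subseteq> {..<n}" by (auto simp: K_def)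
    ultimately show ?thesis by (meson finite_imageD finite_lessThan finite_subset)
  qed
  have "\<exists>f. inj_on f (K n) \<and> (\<forall>i\<in>K n. f i \<in> A i)" for n
    by (rule hall_finite) (use finK finA in \<open>auto simp: K_def intro!: hall intro: finite_subset\<close>)
  then obtain F where F: "\<And>n. inj_on (F n) (K n)" "\<And>n i. i \<in> K n \<Longrightarrow> F n i \<in> A i" by metis
  have evK: "eventually (\<lambda>n. i \<in> K n) U" if "i \<in> I" for i
  proof (rule filter_leD)
    show "U \<le> sequentially" using U by (simp add: ultra_def)
    show "eventually (\<lambda>n. i \<in> K n) sequentially"
      using that by (auto simp: K_def intro: eventually_gt_at_top)
  qed
  have "\<exists>a\<in>A i. eventually (\<lambda>n. F n i = a) U" if "i \<in> I" for i
    by (rule ultra_finite_choice[OF U finA[OF that]])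
      (use evK[OF that] F(2) in \<open>auto elim: eventually_mono\<close>)
  then obtain f where f: "\<And>i. i \<in> I \<Longrightarrow> f i \<in> A i" "\<And>i. i \<in> I \<Longrightarrow> eventually (\<lambda>n. F n i = f i) U"
    by metis
  have "inj_on f I"
  proof (rule inj_onI)
    fix i j assume ij: "i \<in> I" "j \<in> I" "f i = f j"
    have "eventually (\<lambda>n. i = j) U"
      using evK[OF ij(1)] evK[OF ij(2)] f(2)[OF ij(1)] f(2)[OF ij(2)]
      by eventually_elim (use F(1) ij(3) in \<open>metis inj_onD\<close>)
    then show "i = j" using U by (auto simp: ultra_def eventually_const_iff split: if_splits)
  qed
  with f show ?thesis by blast
qed

section \<open>Set actions and Folner sets\<close>

text \<open>Unlike \<open>group_action\<close>, this asks nothing of \<open>f\<close> outside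
  \<open>E\<close>, so restrictions to invariant subsets, pullbacks and conjugates stay plain lambda
  terms; \<open>restrict_group_action\<close> leads back.\<close>

locale set_action = group G for G (structure) +
  fixes E :: "'x set" and f :: "'a \<Rightarrow> 'x \<Rightarrow> 'x"
  assumes closed [simp, intro]: "g \<in> carrier G \<Longrightarrow> x \<in> E \<Longrightarrow> f g x \<in> E"
    and act_one [simp]: "x \<in> E \<Longrightarrow> f \<one> x = x"
    and act_mult: "g \<in> carrier G \<Longrightarrow> h \<in> carrier G \<Longrightarrow> x \<in> E \<Longrightarrow> f (g \<otimes> h) x = f g (f h x)"
begin

lemma act_inv [simp]: "g \<in> carrier G \<Longrightarrow> x \<in> E \<Longrightarrow> f (inv g) (f g x) = x"
  by (simp flip: act_mult)

lemma act_inv' [simp]: "g \<in> carrier G \<Longrightarrow> x \<in> E \<Longrightarrow> f g (f (inv g) x) = x"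
  by (simp flip: act_mult)

lemma act_inj: "g \<in> carrier G \<Longrightarrow> x \<in> E \<Longrightarrow> y \<in> E \<Longrightarrow> f g x = f g y \<Longrightarrow> x = y"
  by (metis act_inv)

lemma act_inj_on: "g \<in> carrier G \<Longrightarrow> A \<subseteq> E \<Longrightarrow> inj_on (f g) A"
  by (meson act_inj inj_onI subsetD)

lemma act_image_inv:
  assumes "g \<in> carrier G" "A \<subseteq> E" shows "f (inv g) ` f g ` A = A" "f g ` f (inv g) ` A = A"
  using assms by (force simp: image_image)+

lemma act_image_UNIV: "g \<in> carrier G \<Longrightarrow> f g ` E = E"
  using act_inv' by (force intro!: image_eqI[of _ _ "f (inv g) _"])

lemma act_bij: "g \<in> carrier G \<Longrightarrow> bij_betw (f g) E E"
  by (simp add: bij_betw_def act_inj_on act_image_UNIV)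

lemma restrict_group_action: "group_action G E (\<lambda>g. restrict (f g) E)"
proof (unfold group_action_def, rule group_hom.intro[OF is_group group_BijGroup])
  have B: "restrict (f g) E \<in> Bij E" if "g \<in> carrier G" for g
    using act_bij[OF that] by (auto simp: Bij_def cong: bij_betw_cong)
  have "restrict (f (g \<otimes> h)) E = compose E (restrict (f g) E) (restrict (f h) E)"
    if "g \<in> carrier G" "h \<in> carrier G" for g h
    using that by (auto simp: fun_eq_iff compose_def act_mult)
  with B show "group_hom_axioms G (BijGroup E) (\<lambda>g. restrict (f g) E)"
    by (auto simp: group_hom_axioms_def hom_def BijGroup_def)
qed

lemma card_act_image: "g \<in> carrier G \<Longrightarrow> A \<subseteq> E \<Longrightarrow> card (f g ` A) = card A"
  by (simp add: act_inj_on card_image)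

end

lemma (in group_action) set_action: "set_action G E \<phi>"
proof -
  interpret group_hom G "BijGroup E" \<phi> by (rule group_hom)
  show ?thesis
  proof
    show "\<phi> g x \<in> E" if "g \<in> carrier G" "x \<in> E" for g x
      using that element_image by blast
    show "\<phi> \<one> x = x" if "x \<in> E" for x using that by (metis id_eq_one restrict_apply')
  qed (use composition_rule in blast)+
qed

text \<open>Only \<open>gA - A\<close> is bounded: for finite \<open>A\<close> and injective
  \<open>g\<close> the sets \<open>gA - A\<close> and \<open>A - gA\<close> have the same size, see
  \<open>card_symdiff_image\<close>.\<close>

definition folner_action :: "('a, 'c) monoid_scheme \<Rightarrow> 'x set \<Rightarrow> ('a \<Rightarrow> 'x \<Rightarrow> 'x) \<Rightarrow> bool" where
  "folner_action G E f \<longleftrightarrow>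
     (\<forall>Q \<epsilon>. finite Q \<and> Q \<subseteq> carrier G \<and> 0 < \<epsilon> \<longrightarrow>
       (\<exists>A. finite A \<and> A \<noteq> {} \<and> A \<subseteq> E \<and> (\<forall>g\<in>Q. real (card (f g ` A - A)) \<le> \<epsilon> * real (card A))))"

lemma folner_actionD:
  assumes "folner_action G E f" "finite Q" "Q \<subseteq> carrier G" "0 < \<epsilon>"
  obtains A where "finite A" "A \<noteq> {}" "A \<subseteq> E"
    "\<And>g. g \<in> Q \<Longrightarrow> real (card (f g ` A - A)) \<le> \<epsilon> * real (card A)"
  using assms unfolding folner_action_def by meson

section \<open>Elementary properties of invariant means\<close>

lemma invariant_mean_cong:
  assumes "\<And>g x. g \<in> carrier G \<Longrightarrow> x \<in> E \<Longrightarrow> f g x = f' g x"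
  shows "invariant_mean G E f \<mu> \<longleftrightarrow> invariant_mean G E f' \<mu>"
proof -
  have "f g ` A = f' g ` A" if "g \<in> carrier G" "A \<subseteq> E" for g A
    using assms that by (intro image_cong) auto
  then show ?thesis unfolding invariant_mean_def by simp
qed

lemma invariant_mean_empty:
  assumes "invariant_mean G E f \<mu>" shows "\<mu> {} = 0"
proof -
  have "\<mu> ({} \<union> {}) = \<mu> {} + \<mu> {}" using assms unfolding invariant_mean_def by blast
  then show ?thesis by simp
qed

lemma invariant_mean_Un:
  "invariant_mean G E f \<mu> \<Longrightarrow> A \<subseteq> E \<Longrightarrow> B \<subseteq> E \<Longrightarrow> A \<inter> B = {} \<Longrightarrow> \<mu> (A \<union> B) = \<mu> A + \<mu> B"
  unfolding invariant_mean_def by blast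

lemma invariant_mean_mono:
  assumes m: "invariant_mean G E f \<mu>" and "A \<subseteq> B" "B \<subseteq> E" shows "\<mu> A \<le> \<mu> B"
proof -
  have "\<mu> (A \<union> (B - A)) = \<mu> A + \<mu> (B - A)"
    using assms by (intro invariant_mean_Un[OF m]) auto
  moreover have "A \<union> (B - A) = B" using assms by auto
  moreover have "B - A \<subseteq> E" using assms by auto
  then have "0 \<le> \<mu> (B - A)" using m unfolding invariant_mean_def by blast
  ultimately show ?thesis by simp
qed

lemma invariant_mean_UN:
  assumes m: "invariant_mean G E f \<mu>" and "finite I" and "\<And>i. i \<in> I \<Longrightarrow> A i \<subseteq> E"
    and "disjoint_family_on A I"
  shows "\<mu> (\<Union>i\<in>I. A i) = (\<Sum>i\<in>I. \<mu> (A i))"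
  using assms(2-)
proof (induction I)
  case empty
  then show ?case by (simp add: invariant_mean_empty[OF m])
next
  case (insert i I)
  have "\<mu> (A i \<union> (\<Union>i\<in>I. A i)) = \<mu> (A i) + \<mu> (\<Union>i\<in>I. A i)"
    using insert.prems insert.hyps by (intro invariant_mean_Un[OF m]) (auto simp: disjoint_family_on_def)
  then show ?case using insert by (simp add: disjoint_family_on_def)
qed

lemma invariant_mean_subadd:
  assumes m: "invariant_mean G E f \<mu>" and "A \<subseteq> E" "B \<subseteq> E" shows "\<mu> (A \<union> B) \<le> \<mu> A + \<mu> B"
proof -
  have "\<mu> (A \<union> (B - A)) = \<mu> A + \<mu> (B - A)"
    using assms by (intro invariant_mean_Un[OF m]) auto
  moreover have "\<mu> (B - A) \<le> \<mu> B" using assms by (intro invariant_mean_mono[OF m]) auto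
  ultimately show ?thesis by simp
qed

context set_action begin

text \<open>An injection that moves each of finitely many pieces by one group element preserves the
  mean, so its image has full mean. Two such injections with disjoint images contradict
  additivity.\<close>

lemma mean_piecewise:
  assumes m: "invariant_mean G E f \<mu>" and R: "finite R" "R \<subseteq> carrier G"
    and c: "\<And>x. x \<in> E \<Longrightarrow> c x \<in> R" and inj: "inj_on (\<lambda>x. f (c x) x) E"
  shows "\<mu> ((\<lambda>x. f (c x) x) ` E) = 1"
proof -
  define P where "P r = {x \<in> E. c x = r}" for r
  have PE: "P r \<subseteq> E" for r by (auto simp: P_def)
  have fP: "f r ` P r = (\<lambda>x. f (c x) x) ` P r" for r by (auto simp: P_def)
  have "(\<lambda>x. f (c x) x) ` E = (\<Union>r\<in>R. f r ` P r)" using c by (auto simp: P_def)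
  also have "\<mu> \<dots> = (\<Sum>r\<in>R. \<mu> (f r ` P r))"
  proof (rule invariant_mean_UN[OF m R(1)])
    show "disjoint_family_on (\<lambda>r. f r ` P r) R"
      unfolding disjoint_family_on_def
    proof (intro ballI impI)
      fix r s :: 'a assume "r \<noteq> s"
      then have "P r \<inter> P s = {}" by (auto simp: P_def)
      then show "f r ` P r \<inter> f s ` P s = {}"
        unfolding fP using inj_on_image_Int[OF inj PE PE, of r s] by auto
    qed
  qed (use R PE in auto)
  also have "\<dots> = (\<Sum>r\<in>R. \<mu> (P r))"
    using m R PE by (intro sum.cong) (auto simp: invariant_mean_def)
  also have "\<dots> = \<mu> (\<Union>r\<in>R. P r)"
    by (rule invariant_mean_UN[OF m R(1), symmetric]) (auto simp: P_def disjoint_family_on_def)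
  also have "(\<Union>r\<in>R. P r) = E" using c by (auto simp: P_def)
  also have "\<mu> E = 1" using m by (simp add: invariant_mean_def)
  finally show ?thesis .
qed

text \<open>If there were no Folner sets, finite sets would double under a fixed finite subset of
  \<open>G\<close>, and the marriage theorem would produce a paradoxical decomposition.\<close>

lemma mean_imp_folner:
  assumes m: "invariant_mean G E f \<mu>" and cE: "countable E"
  shows "folner_action G E f"
proof (rule ccontr)
  assume "\<not> ?thesis"
  then obtain Q \<epsilon> where Q': "finite Q \<and> Q \<subseteq> carrier G \<and> 0 < \<epsilon>"
    and no': "\<not> (\<exists>A. finite A \<and> A \<noteq> {} \<and> A \<subseteq> E \<and>
        (\<forall>g\<in>Q. real (card (f g ` A - A)) \<le> \<epsilon> * real (card A)))"
    unfolding folner_action_def by blast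
  note Q = Q'[THEN conjunct1] Q'[THEN conjunct2, THEN conjunct1] Q'[THEN conjunct2, THEN conjunct2]
  have no: "\<exists>g\<in>Q. \<epsilon> * real (card A) < real (card (f g ` A - A))" if "finite A" "A \<noteq> {}" "A \<subseteq> E" for A
    using no' that by (simp add: not_le) blast
  \<comment> \<open>Without Folner sets for \<open>Q\<close> and \<open>\<epsilon>\<close>, adding
    the translates by \<open>Q\<close> enlarges every finite set by the factor
    \<open>1 + \<epsilon>\<close>; iterating this yields the doubling.\<close>
  define T where "T A = (\<Union>g\<in>insert \<one> Q. f g ` A)" for A
  have grow: "(1 + \<epsilon>) * card A \<le> card (T A)" and TE: "T A \<subseteq> E" "finite (T A)"
    if "finite A" "A \<subseteq> E" for A
  proof -
    show "T A \<subseteq> E" "finite (T A)" using that Q by (auto simp: T_def)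
    show "(1 + \<epsilon>) * card A \<le> card (T A)"
    proof (cases "A = {}")
      case False
      with no that obtain g where g: "g \<in> Q" "\<epsilon> * card A < card (f g ` A - A)" by blast
      have "f \<one> ` A = A" using that by force
      then have "A \<union> (f g ` A - A) \<subseteq> T A" using g by (auto simp: T_def)
      then have "card (A \<union> (f g ` A - A)) \<le> card (T A)" using \<open>finite (T A)\<close> by (rule card_mono[rotated])
      moreover have "card (A \<union> (f g ` A - A)) = card A + card (f g ` A - A)"
        using that by (intro card_Un_disjoint) auto
      ultimately show ?thesis using g by (simp add: algebra_simps)
    qed simp
  qed
  have doubling: "\<exists>R. finite R \<and> R \<subseteq> carrier G \<and>
          (\<forall>A. finite A \<and> A \<subseteq> E \<longrightarrow> (1 + \<epsilon>) ^ n * real (card A) \<le> real (card (\<Union>r\<in>R. f r ` A)))" for n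
  proof (induction n)
    case 0
    have "(\<Union>r\<in>{\<one>}. f r ` A) = A" if "A \<subseteq> E" for A using that by force
    then show ?case by (intro exI[of _ "{\<one>}"]) auto
  next
    case (Suc n)
    then obtain R where R: "finite R" "R \<subseteq> carrier G"
      "\<And>A. finite A \<Longrightarrow> A \<subseteq> E \<Longrightarrow> (1 + \<epsilon>) ^ n * card A \<le> card (\<Union>r\<in>R. f r ` A)" by blast
    let ?S = "(\<lambda>(r, g). r \<otimes> g) ` (R \<times> insert \<one> Q)"
    have "(1 + \<epsilon>) ^ Suc n * card A \<le> card (\<Union>s\<in>?S. f s ` A)" if A: "finite A" "A \<subseteq> E" for A
    proof -
      have "(1 + \<epsilon>) ^ Suc n * card A = (1 + \<epsilon>) ^ n * ((1 + \<epsilon>) * card A)" by simp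
      also have "\<dots> \<le> (1 + \<epsilon>) ^ n * card (T A)"
        using grow[OF A] Q by (intro mult_left_mono) auto
      also have "\<dots> \<le> card (\<Union>r\<in>R. f r ` T A)" using TE[OF A] by (intro R) auto
      also have "(\<Union>r\<in>R. f r ` T A) = (\<Union>s\<in>?S. f s ` A)"
      proof -
        have "f r ` T A = (\<Union>g\<in>insert \<one> Q. f (r \<otimes> g) ` A)" if "r \<in> R" for r
          unfolding T_def image_UN image_image
          by (intro SUP_cong image_cong refl) (use that R(2) Q A in \<open>auto simp: act_mult subset_eq\<close>)
        then show ?thesis by auto
      qed
      finally show ?thesis by simp
    qed
    moreover have "finite ?S" "?S \<subseteq> carrier G" using R Q by auto
    ultimately show ?case by blast
  qed
  obtain n where n: "2 < (1 + \<epsilon>) ^ n"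
    using real_arch_pow[of "1 + \<epsilon>" 2] Q by auto
  obtain R where R': "finite R \<and> R \<subseteq> carrier G \<and>
      (\<forall>A. finite A \<and> A \<subseteq> E \<longrightarrow> (1 + \<epsilon>) ^ n * real (card A) \<le> real (card (\<Union>r\<in>R. f r ` A)))"
    using doubling[of n] by (elim exE) (rule that)
  have R: "finite R" "R \<subseteq> carrier G"
    "\<And>A. finite A \<Longrightarrow> A \<subseteq> E \<Longrightarrow> (1 + \<epsilon>) ^ n * real (card A) \<le> real (card (\<Union>r\<in>R. f r ` A))"
    using R' by simp_all
  have R2: "2 * real (card A) \<le> real (card (\<Union>r\<in>R. f r ` A))" if "finite A" "A \<subseteq> E" for A
    using R(3)[OF that] mult_right_mono[of 2 "(1 + \<epsilon>) ^ n" "real (card A)"] n by linarith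
  \<comment> \<open>The marriage theorem for two copies of every point: \<open>R2\<close> is its
    condition, and \<open>\<Phi>\<close> sends the copies injectively to translates under
    \<open>R\<close>.\<close>
  have "\<exists>\<Phi>. inj_on \<Phi> (E \<times> (UNIV :: bool set)) \<and> (\<forall>p\<in>E \<times> UNIV. \<Phi> p \<in> (\<lambda>r. f r (fst p)) ` R)"
  proof (rule hall_countable)
    fix J :: "('x \<times> bool) set" assume J: "finite J" "J \<subseteq> E \<times> UNIV"
    have JE: "fst ` J \<subseteq> E" using J(2) by auto
    have "J \<subseteq> fst ` J \<times> UNIV" by force
    then have "card J \<le> card (fst ` J \<times> (UNIV :: bool set))"
      using J by (intro card_mono) auto
    also have "\<dots> = 2 * card (fst ` J)" by (simp add: card_cartesian_product)
    also have "real \<dots> \<le> card (\<Union>r\<in>R. f r ` fst ` J)"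
      using R2[of "fst ` J"] J(1) JE by simp
    also have "(\<Union>r\<in>R. f r ` fst ` J) = (\<Union>p\<in>J. (\<lambda>r. f r (fst p)) ` R)" by auto
    finally show "card J \<le> card (\<Union>p\<in>J. (\<lambda>r. f r (fst p)) ` R)" by simp
  qed (use cE R in auto)
  then obtain \<Phi> where \<Phi>: "inj_on \<Phi> (E \<times> (UNIV :: bool set))"
    "\<And>x b. x \<in> E \<Longrightarrow> \<exists>r\<in>R. \<Phi> (x, b) = f r x" by (force simp: image_iff)
  define c where "c b x = (SOME r. r \<in> R \<and> \<Phi> (x, b) = f r x)" for b x
  have c: "c b x \<in> R \<and> \<Phi> (x, b) = f (c b x) x" if "x \<in> E" for x b
    unfolding c_def by (rule someI_ex) (use \<Phi>(2)[OF that] in blast)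
  have inj: "inj_on (\<lambda>x. f (c b x) x) E" for b
    using \<Phi>(1) c by (auto simp: inj_on_def)
  \<comment> \<open>Each copy of \<open>E\<close> has an image of mean 1, and the two images are
    disjoint.\<close>
  have "\<mu> ((\<lambda>x. f (c b x) x) ` E) = 1" for b
    by (rule mean_piecewise[OF m R(1,2) _ inj]) (use c in auto)
  moreover have "(\<lambda>x. f (c True x) x) ` E \<inter> (\<lambda>x. f (c False x) x) ` E = {}"
    using \<Phi>(1) c by (auto simp: inj_on_def)
  moreover have "(\<lambda>x. f (c b x) x) ` E \<subseteq> E" for b
    using c R(2) by auto
  ultimately have "\<mu> ((\<lambda>x. f (c True x) x) ` E \<union> (\<lambda>x. f (c False x) x) ` E) = 2"
    by (simp add: invariant_mean_Un[OF m])
  moreover have "\<mu> ((\<lambda>x. f (c True x) x) ` E \<union> (\<lambda>x. f (c False x) x) ` E) \<le> 1"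
    using m \<open>\<And>b. (\<lambda>x. f (c b x) x) ` E \<subseteq> E\<close> by (simp add: invariant_mean_def)
  ultimately show False by simp
qed

text \<open>The mean of \<open>S\<close> is the limit along an ultrafilter of the proportion of
  \<open>A n\<close> lying in \<open>S\<close>, where \<open>A n\<close> is a Folner set for the
  first \<open>n + 1\<close> group elements with error \<open>1 / (n + 1)\<close>.\<close>

lemma folner_imp_mean:
  assumes F: "folner_action G E f" and cG: "countable (carrier G)"
  shows "\<exists>\<mu>. invariant_mean G E f \<mu>"
proof -
  obtain U where U: "ultra U" using ex_ultra by blast
  define Q where "Q n = from_nat_into (carrier G) ` {..n}" for n
  have "\<exists>A. finite A \<and> A \<noteq> {} \<and> A \<subseteq> E \<and>
          (\<forall>g\<in>Q n. real (card (f g ` A - A)) \<le> inverse (real (Suc n)) * card A)" for n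
    by (rule folner_actionD[OF F, of "Q n" "inverse (real (Suc n))"])
      (auto simp: Q_def from_nat_into[OF carrier_not_empty])
  then obtain A where A: "\<And>n. finite (A n)" "\<And>n. A n \<noteq> {}" "\<And>n. A n \<subseteq> E"
    "\<And>n g. g \<in> Q n \<Longrightarrow> real (card (f g ` A n - A n)) \<le> inverse (real (Suc n)) * card (A n)"
    by metis
  define p where "p S n = real (card (S \<inter> A n)) / card (A n)" for S n
  have pos: "0 < real (card (A n))" for n using A by (simp add: card_gt_0_iff)
  have p01: "p S n \<in> {0..1}" for S n
    using pos[of n] A by (auto simp: p_def divide_le_eq_1 intro!: card_mono)
  define \<mu> where "\<mu> S = (SOME l. l \<in> {0..1} \<and> (p S \<longlongrightarrow> l) U)" for S
  have "\<mu> S \<in> {0..1} \<and> (p S \<longlongrightarrow> \<mu> S) U" for S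
    unfolding \<mu>_def by (rule someI_ex) (use ultra_limit[OF U, of "p S"] p01 in blast)
  then have \<mu>: "\<mu> S \<in> {0..1}" "(p S \<longlongrightarrow> \<mu> S) U" for S by auto
  have nb: "U \<noteq> bot" and seq: "U \<le> sequentially" using U by (auto simp: ultra_def)
  \<comment> \<open>Translating by \<open>inv g\<close> loses at most the part of \<open>A n\<close>
    that leaves \<open>A n\<close>. Applying the inequality to \<open>inv g\<close> as well gives
    equality.\<close>
  have le: "\<mu> (f g ` S) \<le> \<mu> S" if g: "g \<in> carrier G" and S: "S \<subseteq> E" for g S
  proof -
    obtain k where k: "from_nat_into (carrier G) k = inv g"
      using from_nat_into_surj[OF cG] g by (meson inv_closed)
    have "p (f g ` S) n \<le> p S n + inverse (real (Suc n))" if "k \<le> n" for n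
    proof -
      have "f (inv g) ` (f g ` S \<inter> A n) \<subseteq> (S \<inter> A n) \<union> (f (inv g) ` A n - A n)"
        using g S by (auto simp: subset_eq)
      then have "card (f (inv g) ` (f g ` S \<inter> A n)) \<le> card ((S \<inter> A n) \<union> (f (inv g) ` A n - A n))"
        using A by (intro card_mono) auto
      also have "\<dots> \<le> card (S \<inter> A n) + card (f (inv g) ` A n - A n)" by (rule card_Un_le)
      also have "card (f (inv g) ` (f g ` S \<inter> A n)) = card (f g ` S \<inter> A n)"
        using g A by (intro card_act_image) auto
      finally have "real (card (f g ` S \<inter> A n)) \<le> card (S \<inter> A n) + card (f (inv g) ` A n - A n)"
        by simp
      moreover have "inv g \<in> Q n" using k that by (force simp: Q_def)
      ultimately have "real (card (f g ` S \<inter> A n)) \<le> card (S \<inter> A n) + inverse (real (Suc n)) * card (A n)"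
        using A(4)[of "inv g" n] by linarith
      then have "p (f g ` S) n \<le> (card (S \<inter> A n) + inverse (real (Suc n)) * card (A n)) / card (A n)"
        unfolding p_def by (rule divide_right_mono) simp
      then show ?thesis using pos[of n] unfolding p_def add_divide_distrib by simp
    qed
    then have "eventually (\<lambda>n. p (f g ` S) n \<le> p S n + inverse (real (Suc n))) U"
      using seq eventually_ge_at_top[of k] by (metis (mono_tags, lifting) eventually_mono filter_leD)
    moreover have "((\<lambda>n. p S n + inverse (real (Suc n))) \<longlongrightarrow> \<mu> S + 0) U"
      by (intro tendsto_add \<mu> tendsto_mono[OF seq LIMSEQ_inverse_real_of_nat])
    ultimately show ?thesis using tendsto_le[OF nb _ \<mu>(2)] by (metis add.right_neutral)
  qed
  have "invariant_mean G E f \<mu>"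
    unfolding invariant_mean_def
  proof (intro conjI allI impI ballI)
    show "0 \<le> \<mu> S" "\<mu> S \<le> 1" for S using \<mu>(1)[of S] by auto
    fix S T assume ST: "S \<subseteq> E \<and> T \<subseteq> E \<and> S \<inter> T = {}"
    have "p (S \<union> T) n = p S n + p T n" for n
    proof -
      have "card ((S \<inter> A n) \<union> (T \<inter> A n)) = card (S \<inter> A n) + card (T \<inter> A n)"
        using ST A by (intro card_Un_disjoint) auto
      then show ?thesis by (simp add: p_def Int_Un_distrib2 add_divide_distrib)
    qed
    then have "p (S \<union> T) = (\<lambda>n. p S n + p T n)" by (rule ext)
    then have "(p (S \<union> T) \<longlongrightarrow> \<mu> S + \<mu> T) U"
      using tendsto_add[OF \<mu>(2)[of S] \<mu>(2)[of T]] by simp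
    then show "\<mu> (S \<union> T) = \<mu> S + \<mu> T" using tendsto_unique[OF nb \<mu>(2)] by blast
  next
    have "p E n = 1" for n using A(3)[of n] pos[of n] by (simp add: p_def Int_absorb1)
    then have "p E = (\<lambda>_. 1)" by (rule ext)
    then have "(p E \<longlongrightarrow> 1) U" by simp
    then show "\<mu> E = 1" using tendsto_unique[OF nb \<mu>(2)] by blast
  next
    fix g S assume gS: "g \<in> carrier G" "S \<subseteq> E"
    have "\<mu> (f (inv g) ` f g ` S) \<le> \<mu> (f g ` S)" using gS by (intro le) auto
    with le[OF gS] gS show "\<mu> (f g ` S) = \<mu> S" by (simp add: act_image_inv)
  qed
  then show ?thesis by blast
qed

lemma amenable_action_restrict_iff:
  "amenable_action G E (\<lambda>g. restrict (f g) E) \<longleftrightarrow> (\<exists>\<mu>. invariant_mean G E f \<mu>)"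
  unfolding amenable_action_def
  using restrict_group_action invariant_mean_cong[of G E f "\<lambda>g. restrict (f g) E"] by simp

end

section \<open>Criteria for membership in the class\<close>

definition transitive_on :: "('a, 'c) monoid_scheme \<Rightarrow> 'x set \<Rightarrow> ('a \<Rightarrow> 'x \<Rightarrow> 'x) \<Rightarrow> bool" where
  "transitive_on G E f \<longleftrightarrow> (\<forall>x\<in>E. \<forall>y\<in>E. \<exists>g\<in>carrier G. f g x = y)"

definition faithful_on :: "('a, 'c) monoid_scheme \<Rightarrow> 'x set \<Rightarrow> ('a \<Rightarrow> 'x \<Rightarrow> 'x) \<Rightarrow> bool" where
  "faithful_on G E f \<longleftrightarrow> (\<forall>g\<in>carrier G. (\<forall>x\<in>E. f g x = x) \<longrightarrow> g = \<one>\<^bsub>G\<^esub>)"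

lemma (in set_action) transitive_onI:
  assumes "x0 \<in> E" "\<And>x. x \<in> E \<Longrightarrow> \<exists>g\<in>carrier G. f g x0 = x"
  shows "transitive_on G E f"
  unfolding transitive_on_def
proof (intro ballI)
  fix x y assume xy: "x \<in> E" "y \<in> E"
  obtain g h where gh: "g \<in> carrier G" "h \<in> carrier G" "f g x0 = x" "f h x0 = y"
    using assms(2)[OF xy(1)] assms(2)[OF xy(2)] by blast
  then have "f (h \<otimes> inv g) x = y" using assms(1) by (auto simp: act_mult)
  with gh show "\<exists>g\<in>carrier G. f g x = y" by (meson inv_closed m_closed)
qed

lemma (in set_action) class_A_meanI:
  assumes cG: "countable_group G" and t: "transitive_on G E f" and fa: "faithful_on G E f"
    and m: "invariant_mean G E f \<mu>"
  shows "class_A G"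
proof (rule class_AI[OF cG])
  interpret r: group_action G E "\<lambda>g. restrict (f g) E" by (rule restrict_group_action)
  show "amenable_action G E (\<lambda>g. restrict (f g) E)"
    using m amenable_action_restrict_iff by blast
  show "transitive_action G E (\<lambda>g. restrict (f g) E)"
    by unfold_locales (use t in \<open>auto simp: transitive_on_def\<close>)
  show "faithful_action G E (\<lambda>g. restrict (f g) E)"
  proof (unfold_locales, rule inj_onI)
    fix g h assume gh: "g \<in> carrier G" "h \<in> carrier G" "restrict (f g) E = restrict (f h) E"
    have "f (inv h \<otimes> g) x = x" if "x \<in> E" for x
    proof -
      have "f g x = f h x" using gh(3) that by (metis restrict_apply')
      with gh that show ?thesis by (simp add: act_mult)
    qed
    then have "inv h \<otimes> g = \<one>" using fa gh unfolding faithful_on_def by blast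
    then show "g = h" using gh by (metis inv_equality inv_inv inv_closed)
  qed
qed

lemma (in set_action) class_A_folnerI:
  assumes "countable_group G" "transitive_on G E f" "faithful_on G E f" "folner_action G E f"
  shows "class_A G"
  using class_A_meanI folner_imp_mean assms by (metis countable_group_def)

text \<open>The working form of membership. Since \<open>E\<close> is a set of natural numbers,
  hence countable, the mean comes with Folner sets.\<close>

lemma class_AE:
  assumes "class_A G"
  obtains E :: "nat set" and f \<mu> where "set_action G E f" "countable_group G" "transitive_on G E f"
    "faithful_on G E f" "invariant_mean G E f \<mu>" "folner_action G E f" "E \<noteq> {}"
proof -
  from assms obtain E :: "nat set" and f where f: "countable_group G" "faithful_action G E f"
    "transitive_action G E f" "amenable_action G E f" unfolding class_A_def by blast
  interpret faithful_action G E f by fact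
  interpret t: transitive_action G E f by fact
  interpret s: set_action G E f by (rule set_action)
  obtain \<mu> where \<mu>: "invariant_mean G E f \<mu>" using f by (auto simp: amenable_action_def)
  have "faithful_on G E f" unfolding faithful_on_def
  proof (intro ballI impI)
    fix g assume g: "g \<in> carrier G" "\<forall>x\<in>E. f g x = x"
    have "f g = f \<one>\<^bsub>G\<^esub>"
    proof (rule extensionalityI)
      show "f g \<in> extensional E" "f \<one>\<^bsub>G\<^esub> \<in> extensional E"
        using g bij_prop0 Bij_imp_extensional by blast+
    qed (use g in auto)
    then show "g = \<one>\<^bsub>G\<^esub>" using faithful g by (auto dest: inj_onD)
  qed
  moreover have "E \<noteq> {}" using \<mu> invariant_mean_empty[OF \<mu>] by (auto simp: invariant_mean_def)
  moreover have "transitive_on G E f" using t.unique_orbit by (auto simp: transitive_on_def)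
  ultimately show ?thesis
    using that[OF s.set_action_axioms] f \<mu> s.mean_imp_folner[OF \<mu>] by auto
qed

section \<open>Isomorphic copies\<close>

lemma set_action_iso:
  assumes "set_action G E f" and "group G'" and h: "h \<in> hom G' G"
  shows "set_action G' E (\<lambda>g. f (h g))"
proof -
  interpret set_action G E f by fact
  interpret G': group G' by fact
  interpret h: group_hom G' G h using h by unfold_locales
  show ?thesis by unfold_locales (auto simp: act_mult)
qed

lemma class_A_iso:
  assumes A: "class_A G" and "group G'" and h: "h \<in> iso G' G"
  shows "class_A G'"
proof -
  obtain E :: "nat set" and f \<mu> where E: "set_action G E f" "countable_group G" "transitive_on G E f"
    "faithful_on G E f" "invariant_mean G E f \<mu>" using class_AE[OF A] by metis
  have hh: "h \<in> hom G' G" and bij: "bij_betw h (carrier G') (carrier G)"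
    using h by (auto simp: iso_def)
  interpret group_hom G' G h
    using E(2) assms(2) hh by (simp add: group_hom_def group_hom_axioms_def countable_group_def)
  interpret s: set_action G' E "\<lambda>g. f (h g)" by (rule set_action_iso[OF E(1) assms(2) hh])
  have im: "h ` carrier G' = carrier G" using bij by (simp add: bij_betw_def)
  show ?thesis
  proof (rule s.class_A_meanI)
    show "countable_group G'"
      using E(2) assms(2) bij unfolding countable_group_def
      by (metis bij_betw_finite bij_betw_def countable_image_inj_eq)
    show "transitive_on G' E (\<lambda>g. f (h g))"
      using E(3) unfolding transitive_on_def by (metis im imageE)
    show "faithful_on G' E (\<lambda>g. f (h g))"
      using E(4) bij unfolding faithful_on_def
      by (metis bij_betw_imp_inj_on hom_closed hom_one inj_on_def G.one_closed)
    show "invariant_mean G' E (\<lambda>g. f (h g)) \<mu>"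
      using E(5) unfolding invariant_mean_def by auto
  qed
qed

text \<open>Iterated constructions pile up types; copying their results onto \<open>nat\<close>
  keeps the witnesses of the existential statements in one type.\<close>

lemma nat_copy:
  assumes G: "countable_group G"
  obtains G' :: "nat monoid" and h where "group G'" "h \<in> iso G' G" "countable_group G'"
proof -
  define e where "e = to_nat_on (carrier G)"
  define d where "d = from_nat_into (carrier G)"
  interpret group G using G by (simp add: countable_group_def)
  have ed: "bij_betw e (carrier G) UNIV" and d: "bij_betw d UNIV (carrier G)"
    using G by (auto simp: countable_group_def e_def d_def to_nat_on_infinite bij_betw_from_nat_into)
  have de [simp]: "d (e x) = x" if "x \<in> carrier G" for x
    using that G by (simp add: e_def d_def countable_group_def)
  have ed' [simp]: "e (d n) = n" for n
    using G by (simp add: e_def d_def countable_group_def)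
  have dc [simp]: "d n \<in> carrier G" for n using d by (auto simp: bij_betw_def)
  define G' :: "nat monoid" where "G' = \<lparr>carrier = UNIV, monoid.mult = (\<lambda>m n. e (d m \<otimes>\<^bsub>G\<^esub> d n)), one = e \<one>\<^bsub>G\<^esub>\<rparr>"
  have "group G'"
  proof (rule groupI)
    fix x assume "x \<in> carrier G'"
    have "e (inv\<^bsub>G\<^esub> d x) \<otimes>\<^bsub>G'\<^esub> x = \<one>\<^bsub>G'\<^esub>" by (simp add: G'_def)
    then show "\<exists>y\<in>carrier G'. y \<otimes>\<^bsub>G'\<^esub> x = \<one>\<^bsub>G'\<^esub>"
      by (intro bexI[of _ "e (inv\<^bsub>G\<^esub> d x)"]) (simp_all add: G'_def)
  qed (auto simp: G'_def m_assoc)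
  moreover have "d \<in> iso G' G" using d by (auto simp: iso_def hom_def G'_def)
  moreover have "countable_group G'" using \<open>group G'\<close> by (simp add: countable_group_def G'_def)
  ultimately show ?thesis using that by blast
qed

section \<open>Products and extensions\<close>

lemma transitive_onD:
  assumes "transitive_on G E f" "x \<in> E" "y \<in> E"
  obtains g where "g \<in> carrier G" "f g x = y"
  using assms unfolding transitive_on_def by blast

lemma invariant_mean_image:
  "invariant_mean G E f \<mu> \<Longrightarrow> g \<in> carrier G \<Longrightarrow> A \<subseteq> E \<Longrightarrow> \<mu> (f g ` A) = \<mu> A"
  unfolding invariant_mean_def by blast

lemma set_action_prod:
  assumes "set_action G S f" "set_action H Y f'"
  shows "set_action (G \<times>\<times> H) (S \<times> Y) (\<lambda>p q. (f (fst p) (fst q), f' (snd p) (snd q)))"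
proof -
  interpret a: set_action G S f by fact
  interpret b: set_action H Y f' by fact
  interpret p: group "G \<times>\<times> H" by (intro DirProd_group a.is_group b.is_group)
  show ?thesis by unfold_locales (auto simp: DirProd_def a.act_mult b.act_mult)
qed

lemma folner_prod:
  assumes a: "set_action G S f" and b: "set_action H Y f'"
    and F: "folner_action G S f" "folner_action H Y f'"
  shows "folner_action (G \<times>\<times> H) (S \<times> Y) (\<lambda>p q. (f (fst p) (fst q), f' (snd p) (snd q)))"
  unfolding folner_action_def
proof (intro allI impI)
  interpret a: set_action G S f by fact
  interpret b: set_action H Y f' by fact
  fix Q :: "('a \<times> 'd) set" and \<epsilon> :: real
  assume Q: "finite Q \<and> Q \<subseteq> carrier (G \<times>\<times> H) \<and> 0 < \<epsilon>"
  have Q1: "finite (fst ` Q)" "fst ` Q \<subseteq> carrier G" "0 < \<epsilon> / 2"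
    and Q2: "finite (snd ` Q)" "snd ` Q \<subseteq> carrier H" "0 < \<epsilon> / 2" using Q by auto
  obtain A where A: "finite A" "A \<noteq> {}" "A \<subseteq> S"
    "\<And>g. g \<in> fst ` Q \<Longrightarrow> real (card (f g ` A - A)) \<le> \<epsilon> / 2 * card A"
    by (rule folner_actionD[OF F(1) Q1]) (rule that)
  obtain B where B: "finite B" "B \<noteq> {}" "B \<subseteq> Y"
    "\<And>h. h \<in> snd ` Q \<Longrightarrow> real (card (f' h ` B - B)) \<le> \<epsilon> / 2 * card B"
    by (rule folner_actionD[OF F(2) Q2]) (rule that)
  let ?f = "\<lambda>p q. (f (fst p) (fst q), f' (snd p) (snd q))"
  have "real (card (?f p ` (A \<times> B) - A \<times> B)) \<le> \<epsilon> * card (A \<times> B)" if p: "p \<in> Q" for p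
  proof -
    obtain g h where gh: "p = (g, h)" "g \<in> carrier G" "h \<in> carrier H" using p Q by auto
    \<comment> \<open>A point of the product leaves \<open>A \<times> B\<close> through one
      coordinate or the other, and each exit is charged half of \<open>\<epsilon>\<close>.\<close>
    have "?f p ` (A \<times> B) - A \<times> B \<subseteq> (f g ` A - A) \<times> (f' h ` B) \<union> (f g ` A) \<times> (f' h ` B - B)"
      by (auto simp: gh)
    then have "card (?f p ` (A \<times> B) - A \<times> B)
        \<le> card ((f g ` A - A) \<times> (f' h ` B) \<union> (f g ` A) \<times> (f' h ` B - B))"
      using A B by (intro card_mono) auto
    also have "\<dots> \<le> card ((f g ` A - A) \<times> (f' h ` B)) + card ((f g ` A) \<times> (f' h ` B - B))"
      by (rule card_Un_le)
    also have "\<dots> = card (f g ` A - A) * card B + card A * card (f' h ` B - B)"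
      using A B gh by (simp add: card_cartesian_product a.card_act_image b.card_act_image)
    finally have "real (card (?f p ` (A \<times> B) - A \<times> B))
      \<le> real (card (f g ` A - A)) * card B + card A * real (card (f' h ` B - B))"
      by (simp flip: of_nat_mult of_nat_add)
    also have "\<dots> \<le> (\<epsilon> / 2 * card A) * card B + card A * (\<epsilon> / 2 * card B)"
    proof (intro add_mono mult_right_mono mult_left_mono)
      show "real (card (f g ` A - A)) \<le> \<epsilon> / 2 * card A"
        by (rule A(4)) (use p gh in \<open>auto intro: rev_image_eqI\<close>)
      show "real (card (f' h ` B - B)) \<le> \<epsilon> / 2 * card B"
        by (rule B(4)) (use p gh in \<open>auto intro: rev_image_eqI\<close>)
    qed auto
    finally show ?thesis by (simp add: card_cartesian_product algebra_simps)
  qed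
  then show "\<exists>C. finite C \<and> C \<noteq> {} \<and> C \<subseteq> S \<times> Y \<and> (\<forall>g\<in>Q. real (card (?f g ` C - C)) \<le> \<epsilon> * card C)"
    using A B by (intro exI[of _ "A \<times> B"]) auto
qed

lemma class_A_DirProd:
  assumes "class_A G" "class_A H" shows "class_A (G \<times>\<times> H)"
proof -
  obtain S :: "nat set" and f where S: "set_action G S f" "countable_group G" "transitive_on G S f"
    "faithful_on G S f" "folner_action G S f" "S \<noteq> {}" using class_AE[OF assms(1)] by metis
  obtain Y :: "nat set" and f' where Y: "set_action H Y f'" "countable_group H" "transitive_on H Y f'"
    "faithful_on H Y f'" "folner_action H Y f'" "Y \<noteq> {}" using class_AE[OF assms(2)] by metis
  interpret set_action "G \<times>\<times> H" "S \<times> Y" "\<lambda>p q. (f (fst p) (fst q), f' (snd p) (snd q))"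
    by (rule set_action_prod[OF S(1) Y(1)])
  show ?thesis
  proof (rule class_A_folnerI)
    show "countable_group (G \<times>\<times> H)"
      using S(2) Y(2) is_group group.is_monoid[THEN monoid.carrier_not_empty]
      by (auto simp: countable_group_def finite_cartesian_product_iff)
    show "transitive_on (G \<times>\<times> H) (S \<times> Y) (\<lambda>p q. (f (fst p) (fst q), f' (snd p) (snd q)))"
      using S(3) Y(3) by (force simp: transitive_on_def)
    show "faithful_on (G \<times>\<times> H) (S \<times> Y) (\<lambda>p q. (f (fst p) (fst q), f' (snd p) (snd q)))"
      using S(4,6) Y(4,6) by (auto simp: faithful_on_def)
  qed (rule folner_prod[OF S(1) Y(1) S(5) Y(5)])
qed

text \<open>The orbits of a factor are permuted transitively by elements commuting with that factor, so
  they are all isomorphic to a single orbit, onto which the mean can be pushed forward.\<close>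

lemma class_A_commuting_factor:
  assumes A: "class_A G" and N: "countable_group N" and i: "i \<in> hom N G" "inj_on i (carrier N)"
    and C: "C \<subseteq> carrier G"
    and gen: "\<And>g. g \<in> carrier G \<Longrightarrow> \<exists>n\<in>carrier N. \<exists>c\<in>C. g = i n \<otimes>\<^bsub>G\<^esub> c"
    and comm: "\<And>n c. n \<in> carrier N \<Longrightarrow> c \<in> C \<Longrightarrow> i n \<otimes>\<^bsub>G\<^esub> c = c \<otimes>\<^bsub>G\<^esub> i n"
  shows "class_A N"
proof -
  obtain E :: "nat set" and f \<mu> where E: "set_action G E f" "countable_group G" "transitive_on G E f"
    "faithful_on G E f" "invariant_mean G E f \<mu>" "E \<noteq> {}" using class_AE[OF A] by metis
  interpret set_action G E f by fact
  interpret i: group_hom N G i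
    using N i is_group by (simp add: group_hom_def group_hom_axioms_def countable_group_def)
  interpret n: set_action N E "\<lambda>n. f (i n)"
    by (rule set_action_iso[OF E(1) _ i(1)]) (use N in \<open>simp add: countable_group_def\<close>)
  obtain x0 where x0: "x0 \<in> E" using E(6) by blast
  define orb where "orb x = {f (i n) x |n. n \<in> carrier N}" for x
  have orb_self: "x \<in> orb x" if "x \<in> E" for x
    using that by (auto simp: orb_def intro!: exI[of _ "\<one>\<^bsub>N\<^esub>"])
  have orbE: "orb x \<subseteq> E" if "x \<in> E" for x using that by (auto simp: orb_def)
  have orb_act: "orb (f (i n) x) = orb x" if n: "n \<in> carrier N" and "x \<in> E" for n x
  proof
    show "orb (f (i n) x) \<subseteq> orb x"
      using that by (auto simp: orb_def simp flip: n.act_mult simp del: i.hom_mult)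
    show "orb x \<subseteq> orb (f (i n) x)"
    proof
      fix y assume "y \<in> orb x"
      then obtain m where m: "m \<in> carrier N" "y = f (i m) x" by (auto simp: orb_def)
      then have "y = f (i (m \<otimes>\<^bsub>N\<^esub> inv\<^bsub>N\<^esub> n)) (f (i n) x)"
        using that by (simp add: n.act_mult del: i.hom_mult i.hom_inv)
      then show "y \<in> orb (f (i n) x)" using m n by (auto simp: orb_def simp del: i.hom_mult i.hom_inv)
    qed
  qed
  define E0 where "E0 = orb x0"
  have E0E: "E0 \<subseteq> E" unfolding E0_def by (rule orbE[OF x0])
  have fC: "f (i n) (f c x) = f c (f (i n) x)" if "n \<in> carrier N" "c \<in> C" "x \<in> E" for n c x
    using comm[OF that(1,2)] that C by (metis act_mult i.hom_closed subsetD)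
  \<comment> \<open>If \<open>g x0 = x\<close> and \<open>g\<close> is the product of
    \<open>i n\<close> and \<open>c\<close>, then the inverse of \<open>c\<close> commutes with the
    action of \<open>N\<close> and carries the orbit of \<open>x\<close> into that of
    \<open>x0\<close>.\<close>
  have exc: "\<exists>c\<in>carrier G. (\<forall>n\<in>carrier N. \<forall>y\<in>E. f (i n) (f c y) = f c (f (i n) y)) \<and> f c ` orb x \<subseteq> E0"
    if x: "x \<in> E" for x
  proof -
    obtain g where g: "g \<in> carrier G" "f g x0 = x" using E(3) x x0 unfolding transitive_on_def by blast
    then obtain n c where nc: "n \<in> carrier N" "c \<in> C" "g = i n \<otimes>\<^bsub>G\<^esub> c" using gen by blast
    have c: "c \<in> carrier G" using nc C by auto
    have cc: "f (i m) (f (inv\<^bsub>G\<^esub> c) y) = f (inv\<^bsub>G\<^esub> c) (f (i m) y)" if "m \<in> carrier N" "y \<in> E" for m y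
    proof -
      have "f (i m) y = f (i m) (f c (f (inv\<^bsub>G\<^esub> c) y))" using that c by simp
      also have "\<dots> = f c (f (i m) (f (inv\<^bsub>G\<^esub> c) y))"
        using fC[of m c "f (inv\<^bsub>G\<^esub> c) y"] that nc c by simp
      finally show ?thesis using that c by simp
    qed
    have "x = f c (f (i n) x0)" using g nc c x0 fC[of n c x0] by (auto simp: act_mult)
    then have "f (inv\<^bsub>G\<^esub> c) x = f (i n) x0" using c x0 nc by simp
    then have "f (inv\<^bsub>G\<^esub> c) (f (i m) x) = f (i (m \<otimes>\<^bsub>N\<^esub> n)) x0" if "m \<in> carrier N" for m
      using that cc[of m x] x x0 nc by (simp add: n.act_mult del: i.hom_mult)
    then have "f (inv\<^bsub>G\<^esub> c) ` orb x \<subseteq> E0"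
      using nc i.G.m_closed by (auto simp: orb_def E0_def simp del: i.hom_mult)
    with cc c show ?thesis by (intro bexI[of _ "inv\<^bsub>G\<^esub> c"]) auto
  qed
  \<comment> \<open>The carrying element is chosen per orbit and not per point, which makes the map
    \<open>p\<close> below equivariant.\<close>
  define good where "good T c \<longleftrightarrow> c \<in> carrier G \<and>
          (\<forall>n\<in>carrier N. \<forall>y\<in>E. f (i n) (f c y) = f c (f (i n) y)) \<and> f c ` T \<subseteq> E0" for T c
  define k where "k T = (SOME c. good T c)" for T
  have "good (orb x) (k (orb x))" if "x \<in> E" for x
    unfolding k_def by (rule someI_ex) (use exc[OF that] in \<open>auto simp: good_def\<close>)
  then have k: "\<And>x. x \<in> E \<Longrightarrow> k (orb x) \<in> carrier G"
    "\<And>x n y. x \<in> E \<Longrightarrow> n \<in> carrier N \<Longrightarrow> y \<in> E \<Longrightarrow> f (i n) (f (k (orb x)) y) = f (k (orb x)) (f (i n) y)"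
    "\<And>x. x \<in> E \<Longrightarrow> f (k (orb x)) ` orb x \<subseteq> E0" unfolding good_def by blast+
  define p where "p x = f (k (orb x)) x" for x
  have pE: "p x \<in> E0" if "x \<in> E" for x
    using k(3)[OF that] orb_self[OF that] by (auto simp: p_def)
  have p_eq: "p (f (i n) x) = f (i n) (p x)" if "x \<in> E" "n \<in> carrier N" for n x
    using that k(2) by (simp add: p_def orb_act)
  have E0_cl: "f (i n) x \<in> E0" if "n \<in> carrier N" "x \<in> E0" for n x
  proof -
    obtain m where "m \<in> carrier N" "x = f (i m) x0" using \<open>x \<in> E0\<close> by (auto simp: E0_def orb_def)
    then have "f (i n) x = f (i (n \<otimes>\<^bsub>N\<^esub> m)) x0" "n \<otimes>\<^bsub>N\<^esub> m \<in> carrier N"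
      using that x0 by (simp_all add: n.act_mult del: i.hom_mult)
    then show ?thesis unfolding E0_def orb_def by blast
  qed
  interpret e: set_action N E0 "\<lambda>n. f (i n)"
    by unfold_locales (use E0_cl E0E n.act_mult in \<open>auto simp del: i.hom_mult simp: subset_eq\<close>)
  show ?thesis
  proof (rule e.class_A_meanI[OF N])
    show "transitive_on N E0 (\<lambda>n. f (i n))"
      by (rule e.transitive_onI[of x0]) (use orb_self[OF x0] in \<open>auto simp: E0_def orb_def\<close>)
    show "faithful_on N E0 (\<lambda>n. f (i n))"
      unfolding faithful_on_def
    proof (intro ballI impI)
      fix n assume n: "n \<in> carrier N" "\<forall>x\<in>E0. f (i n) x = x"
      \<comment> \<open>An element fixing \<open>E0\<close> pointwise fixes every orbit, because
        each orbit is carried into \<open>E0\<close> by an injection commuting with the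
        action.\<close>
      have "f (i n) x = x" if x: "x \<in> E" for x
      proof -
        have "f (k (orb x)) (f (i n) x) = f (k (orb x)) x"
          using n pE[OF x] k(2)[OF x n(1) x] by (simp add: p_def)
        then show ?thesis using k(1)[OF x] x n by (meson act_inj n.closed)
      qed
      then have "i n = \<one>\<^bsub>G\<^esub>" using E(4) n i.hom_closed unfolding faithful_on_def by blast
      then show "n = \<one>\<^bsub>N\<^esub>" using i(2) n by (metis i.hom_one inj_onD i.G.one_closed)
    qed
    show "invariant_mean N E0 (\<lambda>n. f (i n)) (\<lambda>A. \<mu> {x \<in> E. p x \<in> A})"
      unfolding invariant_mean_def
    proof (intro conjI allI impI ballI)
      show "0 \<le> \<mu> {x \<in> E. p x \<in> A}" "\<mu> {x \<in> E. p x \<in> A} \<le> 1" for A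
        using E(5) unfolding invariant_mean_def by auto
      have "{x \<in> E. p x \<in> E0} = E" using pE by auto
      then show "\<mu> {x \<in> E. p x \<in> E0} = 1" using E(5) by (simp add: invariant_mean_def)
    next
      fix A B assume "A \<subseteq> E0 \<and> B \<subseteq> E0 \<and> A \<inter> B = {}"
      then have "\<mu> ({x \<in> E. p x \<in> A} \<union> {x \<in> E. p x \<in> B}) = \<mu> {x \<in> E. p x \<in> A} + \<mu> {x \<in> E. p x \<in> B}"
        by (intro invariant_mean_Un[OF E(5)]) auto
      moreover have "{x \<in> E. p x \<in> A} \<union> {x \<in> E. p x \<in> B} = {x \<in> E. p x \<in> A \<union> B}" by auto
      ultimately show "\<mu> {x \<in> E. p x \<in> A \<union> B} = \<mu> {x \<in> E. p x \<in> A} + \<mu> {x \<in> E. p x \<in> B}" by simp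
    next
      fix n A assume nA: "n \<in> carrier N" "A \<subseteq> E0"
      have "{x \<in> E. p x \<in> f (i n) ` A} = f (i n) ` {x \<in> E. p x \<in> A}"
      proof (intro subset_antisym subsetI)
        fix x assume "x \<in> {x \<in> E. p x \<in> f (i n) ` A}"
        then obtain a where a: "x \<in> E" "a \<in> A" "p x = f (i n) a" by auto
        let ?y = "f (i (inv\<^bsub>N\<^esub> n)) x"
        have "p ?y = a" using a nA E0E p_eq[of x "inv\<^bsub>N\<^esub> n"] by (auto simp del: i.hom_inv)
        moreover have "x = f (i n) ?y" "?y \<in> E" using a nA by (auto simp del: i.hom_inv)
        ultimately show "x \<in> f (i n) ` {x \<in> E. p x \<in> A}" using a by blast
      qed (use nA p_eq in auto)
      then show "\<mu> {x \<in> E. p x \<in> f (i n) ` A} = \<mu> {x \<in> E. p x \<in> A}"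
        using E(5) nA unfolding invariant_mean_def by auto
    qed
  qed
qed

lemma class_A_DirProd_iff:
  assumes "countable_group G" "countable_group H"
  shows "class_A (G \<times>\<times> H) \<longleftrightarrow> class_A G \<and> class_A H"
proof
  assume A: "class_A (G \<times>\<times> H)"
  interpret G: group G using assms by (simp add: countable_group_def)
  interpret H: group H using assms by (simp add: countable_group_def)
  show "class_A G \<and> class_A H"
  proof
    show "class_A G"
    proof (rule class_A_commuting_factor[OF A assms(1), where i = "\<lambda>g. (g, \<one>\<^bsub>H\<^esub>)" and C = "{\<one>\<^bsub>G\<^esub>} \<times> carrier H"])
      fix p assume "p \<in> carrier (G \<times>\<times> H)"
      then obtain g h where "p = (g, h)" "g \<in> carrier G" "h \<in> carrier H" by auto
      then show "\<exists>n\<in>carrier G. \<exists>c\<in>{\<one>\<^bsub>G\<^esub>} \<times> carrier H. p = (n, \<one>\<^bsub>H\<^esub>) \<otimes>\<^bsub>G \<times>\<times> H\<^esub> c"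
        by (intro bexI[of _ g] bexI[of _ "(\<one>\<^bsub>G\<^esub>, h)"]) auto
    qed (auto simp: hom_def inj_on_def)
    show "class_A H"
    proof (rule class_A_commuting_factor[OF A assms(2), where i = "\<lambda>h. (\<one>\<^bsub>G\<^esub>, h)" and C = "carrier G \<times> {\<one>\<^bsub>H\<^esub>}"])
      fix p assume "p \<in> carrier (G \<times>\<times> H)"
      then obtain g h where "p = (g, h)" "g \<in> carrier G" "h \<in> carrier H" by auto
      then show "\<exists>n\<in>carrier H. \<exists>c\<in>carrier G \<times> {\<one>\<^bsub>H\<^esub>}. p = (\<one>\<^bsub>G\<^esub>, n) \<otimes>\<^bsub>G \<times>\<times> H\<^esub> c"
        by (intro bexI[of _ h] bexI[of _ "(g, \<one>\<^bsub>H\<^esub>)"]) auto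
    qed (auto simp: hom_def inj_on_def)
  qed
qed (use class_A_DirProd in auto)

text \<open>Given coset representatives \<open>s a\<close>, spread a Folner set of the stabilizer over a Folner set of
  the base.\<close>

lemma folner_extension:
  assumes E: "set_action G E f" and E': "set_action G E' f'"
    and t: "transitive_on G E f" and x0: "x0 \<in> E" and F: "folner_action G E f"
    and p: "\<And>g x. g \<in> carrier G \<Longrightarrow> x \<in> E' \<Longrightarrow> p (f' g x) = f g (p x)"
    and L: "L = {g \<in> carrier G. f g x0 = x0}"
    and Y: "set_action (G\<lparr>carrier := L\<rparr>) Y fy" "folner_action (G\<lparr>carrier := L\<rparr>) Y fy"
    and q: "inj_on q Y" "q ` Y \<subseteq> E'" "\<And>y. y \<in> Y \<Longrightarrow> p (q y) = x0"
      "\<And>h y. h \<in> L \<Longrightarrow> y \<in> Y \<Longrightarrow> q (fy h y) = f' h (q y)"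
  shows "folner_action G E' f'"
  unfolding folner_action_def
proof (intro allI impI)
  interpret a: set_action G E f by fact
  interpret b: set_action G E' f' by fact
  interpret y: set_action "G\<lparr>carrier := L\<rparr>" Y fy by fact
  fix Q :: "'a set" and \<epsilon> :: real
  assume Q: "finite Q \<and> Q \<subseteq> carrier G \<and> 0 < \<epsilon>"
  obtain A where A: "finite A" "A \<noteq> {}" "A \<subseteq> E"
    "\<And>g. g \<in> Q \<Longrightarrow> real (card (f g ` A - A)) \<le> \<epsilon> / 2 * card A"
    by (rule folner_actionD[OF F, of Q "\<epsilon> / 2"]) (use Q in auto)
  obtain s where s: "\<And>x. x \<in> E \<Longrightarrow> s x \<in> carrier G" "\<And>x. x \<in> E \<Longrightarrow> f (s x) x0 = x"
    using t x0 unfolding transitive_on_def by metis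
  \<comment> \<open>The cocycle of the section \<open>s\<close>: it measures how far
    \<open>g\<close> fails to carry representatives to representatives, by
    \<open>g s(a) = s(ga) h(g, a)\<close>.\<close>
  define h where "h g a = inv\<^bsub>G\<^esub> (s (f g a)) \<otimes>\<^bsub>G\<^esub> (g \<otimes>\<^bsub>G\<^esub> s a)" for g a
  have hL: "h g a \<in> L" if "g \<in> carrier G" "a \<in> E" for g a
  proof -
    have "f (inv\<^bsub>G\<^esub> (s (f g a))) (f g a) = x0"
      using that s x0 a.act_inv[of "s (f g a)" x0] by simp
    then show ?thesis using that s x0 by (simp add: L h_def a.act_mult)
  qed
  have sh: "s (f g a) \<otimes>\<^bsub>G\<^esub> h g a = g \<otimes>\<^bsub>G\<^esub> s a" if "g \<in> carrier G" "a \<in> E" for g a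
    using that s by (simp add: h_def flip: a.m_assoc)
  \<comment> \<open>Only finitely many cocycle values occur for \<open>g\<close> in \<open>Q\<close>
    and \<open>a\<close> in \<open>A\<close>, so one fibre set \<open>B\<close> serves them
    all.\<close>
  obtain B where B: "finite B" "B \<noteq> {}" "B \<subseteq> Y"
    "\<And>l. l \<in> (\<lambda>(g, a). h g a) ` (Q \<times> A) \<Longrightarrow> real (card (fy l ` B - B)) \<le> \<epsilon> / 2 * card B"
    by (rule folner_actionD[OF Y(2), of "(\<lambda>(g, a). h g a) ` (Q \<times> A)" "\<epsilon> / 2"])
      (use Q A hL in \<open>auto simp: subset_eq\<close>)
  \<comment> \<open>The representative \<open>s a\<close> carries the fibre over \<open>x0\<close>
    to the fibre over \<open>a\<close>, so base and fibre points together parametrize part of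
    \<open>E'\<close>.\<close>
  define j where "j = (\<lambda>(a, y). f' (s a) (q y))"
  have qE: "q y \<in> E'" if "y \<in> Y" for y using that q by auto
  have pj: "p (j (a, y)) = a" if "a \<in> E" "y \<in> Y" for a y
    using that s q qE by (simp add: j_def p)
  have j_inj: "inj_on j (E \<times> Y)"
  proof (rule inj_onI, clarify)
    fix a y b z assume *: "a \<in> E" "y \<in> Y" "b \<in> E" "z \<in> Y" "j (a, y) = j (b, z)"
    then have "a = b" using pj by metis
    moreover from this * have "q y = q z"
      using b.act_inj[of "s b" "q y" "q z"] s qE by (simp add: j_def)
    ultimately show "a = b \<and> y = z" using * q(1) by (auto dest: inj_onD)
  qed
  define F' where "F' = j ` (A \<times> B)"
  have jE: "j (a, y) \<in> E'" if "a \<in> E" "y \<in> Y" for a y using that s qE by (auto simp: j_def)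
  have ABE: "A \<times> B \<subseteq> E \<times> Y" using A B by auto
  have cardF: "card F' = card A * card B"
    unfolding F'_def using card_image[OF inj_on_subset[OF j_inj ABE]] by (simp add: card_cartesian_product)
  have move: "f' g (j (a, y)) = j (f g a, fy (h g a) y)" if "g \<in> carrier G" "a \<in> E" "y \<in> Y" for g a y
  proof -
    have hc: "h g a \<in> carrier G" using hL[of g a] that by (simp add: L)
    have "f' g (j (a, y)) = f' (g \<otimes>\<^bsub>G\<^esub> s a) (q y)" using that s qE by (simp add: j_def b.act_mult)
    also have "\<dots> = f' (s (f g a)) (f' (h g a) (q y))"
      using that s qE hc by (simp add: b.act_mult flip: sh)
    finally show ?thesis using q(4)[OF hL[OF that(1,2)] that(3)] by (simp add: j_def)
  qed
  have "real (card (f' g ` F' - F')) \<le> \<epsilon> * card F'" if g: "g \<in> Q" for g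
  proof -
    have gc: "g \<in> carrier G" using g Q by auto
    \<comment> \<open>In the first set the base point leaves \<open>A\<close>; in the second it
      stays in \<open>A\<close> and the fibre point leaves \<open>B\<close>. The inner union has
      just one member, as \<open>f g\<close> is injective.\<close>
    have "f' g ` F' - F' \<subseteq> j ` ((f g ` A - A) \<times> Y \<inter> (\<lambda>(a, y). (f g a, fy (h g a) y)) ` (A \<times> B))
        \<union> j ` (SIGMA c: A \<inter> f g ` A. \<Union>a\<in>{a\<in>A. f g a = c}. fy (h g a) ` B - B)"
      (is "_ \<subseteq> j ` ?U \<union> j ` ?V")
    proof
      fix z assume z: "z \<in> f' g ` F' - F'"
      then obtain a y where ay: "a \<in> A" "y \<in> B" "z = f' g (j (a, y))" by (auto simp: F'_def)
      then have ay': "a \<in> E" "y \<in> Y" using A B by auto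
      have z': "z = j (f g a, fy (h g a) y)" using move[OF gc ay'] ay by simp
      have hy: "fy (h g a) y \<in> Y" using hL[OF gc ay'(1)] ay' by (intro y.closed) auto
      show "z \<in> j ` ?U \<union> j ` ?V"
      proof (cases "f g a \<in> A")
        case False
        then show ?thesis using z' ay hy by (intro UnI1) force
      next
        case True
        then have "fy (h g a) y \<notin> B" using z z' by (auto simp: F'_def)
        then show ?thesis using z' ay True by (intro UnI2) force
      qed
    qed
    moreover have finU: "finite ?U" and finV: "finite ?V" using A B by auto
    ultimately have "card (f' g ` F' - F') \<le> card (j ` ?U \<union> j ` ?V)" by (intro card_mono) auto
    also have "\<dots> \<le> card (j ` ?U) + card (j ` ?V)" by (rule card_Un_le)
    also have "\<dots> \<le> card ?U + card ?V" using finU finV by (intro add_mono card_image_le)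
    finally have 1: "real (card (f' g ` F' - F')) \<le> card ?U + card ?V" by linarith
    have "?U \<subseteq> (\<lambda>(a, y). (f g a, fy (h g a) y)) ` ({a\<in>A. f g a \<notin> A} \<times> B)" by auto
    then have "card ?U \<le> card ({a\<in>A. f g a \<notin> A} \<times> B)"
      using A(1) B(1) by (intro surj_card_le) auto
    also have "\<dots> = card {a\<in>A. f g a \<notin> A} * card B" by (simp add: card_cartesian_product)
    also have "card {a\<in>A. f g a \<notin> A} = card (f g ` {a\<in>A. f g a \<notin> A})"
      using A gc by (intro a.card_act_image[symmetric]) auto
    also have "f g ` {a\<in>A. f g a \<notin> A} = f g ` A - A" by auto
    finally have "real (card ?U) \<le> real (card (f g ` A - A)) * card B"
      by (simp flip: of_nat_mult)
    also have "\<dots> \<le> (\<epsilon> / 2 * card A) * card B" using A(4)[OF g] by (intro mult_right_mono) auto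
    finally have 2: "real (card ?U) \<le> \<epsilon> / 2 * (card A * card B)" by simp
    have "real (card (\<Union>a\<in>{a\<in>A. f g a = c}. fy (h g a) ` B - B)) \<le> \<epsilon> / 2 * card B"
      if "c \<in> A \<inter> f g ` A" for c
    proof -
      obtain a0 where a: "a0 \<in> A" "f g a0 = c" using \<open>c \<in> A \<inter> f g ` A\<close> by blast
      have "{a\<in>A. f g a = c} = {a0}" using a A(3) a.act_inj[OF gc] by auto
      then show ?thesis using B(4)[of "h g a0"] a g by auto
    qed
    then have "(\<Sum>c\<in>A \<inter> f g ` A. real (card (\<Union>a\<in>{a\<in>A. f g a = c}. fy (h g a) ` B - B)))
        \<le> real (card (A \<inter> f g ` A)) * (\<epsilon> / 2 * card B)" by (rule sum_bounded_above)
    moreover have "card ?V = (\<Sum>c\<in>A \<inter> f g ` A. card (\<Union>a\<in>{a\<in>A. f g a = c}. fy (h g a) ` B - B))"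
      using A B by (intro card_SigmaI) auto
    moreover have "real (card (A \<inter> f g ` A)) * (\<epsilon> / 2 * card B) \<le> card A * (\<epsilon> / 2 * card B)"
      using A(1) Q by (intro mult_right_mono) (auto intro: card_mono)
    ultimately have "real (card ?V) \<le> \<epsilon> / 2 * (card A * card B)" by (simp add: algebra_simps)
    with 1 2 show ?thesis by (simp add: cardF)
  qed
  then show "\<exists>C. finite C \<and> C \<noteq> {} \<and> C \<subseteq> E' \<and> (\<forall>g\<in>Q. real (card (f' g ` C - C)) \<le> \<epsilon> * card C)"
    using A B ABE jE by (intro exI[of _ F']) (auto simp: F'_def)
qed

section \<open>Regular and coset actions\<close>

lemma regular_set_action: "group G \<Longrightarrow> set_action G (carrier G) (\<otimes>\<^bsub>G\<^esub>)"
  by (simp add: set_action_def set_action_axioms_def group.is_monoid monoid.m_assoc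
      monoid.m_closed monoid.l_one)

lemma amenable_group_iff_mean:
  "amenable_group G \<longleftrightarrow> group G \<and> (\<exists>\<mu>. invariant_mean G (carrier G) (\<otimes>\<^bsub>G\<^esub>) \<mu>)"
  using set_action.amenable_action_restrict_iff[OF regular_set_action]
  unfolding amenable_group_def by blast

lemma amenable_group_folnerI:
  assumes "group G" "countable (carrier G)" "folner_action G (carrier G) (\<otimes>\<^bsub>G\<^esub>)"
  shows "amenable_group G"
  using assms set_action.folner_imp_mean[OF regular_set_action] amenable_group_iff_mean by blast

section \<open>Amenable groups, Folner intervals and Tarski monsters\<close>

lemma class_A_amenable:
  assumes "countable_group G" "amenable_group G" shows "class_A G"
proof -
  interpret G: group G using assms by (simp add: countable_group_def)
  interpret set_action G "carrier G" "(\<otimes>\<^bsub>G\<^esub>)" by (rule regular_set_action[OF G.is_group])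
  obtain \<mu> where "invariant_mean G (carrier G) (\<otimes>\<^bsub>G\<^esub>) \<mu>"
    using assms by (auto simp: amenable_group_iff_mean)
  then show ?thesis
  proof (rule class_A_meanI[OF assms(1), rotated 2])
    show "transitive_on G (carrier G) (\<otimes>\<^bsub>G\<^esub>)"
      by (rule transitive_onI[of "\<one>\<^bsub>G\<^esub>"]) auto
    show "faithful_on G (carrier G) (\<otimes>\<^bsub>G\<^esub>)"
      by (auto simp: faithful_on_def dest: bspec[of _ _ "\<one>\<^bsub>G\<^esub>"])
  qed
qed

text \<open>Along the sequence \<open>pt\<close> every \<open>p\<close> is, sufficiently far to the
  left, the shift by \<open>e p\<close>. A long interval placed far enough to the left meets only
  these shifts, so its boundary does not grow with its length.\<close>

lemma (in set_action) folner_shiftI: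
  fixes pt :: "int \<Rightarrow> 'x" and e :: "'a \<Rightarrow> int"
  assumes pt: "\<And>k. k < 0 \<Longrightarrow> pt k \<in> E" and inj: "inj_on pt {..<0}"
    and move: "\<And>p. p \<in> carrier G \<Longrightarrow> \<exists>b. \<forall>k<b. f p (pt k) = pt (k + e p)"
  shows "folner_action G E f"
  unfolding folner_action_def
proof (intro allI impI)
  fix Q and \<epsilon> :: real assume Q: "finite Q \<and> Q \<subseteq> carrier G \<and> 0 < \<epsilon>"
  have "\<forall>p\<in>Q. \<exists>b. \<forall>k<b. f p (pt k) = pt (k + e p)" using move Q by blast
  then obtain b where b: "\<And>p k. p \<in> Q \<Longrightarrow> k < b p \<Longrightarrow> f p (pt k) = pt (k + e p)" by metis
  define J where "J = (\<Sum>p\<in>Q. \<bar>e p\<bar>)"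
  \<comment> \<open>The interval ends just before \<open>c\<close>: below every threshold
    \<open>b p\<close>, and low enough that moving right by \<open>J\<close> still gives negative
    indices.\<close>
  define c where "c = - (\<Sum>p\<in>Q. \<bar>b p\<bar>) - J"
  have J: "\<bar>e p\<bar> \<le> J" if "p \<in> Q" for p
    unfolding J_def using that Q by (intro member_le_sum) auto
  have c: "c \<le> b p" if "p \<in> Q" for p
  proof -
    have "\<bar>b p\<bar> \<le> (\<Sum>p\<in>Q. \<bar>b p\<bar>)" using that Q by (intro member_le_sum) auto
    then show ?thesis using J[OF that] unfolding c_def by linarith
  qed
  have J0: "0 \<le> J" unfolding J_def by (intro sum_nonneg) auto
  have "0 \<le> (\<Sum>p\<in>Q. \<bar>b p\<bar>)" by (intro sum_nonneg) auto
  then have cJ: "c + J \<le> 0" by (simp add: c_def)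
  \<comment> \<open>At most \<open>2 J\<close> points lie next to the interval within reach of the
    shifts, so more than \<open>2 J / \<epsilon>\<close> points are enough.\<close>
  obtain n where n: "2 * real_of_int J / \<epsilon> < real n" using reals_Archimedean2 by blast
  define A where "A = pt ` {c - int n - 1..<c}"
  have cardA: "card A = n + 1" unfolding A_def
    by (subst card_image[OF inj_on_subset[OF inj]]) (use cJ J0 in auto)
  have "real (card (f p ` A - A)) \<le> \<epsilon> * real (card A)" if p: "p \<in> Q" for p
  proof -
    let ?I = "{c..<c + J} \<union> {c - int n - 1 - J..<c - int n - 1}"
    have "f p ` A - A \<subseteq> pt ` ?I"
    proof
      fix x assume x: "x \<in> f p ` A - A"
      then obtain k where k: "k \<in> {c - int n - 1..<c}" "x = f p (pt k)" unfolding A_def by blast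
      have "x = pt (k + e p)" using b[OF p, of k] c[OF p] k by simp
      moreover from this have "k + e p \<notin> {c - int n - 1..<c}" using x unfolding A_def by blast
      then have "k + e p \<in> ?I" using k(1) J[OF p] by auto
      ultimately show "x \<in> pt ` ?I" by blast
    qed
    then have "card (f p ` A - A) \<le> card ?I" by (rule surj_card_le[rotated]) simp
    also have "\<dots> \<le> card {c..<c + J} + card {c - int n - 1 - J..<c - int n - 1}" by (rule card_Un_le)
    finally have "real (card (f p ` A - A)) \<le> 2 * real_of_int J" using J0 by simp
    also have "\<dots> \<le> \<epsilon> * real n" using n Q by (simp add: pos_divide_less_eq mult.commute)
    also have "\<dots> \<le> \<epsilon> * real (card A)" using Q by (simp add: cardA)
    finally show ?thesis .
  qed
  moreover have "finite A" "A \<noteq> {}" "A \<subseteq> E" using pt cJ J0 by (auto simp: A_def)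
  ultimately show "\<exists>A. finite A \<and> A \<noteq> {} \<and> A \<subseteq> E \<and> (\<forall>p\<in>Q. real (card (f p ` A - A)) \<le> \<epsilon> * real (card A))"
    by blast
qed

lemma folner_cyclic:
  assumes "group G" "cyclic_group G"
  shows "folner_action G (carrier G) (\<otimes>\<^bsub>G\<^esub>)"
proof (cases "finite (carrier G)")
  case True
  interpret group G by fact
  interpret set_action G "carrier G" "(\<otimes>\<^bsub>G\<^esub>)" by (rule regular_set_action) fact
  show ?thesis unfolding folner_action_def
    using True act_image_UNIV by (intro allI impI exI[of _ "carrier G"]) (auto simp: subset_eq)
next
  case False
  interpret group G by fact
  interpret set_action G "carrier G" "(\<otimes>\<^bsub>G\<^esub>)" by (rule regular_set_action) fact
  obtain a where a: "a \<in> carrier G" "carrier G = range (\<lambda>n::int. a [^]\<^bsub>G\<^esub> n)"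
    using assms(2) cyclic_group by blast
  \<comment> \<open>Two equal powers of the generator would make the group finite.\<close>
  have inj: "i = j" if "a [^]\<^bsub>G\<^esub> i = a [^]\<^bsub>G\<^esub> j" for i j :: int
  proof (rule ccontr)
    assume "i \<noteq> j"
    have "a [^]\<^bsub>G\<^esub> (i - j) = \<one>\<^bsub>G\<^esub>" "a [^]\<^bsub>G\<^esub> (j - i) = \<one>\<^bsub>G\<^esub>"
      using that a(1) by (simp_all add: int_pow_diff)
    then have "a [^]\<^bsub>G\<^esub> int (nat \<bar>i - j\<bar>) = \<one>\<^bsub>G\<^esub>" by (simp add: abs_if)
    then have "a [^]\<^bsub>G\<^esub> nat \<bar>i - j\<bar> = \<one>\<^bsub>G\<^esub>" by (simp add: int_pow_int)
    moreover have "nat \<bar>i - j\<bar> \<noteq> 0" using \<open>i \<noteq> j\<close> by simp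
    ultimately have "finite (carrier (subgroup_generated G {a}))"
      using finite_cyclic_subgroup[OF a(1)] by blast
    moreover have "carrier (subgroup_generated G {a}) = carrier G"
      using a carrier_subgroup_generated_by_singleton[OF a(1)] by auto
    ultimately show False using False by simp
  qed
  have "\<forall>g\<in>carrier G. \<exists>k::int. g = a [^]\<^bsub>G\<^esub> k" using a(2) by blast
  then obtain e where e: "\<And>g. g \<in> carrier G \<Longrightarrow> g = a [^]\<^bsub>G\<^esub> (e g :: int)" by metis
  show ?thesis
  proof (rule folner_shiftI[where pt = "\<lambda>k :: int. a [^]\<^bsub>G\<^esub> k" and e = e])
    fix g assume g: "g \<in> carrier G"
    have "g \<otimes>\<^bsub>G\<^esub> a [^]\<^bsub>G\<^esub> k = a [^]\<^bsub>G\<^esub> (k + e g)" for k :: int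
      using e[OF g] int_pow_mult[OF a(1), of "e g" k] by (simp add: add.commute)
    then show "\<exists>b. \<forall>k<b. g \<otimes>\<^bsub>G\<^esub> a [^]\<^bsub>G\<^esub> k = a [^]\<^bsub>G\<^esub> (k + e g)" by blast
  qed (use a(1) inj in \<open>auto simp: inj_on_def\<close>)
qed

lemma class_A_integer_group: "class_A integer_group"
proof (rule class_A_amenable)
  show "countable_group integer_group" by (simp add: countable_group_def infinite_UNIV_int)
  show "amenable_group integer_group" 
    using folner_cyclic[of integer_group] by (intro amenable_group_folnerI) auto
qed

lemma tarski_monster_not_class_A:
  assumes T: "tarski_monster G" and "\<not> amenable_group G"
  shows "\<not> class_A G"
proof
  assume "class_A G"
  then obtain E :: "nat set" and f \<mu> where E: "set_action G E f" "countable_group G" "transitive_on G E f"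
    "faithful_on G E f" "folner_action G E f" "E \<noteq> {}" using class_AE by metis
  interpret set_action G E f by fact
  obtain x0 where x0: "x0 \<in> E" using E(6) by blast
  define L where "L = {g \<in> carrier G. f g x0 = x0}"
  have LG: "L \<subseteq> carrier G" by (auto simp: L_def)
  have invL: "inv\<^bsub>G\<^esub> g \<in> L" if "g \<in> L" for g
    using that x0 act_inv[of g x0] by (simp add: L_def)
  have L: "subgroup L G"
  proof (rule subgroupI)
    have "\<one>\<^bsub>G\<^esub> \<in> L" using x0 by (simp add: L_def)
    then show "L \<noteq> {}" by blast
    show "L \<subseteq> carrier G" by (rule LG)
    show "inv\<^bsub>G\<^esub> a \<in> L" if "a \<in> L" for a using that by (rule invL)
    show "a \<otimes>\<^bsub>G\<^esub> b \<in> L" if "a \<in> L" "b \<in> L" for a b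
    proof -
      have "a \<in> carrier G" "b \<in> carrier G" "f a x0 = x0" "f b x0 = x0" using that by (auto simp: L_def)
      moreover from this have "f (a \<otimes>\<^bsub>G\<^esub> b) x0 = f a (f b x0)" using x0 by (intro act_mult)
      ultimately show ?thesis unfolding L_def by simp
    qed
  qed
  \<comment> \<open>A fixed point of a transitive action is the only point, and faithfulness would
    then make the infinite group trivial.\<close>
  have "L \<noteq> carrier G"
  proof
    assume *: "L = carrier G"
    have "x = x0" if x: "x \<in> E" for x
    proof -
      obtain g where "g \<in> carrier G" "f g x0 = x" by (rule transitive_onD[OF E(3) x0 x])
      then show ?thesis using * by (auto simp: L_def)
    qed
    then have "g = \<one>\<^bsub>G\<^esub>" if "g \<in> carrier G" for g
      using E(4) that closed[OF that] unfolding faithful_on_def by blast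
    then have "carrier G \<subseteq> {\<one>\<^bsub>G\<^esub>}" by blast
    then show False using E(2) finite_subset by (auto simp: countable_group_def)
  qed
  then have cyc: "cyclic_group (G\<lparr>carrier := L\<rparr>)" using T L by (auto simp: tarski_monster_def)
  have gL: "group (G\<lparr>carrier := L\<rparr>)" by (rule subgroup.subgroup_is_group[OF L is_group])
  \<comment> \<open>The orbit map \<open>g -> f g x0\<close> is equivariant from the regular action,
    and its fibre over \<open>x0\<close> is \<open>L\<close>, on which \<open>L\<close> acts
    regularly.\<close>
  have "folner_action G (carrier G) (\<otimes>\<^bsub>G\<^esub>)"
  proof (rule folner_extension[OF E(1) regular_set_action[OF is_group] E(3) x0 E(5),
        where p = "\<lambda>g. f g x0" and Y = L and fy = "(\<otimes>\<^bsub>G\<^esub>)" and q = "\<lambda>x. x" and L = L])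
    show "set_action (G\<lparr>carrier := L\<rparr>) L (\<otimes>\<^bsub>G\<^esub>)" using regular_set_action[OF gL] by simp
    show "folner_action (G\<lparr>carrier := L\<rparr>) L (\<otimes>\<^bsub>G\<^esub>)" using folner_cyclic[OF gL cyc] by simp
  qed (use x0 act_mult in \<open>auto simp: L_def\<close>)
  then have "amenable_group G"
    using E(2) amenable_group_folnerI is_group by (auto simp: countable_group_def)
  then show False using assms(2) by simp
qed

section \<open>Coset spaces and co-amenable subgroups\<close>

lemma (in group) l_coset_set_action: "set_action G (Pow (carrier G)) (\<lambda>g C. g <# C)"
proof
  show "g <# C \<in> Pow (carrier G)" if "g \<in> carrier G" "C \<in> Pow (carrier G)" for g C
    using that l_coset_subset_G by blast
  show "\<one> <# C = C" if "C \<in> Pow (carrier G)" for C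
    using that by (auto simp: l_coset_def subset_eq)
  show "g \<otimes> h <# C = g <# (h <# C)" if "g \<in> carrier G" "h \<in> carrier G" "C \<in> Pow (carrier G)" for g h C
    using that by (simp add: lcos_m_assoc)
qed

lemma set_action_subset:
  assumes "set_action G E f" "E' \<subseteq> E" "\<And>g x. g \<in> carrier G \<Longrightarrow> x \<in> E' \<Longrightarrow> f g x \<in> E'"
  shows "set_action G E' f"
proof -
  interpret set_action G E f by fact
  show ?thesis by unfold_locales (use assms act_mult in auto)
qed

lemma (in group) lcosets_set_action:
  assumes "L \<subseteq> carrier G" shows "set_action G (lcosets L) (\<lambda>g C. g <# C)"
proof (rule set_action_subset[OF l_coset_set_action])
  show "lcosets L \<subseteq> Pow (carrier G)" using assms l_coset_subset_G by (auto simp: LCOSETS_def)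
  show "g <# C \<in> lcosets L" if "g \<in> carrier G" "C \<in> lcosets L" for g C
    using that assms by (auto simp: LCOSETS_def lcos_m_assoc)
qed

lemma (in group) countable_lcosets: "countable (carrier G) \<Longrightarrow> countable (lcosets L)"
  unfolding LCOSETS_def by (rule countable_UN) auto

lemma (in group) lcosets_transitive_on:
  assumes "subgroup L G" shows "transitive_on G (lcosets L) (\<lambda>g C. g <#\<^bsub>G\<^esub> C)"
proof -
  have L: "L \<subseteq> carrier G" using assms by (rule subgroup.subset)
  interpret c: set_action G "lcosets L" "\<lambda>g C. g <#\<^bsub>G\<^esub> C" by (rule lcosets_set_action[OF L])
  have "\<one> <# L = L" using L by (auto simp: l_coset_def subset_eq)
  then have "L \<in> lcosets L" unfolding LCOSETS_def by blast
  then show ?thesis by (rule c.transitive_onI) (auto simp: LCOSETS_def)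
qed

text \<open>\<open>G\<close> acts on the cosets of the stabilizer \<open>L\<close> of a point in the
  \<open>H\<close>-action; this is the action induced from \<open>H\<close>. The map onto
  \<open>G/H\<close> has fibre \<open>H/L\<close>, a copy of \<open>Y\<close>, and both base and
  fibre have Folner sets.\<close>

lemma class_A_co_amenable:
  assumes cG: "countable_group G" and co: "co_amenable H G" and A: "class_A (G\<lparr>carrier := H\<rparr>)"
  shows "class_A G"
proof -
  interpret group G using cG by (simp add: countable_group_def)
  have H: "subgroup H G" using co by (simp add: co_amenable_def)
  have HG: "H \<subseteq> carrier G" by (rule subgroup.subset[OF H])
  obtain Y :: "nat set" and fy where Y: "set_action (G\<lparr>carrier := H\<rparr>) Y fy"
    "transitive_on (G\<lparr>carrier := H\<rparr>) Y fy" "faithful_on (G\<lparr>carrier := H\<rparr>) Y fy"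
    "folner_action (G\<lparr>carrier := H\<rparr>) Y fy" "Y \<noteq> {}" using class_AE[OF A] by metis
  interpret y: set_action "G\<lparr>carrier := H\<rparr>" Y fy by fact
  obtain y0 where y0: "y0 \<in> Y" using Y(5) by blast
  define L where "L = {h \<in> H. fy h y0 = y0}"
  have invH: "inv\<^bsub>G\<lparr>carrier := H\<rparr>\<^esub> h = inv\<^bsub>G\<^esub> h" if "h \<in> H" for h
    using m_inv_consistent[OF H that] .
  have invHH: "inv\<^bsub>G\<^esub> h \<in> H" if "h \<in> H" for h using H that by (rule subgroup.m_inv_closed)
  have HH: "g \<otimes>\<^bsub>G\<^esub> h \<in> H" if "g \<in> H" "h \<in> H" for g h using H that by (rule subgroup.m_closed)
  have fy_mult: "fy (g \<otimes>\<^bsub>G\<^esub> h) x = fy g (fy h x)" if "g \<in> H" "h \<in> H" "x \<in> Y" for g h x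
    using y.act_mult that by simp
  have fyY: "fy g x \<in> Y" if "g \<in> H" "x \<in> Y" for g x using y.closed that by simp
  have fy_inv: "fy (inv\<^bsub>G\<^esub> g) (fy g x) = x" if "g \<in> H" "x \<in> Y" for g x
    using y.act_inv that by (simp add: invH)
  have L: "subgroup L G"
  proof (rule subgroupI)
    show "L \<subseteq> carrier G" using HG by (auto simp: L_def)
    have "\<one>\<^bsub>G\<^esub> \<in> L" using y.act_one[OF y0] subgroup.one_closed[OF H] by (simp add: L_def)
    then show "L \<noteq> {}" by blast
    show "inv\<^bsub>G\<^esub> a \<in> L" if "a \<in> L" for a
      using that fy_inv[of a y0] y0 invHH by (auto simp: L_def)
    show "a \<otimes>\<^bsub>G\<^esub> b \<in> L" if "a \<in> L" "b \<in> L" for a b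
      using that y0 HH fy_mult by (auto simp: L_def)
  qed
  have LG: "L \<subseteq> carrier G" by (rule subgroup.subset[OF L])
  interpret c: set_action G "lcosets\<^bsub>G\<^esub> H" "\<lambda>g C. g <#\<^bsub>G\<^esub> C" by (rule lcosets_set_action[OF HG])
  interpret d: set_action G "lcosets\<^bsub>G\<^esub> L" "\<lambda>g C. g <#\<^bsub>G\<^esub> C" by (rule lcosets_set_action[OF LG])
  have HE: "H \<in> lcosets\<^bsub>G\<^esub> H"
    using lcos_mult_one[OF HG] unfolding LCOSETS_def by blast
  \<comment> \<open>The coset of \<open>L\<close> that corresponds to \<open>y\<close>: all elements
    of \<open>H\<close> carrying \<open>y0\<close> to \<open>y\<close>.\<close>
  define q where "q y = {h \<in> H. fy h y0 = y}" for y
  have trans: "\<exists>h\<in>H. fy h y0 = y" if "y \<in> Y" for y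
    using Y(2) that y0 unfolding transitive_on_def by simp
  have q_coset: "q (fy h y0) = h <#\<^bsub>G\<^esub> L" if h: "h \<in> H" for h
  proof (intro subset_antisym subsetI)
    fix g assume g: "g \<in> q (fy h y0)"
    then have "inv\<^bsub>G\<^esub> h \<otimes>\<^bsub>G\<^esub> g \<in> L"
      using h y0 HH invHH fy_mult fy_inv by (auto simp: q_def L_def)
    moreover have "g = h \<otimes>\<^bsub>G\<^esub> (inv\<^bsub>G\<^esub> h \<otimes>\<^bsub>G\<^esub> g)"
      using g h HG by (auto simp: q_def subset_eq simp flip: m_assoc)
    ultimately show "g \<in> h <#\<^bsub>G\<^esub> L" unfolding l_coset_def by blast
  next
    fix g assume "g \<in> h <#\<^bsub>G\<^esub> L"
    then show "g \<in> q (fy h y0)" using h y0 HH fy_mult by (auto simp: l_coset_def L_def q_def)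
  qed
  show ?thesis
  proof (rule d.class_A_folnerI[OF cG lcosets_transitive_on[OF L]])
    show "faithful_on G (lcosets\<^bsub>G\<^esub> L) (\<lambda>g C. g <#\<^bsub>G\<^esub> C)"
      unfolding faithful_on_def
    proof (intro ballI impI)
      fix g assume g: "g \<in> carrier G" "\<forall>C\<in>lcosets\<^bsub>G\<^esub> L. g <#\<^bsub>G\<^esub> C = C"
      \<comment> \<open>An element trivial on all cosets lies in every conjugate of
        \<open>L\<close>. The choice \<open>k = \<one>\<close> places it in \<open>H\<close>, and
        conjugation by elements of \<open>H\<close> makes it fix all of \<open>Y\<close>.\<close>
      have conj: "\<exists>l\<in>L. g \<otimes>\<^bsub>G\<^esub> k = k \<otimes>\<^bsub>G\<^esub> l" if k: "k \<in> carrier G" for k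
      proof -
        have "g <#\<^bsub>G\<^esub> (k <#\<^bsub>G\<^esub> L) = k <#\<^bsub>G\<^esub> L" using g k by (auto simp: LCOSETS_def)
        moreover have "g \<otimes>\<^bsub>G\<^esub> k \<in> g <#\<^bsub>G\<^esub> (k <#\<^bsub>G\<^esub> L)"
          using k subgroup.one_closed[OF L] unfolding l_coset_def
          by (auto intro!: bexI[of _ k] bexI[of _ "\<one>\<^bsub>G\<^esub>"])
        ultimately show ?thesis unfolding l_coset_def by auto
      qed
      have gH: "g \<in> H" using conj[of "\<one>\<^bsub>G\<^esub>"] g LG by (auto simp: L_def subset_eq)
      have "fy g y = y" if yY: "y \<in> Y" for y
      proof -
        obtain k where k: "k \<in> H" "fy k y0 = y" using trans[OF yY] by blast
        obtain l where l: "l \<in> L" "g \<otimes>\<^bsub>G\<^esub> k = k \<otimes>\<^bsub>G\<^esub> l" using conj[of k] k HG by blast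
        have "fy g y = fy (k \<otimes>\<^bsub>G\<^esub> l) y0" using gH k y0 by (simp add: fy_mult flip: l(2))
        also have "\<dots> = y" using l k y0 by (auto simp: fy_mult L_def)
        finally show ?thesis .
      qed
      then show "g = \<one>\<^bsub>G\<^esub>" using Y(3) gH by (simp add: faithful_on_def)
    qed
    have amen: "folner_action G (lcosets\<^bsub>G\<^esub> H) (\<lambda>g C. g <#\<^bsub>G\<^esub> C)"
    proof -
      obtain \<mu> where "invariant_mean G (lcosets\<^bsub>G\<^esub> H) (\<lambda>g C. g <#\<^bsub>G\<^esub> C) \<mu>"
        using co c.amenable_action_restrict_iff by (auto simp: co_amenable_def)
      then show ?thesis
        by (rule c.mean_imp_folner) (use cG countable_lcosets in \<open>auto simp: countable_group_def\<close>)
    qed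
    \<comment> \<open>The base map sends a coset \<open>C\<close> of \<open>L\<close> to
      \<open>C H\<close>, the coset of \<open>H\<close> that contains it.\<close>
    show "folner_action G (lcosets\<^bsub>G\<^esub> L) (\<lambda>g C. g <#\<^bsub>G\<^esub> C)"
    proof (rule folner_extension[OF c.set_action_axioms d.set_action_axioms lcosets_transitive_on[OF H] HE amen,
          where p = "\<lambda>C. C <#>\<^bsub>G\<^esub> H" and q = q and fy = fy and Y = Y and L = H])
      show "g <#\<^bsub>G\<^esub> C <#>\<^bsub>G\<^esub> H = g <#\<^bsub>G\<^esub> (C <#>\<^bsub>G\<^esub> H)"
        if "g \<in> carrier G" "C \<in> lcosets\<^bsub>G\<^esub> L" for g C
      proof -
        have "C \<subseteq> carrier G" using that LG l_coset_subset_G by (auto simp: LCOSETS_def)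
        then show ?thesis using that HG by (simp add: l_coset_eq_set_mult set_mult_assoc)
      qed
      show "H = {g \<in> carrier G. g <#\<^bsub>G\<^esub> H = H}"
      proof (intro subset_antisym subsetI)
        fix h assume "h \<in> H"
        then show "h \<in> {g \<in> carrier G. g <#\<^bsub>G\<^esub> H = H}" using H HG coset_join3 by blast
      next
        fix g assume "g \<in> {g \<in> carrier G. g <#\<^bsub>G\<^esub> H = H}"
        then have "g \<in> carrier G" "g \<otimes>\<^bsub>G\<^esub> \<one>\<^bsub>G\<^esub> \<in> H"
          using subgroup.one_closed[OF H] unfolding l_coset_def by blast+
        then show "g \<in> H" by simp
      qed
      show "inj_on q Y"
        using trans by (auto simp: inj_on_def q_def)
      show "q ` Y \<subseteq> lcosets\<^bsub>G\<^esub> L"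
      proof
        fix C assume "C \<in> q ` Y"
        then obtain h where "h \<in> H" "C = q (fy h y0)" using trans by blast
        then show "C \<in> lcosets\<^bsub>G\<^esub> L" using q_coset HG by (auto simp: LCOSETS_def)
      qed
      show "q y <#>\<^bsub>G\<^esub> H = H" if "y \<in> Y" for y
      proof (intro subset_antisym subsetI)
        fix g assume "g \<in> q y <#>\<^bsub>G\<^esub> H"
        then show "g \<in> H" using HH by (auto simp: set_mult_def q_def)
      next
        fix g assume g: "g \<in> H"
        obtain h where h: "h \<in> H" "fy h y0 = y" using trans[OF \<open>y \<in> Y\<close>] by blast
        have "g = h \<otimes>\<^bsub>G\<^esub> (inv\<^bsub>G\<^esub> h \<otimes>\<^bsub>G\<^esub> g)" using g h HG by (auto simp: subset_eq simp flip: m_assoc)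
        then show "g \<in> q y <#>\<^bsub>G\<^esub> H"
          using g h HH invHH unfolding set_mult_def q_def by blast
      qed
      show "q (fy h y) = h <#\<^bsub>G\<^esub> q y" if "h \<in> H" "y \<in> Y" for h y
      proof -
        obtain k where k: "k \<in> H" "fy k y0 = y" using trans[OF \<open>y \<in> Y\<close>] by blast
        have "q (fy h y) = q (fy (h \<otimes>\<^bsub>G\<^esub> k) y0)" using k that y0 by (simp add: fy_mult)
        also have "\<dots> = h <#\<^bsub>G\<^esub> (k <#\<^bsub>G\<^esub> L)"
          using k that HH HG LG by (simp add: q_coset lcos_m_assoc subset_eq)
        finally show ?thesis using k q_coset by metis
      qed
    qed (use Y in auto)
  qed
qed

lemma card_symdiff_image:
  assumes "finite F" "inj_on g F"
  shows "card ((F - g ` F) \<union> (g ` F - F)) = 2 * card (g ` F - F)"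
proof -
  have "card (F - g ` F) = card (g ` F - F)"
  proof -
    have "card (F - g ` F) = card F - card (F \<inter> g ` F)" "card (g ` F - F) = card (g ` F) - card (g ` F \<inter> F)"
      using assms by (auto intro: card_Diff_subset_Int)
    then show ?thesis using assms by (simp add: card_image Int_commute)
  qed
  moreover have "card ((F - g ` F) \<union> (g ` F - F)) = card (F - g ` F) + card (g ` F - F)"
    using assms by (intro card_Un_disjoint) auto
  ultimately show ?thesis by simp
qed

lemma (in set_action) finite_carrier_if_faithful:
  assumes "faithful_on G E f" "finite E" shows "finite (carrier G)"
proof -
  have "inj_on (\<lambda>g. restrict (f g) E) (carrier G)"
  proof (rule inj_onI)
    fix g h assume gh: "g \<in> carrier G" "h \<in> carrier G" "restrict (f g) E = restrict (f h) E"
    have "f (inv h \<otimes> g) x = x" if "x \<in> E" for x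
    proof -
      have "f g x = f h x" using gh(3) that by (metis restrict_apply')
      with gh that show ?thesis by (simp add: act_mult)
    qed
    then have "inv h \<otimes> g = \<one>" using assms(1) gh unfolding faithful_on_def by blast
    then show "g = h" using gh by (metis inv_equality inv_inv inv_closed)
  qed
  moreover have "(\<lambda>g. restrict (f g) E) ` carrier G \<subseteq> E \<rightarrow>\<^sub>E E" by auto
  ultimately show ?thesis using finite_PiE[of E "\<lambda>_. E"] assms(2) by (metis finite_imageD finite_subset)
qed

section \<open>Free products\<close>

lemma reduced_words_Nil [simp]: "[] \<in> reduced_words G H"
  by (simp add: reduced_words_def)

lemma reduced_words_Cons:
  "l # w \<in> reduced_words G H \<longleftrightarrow> l \<in> Inl ` (carrier G - {\<one>\<^bsub>G\<^esub>}) \<union> Inr ` (carrier H - {\<one>\<^bsub>H\<^esub>}) \<and>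
     w \<in> reduced_words G H \<and> (w = [] \<or> isl l \<noteq> isl (hd w))"
  by (cases w) (auto simp: reduced_words_def)

lemma free_product_simps [simp]:
  "carrier (free_product G H) = reduced_words G H"
  "\<one>\<^bsub>free_product G H\<^esub> = []"
  "u \<otimes>\<^bsub>free_product G H\<^esub> v = foldr (free_product_step G H) u v"
  by (simp_all add: free_product_def)

lemma countable_reduced_words:
  assumes "countable (carrier G)" "countable (carrier H)"
  shows "countable (reduced_words G H)"
proof (rule countable_subset)
  show "reduced_words G H \<subseteq> lists (Inl ` carrier G \<union> Inr ` carrier H)"
    by (auto simp: reduced_words_def lists_eq_set)
  show "countable (lists (Inl ` carrier G \<union> Inr ` carrier H))"
    using assms by (intro countable_lists) auto
qed

lemma free_product_step_reduced_Cons: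
  "l # w \<in> reduced_words G H \<Longrightarrow> free_product_step G H l w = l # w"
  by (cases w; cases l; cases "hd w")
    (auto simp: reduced_words_Cons free_product_step_def push_letter_def split: sum.splits)

text \<open>One letter affects at most the first letter of a word, so a shorter word cannot exhaust
  a longer one; this keeps the faithfulness argument away from the empty word.\<close>

lemma length_free_product_step: "length w \<le> Suc (length (free_product_step G H l w))"
  by (auto simp: free_product_step_def push_letter_def split: sum.splits list.splits)

lemma length_free_product_mult: "length v \<le> length u + length (foldr (free_product_step G H) u v)"
proof (induction u)
  case (Cons l u)
  then show ?case
    using length_free_product_step[of "foldr (free_product_step G H) u v" G H l] by simp
qed simp

text \<open>The universal property of the free product, for actions. Multiplication is built from
  \<open>free_product_step\<close>, so it suffices that one step on a word corresponds to one letter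
  acting.\<close>

lemma set_action_free_product:
  assumes G: "group G" and H: "group H" and a: "set_action G Z \<alpha>" and b: "set_action H Z \<beta>"
  shows "set_action (free_product G H) Z (foldr (case_sum \<alpha> \<beta>))"
proof -
  interpret a: set_action G Z \<alpha> by fact
  interpret b: set_action H Z \<beta> by fact
  interpret P: group "free_product G H" by (rule free_product_group[OF G H])
  let ?F = "foldr (case_sum \<alpha> \<beta>)" and ?s = "free_product_step G H"
  have cl: "?F w z \<in> Z" if "w \<in> reduced_words G H" "z \<in> Z" for w z
    using that(1) by (induction w) (use that(2) in \<open>auto simp: reduced_words_Cons\<close>)
  have step: "?F (?s l w) z = case_sum \<alpha> \<beta> l (?F w z)"
    if "l \<in> Inl ` carrier G \<union> Inr ` carrier H" "w \<in> reduced_words G H" "z \<in> Z" for l w z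
  proof -
    have push: "?F (push_letter G H l' w') z = case_sum \<alpha> \<beta> l' (?F w' z)"
      if "w' \<in> reduced_words G H" for l' w'
      using cl[OF that \<open>z \<in> Z\<close>] by (auto simp: push_letter_def)
    show ?thesis
    proof (cases w)
      case Nil
      then show ?thesis using push[of "[]" l] by (cases l) (simp_all add: free_product_step_def)
    next
      case (Cons k w')
      then have w': "w' \<in> reduced_words G H" and k: "k \<in> Inl ` carrier G \<union> Inr ` carrier H"
        using that by (auto simp: reduced_words_Cons)
      note c = cl[OF w' \<open>z \<in> Z\<close>]
      show ?thesis
        using Cons push[OF w'] push[OF that(2), of l] that(1) k c
        by (cases l; cases k) (auto simp: free_product_step_def a.act_mult b.act_mult)
    qed
  qed
  show ?thesis
  proof
    show "?F w z \<in> Z" if "w \<in> carrier (free_product G H)" "z \<in> Z" for w z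
      using cl that by simp
    fix u v z assume uv: "u \<in> carrier (free_product G H)" "v \<in> carrier (free_product G H)" and z: "z \<in> Z"
    have "?F (foldr ?s u v) z = ?F u (?F v z)"
      using uv(1)
    proof (induction u)
      case (Cons l u)
      then have u: "u \<in> reduced_words G H" and l: "l \<in> Inl ` carrier G \<union> Inr ` carrier H"
        by (auto simp: reduced_words_Cons)
      have "foldr ?s u v \<in> reduced_words G H" using P.m_closed[of u v] u uv by simp
      then show ?case using step[OF l _ z] Cons.IH u by simp
    qed simp
    then show "?F (u \<otimes>\<^bsub>free_product G H\<^esub> v) z = ?F u (?F v z)" by simp
  qed simp
qed

lemma hom_free_product_left:
  assumes "group G" "group H"
  shows "(\<lambda>g. push_letter G H (Inl g) []) \<in> hom G (free_product G H)"
  using group.is_monoid[OF assms(1)] group.l_cancel_one'[OF assms(1)]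
  by (auto simp: hom_def push_letter_def free_product_step_def reduced_words_Cons monoid.m_closed monoid.l_one monoid.r_one)

lemma hom_free_product_right:
  assumes "group G" "group H"
  shows "(\<lambda>g. push_letter G H (Inr g) []) \<in> hom H (free_product G H)"
  using group.is_monoid[OF assms(2)]
  by (auto simp: hom_def push_letter_def free_product_step_def reduced_words_Cons monoid.m_closed monoid.l_one monoid.r_one)

lemma exists_long_reduced_word:
  assumes "countable_group G" "countable_group H"
  shows "\<exists>w\<in>reduced_words G H. length w = n"
proof -
  have "carrier G - {\<one>\<^bsub>G\<^esub>} \<noteq> {}" "carrier H - {\<one>\<^bsub>H\<^esub>} \<noteq> {}"
    using assms by (auto simp: countable_group_def dest: finite_subset[of _ "{_}"])
  then obtain g h where gh: "g \<in> carrier G" "g \<noteq> \<one>\<^bsub>G\<^esub>" "h \<in> carrier H" "h \<noteq> \<one>\<^bsub>H\<^esub>" by blast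
  show ?thesis
  proof (induction n)
    case (Suc n)
    then obtain w where w: "w \<in> reduced_words G H" "length w = n" by blast
    define l where "l = (if w \<noteq> [] \<and> isl (hd w) then Inr h else Inl g)"
    have "l # w \<in> reduced_words G H" using w gh by (auto simp: reduced_words_Cons l_def)
    then show ?case using w by (intro bexI[of _ "l # w"]) auto
  qed (auto intro!: bexI[of _ "[]"])
qed

lemma set_action_map_sum:
  assumes "set_action G S f" "set_action G T f'"
  shows "set_action G (Inl ` S \<union> Inr ` T) (\<lambda>g. map_sum (f g) (f' g))"
proof -
  interpret a: set_action G S f by fact
  interpret b: set_action G T f' by fact
  show ?thesis by unfold_locales (auto simp: a.act_mult b.act_mult)
qed

lemma set_action_conj:
  assumes "set_action G E f" and s: "\<And>x. x \<in> E \<Longrightarrow> s x \<in> E" "\<And>x. x \<in> E \<Longrightarrow> s (s x) = x"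
  shows "set_action G E (\<lambda>g x. s (f g (s x)))"
proof -
  interpret set_action G E f by fact
  show ?thesis by unfold_locales (use s in \<open>auto simp: act_mult\<close>)
qed

text \<open>Transitivity gives all points the same mass, and arbitrarily many of them share a total
  of at most 1.\<close>

lemma (in set_action) mean_singleton:
  assumes m: "invariant_mean G E f \<mu>" and t: "transitive_on G E f" and inf: "infinite E" and x: "x \<in> E"
  shows "\<mu> {x} = 0"
proof (rule ccontr)
  assume ne: "\<mu> {x} \<noteq> 0"
  have "0 \<le> \<mu> {x}" using m x by (auto simp: invariant_mean_def)
  with ne have pos: "0 < \<mu> {x}" by simp
  have same: "\<mu> {y} = \<mu> {x}" if yE: "y \<in> E" for y
  proof -
    obtain g where g: "g \<in> carrier G" "f g x = y" by (rule transitive_onD[OF t x yE])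
    then have "\<mu> (f g ` {x}) = \<mu> {x}" using x by (intro invariant_mean_image[OF m]) auto
    then show ?thesis using g by simp
  qed
  obtain n where n: "1 < real n * \<mu> {x}" using reals_Archimedean3[OF pos] by blast
  obtain A where A: "A \<subseteq> E" "finite A" "card A = n" using infinite_arbitrarily_large[OF inf] by blast
  have "\<mu> (\<Union>y\<in>A. {y}) = (\<Sum>y\<in>A. \<mu> {y})"
    using A by (intro invariant_mean_UN[OF m]) (auto simp: disjoint_family_on_def)
  also have "\<dots> = (\<Sum>y\<in>A. \<mu> {x})" using A same by (intro sum.cong) auto
  finally have "\<mu> A = real n * \<mu> {x}" using A by simp
  moreover have "\<mu> A \<le> 1" using m A by (auto simp: invariant_mean_def)
  ultimately show False using n by simp
qed

lemma mean_insert_null: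
  assumes m: "invariant_mean G E f \<mu>" and "A \<subseteq> E" "x \<in> E" "\<mu> {x} = 0"
  shows "\<mu> (insert x A) = \<mu> A"
proof (cases "x \<in> A")
  case False
  then have "\<mu> ({x} \<union> A) = \<mu> {x} + \<mu> A" using assms by (intro invariant_mean_Un[OF m]) auto
  then show ?thesis using assms by simp
qed (simp add: insert_absorb)

text \<open>Let the factors act on the disjoint union of \<open>S \<times> T\<close> (one factor on each coordinate)
  and the free product itself (by left multiplication), and conjugate the action of \<open>H\<close> by the
  transposition of one point of \<open>S \<times> T\<close> with the empty word. This glues the two pieces
  into one orbit; a mean on \<open>S \<times> T\<close> does not see the transposition, and far away from the
  empty word the action is left multiplication, hence faithful.\<close>

lemma class_A_free_product:
  fixes G :: "('a, 'm) monoid_scheme" and H :: "('b, 'n) monoid_scheme"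
    and S :: "'s set" and T :: "'t set"
  assumes cG: "countable_group G" and cH: "countable_group H"
    and S: "set_action G S f" "transitive_on G S f" "infinite S" "folner_action G S f"
    and T: "set_action H T f'" "transitive_on H T f'" "infinite T" "folner_action H T f'"
  shows "class_A (free_product G H)"
proof -
  have gG: "group G" and gH: "group H" using cG cH by (simp_all add: countable_group_def)
  define P where "P = free_product G H"
  define W where "W = reduced_words G H"
  interpret P: group P unfolding P_def by (rule free_product_group[OF gG gH])
  have P [simp]: "carrier P = W" "\<one>\<^bsub>P\<^esub> = []"
    "\<And>u v. u \<otimes>\<^bsub>P\<^esub> v = foldr (free_product_step G H) u v" by (simp_all add: P_def W_def)
  interpret S: set_action G S f by fact
  interpret T: set_action H T f' by fact
  define a0 where "a0 = (SOME p. p \<in> S \<times> T)"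
  have "S \<times> T \<noteq> {}" using S(3) T(3) by auto
  then have a0: "a0 \<in> S \<times> T" unfolding a0_def by (metis ex_in_conv someI_ex)
  define Z :: "('s \<times> 't + ('a + 'b) list) set" where "Z = Inl ` (S \<times> T) \<union> Inr ` W"
  define sw :: "'s \<times> 't + ('a + 'b) list \<Rightarrow> 's \<times> 't + ('a + 'b) list"
    where "sw z = (if z = Inl a0 then Inr [] else if z = Inr [] then Inl a0 else z)" for z
  have sw: "sw z \<in> Z" "sw (sw z) = z" if "z \<in> Z" for z
    using that a0 by (auto simp: sw_def Z_def W_def)
  define fl where "fl g p = (f g (fst p), snd p)" for g and p :: "'s \<times> 't"
  define fr where "fr h p = (fst p, f' h (snd p))" for h and p :: "'s \<times> 't"
  define \<alpha> where "\<alpha> g = map_sum (fl g) (\<lambda>w. push_letter G H (Inl g) [] \<otimes>\<^bsub>P\<^esub> w)" for g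
  define \<beta>0 where "\<beta>0 h = map_sum (fr h) (\<lambda>w. push_letter G H (Inr h) [] \<otimes>\<^bsub>P\<^esub> w)" for h
  define \<beta> where "\<beta> h z = sw (\<beta>0 h (sw z))" for h z
  have regP: "set_action P W (\<otimes>\<^bsub>P\<^esub>)" using regular_set_action[OF P.is_group] by simp
  have fl: "set_action G (S \<times> T) fl" by unfold_locales (auto simp: fl_def S.act_mult)
  have fr: "set_action H (S \<times> T) fr" by unfold_locales (auto simp: fr_def T.act_mult)
  interpret fr: set_action H "S \<times> T" fr by (rule fr)
  interpret fl: set_action G "S \<times> T" fl by (rule fl)
  have \<alpha>: "set_action G Z \<alpha>"
    unfolding Z_def \<alpha>_def
    by (intro set_action_map_sum fl set_action_iso[OF regP gG]) (use hom_free_product_left[OF gG gH] in \<open>simp add: P_def\<close>)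
  have \<beta>0: "set_action H Z \<beta>0"
    unfolding Z_def \<beta>0_def
    by (intro set_action_map_sum fr set_action_iso[OF regP gH]) (use hom_free_product_right[OF gG gH] in \<open>simp add: P_def\<close>)
  have \<beta>: "set_action H Z \<beta>" unfolding \<beta>_def by (rule set_action_conj[OF \<beta>0 sw])
  interpret \<alpha>: set_action G Z \<alpha> by (rule \<alpha>)
  interpret \<beta>: set_action H Z \<beta> by (rule \<beta>)
  define F where "F = foldr (case_sum \<alpha> \<beta>)"
  have F: "set_action P Z F" unfolding F_def P_def by (rule set_action_free_product[OF gG gH \<alpha> \<beta>])
  interpret F: set_action P Z F by (rule F)
  have step_one: "free_product_step G H (Inl \<one>\<^bsub>G\<^esub>) w = w" "free_product_step G H (Inr \<one>\<^bsub>H\<^esub>) w = w"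
    if "w \<in> W" for w
    using that by (cases w; cases "hd w"; auto simp: W_def free_product_step_def push_letter_def reduced_words_Cons)+
  have \<alpha>_simps: "\<alpha> g (Inl p) = Inl (fl g p)" "\<alpha> g (Inr w) = Inr (free_product_step G H (Inl g) w)"
    if "w \<in> W" for g p w using that by (auto simp: \<alpha>_def push_letter_def step_one)
  have \<beta>0_simps: "\<beta>0 h (Inl p) = Inl (fr h p)" "\<beta>0 h (Inr w) = Inr (free_product_step G H (Inr h) w)"
    if "w \<in> W" for h p w using that by (auto simp: \<beta>0_def push_letter_def step_one)
  have F_left: "F (push_letter G H (Inl g) []) z = \<alpha> g z" if "z \<in> Z" for g z
    using that by (auto simp: F_def push_letter_def)
  have F_right: "F (push_letter G H (Inr h) []) z = \<beta> h z" if "z \<in> Z" for h z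
    using that by (auto simp: F_def push_letter_def)
  have pushW: "push_letter G H (Inl g) [] \<in> W" "push_letter G H (Inr h) [] \<in> W"
    if "g \<in> carrier G" "h \<in> carrier H" for g h
    using that by (auto simp: push_letter_def W_def reduced_words_Cons)
  show ?thesis
    unfolding P_def[symmetric]
  proof -
    obtain x0 y0 where xy0: "a0 = (x0, y0)" "x0 \<in> S" "y0 \<in> T" using a0 by auto
    have "S - {x0} \<noteq> {}" "T - {y0} \<noteq> {}"
      using infinite_remove[OF S(3), of x0] infinite_remove[OF T(3), of y0] infinite_imp_nonempty by blast+
    \<comment> \<open>With \<open>x1\<close> and \<open>y1\<close> one can move inside
      \<open>S \<times> T\<close> along points other than \<open>a0\<close>, where the transposition
      has no effect.\<close>
    then obtain x1 y1 where x1: "x1 \<in> S" "x1 \<noteq> x0" and y1: "y1 \<in> T" "y1 \<noteq> y0" by blast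
    define \<Omega> where "\<Omega> = (\<lambda>w. F w (Inl a0)) ` W"
    have a0Z: "Inl a0 \<in> Z" using a0 by (simp add: Z_def)
    have \<Omega>Z: "\<Omega> \<subseteq> Z" using F.closed a0Z by (auto simp: \<Omega>_def)
    have \<Omega>\<alpha>: "\<alpha> g z \<in> \<Omega>" if g: "g \<in> carrier G" and z: "z \<in> \<Omega>" for g z
    proof -
      obtain w where w: "w \<in> W" "z = F w (Inl a0)" using z by (auto simp: \<Omega>_def)
      let ?u = "push_letter G H (Inl g) []"
      have u: "?u \<in> W" using pushW(1)[OF g T.one_closed] .
      have "\<alpha> g z = F (?u \<otimes>\<^bsub>P\<^esub> w) (Inl a0)"
        using F.act_mult[of ?u w "Inl a0"] u w a0Z z \<Omega>Z F_left[of z g] by (auto simp del: P(3))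
      moreover have "?u \<otimes>\<^bsub>P\<^esub> w \<in> W" using P.m_closed[of ?u w] u w by (simp del: P(3))
      ultimately show ?thesis unfolding \<Omega>_def by blast
    qed
    have \<Omega>\<beta>: "\<beta> h z \<in> \<Omega>" if h: "h \<in> carrier H" and z: "z \<in> \<Omega>" for h z
    proof -
      obtain w where w: "w \<in> W" "z = F w (Inl a0)" using z by (auto simp: \<Omega>_def)
      let ?u = "push_letter G H (Inr h) []"
      have u: "?u \<in> W" using pushW(2)[OF S.one_closed h] .
      have "\<beta> h z = F (?u \<otimes>\<^bsub>P\<^esub> w) (Inl a0)"
        using F.act_mult[of ?u w "Inl a0"] u w a0Z z \<Omega>Z F_right[of z h] by (auto simp del: P(3))
      moreover have "?u \<otimes>\<^bsub>P\<^esub> w \<in> W" using P.m_closed[of ?u w] u w by (simp del: P(3))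
      ultimately show ?thesis unfolding \<Omega>_def by blast
    qed
    have W0: "[] \<in> W" by (simp add: W_def)
    have a0\<Omega>: "Inl a0 \<in> \<Omega>" unfolding \<Omega>_def using W0 by (force simp: F_def)
    have o1: "Inl (x, y0) \<in> \<Omega>" if x: "x \<in> S" for x
    proof -
      obtain g where g: "g \<in> carrier G" "f g x0 = x" using S(2) x xy0 unfolding transitive_on_def by blast
      then have "\<alpha> g (Inl a0) = Inl (x, y0)" using xy0 \<alpha>_simps(1)[OF W0] by (simp add: fl_def)
      then show ?thesis using \<Omega>\<alpha>[OF g(1) a0\<Omega>] by simp
    qed
    have o2: "Inl (x1, y) \<in> \<Omega>" if y: "y \<in> T" for y
    proof -
      obtain h where h: "h \<in> carrier H" "f' h y0 = y" using T(2) y xy0 unfolding transitive_on_def by blast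
      then have "\<beta> h (Inl (x1, y0)) = Inl (x1, y)"
        using x1 xy0 \<beta>0_simps(1)[OF W0] by (simp add: fr_def \<beta>_def sw_def)
      then show ?thesis using \<Omega>\<beta>[OF h(1) o1[OF x1(1)]] by simp
    qed
    have o3: "Inl (x, y) \<in> \<Omega>" if x: "x \<in> S" and y: "y \<in> T" for x y
    proof -
      obtain g where g: "g \<in> carrier G" "f g x1 = x" using S(2) x x1 unfolding transitive_on_def by blast
      then have "\<alpha> g (Inl (x1, y)) = Inl (x, y)" using \<alpha>_simps(1)[OF W0] by (simp add: fl_def)
      then show ?thesis using \<Omega>\<alpha>[OF g(1) o2[OF y]] by simp
    qed
    \<comment> \<open>The element \<open>h\<close> carries \<open>(x0, y1)\<close> to
      \<open>a0\<close>, which the final transposition turns into the empty word.\<close>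
    have o4: "Inr [] \<in> \<Omega>"
    proof -
      obtain h where h: "h \<in> carrier H" "f' h y1 = y0" using T(2) y1 xy0 unfolding transitive_on_def by blast
      then have "\<beta> h (Inl (x0, y1)) = Inr []"
        using y1 xy0 \<beta>0_simps(1)[OF W0] by (simp add: fr_def \<beta>_def sw_def)
      then show ?thesis using \<Omega>\<beta>[OF h(1) o3[OF xy0(2) y1(1)]] by simp
    qed
    have o5: "Inr w \<in> \<Omega>" if "w \<in> W" for w
      using that
    proof (induction w)
      case (Cons l w)
      have lw: "l # w \<in> reduced_words G H" and w: "w \<in> W" using Cons.prems by (auto simp: W_def reduced_words_Cons)
      note st = free_product_step_reduced_Cons[OF lw]
      show ?case
      proof (cases l)
        case (Inl g)
        then have g: "g \<in> carrier G" using lw by (auto simp: reduced_words_Cons)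
        have "\<alpha> g (Inr w) = Inr (l # w)" using \<alpha>_simps(2)[OF w] st Inl by simp
        then show ?thesis using \<Omega>\<alpha>[OF g Cons.IH[OF w]] by simp
      next
        case (Inr h)
        then have h: "h \<in> carrier H" using lw by (auto simp: reduced_words_Cons)
        \<comment> \<open>From the side of \<open>H\<close> the empty word sits at
          \<open>a0\<close>, so the one-letter words from \<open>H\<close> are reached from
          there.\<close>
        show ?thesis
        proof (cases "w = []")
          case True
          have "\<beta> h (Inl a0) = Inr (l # w)" using \<beta>0_simps(2)[OF w] st Inr True by (simp add: \<beta>_def sw_def)
          then show ?thesis using \<Omega>\<beta>[OF h a0\<Omega>] by simp
        next
          case False
          have "\<beta> h (Inr w) = Inr (l # w)" using \<beta>0_simps(2)[OF w] st Inr False by (simp add: \<beta>_def sw_def)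
          then show ?thesis using \<Omega>\<beta>[OF h Cons.IH[OF w]] by simp
        qed
      qed
    qed (rule o4)
    have "Z \<subseteq> \<Omega>" using o3 o5 by (auto simp: Z_def)
    then have trans: "transitive_on P Z F"
      by (intro F.transitive_onI[OF a0Z]) (auto simp: \<Omega>_def subset_eq)

    \<comment> \<open>Acting on a longer word \<open>v\<close>, no suffix of \<open>u\<close>
      cancels it completely, so the transposition is never met and the action is left
      multiplication.\<close>
    have far: "F u (Inr v) = Inr (foldr (free_product_step G H) u v)"
      if "u \<in> W" "v \<in> W" "length u < length v" for u v
      using that(1,3)
    proof (induction u)
      case (Cons l u)
      then have u: "u \<in> W" by (auto simp: W_def reduced_words_Cons)
      let ?x = "foldr (free_product_step G H) u v"
      have x: "?x \<in> W" using P.m_closed[of u v] u that by simp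
      have IH: "F u (Inr v) = Inr ?x" using Cons u by simp
      have ne: "?x \<noteq> []" "free_product_step G H l ?x \<noteq> []"
        using length_free_product_mult[of v u G H] length_free_product_mult[of v "l # u" G H] Cons.prems
        by (auto simp del: length_greater_0_conv)
      show ?case
        using IH ne \<alpha>_simps(2)[OF x] \<beta>0_simps(2)[OF x]
        by (cases l) (auto simp: F_def \<beta>_def sw_def)
    qed (simp add: F_def)
    have faith: "faithful_on P Z F"
      unfolding faithful_on_def
    proof (intro ballI impI)
      fix w assume w: "w \<in> carrier P" "\<forall>z\<in>Z. F w z = z"
      obtain v where v: "v \<in> W" "length v = Suc (length w)"
        using exists_long_reduced_word[OF cG cH] unfolding W_def by blast
      have "F w (Inr v) = Inr (w \<otimes>\<^bsub>P\<^esub> v)" using far[of w v] w v by simp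
      moreover have "F w (Inr v) = Inr v" using w(2) v by (auto simp: Z_def)
      ultimately have "w \<otimes>\<^bsub>P\<^esub> v = v" by simp
      then show "w = \<one>\<^bsub>P\<^esub>" using P.l_cancel_one[of v w] w v by (simp del: P(2,3))
    qed

    interpret GH: set_action "DirProd G H" "S \<times> T" "\<lambda>p q. (f (fst p) (fst q), f' (snd p) (snd q))"
      by (rule set_action_prod[OF S(1) T(1)])
    have "countable (carrier (DirProd G H))" using cG cH by (auto simp: countable_group_def)
    then obtain m where m: "invariant_mean (DirProd G H) (S \<times> T) (\<lambda>p q. (f (fst p) (fst q), f' (snd p) (snd q))) m"
      using GH.folner_imp_mean[OF folner_prod[OF S(1) T(1) S(4) T(4)]] by blast
    have tGH: "transitive_on (DirProd G H) (S \<times> T) (\<lambda>p q. (f (fst p) (fst q), f' (snd p) (snd q)))"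
      using S(2) T(2) by (force simp: transitive_on_def)
    have null: "m {p} = 0" if "p \<in> S \<times> T" for p
      by (rule GH.mean_singleton[OF m tGH _ that]) (use S(3) T(3) in \<open>auto simp: finite_cartesian_product_iff\<close>)
    have m_fl: "m (fl g ` A) = m A" if "g \<in> carrier G" "A \<subseteq> S \<times> T" for g A
    proof -
      have "(\<lambda>q. (f (fst (g, \<one>\<^bsub>H\<^esub>)) (fst q), f' (snd (g, \<one>\<^bsub>H\<^esub>)) (snd q))) ` A = fl g ` A"
        using that by (intro image_cong) (auto simp: fl_def)
      then show ?thesis using invariant_mean_image[OF m _ that(2), of "(g, \<one>\<^bsub>H\<^esub>)"] that by simp
    qed
    have m_fr: "m (fr h ` A) = m A" if "h \<in> carrier H" "A \<subseteq> S \<times> T" for h A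
    proof -
      have "(\<lambda>q. (f (fst (\<one>\<^bsub>G\<^esub>, h)) (fst q), f' (snd (\<one>\<^bsub>G\<^esub>, h)) (snd q))) ` A = fr h ` A"
        using that by (intro image_cong) (auto simp: fr_def)
      then show ?thesis using invariant_mean_image[OF m _ that(2), of "(\<one>\<^bsub>G\<^esub>, h)"] that by simp
    qed
    \<comment> \<open>The mean lives on \<open>S \<times> T\<close> only; \<open>D\<close> forgets
      the words.\<close>
    define D where "D C = {p \<in> S \<times> T. Inl p \<in> C}" for C :: "('s \<times> 't + ('a + 'b) list) set"
    have DS: "D C \<subseteq> S \<times> T" for C by (auto simp: D_def)
    have D\<alpha>: "m (D (\<alpha> g ` C)) = m (D C)" if "g \<in> carrier G" "C \<subseteq> Z" for g C
    proof -
      have "D (\<alpha> g ` C) = fl g ` D C"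
      proof (intro subset_antisym subsetI)
        fix p assume "p \<in> D (\<alpha> g ` C)"
        then obtain z where z: "z \<in> C" "Inl p = \<alpha> g z" by (auto simp: D_def)
        then obtain q where "z = Inl q" "p = fl g q" by (cases z) (auto simp: \<alpha>_def)
        then show "p \<in> fl g ` D C" using z that by (auto simp: D_def Z_def)
      next
        fix p assume "p \<in> fl g ` D C"
        then obtain q where q: "q \<in> S \<times> T" "Inl q \<in> C" "p = fl g q" by (auto simp: D_def)
        then have "Inl p = \<alpha> g (Inl q)" by (simp add: \<alpha>_def)
        then show "p \<in> D (\<alpha> g ` C)" using q fl.closed[OF that(1) q(1)] by (simp add: D_def)
      qed
      then show ?thesis using m_fl[OF that(1) DS] by simp
    qed
    have D\<beta>: "m (D (\<beta> h ` C)) = m (D C)" if h: "h \<in> carrier H" and C: "C \<subseteq> Z" for h C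
    proof -
      have ha0: "fr h a0 \<in> S \<times> T" using h a0 by blast
      \<comment> \<open>Inside \<open>S \<times> T\<close>, the images under the conjugated and the
        original action of \<open>h\<close> differ at most in the points \<open>a0\<close> and
        \<open>fr h a0\<close>, which are null.\<close>
      have eq: "insert a0 (insert (fr h a0) (D (\<beta> h ` C))) = insert a0 (insert (fr h a0) (fr h ` D C))"
      proof (intro subset_antisym subsetI)
        fix p assume p: "p \<in> insert a0 (insert (fr h a0) (D (\<beta> h ` C)))"
        show "p \<in> insert a0 (insert (fr h a0) (fr h ` D C))"
        proof (cases "p = a0 \<or> p = fr h a0")
          case False
          then obtain z where z: "z \<in> C" "Inl p = \<beta> h z" "p \<in> S \<times> T" using p by (auto simp: D_def)
          have "Inl p = \<beta>0 h (sw z)" using z(2) False by (auto simp: \<beta>_def sw_def split: if_splits)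
          then obtain q where q: "sw z = Inl q" "p = fr h q" by (cases "sw z") (auto simp: \<beta>0_def)
          then have "z = Inl q" using False by (auto simp: sw_def split: if_splits)
          then show ?thesis using z q C by (auto simp: D_def Z_def)
        qed auto
      next
        fix p assume p: "p \<in> insert a0 (insert (fr h a0) (fr h ` D C))"
        show "p \<in> insert a0 (insert (fr h a0) (D (\<beta> h ` C)))"
        proof (cases "p = a0 \<or> p = fr h a0")
          case False
          then obtain q where q: "q \<in> S \<times> T" "Inl q \<in> C" "p = fr h q" using p by (auto simp: D_def)
          then have "q \<noteq> a0" using False by auto
          then have "\<beta> h (Inl q) = Inl p" using q False by (simp add: \<beta>_def sw_def \<beta>0_def)
          then have "p \<in> D (\<beta> h ` C)" using q fr.closed[OF h q(1)] by (force simp: D_def)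
          then show ?thesis by blast
        qed auto
      qed
      have ins: "m (insert a0 (insert (fr h a0) A)) = m A" if "A \<subseteq> S \<times> T" for A
        using mean_insert_null[OF m, of A "fr h a0"] mean_insert_null[OF m, of "insert (fr h a0) A" a0]
          that a0 ha0 null by simp
      have "fr h ` D C \<subseteq> S \<times> T" using h DS by (auto simp: subset_eq)
      then show ?thesis using ins[OF DS[of "\<beta> h ` C"]] ins[of "fr h ` D C"] eq m_fr[OF h DS] by simp
    qed
    have "invariant_mean P Z F (\<lambda>C. m (D C))"
      unfolding invariant_mean_def
    proof (intro conjI allI impI ballI)
      show "0 \<le> m (D C)" "m (D C) \<le> 1" for C using m DS[of C] unfolding invariant_mean_def by blast+
      have "D Z = S \<times> T" by (auto simp: D_def Z_def)
      then show "m (D Z) = 1" using m by (simp add: invariant_mean_def)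
    next
      fix A B assume "A \<subseteq> Z \<and> B \<subseteq> Z \<and> A \<inter> B = {}"
      then have "m (D A \<union> D B) = m (D A) + m (D B)"
        by (intro invariant_mean_Un[OF m] DS) (auto simp: D_def)
      moreover have "D (A \<union> B) = D A \<union> D B" by (auto simp: D_def)
      ultimately show "m (D (A \<union> B)) = m (D A) + m (D B)" by simp
    next
      fix w C assume "w \<in> carrier P" and C: "C \<subseteq> Z"
      then show "m (D (F w ` C)) = m (D C)"
      proof (induction w)
        case (Cons l w)
        then have w: "w \<in> carrier P" by (auto simp: W_def reduced_words_Cons)
        have FC: "F w ` C \<subseteq> Z" using F.closed[OF w] C by blast
        have "F (l # w) ` C = case_sum \<alpha> \<beta> l ` F w ` C" by (auto simp: F_def)
        moreover have "m (D (case_sum \<alpha> \<beta> l ` F w ` C)) = m (D (F w ` C))"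
          using D\<alpha>[OF _ FC] D\<beta>[OF _ FC] Cons.prems by (cases l) (auto simp: W_def reduced_words_Cons)
        ultimately show ?case using Cons.IH[OF w C] by simp
      qed (simp add: F_def)
    qed
    moreover have "countable_group P"
    proof -
      have "infinite W"
      proof
        assume fin: "finite W"
        obtain v where v: "v \<in> W" "length v = Suc (Max (length ` W))"
          using exists_long_reduced_word[OF cG cH] unfolding W_def by blast
        then show False using Max_ge[of "length ` W" "length v"] fin by fastforce
      qed
      then show ?thesis
        using countable_reduced_words[of G H] cG cH P.is_group by (simp add: countable_group_def W_def)
    qed
    ultimately show "class_A P" using trans faith by (intro F.class_A_meanI)
  qed
qed

section \<open>Free actions of \<open>\<int>\<^sup>2\<close> and finite Fourier analysis\<close>

definition pairing :: "int \<times> int \<Rightarrow> int \<times> int \<Rightarrow> int" where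
  "pairing u z = fst u * fst z + snd u * snd z"

text \<open>The character of (Z/N)^2 with frequency \<open>u\<close>; these finite characters stand
  in for the points of the dual torus.\<close>

definition char :: "nat \<Rightarrow> int \<times> int \<Rightarrow> int \<times> int \<Rightarrow> complex" where
  "char N u z = cis (2 * pi * of_int (pairing u z) / of_nat N)"

text \<open>A full set of frequencies modulo \<open>2 M + 1\<close>, centred so that closeness to 0
  is visible in the absolute values of the coordinates.\<close>

definition dual_box :: "nat \<Rightarrow> (int \<times> int) set" where
  "dual_box M = {- int M..int M} \<times> {- int M..int M}"

lemma char_add: "char N u (z + z') = char N u z * char N u z'"
  by (simp add: char_def pairing_def cis_mult algebra_simps add_divide_distrib)

lemma norm_char [simp]: "cmod (char N u z) = 1"
  by (simp add: char_def)

lemma char_cnj: "char N u z * cnj (char N u z') = char N u (z - z')"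
  by (simp add: char_def pairing_def cis_cnj cis_mult algebra_simps diff_divide_distrib add_divide_distrib)

text \<open>A geometric sum over a full period of a root of unity. The bound on \<open>k\<close> is
  what keeps the root different from 1.\<close>

lemma sum_cis_symmetric:
  fixes M :: nat and k :: int
  assumes "k \<noteq> 0" "\<bar>k\<bar> < 2 * int M + 1"
  shows "(\<Sum>j\<in>{- int M..int M}. cis (2 * pi * of_int (j * k) / of_nat (2 * M + 1))) = 0"
proof -
  let ?N = "2 * M + 1"
  let ?w = "cis (2 * pi * of_int k / of_nat ?N)"
  have w1: "?w \<noteq> 1"
  proof
    assume "?w = 1"
    then have "cos (2 * pi * of_int k / of_nat ?N) = 1" by (metis cis.sel(1) one_complex.sel(1))
    then obtain m :: int where "2 * pi * of_int k / of_nat ?N = of_int m * 2 * pi"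
      using cos_one_2pi_int by blast
    then have "(2 * pi) * real_of_int k = (2 * pi) * (of_int m * of_nat ?N)" by (simp add: field_simps)
    then have "real_of_int k = of_int m * of_nat ?N" by (simp only: mult_cancel_left) simp
    then have "real_of_int k = of_int (m * int ?N)" by simp
    then have k: "k = m * int ?N" by (simp only: of_int_eq_iff)
    then have "m \<noteq> 0" using assms by auto
    then have "1 * int ?N \<le> \<bar>m\<bar> * int ?N" by (intro mult_right_mono) auto
    also have "\<bar>m\<bar> * int ?N = \<bar>k\<bar>" using k by (simp add: abs_mult)
    finally show False using assms by simp
  qed
  have wN: "?w ^ ?N = 1"
  proof -
    have "?w ^ ?N = cis (of_nat ?N * (2 * pi * of_int k / of_nat ?N))" by (rule Complex.DeMoivre)
    also have "of_nat ?N * (2 * pi * of_int k / of_nat ?N) = 2 * pi * of_int k" by simp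
    finally show ?thesis by (simp add: cis_multiple_2pi)
  qed
  have "(\<Sum>j\<in>{- int M..int M}. cis (2 * pi * of_int (j * k) / of_nat ?N))
      = (\<Sum>i<?N. cis (2 * pi * of_int ((int i - int M) * k) / of_nat ?N))"
    by (rule sum.reindex_bij_witness[of _ "\<lambda>i. int i - int M" "\<lambda>j. nat (j + int M)"]) auto
  also have "\<dots> = (\<Sum>i<?N. cis (2 * pi * of_int (- int M * k) / of_nat ?N) * ?w ^ i)"
  proof (rule sum.cong[OF refl])
    fix i
    have "2 * pi * of_int ((int i - int M) * k) / of_nat ?N
      = 2 * pi * of_int (- int M * k) / of_nat ?N + of_nat i * (2 * pi * of_int k / of_nat ?N)"
      by (simp add: algebra_simps diff_divide_distrib add_divide_distrib)
    then show "cis (2 * pi * of_int ((int i - int M) * k) / of_nat ?N)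
      = cis (2 * pi * of_int (- int M * k) / of_nat ?N) * ?w ^ i"
      unfolding Complex.DeMoivre cis_mult by (rule arg_cong)
  qed
  also have "\<dots> = cis (2 * pi * of_int (- int M * k) / of_nat ?N) * (\<Sum>i<?N. ?w ^ i)"
    by (rule sum_distrib_left[symmetric])
  also have "(\<Sum>i<?N. ?w ^ i) = 0" using geometric_sum[OF w1, of ?N] wN by simp
  finally show ?thesis by simp
qed

text \<open>Orthogonality of characters. The range allowed for \<open>z\<close> is that of a
  difference of two points of the box, so distinct points are not identified modulo
  \<open>2 M + 1\<close>.\<close>

lemma sum_char:
  fixes M :: nat and z :: "int \<times> int"
  assumes "\<bar>fst z\<bar> < 2 * int M + 1" "\<bar>snd z\<bar> < 2 * int M + 1"
  shows "(\<Sum>u\<in>dual_box M. char (2 * M + 1) u z) = (if z = 0 then of_nat ((2 * M + 1)\<^sup>2) else 0)"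
proof -
  let ?I = "{- int M..int M}" and ?N = "2 * M + 1"
  let ?c = "\<lambda>k j. cis (2 * pi * of_int (j * k) / of_nat ?N)"
  have split: "char ?N (i, j) z = ?c (fst z) i * ?c (snd z) j" for i j
    by (simp add: char_def pairing_def cis_mult algebra_simps add_divide_distrib)
  have "(\<Sum>u\<in>dual_box M. char ?N u z) = (\<Sum>i\<in>?I. \<Sum>j\<in>?I. char ?N (i, j) z)"
    unfolding dual_box_def by (simp add: sum.cartesian_product)
  also have "\<dots> = (\<Sum>i\<in>?I. ?c (fst z) i) * (\<Sum>j\<in>?I. ?c (snd z) j)"
    unfolding split by (simp only: sum_product)
  finally have *: "(\<Sum>u\<in>dual_box M. char ?N u z) = (\<Sum>i\<in>?I. ?c (fst z) i) * (\<Sum>j\<in>?I. ?c (snd z) j)" .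
  show ?thesis
  proof (cases "z = 0")
    case True
    then show ?thesis unfolding * by (simp add: power2_eq_square algebra_simps)
  next
    case False
    then have "fst z \<noteq> 0 \<or> snd z \<noteq> 0" by (metis prod.collapse zero_prod_def)
    then show ?thesis
      unfolding * using sum_cis_symmetric[of "fst z" M] sum_cis_symmetric[of "snd z" M] assms False by auto
  qed
qed

section \<open>Orbits, coordinates and spectral densities of a free action\<close>

locale free_Zsq_action =
  fixes E :: "'x set" and \<tau> :: "int \<times> int \<Rightarrow> 'x \<Rightarrow> 'x"
  assumes \<tau>_closed [simp]: "x \<in> E \<Longrightarrow> \<tau> z x \<in> E"
    and \<tau>_zero [simp]: "x \<in> E \<Longrightarrow> \<tau> 0 x = x"
    and \<tau>_add: "x \<in> E \<Longrightarrow> \<tau> (z + z') x = \<tau> z (\<tau> z' x)"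
    and \<tau>_free: "x \<in> E \<Longrightarrow> \<tau> z x = x \<Longrightarrow> z = 0"
begin

text \<open>The choice is made from the orbit as a set, so points of one orbit get the same
  representative; together with \<open>coord\<close> this identifies \<open>E\<close> with a
  disjoint union of copies of Z^2.\<close>

definition rep :: "'x \<Rightarrow> 'x" where
  "rep x = (SOME y. y \<in> range (\<lambda>z. \<tau> z x))"

definition coord :: "'x \<Rightarrow> int \<times> int" where
  "coord x = (SOME z. \<tau> z (rep x) = x)"

lemma rep_cases:
  assumes "x \<in> E" obtains z where "rep x = \<tau> z x"
proof -
  have "rep x \<in> range (\<lambda>z. \<tau> z x)" unfolding rep_def by (rule someI[of _ "\<tau> 0 x"]) blast
  then show ?thesis using that by blast
qed

lemma rep_closed [simp]: "x \<in> E \<Longrightarrow> rep x \<in> E"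
  by (metis rep_cases \<tau>_closed)

lemma \<tau>_inj: "x \<in> E \<Longrightarrow> \<tau> z x = \<tau> z' x \<Longrightarrow> z = z'"
  using \<tau>_free[of x "- z' + z"] \<tau>_add[of x "- z'" z] \<tau>_add[of x "- z'" z'] by simp

lemma \<tau>_cancel: "x \<in> E \<Longrightarrow> y \<in> E \<Longrightarrow> \<tau> z x = \<tau> z y \<Longrightarrow> x = y"
  using \<tau>_add[of x "- z" z] \<tau>_add[of y "- z" z] by simp

lemma \<tau>_coord: "x \<in> E \<Longrightarrow> \<tau> (coord x) (rep x) = x"
proof -
  assume x: "x \<in> E"
  then obtain z where "rep x = \<tau> z x" by (rule rep_cases)
  then have "\<tau> (- z) (rep x) = x" using x \<tau>_add[of x "- z" z] by simp
  then show ?thesis unfolding coord_def by (rule someI)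
qed

lemma rep_\<tau> [simp]: "x \<in> E \<Longrightarrow> rep (\<tau> z x) = rep x"
proof -
  assume x: "x \<in> E"
  have "range (\<lambda>z'. \<tau> z' (\<tau> z x)) = range (\<lambda>z'. \<tau> z' x)"
  proof (intro subset_antisym subsetI)
    fix y assume "y \<in> range (\<lambda>z'. \<tau> z' x)"
    then obtain z' where "y = \<tau> z' x" by blast
    then have "y = \<tau> (z' - z) (\<tau> z x)" using x \<tau>_add[of x "z' - z" z] by simp
    then show "y \<in> range (\<lambda>z'. \<tau> z' (\<tau> z x))" by blast
  qed (use x in \<open>auto simp flip: \<tau>_add\<close>)
  then show ?thesis by (simp add: rep_def)
qed

lemma coord_\<tau> [simp]: "x \<in> E \<Longrightarrow> coord (\<tau> z x) = z + coord x"
  using \<tau>_inj[of "rep x" "coord (\<tau> z x)" "z + coord x"] \<tau>_coord[of "\<tau> z x"] \<tau>_coord[of x]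
    \<tau>_add[of "rep x" z "coord x"] by simp

lemma rep_coord_inj: "x \<in> E \<Longrightarrow> y \<in> E \<Longrightarrow> rep x = rep y \<Longrightarrow> coord x = coord y \<Longrightarrow> x = y"
  by (metis \<tau>_coord)

lemma rep_rep [simp]: "x \<in> E \<Longrightarrow> rep (rep x) = rep x"
  by (metis rep_\<tau> rep_cases)

text \<open>Finite Fourier transform at frequency \<open>u\<close> of the function \<open>c\<close>
  on \<open>S\<close>, restricted to the orbit with representative \<open>y\<close>.\<close>

definition vhat :: "nat \<Rightarrow> ('x \<Rightarrow> complex) \<Rightarrow> 'x set \<Rightarrow> 'x \<Rightarrow> int \<times> int \<Rightarrow> complex" where
  "vhat N c S y u = (\<Sum>x\<in>{x \<in> S. rep x = y}. c x * char N u (coord x))"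

text \<open>Expand the square and sum over \<open>u\<close> first: orthogonality leaves only the
  diagonal. Coordinates of absolute value at most \<open>M\<close> make distinct points of an orbit
  distinct modulo \<open>2 M + 1\<close>.\<close>

lemma parseval:
  assumes S: "finite S" "S \<subseteq> E" and Y: "finite Y" "rep ` S \<subseteq> Y"
    and M: "\<And>x. x \<in> S \<Longrightarrow> \<bar>fst (coord x)\<bar> \<le> int M \<and> \<bar>snd (coord x)\<bar> \<le> int M"
  shows "(\<Sum>u\<in>dual_box M. \<Sum>y\<in>Y. (cmod (vhat (2 * M + 1) c S y u))\<^sup>2)
    = (2 * real M + 1)\<^sup>2 * (\<Sum>x\<in>S. (cmod (c x))\<^sup>2)"
proof -
  let ?N = "2 * M + 1"
  let ?S = "\<lambda>y. {x \<in> S. rep x = y}"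
  have sq: "complex_of_real ((cmod (vhat ?N c S y u))\<^sup>2)
      = (\<Sum>x\<in>?S y. \<Sum>x'\<in>?S y. c x * cnj (c x') * char ?N u (coord x - coord x'))" for y u
    unfolding complex_norm_square vhat_def cnj_sum sum_product
    by (intro sum.cong refl) (simp flip: char_cnj add: mult_ac)
  have inner: "(\<Sum>u\<in>dual_box M. \<Sum>x\<in>?S y. \<Sum>x'\<in>?S y. c x * cnj (c x') * char ?N u (coord x - coord x'))
      = of_nat (?N\<^sup>2) * (\<Sum>x\<in>?S y. of_real ((cmod (c x))\<^sup>2))" for y
  proof -
    have "(\<Sum>u\<in>dual_box M. \<Sum>x\<in>?S y. \<Sum>x'\<in>?S y. c x * cnj (c x') * char ?N u (coord x - coord x'))
      = (\<Sum>x\<in>?S y. \<Sum>x'\<in>?S y. \<Sum>u\<in>dual_box M. c x * cnj (c x') * char ?N u (coord x - coord x'))"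
      by (subst sum.swap, rule sum.cong[OF refl], rule sum.swap)
    also have "\<dots> = (\<Sum>x\<in>?S y. \<Sum>x'\<in>?S y. if x' = x then of_nat (?N\<^sup>2) * of_real ((cmod (c x))\<^sup>2) else 0)"
    proof (intro sum.cong refl)
      fix x x' assume xx: "x \<in> ?S y" "x' \<in> ?S y"
      let ?z = "coord x - coord x'"
      have "(\<Sum>u\<in>dual_box M. char ?N u ?z) = (if ?z = 0 then of_nat (?N\<^sup>2) else 0)"
        using xx M[of x] M[of x'] by (intro sum_char) auto
      moreover have "?z = 0 \<longleftrightarrow> x' = x" using xx S rep_coord_inj[of x x'] by auto
      ultimately show "(\<Sum>u\<in>dual_box M. c x * cnj (c x') * char ?N u ?z)
          = (if x' = x then of_nat (?N\<^sup>2) * of_real ((cmod (c x))\<^sup>2) else 0)"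
        unfolding sum_distrib_left[symmetric] complex_norm_square by auto
    qed
    also have "\<dots> = (\<Sum>x\<in>?S y. of_nat (?N\<^sup>2) * of_real ((cmod (c x))\<^sup>2))"
      using S by (intro sum.cong refl) (simp add: sum.delta)
    finally show ?thesis by (simp add: sum_distrib_left)
  qed
  have "complex_of_real (\<Sum>u\<in>dual_box M. \<Sum>y\<in>Y. (cmod (vhat ?N c S y u))\<^sup>2)
     = (\<Sum>y\<in>Y. \<Sum>u\<in>dual_box M. complex_of_real ((cmod (vhat ?N c S y u))\<^sup>2))"
    unfolding of_real_sum by (rule sum.swap)
  also have "\<dots> = (\<Sum>y\<in>Y. of_nat (?N\<^sup>2) * (\<Sum>x\<in>?S y. of_real ((cmod (c x))\<^sup>2)))"
    unfolding sq inner ..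
  also have "\<dots> = of_nat (?N\<^sup>2) * (\<Sum>x\<in>S. of_real ((cmod (c x))\<^sup>2))"
    unfolding sum_distrib_left[symmetric] by (subst sum.group[OF S(1) Y(1) Y(2)]) (rule refl)
  also have "\<dots> = complex_of_real ((2 * real M + 1)\<^sup>2 * (\<Sum>x\<in>S. (cmod (c x))\<^sup>2))"
    by (simp add: of_real_sum add.commute)
  finally show ?thesis by (simp only: of_real_eq_iff)
qed

text \<open>Spectral density of the indicator function of \<open>F\<close>, summed over the orbits.
  By \<open>total_weight\<close>, dividing by \<open>(2 M + 1)\<^sup>2 * card F\<close> makes it a
  probability distribution on \<open>dual_box M\<close>, provided that \<open>F\<close> is non-empty
  and its coordinates fit in the box.\<close>

definition weight :: "nat \<Rightarrow> 'x set \<Rightarrow> int \<times> int \<Rightarrow> real" where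
  "weight N F u = (\<Sum>y\<in>rep ` F. (cmod (vhat N (\<lambda>_. 1) F y u))\<^sup>2)"

lemma weight_nonneg [simp]: "0 \<le> weight N F u"
  by (simp add: weight_def sum_nonneg)

text \<open>Allows the densities of two sets to be compared over one common set of orbits.\<close>

lemma weight_superset:
  assumes "finite S" "F \<subseteq> S"
  shows "weight N F u = (\<Sum>y\<in>rep ` S. (cmod (vhat N (\<lambda>x. of_bool (x \<in> F)) S y u))\<^sup>2)"
proof -
  have eq: "vhat N (\<lambda>x. of_bool (x \<in> F)) S y u = vhat N (\<lambda>_. 1) F y u" for y
    unfolding vhat_def using assms by (intro sum.mono_neutral_cong_right) auto
  have "vhat N (\<lambda>_. 1) F y u = 0" if "y \<notin> rep ` F" for y
  proof -
    have "{x \<in> F. rep x = y} = {}" using that by blast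
    then show ?thesis unfolding vhat_def by (simp only: sum.empty)
  qed
  then have "weight N F u = (\<Sum>y\<in>rep ` S. (cmod (vhat N (\<lambda>_. 1) F y u))\<^sup>2)"
    unfolding weight_def using assms by (intro sum.mono_neutral_left) auto
  then show ?thesis by (simp add: eq)
qed

lemma total_weight:
  assumes "finite F" "F \<subseteq> E" "\<And>x. x \<in> F \<Longrightarrow> \<bar>fst (coord x)\<bar> \<le> int M \<and> \<bar>snd (coord x)\<bar> \<le> int M"
  shows "(\<Sum>u\<in>dual_box M. weight (2 * M + 1) F u) = (2 * real M + 1)\<^sup>2 * card F"
  using parseval[OF assms(1,2) finite_imageI[OF assms(1)] order_refl assms(3), of "\<lambda>_. 1"]
  by (simp add: weight_def)

text \<open>At frequency 0 the transform just counts the points of \<open>F\<close> in an orbit.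
  Against the total \<open>N\<^sup>2 * card F\<close> this is negligible once \<open>N\<close> is
  large compared with \<open>card F\<close>, which is how mass at 0 is excluded.\<close>

lemma weight_zero:
  assumes "finite F" shows "weight N F 0 \<le> (real (card F))\<^sup>2"
proof -
  have v: "cmod (vhat N (\<lambda>_. 1) F y 0) = card {x \<in> F. rep x = y}" for y
    by (simp add: vhat_def char_def pairing_def)
  have "weight N F 0 \<le> (\<Sum>y\<in>rep ` F. real (card F) * real (card {x \<in> F. rep x = y}))"
    unfolding weight_def v power2_eq_square
    using assms by (intro sum_mono mult_right_mono) (auto intro: card_mono)
  also have "\<dots> = real (card F) * (\<Sum>y\<in>rep ` F. \<Sum>x\<in>{x \<in> F. rep x = y}. 1)"
    by (simp add: sum_distrib_left)
  also have "(\<Sum>y\<in>rep ` F. \<Sum>x\<in>{x \<in> F. rep x = y}. 1) = real (card F)"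
    by (subst sum.group[OF assms finite_imageI[OF assms] order_refl]) simp
  finally show ?thesis by (simp add: power2_eq_square)
qed

text \<open>On each orbit \<open>g\<close> acts on coordinates as \<open>\<alpha>\<close> followed
  by an offset. The offset contributes only a phase of modulus 1, and \<open>\<alpha>\<close> is
  moved to the frequency by transposition.\<close>

lemma weight_linear_image:
  assumes F: "finite F" "F \<subseteq> E" and g: "inj_on g E" "g ` E \<subseteq> E"
    and lin: "\<And>x z. x \<in> E \<Longrightarrow> g (\<tau> z x) = \<tau> (\<alpha> z) (g x)"
    and surj: "surj \<alpha>"
    and adj: "\<And>z. pairing u (\<alpha> z) = pairing u' z"
  shows "weight N (g ` F) u = weight N F u'"
proof -
  have gE: "g x \<in> E" if "x \<in> E" for x using g(2) that by blast
  have gx: "g x = \<tau> (\<alpha> (coord x)) (g (rep x))" if "x \<in> E" for x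
    using lin[of "rep x" "coord x"] that by (simp add: \<tau>_coord)
  have rep_g: "rep (g x) = rep (g (rep x))" if "x \<in> E" for x
    using gx[OF that] rep_\<tau>[OF gE[OF rep_closed[OF that]]] by simp
  have coord_g: "coord (g x) = \<alpha> (coord x) + coord (g (rep x))" if "x \<in> E" for x
    using gx[OF that] coord_\<tau>[OF gE[OF rep_closed[OF that]]] by simp
  \<comment> \<open>Surjectivity of \<open>\<alpha>\<close> enters here: \<open>g x\<close> and
    \<open>g x'\<close> differ by a translation by some \<open>\<alpha> z\<close>, which pulls back
    to the translation by \<open>z\<close>.\<close>
  have rep_g_inj: "rep x = rep x'" if xx: "x \<in> E" "x' \<in> E" "rep (g x) = rep (g x')" for x x'
  proof -
    have "g x' = \<tau> (coord (g x') - coord (g x)) (g x)"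
      using \<tau>_add[of "rep (g x)" "coord (g x') - coord (g x)" "coord (g x)"]
        \<tau>_coord[OF gE[OF xx(1)]] \<tau>_coord[OF gE[OF xx(2)]] xx gE by simp
    moreover obtain z where "coord (g x') - coord (g x) = \<alpha> z" by (rule surjE[OF surj])
    ultimately have "g x' = g (\<tau> z x)" by (simp only: lin[OF xx(1)])
    then have "x' = \<tau> z x" by (rule inj_onD[OF g(1) _ xx(2) \<tau>_closed[OF xx(1)]])
    then show ?thesis by (simp only: rep_\<tau>[OF xx(1)])
  qed
  have char_\<alpha>: "char N u (\<alpha> z) = char N u' z" for z by (simp add: char_def adj)
  have v: "vhat N (\<lambda>_. 1) (g ` F) (rep (g y)) u = char N u (coord (g y)) * vhat N (\<lambda>_. 1) F y u'"
    if y: "y \<in> rep ` F" for y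
  proof -
    obtain x0 where x0: "x0 \<in> F" "y = rep x0" using y by blast
    have "{x \<in> g ` F. rep x = rep (g y)} = g ` {x \<in> F. rep x = y}"
    proof (intro subset_antisym subsetI)
      fix x' assume "x' \<in> {x \<in> g ` F. rep x = rep (g y)}"
      then obtain x where x: "x \<in> F" "x' = g x" "rep (g x) = rep (g y)" by blast
      have "x \<in> E" "y \<in> E" "rep y = y" using x x0 F(2) by auto
      then have "rep x = y" using rep_g_inj[of x y] x(3) by metis
      then show "x' \<in> g ` {x \<in> F. rep x = y}" using x by blast
    next
      fix x' assume "x' \<in> g ` {x \<in> F. rep x = y}"
      then obtain x where "x \<in> F" "x' = g x" "rep x = y" by blast
      then show "x' \<in> {x \<in> g ` F. rep x = rep (g y)}" using rep_g[of x] F(2) by blast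
    qed
    moreover have "inj_on g {x \<in> F. rep x = y}" by (rule inj_on_subset[OF g(1)]) (use F(2) in blast)
    ultimately have "vhat N (\<lambda>_. 1) (g ` F) (rep (g y)) u = (\<Sum>x\<in>{x \<in> F. rep x = y}. char N u (coord (g x)))"
      by (simp add: vhat_def sum.reindex)
    also have "\<dots> = (\<Sum>x\<in>{x \<in> F. rep x = y}. char N u (coord (g y)) * char N u' (coord x))"
    proof (rule sum.cong[OF refl])
      fix x assume "x \<in> {x \<in> F. rep x = y}"
      then have "x \<in> E" "rep x = y" using F(2) by auto
      then have "coord (g x) = \<alpha> (coord x) + coord (g y)" using coord_g[of x] by (simp only:)
      then have "char N u (coord (g x)) = char N u' (coord x) * char N u (coord (g y))"
        by (simp only: char_add char_\<alpha>)
      then show "char N u (coord (g x)) = char N u (coord (g y)) * char N u' (coord x)"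
        by (simp only: mult.commute)
    qed
    finally show ?thesis by (simp add: vhat_def sum_distrib_left)
  qed
  have "bij_betw (\<lambda>y. rep (g y)) (rep ` F) (rep ` (g ` F))"
  proof (rule bij_betw_imageI)
    show "inj_on (\<lambda>y. rep (g y)) (rep ` F)"
    proof (rule inj_onI)
      fix y y' assume *: "y \<in> rep ` F" "y' \<in> rep ` F" "rep (g y) = rep (g y')"
      have yE: "y \<in> E" "rep y = y" "y' \<in> E" "rep y' = y'" using *(1,2) F(2) by auto
      have "rep y = rep y'" by (rule rep_g_inj[OF yE(1,3) *(3)])
      then show "y = y'" by (simp only: yE)
    qed
    show "(\<lambda>y. rep (g y)) ` rep ` F = rep ` (g ` F)"
      unfolding image_image using F(2) by (intro image_cong refl rep_g[symmetric]) blast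
  qed
  then have "weight N (g ` F) u = (\<Sum>y\<in>rep ` F. (cmod (vhat N (\<lambda>_. 1) (g ` F) (rep (g y)) u))\<^sup>2)"
    unfolding weight_def by (rule sum.reindex_bij_betw[symmetric])
  also have "\<dots> = weight N F u'"
    unfolding weight_def
  proof (rule sum.cong[OF refl])
    fix y assume "y \<in> rep ` F"
    then show "(cmod (vhat N (\<lambda>_. 1) (g ` F) (rep (g y)) u))\<^sup>2 = (cmod (vhat N (\<lambda>_. 1) F y u'))\<^sup>2"
      by (simp only: v norm_mult norm_char mult_1_left)
  qed
  finally show ?thesis .
qed

text \<open>Since \<open>(r + s)\<^sup>2 \<le> (1 + t) * r\<^sup>2 + (1 + 1 / t) *
  s\<^sup>2\<close>, the choice \<open>t = 1 / 10\<close> gives the factors 11/10 and 11. The error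
  is at most the total energy of the difference of the indicators, which Parseval turns into the
  size of the symmetric difference.\<close>

lemma weight_compare:
  assumes F: "finite F" "F \<subseteq> E" "finite F'" "F' \<subseteq> E"
    and M: "\<And>x. x \<in> F \<union> F' \<Longrightarrow> \<bar>fst (coord x)\<bar> \<le> int M \<and> \<bar>snd (coord x)\<bar> \<le> int M"
    and T: "T \<subseteq> dual_box M"
  shows "(\<Sum>u\<in>T. weight (2 * M + 1) F u)
    \<le> 11 / 10 * (\<Sum>u\<in>T. weight (2 * M + 1) F' u) + 11 * ((2 * real M + 1)\<^sup>2 * card ((F - F') \<union> (F' - F)))"
proof -
  let ?N = "2 * M + 1" and ?S = "F \<union> F'"
  let ?c = "\<lambda>A x. of_bool (x \<in> A) :: complex"
  let ?d = "\<lambda>x. ?c F x - ?c F' x"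
  have S: "finite ?S" "?S \<subseteq> E" using F by auto
  have ineq: "(cmod a)\<^sup>2 \<le> 11 / 10 * (cmod b)\<^sup>2 + 11 * (cmod (a - b))\<^sup>2" for a b :: complex
  proof -
    have "cmod a \<le> cmod b + cmod (a - b)" by (metis add.commute diff_add_cancel norm_triangle_ineq)
    then have "(cmod a)\<^sup>2 \<le> (cmod b + cmod (a - b))\<^sup>2" by (intro power_mono) auto
    also have "\<dots> = 11 / 10 * (cmod b)\<^sup>2 + 11 * (cmod (a - b))\<^sup>2 - (cmod b - 10 * cmod (a - b))\<^sup>2 / 10"
      by (simp add: power2_eq_square field_simps)
    finally show ?thesis using zero_le_power2[of "cmod b - 10 * cmod (a - b)"] by linarith
  qed
  have vd: "vhat ?N (?c F) ?S y u - vhat ?N (?c F') ?S y u = vhat ?N ?d ?S y u" for y u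
    by (simp add: vhat_def sum_subtractf left_diff_distrib)
  have finD: "finite (dual_box M)" by (simp add: dual_box_def)
  have "(\<Sum>u\<in>T. weight ?N F u) = (\<Sum>u\<in>T. \<Sum>y\<in>rep ` ?S. (cmod (vhat ?N (?c F) ?S y u))\<^sup>2)"
    using S by (intro sum.cong refl weight_superset) auto
  also have "\<dots> \<le> (\<Sum>u\<in>T. \<Sum>y\<in>rep ` ?S. 11 / 10 * (cmod (vhat ?N (?c F') ?S y u))\<^sup>2
        + 11 * (cmod (vhat ?N ?d ?S y u))\<^sup>2)"
    unfolding vd[symmetric] by (intro sum_mono ineq)
  also have "\<dots> = 11 / 10 * (\<Sum>u\<in>T. \<Sum>y\<in>rep ` ?S. (cmod (vhat ?N (?c F') ?S y u))\<^sup>2)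
        + 11 * (\<Sum>u\<in>T. \<Sum>y\<in>rep ` ?S. (cmod (vhat ?N ?d ?S y u))\<^sup>2)"
    by (simp add: sum.distrib sum_distrib_left)
  also have "(\<Sum>u\<in>T. \<Sum>y\<in>rep ` ?S. (cmod (vhat ?N (?c F') ?S y u))\<^sup>2) = (\<Sum>u\<in>T. weight ?N F' u)"
    using S by (intro sum.cong refl weight_superset[symmetric]) auto
  also have "(\<Sum>u\<in>T. \<Sum>y\<in>rep ` ?S. (cmod (vhat ?N ?d ?S y u))\<^sup>2)
      \<le> (\<Sum>u\<in>dual_box M. \<Sum>y\<in>rep ` ?S. (cmod (vhat ?N ?d ?S y u))\<^sup>2)"
    using finD T by (intro sum_mono2) (auto intro: sum_nonneg)
  also have "\<dots> = (2 * real M + 1)\<^sup>2 * (\<Sum>x\<in>?S. (cmod (?d x))\<^sup>2)"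
    using S M by (intro parseval) auto
  also have "(\<Sum>x\<in>?S. (cmod (?d x))\<^sup>2) = (\<Sum>x\<in>?S. of_bool (x \<in> (F - F') \<union> (F' - F)))"
    by (intro sum.cong refl) auto
  also have "\<dots> = card ((F - F') \<union> (F' - F))"
    using S by (simp add: sum.If_cases of_bool_def Int_def) (intro arg_cong[of _ _ card], auto)
  finally show ?thesis by simp
qed

text \<open>Translation by \<open>z\<close> multiplies the transform by \<open>char N u z\<close>.
  Parseval for the difference of the two indicators then shows that a set almost invariant under
  \<open>z\<close> has little mass where this character is far from 1.\<close>

lemma weight_translate:
  assumes F: "finite F" "F \<subseteq> E"
    and M: "\<And>x. x \<in> F \<union> \<tau> z ` F \<Longrightarrow> \<bar>fst (coord x)\<bar> \<le> int M \<and> \<bar>snd (coord x)\<bar> \<le> int M"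
  shows "(\<Sum>u\<in>dual_box M. (cmod (char (2 * M + 1) u z - 1))\<^sup>2 * weight (2 * M + 1) F u)
    = (2 * real M + 1)\<^sup>2 * card ((F - \<tau> z ` F) \<union> (\<tau> z ` F - F))"
proof -
  let ?N = "2 * M + 1" and ?F' = "\<tau> z ` F" and ?S = "F \<union> \<tau> z ` F"
  let ?c = "\<lambda>A x. of_bool (x \<in> A) :: complex"
  let ?d = "\<lambda>x. ?c ?F' x - ?c F x"
  have S: "finite ?S" "?S \<subseteq> E" using F by auto
  have one: "vhat N (?c A) ?S y u = vhat N (\<lambda>_. 1) A y u" if "A \<subseteq> ?S" for N A y u
    unfolding vhat_def using S that by (intro sum.mono_neutral_cong_right) auto
  have tr: "vhat ?N (\<lambda>_. 1) ?F' y u = char ?N u z * vhat ?N (\<lambda>_. 1) F y u" for y u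
  proof -
    have "{x \<in> ?F'. rep x = y} = \<tau> z ` {x \<in> F. rep x = y}" using F by auto
    moreover have "inj_on (\<tau> z) {x \<in> F. rep x = y}" 
    proof (rule inj_onI)
      fix x x' assume "x \<in> {x \<in> F. rep x = y}" "x' \<in> {x \<in> F. rep x = y}" "\<tau> z x = \<tau> z x'"
      then show "x = x'" using F by (intro \<tau>_cancel[of x x' z]) auto
    qed
    ultimately have "vhat ?N (\<lambda>_. 1) ?F' y u = (\<Sum>x\<in>{x \<in> F. rep x = y}. char ?N u (coord (\<tau> z x)))"
      by (simp add: vhat_def sum.reindex)
    also have "\<dots> = (\<Sum>x\<in>{x \<in> F. rep x = y}. char ?N u z * char ?N u (coord x))"
      using F by (intro sum.cong refl) (auto simp: char_add)
    finally show ?thesis by (simp add: vhat_def sum_distrib_left)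
  qed
  have vd: "vhat ?N ?d ?S y u = (char ?N u z - 1) * vhat ?N (?c F) ?S y u" for y u
  proof -
    have "vhat ?N ?d ?S y u = vhat ?N (?c ?F') ?S y u - vhat ?N (?c F) ?S y u"
      by (simp add: vhat_def sum_subtractf left_diff_distrib)
    moreover have "vhat ?N (?c F) ?S y u = vhat ?N (\<lambda>_. 1) F y u" by (rule one) blast
    moreover have "vhat ?N (?c ?F') ?S y u = vhat ?N (\<lambda>_. 1) ?F' y u" by (rule one) blast
    ultimately show ?thesis by (simp only: tr left_diff_distrib mult_1_left)
  qed
  have "(\<Sum>u\<in>dual_box M. (cmod (char ?N u z - 1))\<^sup>2 * weight ?N F u)
      = (\<Sum>u\<in>dual_box M. \<Sum>y\<in>rep ` ?S. (cmod (vhat ?N ?d ?S y u))\<^sup>2)"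
  proof (rule sum.cong[OF refl])
    fix u
    have w: "weight ?N F u = (\<Sum>y\<in>rep ` ?S. (cmod (vhat ?N (?c F) ?S y u))\<^sup>2)"
      by (rule weight_superset[OF S(1)]) blast
    show "(cmod (char ?N u z - 1))\<^sup>2 * weight ?N F u = (\<Sum>y\<in>rep ` ?S. (cmod (vhat ?N ?d ?S y u))\<^sup>2)"
      unfolding w vd by (simp only: norm_mult power_mult_distrib sum_distrib_left)
  qed
  also have "\<dots> = (2 * real M + 1)\<^sup>2 * (\<Sum>x\<in>?S. (cmod (?d x))\<^sup>2)"
    using S M by (intro parseval) auto
  also have "(\<Sum>x\<in>?S. (cmod (?d x))\<^sup>2) = (\<Sum>x\<in>?S. of_bool (x \<in> (F - ?F') \<union> (?F' - F)))"
    by (intro sum.cong refl) auto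
  also have "\<dots> = card ((F - ?F') \<union> (?F' - F))"
    using S by (simp add: sum.If_cases of_bool_def Int_def) (intro arg_cong[of _ _ card], auto)
  finally show ?thesis .
qed

end

section \<open>Mass of cones and tails for an almost invariant set\<close>

context free_Zsq_action begin

text \<open>Under exact invariance the disjoint sets \<open>T\<close>, \<open>s\<close>
  T\<open>and\<close>s' \<open>T\<close> would have equal mass. With the loss in
  \<open>weight_compare\<close> the last two each keep 10/11 of the mass of \<open>T\<close> up to
  an error, and \<open>1 + 2 * 10 / 11 = 31 / 11\<close> is the source of the constants.\<close>

lemma cone_weight:
  fixes \<eta> :: real
  assumes F: "finite F" "F \<subseteq> E"
    and M: "\<And>x. x \<in> F \<union> g ` F \<union> g' ` F \<Longrightarrow> \<bar>fst (coord x)\<bar> \<le> int M \<and> \<bar>snd (coord x)\<bar> \<le> int M"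
    and g: "inj_on g E" "g ` E \<subseteq> E" "\<And>x z. x \<in> E \<Longrightarrow> g (\<tau> z x) = \<tau> (\<alpha> z) (g x)" "surj \<alpha>"
      "\<And>u z. pairing u (\<alpha> z) = pairing (s u) z"
    and g': "inj_on g' E" "g' ` E \<subseteq> E" "\<And>x z. x \<in> E \<Longrightarrow> g' (\<tau> z x) = \<tau> (\<alpha>' z) (g' x)" "surj \<alpha>'"
      "\<And>u z. pairing u (\<alpha>' z) = pairing (s' u) z"
    and T: "T \<subseteq> dual_box M" "s ` T \<subseteq> dual_box M" "s' ` T \<subseteq> dual_box M" "inj_on s T" "inj_on s' T"
      "T \<inter> s ` T = {}" "T \<inter> s' ` T = {}" "s ` T \<inter> s' ` T = {}"
    and \<eta>: "card ((F - g ` F) \<union> (g ` F - F)) \<le> \<eta> * card F" "card ((F - g' ` F) \<union> (g' ` F - F)) \<le> \<eta> * card F"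
  shows "31 * (\<Sum>u\<in>T. weight (2 * M + 1) F u) \<le> 11 * (1 + 20 * \<eta>) * ((2 * real M + 1)\<^sup>2 * card F)"
proof -
  let ?w = "weight (2 * M + 1) F" and ?K = "(2 * real M + 1)\<^sup>2"
  have finD: "finite (dual_box M)" by (simp add: dual_box_def)
  have finT: "finite T" using T(1) finD by (rule finite_subset)
  have K: "0 \<le> ?K" by simp
  have move: "(\<Sum>u\<in>T. ?w u) \<le> 11 / 10 * (\<Sum>u\<in>t ` T. ?w u) + 11 * \<eta> * (?K * card F)"
    if k: "inj_on k E" "k ` E \<subseteq> E" "\<And>x z. x \<in> E \<Longrightarrow> k (\<tau> z x) = \<tau> (\<gamma> z) (k x)" "surj \<gamma>"
      "\<And>u z. pairing u (\<gamma> z) = pairing (t u) z" and it: "inj_on t T"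
      and kM: "\<And>x. x \<in> F \<union> k ` F \<Longrightarrow> \<bar>fst (coord x)\<bar> \<le> int M \<and> \<bar>snd (coord x)\<bar> \<le> int M"
      and k\<eta>: "card ((F - k ` F) \<union> (k ` F - F)) \<le> \<eta> * card F" for k \<gamma> t
  proof -
    have kF: "finite (k ` F)" "k ` F \<subseteq> E" using F k(2) by auto
    have "(\<Sum>u\<in>T. ?w u) \<le> 11 / 10 * (\<Sum>u\<in>T. weight (2 * M + 1) (k ` F) u)
        + 11 * (?K * card ((F - k ` F) \<union> (k ` F - F)))"
      by (rule weight_compare[OF F kF kM T(1)])
    also have "(\<Sum>u\<in>T. weight (2 * M + 1) (k ` F) u) = (\<Sum>u\<in>T. ?w (t u))"
      by (intro sum.cong refl weight_linear_image[OF F k(1,2)]) (use k in auto)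
    also have "\<dots> = (\<Sum>u\<in>t ` T. ?w u)" using it by (simp add: sum.reindex)
    also have "?K * card ((F - k ` F) \<union> (k ` F - F)) \<le> ?K * (\<eta> * card F)"
      using k\<eta> K by (rule mult_left_mono)
    finally show ?thesis by (simp add: mult_ac)
  qed
  have 1: "(\<Sum>u\<in>T. ?w u) \<le> 11 / 10 * (\<Sum>u\<in>s ` T. ?w u) + 11 * \<eta> * (?K * card F)"
    by (rule move[OF g T(4) _ \<eta>(1)]) (use M in auto)
  have 2: "(\<Sum>u\<in>T. ?w u) \<le> 11 / 10 * (\<Sum>u\<in>s' ` T. ?w u) + 11 * \<eta> * (?K * card F)"
    by (rule move[OF g' T(5) _ \<eta>(2)]) (use M in auto)
  have "(\<Sum>u\<in>T. ?w u) + (\<Sum>u\<in>s ` T. ?w u) + (\<Sum>u\<in>s' ` T. ?w u) = (\<Sum>u\<in>T \<union> s ` T \<union> s' ` T. ?w u)"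
    using finT T(6-8) by (subst sum.union_disjoint, auto)+
  also have "\<dots> \<le> (\<Sum>u\<in>dual_box M. ?w u)" using finD T(1-3) by (intro sum_mono2) auto
  also have "\<dots> = ?K * card F" by (rule total_weight[OF F]) (use M in auto)
  finally show ?thesis using 1 2 by (simp add: algebra_simps)
qed

text \<open>The angle lies between pi/4 and pi in absolute value, because
  \<open>M < 4 * \<bar>k\<bar>\<close> gives \<open>2 * M + 1 \<le> 8 * \<bar>k\<bar>\<close>. There
  the cosine is at most \<open>sqrt 2 / 2\<close>, rounded up to 3/4, so the squared distance
  \<open>2 - 2 * cos\<close> is at least 1/2.\<close>

lemma norm_char_minus_one:
  assumes "int M < 4 * \<bar>k\<bar>" "\<bar>k\<bar> \<le> int M"
  shows "1 \<le> 2 * (cmod (cis (2 * pi * of_int k / of_nat (2 * M + 1)) - 1))\<^sup>2"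
proof -
  let ?t = "2 * pi * of_int \<bar>k\<bar> / of_nat (2 * M + 1)"
  have sq: "(cmod (cis t - 1))\<^sup>2 = 2 - 2 * cos t" for t
  proof -
    have "(cmod (cis t - 1))\<^sup>2 = (cos t - 1)\<^sup>2 + (sin t)\<^sup>2" by (simp add: cmod_power2)
    also have "\<dots> = ((cos t)\<^sup>2 + (sin t)\<^sup>2) + 1 - 2 * cos t" by (simp add: power2_eq_square algebra_simps)
    finally show ?thesis by simp
  qed
  have "real_of_int (int (2 * M + 1)) \<le> real_of_int (8 * \<bar>k\<bar>)"
    using assms by (simp only: of_int_le_iff)
  then have "pi * (2 * real M + 1) \<le> pi * (8 * of_int \<bar>k\<bar>)" by (intro mult_left_mono) auto
  then have lo: "pi / 4 \<le> ?t" by (simp add: field_simps)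
  have "real_of_int (2 * \<bar>k\<bar>) \<le> real_of_int (int (2 * M + 1))" using assms by (simp only: of_int_le_iff)
  then have "pi * (2 * of_int \<bar>k\<bar>) \<le> pi * (2 * real M + 1)" by (intro mult_left_mono) auto
  then have hi: "?t \<le> pi" by (simp add: field_simps)
  have "cos ?t \<le> cos (pi / 4)" using lo hi by (intro cos_monotone_0_pi_le) auto
  also have "\<dots> \<le> 3 / 4"
    using real_sqrt_le_mono[of 2 "9 / 4"] by (simp add: cos_45 real_sqrt_divide)
  finally have "cos ?t \<le> 3 / 4" .
  moreover have "cos (2 * pi * of_int k / of_nat (2 * M + 1)) = cos ?t"
  proof (cases "0 \<le> k")
    case False
    then have "?t = - (2 * pi * of_int k / of_nat (2 * M + 1))" by simp
    then show ?thesis by (simp only: cos_minus)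
  qed simp
  moreover have "1 \<le> 2 * (2 - 2 * c)" if "c \<le> 3 / 4" for c :: real using that by simp
  ultimately show ?thesis unfolding sq by simp
qed

text \<open>A frequency with a coordinate beyond \<open>M / 4\<close> has a character value far from
  1 at the corresponding unit vector, so almost invariance under that unit translation bounds the
  mass there.\<close>

lemma tail_weight:
  fixes \<eta> :: real
  assumes F: "finite F" "F \<subseteq> E" and z: "z = (1, 0) \<and> sel = fst \<or> z = (0, 1) \<and> sel = snd"
    and M: "\<And>x. x \<in> F \<union> \<tau> z ` F \<Longrightarrow> \<bar>fst (coord x)\<bar> \<le> int M \<and> \<bar>snd (coord x)\<bar> \<le> int M"
    and \<eta>: "card ((F - \<tau> z ` F) \<union> (\<tau> z ` F - F)) \<le> \<eta> * card F"
  shows "(\<Sum>u\<in>{u \<in> dual_box M. int M < 4 * \<bar>sel u\<bar>}. weight (2 * M + 1) F u) \<le> 2 * \<eta> * ((2 * real M + 1)\<^sup>2 * card F)"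
proof -
  let ?w = "weight (2 * M + 1) F" and ?K = "(2 * real M + 1)\<^sup>2"
  have finD: "finite (dual_box M)" by (simp add: dual_box_def)
  have "(\<Sum>u\<in>{u \<in> dual_box M. int M < 4 * \<bar>sel u\<bar>}. ?w u)
      \<le> (\<Sum>u\<in>{u \<in> dual_box M. int M < 4 * \<bar>sel u\<bar>}. 2 * ((cmod (char (2 * M + 1) u z - 1))\<^sup>2 * ?w u))"
  proof (rule sum_mono)
    fix u assume "u \<in> {u \<in> dual_box M. int M < 4 * \<bar>sel u\<bar>}"
    then have u: "int M < 4 * \<bar>sel u\<bar>" "\<bar>sel u\<bar> \<le> int M" using z by (auto simp: dual_box_def)
    have "pairing u z = sel u" using z by (auto simp: pairing_def)
    then have "1 \<le> 2 * (cmod (char (2 * M + 1) u z - 1))\<^sup>2"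
      using norm_char_minus_one[OF u] by (simp only: char_def)
    then have "1 * ?w u \<le> 2 * (cmod (char (2 * M + 1) u z - 1))\<^sup>2 * ?w u" by (rule mult_right_mono) simp
    then show "?w u \<le> 2 * ((cmod (char (2 * M + 1) u z - 1))\<^sup>2 * ?w u)" by (simp only: mult_1_left mult.assoc)
  qed
  also have "\<dots> \<le> (\<Sum>u\<in>dual_box M. 2 * ((cmod (char (2 * M + 1) u z - 1))\<^sup>2 * ?w u))"
    using finD by (intro sum_mono2) auto
  also have "\<dots> = 2 * (?K * card ((F - \<tau> z ` F) \<union> (\<tau> z ` F - F)))"
    unfolding sum_distrib_left[symmetric] by (subst weight_translate[OF F M]) simp_all
  also have "\<dots> \<le> 2 * (?K * (\<eta> * card F))" using \<eta> by (intro mult_left_mono) auto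
  finally show ?thesis by (simp only: mult_ac)
qed

text \<open>A Folner set would give a probability measure on the dual torus that is concentrated near
  \<open>0\<close>, has no mass at \<open>0\<close>, and is almost invariant under the transposed matrices; ping-pong on
  the two cones rules this out.\<close>

lemma no_almost_invariant_set:
  assumes F: "finite F" "F \<subseteq> E" "F \<noteq> {}"
    and A: "inj_on A E" "A ` E \<subseteq> E" "\<And>v x y. v \<in> E \<Longrightarrow> A (\<tau> (x, y) v) = \<tau> (x + 3 * y, y) (A v)"
    and A': "inj_on A' E" "A' ` E \<subseteq> E" "\<And>v x y. v \<in> E \<Longrightarrow> A' (\<tau> (x, y) v) = \<tau> (x - 3 * y, y) (A' v)"
    and B: "inj_on B E" "B ` E \<subseteq> E" "\<And>v x y. v \<in> E \<Longrightarrow> B (\<tau> (x, y) v) = \<tau> (x, y + 3 * x) (B v)"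
    and B': "inj_on B' E" "B' ` E \<subseteq> E" "\<And>v x y. v \<in> E \<Longrightarrow> B' (\<tau> (x, y) v) = \<tau> (x, y - 3 * x) (B' v)"
    and inv: "\<And>g. g \<in> {A, A', B, B', \<tau> (1, 0), \<tau> (0, 1)} \<Longrightarrow>
      card ((F - g ` F) \<union> (g ` F - F)) \<le> 1 / 1000 * real (card F)"
  shows False
proof -
  define S where "S = F \<union> A ` F \<union> A' ` F \<union> B ` F \<union> B' ` F \<union> \<tau> (1, 0) ` F \<union> \<tau> (0, 1) ` F"
  have finS: "finite S" using F by (simp add: S_def)
  \<comment> \<open>The sum bounds all coordinates that occur; the summand
    \<open>10 * card F\<close> pushes the mass at 0 below one hundredth of the total.\<close>
  define M where "M = 10 * card F + (\<Sum>x\<in>S. nat \<bar>fst (coord x)\<bar> + nat \<bar>snd (coord x)\<bar>)"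
  have M: "\<bar>fst (coord x)\<bar> \<le> int M \<and> \<bar>snd (coord x)\<bar> \<le> int M" if "x \<in> S" for x
  proof -
    have "nat \<bar>fst (coord x)\<bar> + nat \<bar>snd (coord x)\<bar> \<le> (\<Sum>x\<in>S. nat \<bar>fst (coord x)\<bar> + nat \<bar>snd (coord x)\<bar>)"
      using that finS by (intro member_le_sum) auto
    then have "nat \<bar>fst (coord x)\<bar> + nat \<bar>snd (coord x)\<bar> \<le> M" unfolding M_def by linarith
    then show ?thesis by linarith
  qed
  let ?w = "weight (2 * M + 1) F" and ?K = "(2 * real M + 1)\<^sup>2"
  \<comment> \<open>Cutting the cones at \<open>M / 4\<close> keeps their images under shears by 3
    inside the box, as \<open>\<bar>y\<bar> + 3 * \<bar>x\<bar> \<le> 4 * \<bar>x\<bar> \<le>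
    M\<close> on \<open>C1\<close>.\<close>
  define C1 where "C1 = {u :: int \<times> int. \<bar>snd u\<bar> \<le> \<bar>fst u\<bar> \<and> fst u \<noteq> 0 \<and> 4 * \<bar>fst u\<bar> \<le> int M}"
  define C2 where "C2 = {u :: int \<times> int. \<bar>fst u\<bar> \<le> \<bar>snd u\<bar> \<and> snd u \<noteq> 0 \<and> 4 * \<bar>snd u\<bar> \<le> int M}"
  \<comment> \<open>Ping-pong: \<open>\<bar>y + 3 * x\<bar>\<close> and
    \<open>\<bar>y - 3 * x\<bar>\<close> are at least \<open>2 * \<bar>x\<bar>\<close>, and
    \<open>y + 3 * x = y' - 3 * x\<close> would force
    \<open>6 * \<bar>x\<bar> \<le> 2 * \<bar>x\<bar>\<close>.\<close>
  have k1: "\<not> \<bar>y + 3 * x\<bar> \<le> \<bar>x\<bar>" "\<not> \<bar>y - 3 * x\<bar> \<le> \<bar>x\<bar>" if "x \<noteq> 0" "\<bar>y\<bar> \<le> \<bar>x\<bar>" for x y :: int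
    using that by arith+
  have k2: "y + 3 * x \<noteq> y' - 3 * x" if "x \<noteq> 0" "\<bar>y\<bar> \<le> \<bar>x\<bar>" "\<bar>y'\<bar> \<le> \<bar>x\<bar>" for x y y' :: int
    using that by arith
  \<comment> \<open>Frequencies transform by the transpose: where \<open>A\<close> adds
    \<open>3 * y\<close> to \<open>x\<close> on Z^2, it adds \<open>3 * x\<close> to
    \<open>y\<close> on the dual side.\<close>
  have cone1: "31 * (\<Sum>u\<in>C1. ?w u) \<le> 11 * (1 + 20 * (1 / 1000)) * (?K * card F)"
  proof (rule cone_weight[OF F(1,2), where g = A and g' = A' and \<alpha> = "\<lambda>(x, y). (x + 3 * y, y)"
        and \<alpha>' = "\<lambda>(x, y). (x - 3 * y, y)" and s = "\<lambda>(x, y). (x, y + 3 * x)" and s' = "\<lambda>(x, y). (x, y - 3 * x)"])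
    show "surj (\<lambda>(x :: int, y). (x + 3 * y, y))"
      by (rule surjI[of _ "\<lambda>(x, y). (x - 3 * y, y)"]) auto
    show "surj (\<lambda>(x :: int, y). (x - 3 * y, y))"
      by (rule surjI[of _ "\<lambda>(x, y). (x + 3 * y, y)"]) auto
    show "A (\<tau> z v) = \<tau> ((\<lambda>(x, y). (x + 3 * y, y)) z) (A v)" "A' (\<tau> z v) = \<tau> ((\<lambda>(x, y). (x - 3 * y, y)) z) (A' v)"
      if "v \<in> E" for v z using A(3)[OF that] A'(3)[OF that] by (cases z; simp)+
    show "pairing u ((\<lambda>(x, y). (x + 3 * y, y)) z) = pairing ((\<lambda>(x, y). (x, y + 3 * x)) u) z" "pairing u ((\<lambda>(x, y). (x - 3 * y, y)) z) = pairing ((\<lambda>(x, y). (x, y - 3 * x)) u) z" for u z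
      by (cases u; cases z; simp add: pairing_def algebra_simps)+
    show "\<bar>fst (coord x)\<bar> \<le> int M \<and> \<bar>snd (coord x)\<bar> \<le> int M" if "x \<in> F \<union> A ` F \<union> A' ` F" for x
      using that by (intro M) (auto simp: S_def)
    show "inj_on (\<lambda>(x, y). (x, y + 3 * x)) C1" "inj_on (\<lambda>(x, y). (x, y - 3 * x)) C1" by (auto simp: inj_on_def)
    show "C1 \<subseteq> dual_box M" "(\<lambda>(x, y). (x, y + 3 * x)) ` C1 \<subseteq> dual_box M" "(\<lambda>(x, y). (x, y - 3 * x)) ` C1 \<subseteq> dual_box M"
      by (auto simp: C1_def dual_box_def)
      have False if pp: "p \<in> C1" "p \<in> (\<lambda>(x, y). (x, y + 3 * x)) ` C1" for p
      proof -
        obtain x y where "p = (x, y + 3 * x)" "(x, y) \<in> C1" using pp by auto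
        then show False using pp(1) k1(1)[of x y] by (simp add: C1_def)
      qed
      then show "C1 \<inter> (\<lambda>(x, y). (x, y + 3 * x)) ` C1 = {}" by blast
      have False if pp: "p \<in> C1" "p \<in> (\<lambda>(x, y). (x, y - 3 * x)) ` C1" for p
      proof -
        obtain x y where "p = (x, y - 3 * x)" "(x, y) \<in> C1" using pp by auto
        then show False using pp(1) k1(2)[of x y] by (simp add: C1_def)
      qed
      then show "C1 \<inter> (\<lambda>(x, y). (x, y - 3 * x)) ` C1 = {}" by blast
      have False if pp: "p \<in> (\<lambda>(x, y). (x, y + 3 * x)) ` C1" "p \<in> (\<lambda>(x, y). (x, y - 3 * x)) ` C1" for p
      proof -
        obtain x y y' where "p = (x, y + 3 * x)" "(x, y) \<in> C1" "p = (x, y' - 3 * x)" "(x, y') \<in> C1" using pp by auto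
        then show False using k2[of x y y'] by (simp add: C1_def)
      qed
      then show "(\<lambda>(x, y). (x, y + 3 * x)) ` C1 \<inter> (\<lambda>(x, y). (x, y - 3 * x)) ` C1 = {}" by blast
    show "real (card ((F - A ` F) \<union> (A ` F - F))) \<le> 1 / 1000 * real (card F)"
      "real (card ((F - A' ` F) \<union> (A' ` F - F))) \<le> 1 / 1000 * real (card F)" by (rule inv; simp)+
  qed (fact A A')+
  have cone2: "31 * (\<Sum>u\<in>C2. ?w u) \<le> 11 * (1 + 20 * (1 / 1000)) * (?K * card F)"
  proof (rule cone_weight[OF F(1,2), where g = B and g' = B' and \<alpha> = "\<lambda>(x, y). (x, y + 3 * x)"
        and \<alpha>' = "\<lambda>(x, y). (x, y - 3 * x)" and s = "\<lambda>(x, y). (x + 3 * y, y)" and s' = "\<lambda>(x, y). (x - 3 * y, y)"])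
    show "surj (\<lambda>(x :: int, y). (x, y + 3 * x))"
      by (rule surjI[of _ "\<lambda>(x, y). (x, y - 3 * x)"]) auto
    show "surj (\<lambda>(x :: int, y). (x, y - 3 * x))"
      by (rule surjI[of _ "\<lambda>(x, y). (x, y + 3 * x)"]) auto
    show "B (\<tau> z v) = \<tau> ((\<lambda>(x, y). (x, y + 3 * x)) z) (B v)" "B' (\<tau> z v) = \<tau> ((\<lambda>(x, y). (x, y - 3 * x)) z) (B' v)"
      if "v \<in> E" for v z using B(3)[OF that] B'(3)[OF that] by (cases z; simp)+
    show "pairing u ((\<lambda>(x, y). (x, y + 3 * x)) z) = pairing ((\<lambda>(x, y). (x + 3 * y, y)) u) z" "pairing u ((\<lambda>(x, y). (x, y - 3 * x)) z) = pairing ((\<lambda>(x, y). (x - 3 * y, y)) u) z" for u z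
      by (cases u; cases z; simp add: pairing_def algebra_simps)+
    show "\<bar>fst (coord x)\<bar> \<le> int M \<and> \<bar>snd (coord x)\<bar> \<le> int M" if "x \<in> F \<union> B ` F \<union> B' ` F" for x
      using that by (intro M) (auto simp: S_def)
    show "inj_on (\<lambda>(x, y). (x + 3 * y, y)) C2" "inj_on (\<lambda>(x, y). (x - 3 * y, y)) C2" by (auto simp: inj_on_def)
    show "C2 \<subseteq> dual_box M" "(\<lambda>(x, y). (x + 3 * y, y)) ` C2 \<subseteq> dual_box M" "(\<lambda>(x, y). (x - 3 * y, y)) ` C2 \<subseteq> dual_box M"
      by (auto simp: C2_def dual_box_def)
      have False if pp: "p \<in> C2" "p \<in> (\<lambda>(x, y). (x + 3 * y, y)) ` C2" for p
      proof -
        obtain x y where "p = (y + 3 * x, x)" "(y, x) \<in> C2" using pp by auto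
        then show False using pp(1) k1(1)[of x y] by (simp add: C2_def)
      qed
      then show "C2 \<inter> (\<lambda>(x, y). (x + 3 * y, y)) ` C2 = {}" by blast
      have False if pp: "p \<in> C2" "p \<in> (\<lambda>(x, y). (x - 3 * y, y)) ` C2" for p
      proof -
        obtain x y where "p = (y - 3 * x, x)" "(y, x) \<in> C2" using pp by auto
        then show False using pp(1) k1(2)[of x y] by (simp add: C2_def)
      qed
      then show "C2 \<inter> (\<lambda>(x, y). (x - 3 * y, y)) ` C2 = {}" by blast
      have False if pp: "p \<in> (\<lambda>(x, y). (x + 3 * y, y)) ` C2" "p \<in> (\<lambda>(x, y). (x - 3 * y, y)) ` C2" for p
      proof -
        obtain x y y' where "p = (y + 3 * x, x)" "(y, x) \<in> C2" "p = (y' - 3 * x, x)" "(y', x) \<in> C2" using pp by auto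
        then show False using k2[of x y y'] by (simp add: C2_def)
      qed
      then show "(\<lambda>(x, y). (x + 3 * y, y)) ` C2 \<inter> (\<lambda>(x, y). (x - 3 * y, y)) ` C2 = {}" by blast
    show "real (card ((F - B ` F) \<union> (B ` F - F))) \<le> 1 / 1000 * real (card F)"
      "real (card ((F - B' ` F) \<union> (B' ` F - F))) \<le> 1 / 1000 * real (card F)" by (rule inv; simp)+
  qed (fact B B')+
  have tail1: "(\<Sum>u\<in>{u \<in> dual_box M. int M < 4 * \<bar>fst u\<bar>}. ?w u) \<le> 2 * (1 / 1000) * (?K * card F)"
    by (rule tail_weight[OF F(1,2), of "(1, 0)"]) (use M inv in \<open>auto simp: S_def\<close>)
  have tail2: "(\<Sum>u\<in>{u \<in> dual_box M. int M < 4 * \<bar>snd u\<bar>}. ?w u) \<le> 2 * (1 / 1000) * (?K * card F)"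
    by (rule tail_weight[OF F(1,2), of "(0, 1)"]) (use M inv in \<open>auto simp: S_def\<close>)
  have n1: "1 \<le> real (card F)" using F by (simp add: Suc_le_eq card_gt_0_iff)
  have zero: "?w 0 \<le> 1 / 100 * (?K * card F)"
  proof -
    have "10 * card F \<le> M" by (simp add: M_def)
    then have "10 * real (card F) \<le> 2 * real M + 1" by linarith
    then have "(10 * real (card F))\<^sup>2 \<le> ?K" by (intro power_mono) auto
    then have "100 * (real (card F))\<^sup>2 \<le> ?K * 1" by (simp add: power2_eq_square)
    also have "\<dots> \<le> ?K * card F" using n1 by (intro mult_left_mono) auto
    finally show ?thesis using weight_zero[OF F(1), of "2 * M + 1"] by linarith
  qed
  have finD: "finite (dual_box M)" by (simp add: dual_box_def)
  have C: "C1 \<subseteq> dual_box M" "C2 \<subseteq> dual_box M" by (auto simp: C1_def C2_def dual_box_def)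
  then have finC: "finite C1" "finite C2" using finD finite_subset by blast+
  let ?T1 = "{u \<in> dual_box M. int M < 4 * \<bar>fst u\<bar>}" and ?T2 = "{u \<in> dual_box M. int M < 4 * \<bar>snd u\<bar>}"
  have un: "sum ?w (P \<union> Q) \<le> sum ?w P + sum ?w Q" if "finite P" "finite Q" for P Q
    using sum.union_inter[OF that, of ?w] sum_nonneg[of "P \<inter> Q" ?w] by simp
  \<comment> \<open>Every frequency is 0, lies in one of the cut cones, or has a coordinate beyond
    \<open>M / 4\<close>.\<close>
  have "dual_box M \<subseteq> {0} \<union> (C1 \<union> (C2 \<union> (?T1 \<union> ?T2)))"
    by (auto simp: C1_def C2_def dual_box_def zero_prod_def)
  then have "sum ?w (dual_box M) \<le> sum ?w ({0} \<union> (C1 \<union> (C2 \<union> (?T1 \<union> ?T2))))"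
    using finC finD by (intro sum_mono2) auto
  also have "\<dots> \<le> sum ?w {0} + (sum ?w C1 + (sum ?w C2 + (sum ?w ?T1 + sum ?w ?T2)))"
    using finC finD by (intro order_trans[OF un] add_left_mono) auto
  finally have "?K * card F \<le> ?w 0 + (sum ?w C1 + (sum ?w C2 + (sum ?w ?T1 + sum ?w ?T2)))"
    using total_weight[OF F(1,2), of M] M by (simp add: S_def)
  moreover have "0 < ?K * card F" using n1 by (intro mult_pos_pos) auto
  \<comment> \<open>The pieces add up to at most
    \<open>2 * 11.22 / 31 + 2 * 0.002 + 0.01 < 0.74\<close> of the total mass.\<close>
  moreover have False
    if "K \<le> w0 + (c1 + (c2 + (t1 + t2)))" "0 < K" "31 * c1 \<le> 11 * (1 + 20 * (1 / 1000)) * K"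
      "31 * c2 \<le> 11 * (1 + 20 * (1 / 1000)) * K" "t1 \<le> 2 * (1 / 1000) * K" "t2 \<le> 2 * (1 / 1000) * K"
      "w0 \<le> 1 / 100 * K" for K w0 c1 c2 t1 t2 :: real
  proof -
    have "11 * (1 + 20 * (1 / 1000)) * K = 1122 / 100 * K" by simp
    then show False using that by linarith
  qed
  ultimately show False using cone1 cone2 tail1 tail2 zero by blast
qed

end

section \<open>A semidirect product outside the class\<close>

lemma Zsq_simps [simp]:
  "carrier (integer_group \<times>\<times> integer_group) = UNIV"
  "p \<otimes>\<^bsub>integer_group \<times>\<times> integer_group\<^esub> q = p + q"
  "\<one>\<^bsub>integer_group \<times>\<times> integer_group\<^esub> = (0, 0)"
  by (auto simp: DirProd_def plus_prod_def split: prod.splits)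

lemma semidirect_simps [simp]:
  "carrier (semidirect_product N H \<theta>) = carrier N \<times> carrier H"
  "(n, h) \<otimes>\<^bsub>semidirect_product N H \<theta>\<^esub> (n', h') = (n \<otimes>\<^bsub>N\<^esub> \<theta> h n', h \<otimes>\<^bsub>H\<^esub> h')"
  "\<one>\<^bsub>semidirect_product N H \<theta>\<^esub> = (\<one>\<^bsub>N\<^esub>, \<one>\<^bsub>H\<^esub>)"
  by (simp_all add: semidirect_product_def)

lemma three_disjoint_translates:
  assumes m: "invariant_mean G E f \<mu>" and g: "g \<in> carrier G" "g' \<in> carrier G" and P: "P \<subseteq> E"
    and sub: "f g ` P \<subseteq> E" "f g' ` P \<subseteq> E"
    and dis: "P \<inter> f g ` P = {}" "P \<inter> f g' ` P = {}" "f g ` P \<inter> f g' ` P = {}"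
  shows "3 * \<mu> P \<le> 1"
proof -
  have "\<mu> (P \<union> f g ` P) = \<mu> P + \<mu> (f g ` P)"
    by (rule invariant_mean_Un[OF m P sub(1) dis(1)])
  moreover have "\<mu> ((P \<union> f g ` P) \<union> f g' ` P) = \<mu> (P \<union> f g ` P) + \<mu> (f g' ` P)"
    by (rule invariant_mean_Un[OF m]) (use P sub dis in auto)
  moreover have "\<mu> ((P \<union> f g ` P) \<union> f g' ` P) \<le> 1"
  proof -
    have "\<forall>A. A \<subseteq> E \<longrightarrow> 0 \<le> \<mu> A \<and> \<mu> A \<le> 1" using m unfolding invariant_mean_def by (rule conjunct1)
    then show ?thesis using P sub by simp
  qed
  ultimately show ?thesis
    using invariant_mean_image[OF m g(1) P] invariant_mean_image[OF m g(2) P] by linarith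
qed

text \<open>The slopes \<open>p / q\<close> and \<open>p' / q'\<close> lie in
  \<open>[-1, 1]\<close>, so they differ by at most 2, and a shift by \<open>k\<close> with
  \<open>\<bar>k\<bar> \<ge> 3\<close> separates them. The statement is cross-multiplied to stay in
  the integers.\<close>

lemma slope_gap:
  fixes p q p' q' k :: int
  assumes "\<bar>p\<bar> \<le> \<bar>q\<bar>" "\<bar>p'\<bar> \<le> \<bar>q'\<bar>" "q \<noteq> 0" "q' \<noteq> 0" "3 \<le> \<bar>k\<bar>"
  shows "p * q' \<noteq> (p' + k * q') * q"
proof
  assume eq: "p * q' = (p' + k * q') * q"
  let ?m = "\<bar>q\<bar> * \<bar>q'\<bar>"
  have "\<bar>p * q'\<bar> \<le> ?m" unfolding abs_mult using assms by (intro mult_right_mono) auto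
  moreover have "\<bar>p' * q\<bar> \<le> \<bar>q'\<bar> * \<bar>q\<bar>" unfolding abs_mult using assms by (intro mult_right_mono) auto
  moreover have "3 * ?m \<le> \<bar>k\<bar> * ?m" using assms by (intro mult_right_mono) auto
  moreover have "\<bar>k * (q * q')\<bar> = \<bar>k\<bar> * ?m" by (simp add: abs_mult)
  moreover have "k * (q * q') = p * q' - p' * q" using eq by (simp add: algebra_simps)
  moreover have "0 < ?m" using assms by simp
  moreover have "\<bar>p * q' - p' * q\<bar> \<le> \<bar>p * q'\<bar> + \<bar>p' * q\<bar>" by (rule abs_triangle_ineq4)
  ultimately show False by (simp add: mult.commute)
qed

text \<open>All point stabilizers in \<open>\<int>\<^sup>2\<close> have the same rank. Rank 2 contradicts faithfulness, rank
  1 yields an invariant mean on the projective line, and rank 0 is excluded by Fourier analysis.\<close>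

theorem Zsq_semidirect_not_class_A:
  fixes H :: "('b, 'm) monoid_scheme"
  assumes H: "group H" and \<theta>: "\<theta> \<in> hom H (AutoGroup (integer_group \<times>\<times> integer_group))"
    and ab: "a \<in> carrier H" "b \<in> carrier H"
    and \<theta>a: "\<And>x y. \<theta> a (x, y) = (x + 3 * y, y)" and \<theta>b: "\<And>x y. \<theta> b (x, y) = (x, y + 3 * x)"
  shows "\<not> class_A (semidirect_product (integer_group \<times>\<times> integer_group) H \<theta>)"
proof
  let ?Z = "integer_group \<times>\<times> integer_group"
  let ?G = "semidirect_product ?Z H \<theta>"
  assume "class_A ?G"
  then obtain E :: "nat set" and f \<mu> where E: "set_action ?G E f" "transitive_on ?G E f"
    "faithful_on ?G E f" "folner_action ?G E f" "invariant_mean ?G E f \<mu>" "E \<noteq> {}"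
    using class_AE by metis
  interpret set_action ?G E f by fact
  interpret H: group H by fact
  have gZ: "group ?Z" by (intro DirProd_group) auto
  have th: "group_hom H (AutoGroup ?Z) \<theta>"
    using \<theta> H group.AutoGroup[OF gZ] by (simp add: group_hom_def group_hom_axioms_def)
  have aut: "\<theta> h \<in> auto ?Z" if "h \<in> carrier H" for h
    using group_hom.hom_closed[OF th that] by (simp add: AutoGroup_def)
  have \<theta>_add: "\<theta> h (z + z') = \<theta> h z + \<theta> h z'" if "h \<in> carrier H" for h z z'
    using aut[OF that] by (simp add: auto_def hom_def del: split_paired_All)
  have \<theta>_one: "\<theta> \<one>\<^bsub>H\<^esub> z = z" for z
    using group_hom.hom_one[OF th] by (simp add: AutoGroup_def BijGroup_def)
  have \<theta>_comp: "\<theta> (h \<otimes>\<^bsub>H\<^esub> h') z = \<theta> h (\<theta> h' z)" if "h \<in> carrier H" "h' \<in> carrier H" for h h' z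
    using group_hom.hom_mult[OF th that] aut[OF that(1)] aut[OF that(2)]
    by (simp add: AutoGroup_def BijGroup_def auto_def compose_def)
  have \<theta>_zero: "\<theta> h 0 = 0" if "h \<in> carrier H" for h
    using \<theta>_add[OF that, of 0 0] by simp
  have \<theta>_inv: "\<theta> h (\<theta> (inv\<^bsub>H\<^esub> h) z) = z" "\<theta> (inv\<^bsub>H\<^esub> h) (\<theta> h z) = z" if "h \<in> carrier H" for h z
    using \<theta>_comp[of h "inv\<^bsub>H\<^esub> h" z] \<theta>_comp[of "inv\<^bsub>H\<^esub> h" h z] that by (simp_all add: \<theta>_one)
  \<comment> \<open>The two factors act by \<open>\<tau>\<close> and \<open>\<sigma>\<close>; the
    relation \<open>\<sigma>_\<tau>\<close> below encodes the semidirect product.\<close>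
  define \<tau> where "\<tau> z x = f (z, \<one>\<^bsub>H\<^esub>) x" for z x
  define \<sigma> where "\<sigma> h x = f (0, h) x" for h x
  have zero: "(0, 0) = (0 :: int \<times> int)" by (simp add: zero_prod_def)
  have \<tau>_closed: "\<tau> z x \<in> E" if "x \<in> E" for z x using that by (simp add: \<tau>_def)
  have \<sigma>_closed: "\<sigma> h x \<in> E" if "x \<in> E" "h \<in> carrier H" for h x using that by (simp add: \<sigma>_def)
  have \<tau>_zero: "\<tau> 0 x = x" if "x \<in> E" for x using act_one[OF that] by (simp add: \<tau>_def zero)
  have \<tau>_add: "\<tau> (z + z') x = \<tau> z (\<tau> z' x)" if "x \<in> E" for z z' x
    using act_mult[of "(z, \<one>\<^bsub>H\<^esub>)" "(z', \<one>\<^bsub>H\<^esub>)" x] that by (simp add: \<tau>_def \<theta>_one)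
  have \<sigma>_\<tau>: "\<sigma> h (\<tau> z x) = \<tau> (\<theta> h z) (\<sigma> h x)" if "x \<in> E" "h \<in> carrier H" for h z x
    using act_mult[of "(0, h)" "(z, \<one>\<^bsub>H\<^esub>)" x] act_mult[of "(\<theta> h z, \<one>\<^bsub>H\<^esub>)" "(0, h)" x] that
    by (simp add: \<tau>_def \<sigma>_def \<theta>_one)
  have f_split: "f (z, h) x = \<tau> z (\<sigma> h x)" if "x \<in> E" "h \<in> carrier H" for z h x
    using act_mult[of "(z, \<one>\<^bsub>H\<^esub>)" "(0, h)" x] that by (simp add: \<tau>_def \<sigma>_def \<theta>_one)
  have \<sigma>_inj: "x = y" if "\<sigma> h x = \<sigma> h y" "x \<in> E" "y \<in> E" "h \<in> carrier H" for h x y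
    using act_inj[of "(0, h)" x y] that by (simp add: \<sigma>_def)
  define St where "St x = {z. \<tau> z x = x}" for x
  have St_zero: "0 \<in> St x" if "x \<in> E" for x using that \<tau>_zero by (simp add: St_def)
  have St_add: "z + z' \<in> St x" if "x \<in> E" "z \<in> St x" "z' \<in> St x" for x z z'
    using that by (simp add: St_def \<tau>_add)
  have St_minus: "- z \<in> St x" if "x \<in> E" "z \<in> St x" for x z
    using that \<tau>_add[of x "- z" z] \<tau>_zero by (simp add: St_def)
  have St_scale: "(k * fst z, k * snd z) \<in> St x" if "x \<in> E" "z \<in> St x" for x z and k :: int
  proof -
    have nat: "(int n * fst z, int n * snd z) \<in> St x" for n
    proof (induction n)
      case 0
      then show ?case using St_zero[OF that(1)] by (simp add: zero)
    next
      case (Suc n)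
      then have "(int n * fst z, int n * snd z) + z \<in> St x" using St_add that by blast
      moreover have "(int n * fst z, int n * snd z) + z = (int (Suc n) * fst z, int (Suc n) * snd z)"
        by (cases z) (simp add: algebra_simps)
      ultimately show ?case by simp
    qed
    show ?thesis
    proof (cases "0 \<le> k")
      case True
      then show ?thesis using nat[of "nat k"] by simp
    next
      case False
      then show ?thesis using St_minus[OF that(1) nat[of "nat (- k)"]] by simp
    qed
  qed
  have St_\<sigma>: "\<theta> h z \<in> St (\<sigma> h x) \<longleftrightarrow> z \<in> St x" if "x \<in> E" "h \<in> carrier H" for h x z
    using \<sigma>_\<tau>[OF that, of z] \<sigma>_inj[of h "\<tau> z x" x] that \<tau>_closed by (auto simp: St_def)
  have St_\<tau>: "St (\<tau> w x) = St x" if "x \<in> E" for w x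
  proof -
    have "\<tau> z (\<tau> w x) = \<tau> w x \<longleftrightarrow> \<tau> z x = x" for z
    proof -
      have "\<tau> z (\<tau> w x) = \<tau> w (\<tau> z x)" using that by (simp add: add.commute flip: \<tau>_add)
      moreover have "\<tau> w (\<tau> z x) = \<tau> w x \<Longrightarrow> \<tau> z x = x"
        using act_inj[of "(w, \<one>\<^bsub>H\<^esub>)" "\<tau> z x" x] that \<tau>_closed by (simp add: \<tau>_def)
      ultimately show ?thesis by auto
    qed
    then show ?thesis by (simp add: St_def)
  qed
  \<comment> \<open>Translations leave stabilizers unchanged, so by transitivity any two stabilizers
    in Z^2 are images of each other under some \<open>\<theta> h\<close>; this makes the case
    distinction independent of the point.\<close>
  have St_all: "\<exists>h\<in>carrier H. \<forall>z. \<theta> h z \<in> St y \<longleftrightarrow> z \<in> St x" if xy: "x \<in> E" "y \<in> E" for x y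
  proof -
    obtain p where p: "p \<in> carrier ?G" "f p x = y" by (rule transitive_onD[OF E(2) xy])
    obtain w h where wh: "p = (w, h)" "h \<in> carrier H" using p by auto
    then have "y = \<tau> w (\<sigma> h x)" using p f_split xy by simp
    then have "St y = St (\<sigma> h x)" using St_\<tau> \<sigma>_closed wh xy by simp
    then show ?thesis using St_\<sigma> wh xy by (intro bexI[of _ h]) auto
  qed
  have \<theta>a': "\<theta> (inv\<^bsub>H\<^esub> a) (x, y) = (x - 3 * y, y)" for x y
    using \<theta>_inv(2)[OF ab(1), of "(x - 3 * y, y)"] by (simp add: \<theta>a)
  have \<theta>b': "\<theta> (inv\<^bsub>H\<^esub> b) (x, y) = (x, y - 3 * x)" for x y
    using \<theta>_inv(2)[OF ab(2), of "(x, y - 3 * x)"] by (simp add: \<theta>b)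
  have \<theta>_minus: "\<theta> h (- z) = - \<theta> h z" if "h \<in> carrier H" for h z
    using \<theta>_add[OF that, of z "- z"] \<theta>_zero[OF that] by (simp add: eq_neg_iff_add_eq_0 add.commute)
  have \<theta>_scale: "\<theta> h (k * fst z, k * snd z) = (k * fst (\<theta> h z), k * snd (\<theta> h z))"
    if h: "h \<in> carrier H" for h z and k :: int
  proof -
    have nat: "\<theta> h (int n * fst z, int n * snd z) = (int n * fst (\<theta> h z), int n * snd (\<theta> h z))" for n
    proof (induction n)
      case 0
      then show ?case using \<theta>_zero[OF h] by (simp add: zero)
    next
      case (Suc n)
      have "(int (Suc n) * fst z, int (Suc n) * snd z) = (int n * fst z, int n * snd z) + z"
        by (cases z) (simp add: algebra_simps)
      then show ?case using \<theta>_add[OF h] Suc by (cases "\<theta> h z") (simp add: algebra_simps)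
    qed
    show ?thesis
    proof (cases "0 \<le> k")
      case True
      then show ?thesis using nat[of "nat k"] by simp
    next
      case False
      then show ?thesis
        using nat[of "nat (- k)"] \<theta>_minus[OF h, of "(int (nat (- k)) * fst z, int (nat (- k)) * snd z)"] by simp
    qed
  qed
  have nonzero_all: "St y \<noteq> {0}" if xy: "x \<in> E" "y \<in> E" "St x \<noteq> {0}" for x y
  proof -
    obtain h where h: "h \<in> carrier H" "\<And>z. \<theta> h z \<in> St y \<longleftrightarrow> z \<in> St x" using St_all[OF xy(1,2)] by blast
    obtain z where z: "z \<in> St x" "z \<noteq> 0" using xy(3) St_zero[OF xy(1)] by blast
    have "\<theta> h z \<noteq> 0"
    proof
      assume "\<theta> h z = 0"
      then have "z = 0" using \<theta>_inv(2)[OF h(1), of z] \<theta>_zero[of "inv\<^bsub>H\<^esub> h"] h(1) by simp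
      then show False using z(2) by simp
    qed
    then show ?thesis using h(2) z(1) by blast
  qed
  obtain x0 where x0: "x0 \<in> E" using E(6) by blast
  \<comment> \<open>Ranks 0, 2 and 1. A subgroup of Z^2 has rank 2 exactly when it contains
    \<open>m\<close> times Z^2 for some \<open>m \<noteq> 0\<close>, which is the form used
    here.\<close>
  consider (free) "St x0 = {0}"
    | (full) m v where "m \<noteq> 0" "v \<in> E" "\<And>z. (m * fst z, m * snd z) \<in> St v"
    | (line) "St x0 \<noteq> {0}" "\<And>m v. m \<noteq> 0 \<Longrightarrow> v \<in> E \<Longrightarrow> \<exists>z. (m * fst z, m * snd z) \<notin> St v" by blast
  then show False
  proof cases
    case free
    have St0: "St x = {0}" if xE: "x \<in> E" for x
      using nonzero_all[OF xE x0] free by blast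
    interpret fr: free_Zsq_action E \<tau>
    proof
      show "z = 0" if "x \<in> E" "\<tau> z x = x" for x z using St0[OF that(1)] that(2) by (auto simp: St_def)
    qed (use \<tau>_closed \<tau>_zero \<tau>_add in auto)
    let ?e1 = "((1, 0) :: int \<times> int, \<one>\<^bsub>H\<^esub>)" and ?e2 = "((0, 1) :: int \<times> int, \<one>\<^bsub>H\<^esub>)"
    let ?Q = "{(0, a), (0, inv\<^bsub>H\<^esub> a), (0, b), (0, inv\<^bsub>H\<^esub> b), ?e1, ?e2}"
    have Q: "finite ?Q" "?Q \<subseteq> carrier ?G" using ab by auto
    \<comment> \<open>Passing to the symmetric difference doubles the boundary, hence 1/2000 for the
      bound 1/1000.\<close>
    have "(0::real) < 1 / 2000" by simp
    then obtain F where F: "finite F" "F \<noteq> {}" "F \<subseteq> E"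
      "\<And>g. g \<in> ?Q \<Longrightarrow> real (card (f g ` F - F)) \<le> 1 / 2000 * real (card F)"
      using folner_actionD[OF E(4) Q] by metis
    have almost: "card ((F - f g ` F) \<union> (f g ` F - F)) \<le> 1 / 1000 * real (card F)" if g: "g \<in> ?Q" for g
    proof -
      have "inj_on (f g) F" using act_inj_on[OF _ F(3)] Q(2) g by blast
      then show ?thesis using card_symdiff_image[OF F(1)] F(4)[OF g] by simp
    qed
    have \<sigma>E: "inj_on (\<sigma> h) E" "\<sigma> h ` E \<subseteq> E" if "h \<in> carrier H" for h
      using \<sigma>_inj \<sigma>_closed that by (auto simp: inj_on_def)
    show False
    proof (rule fr.no_almost_invariant_set[OF F(1,3,2),
          where A = "\<sigma> a" and A' = "\<sigma> (inv\<^bsub>H\<^esub> a)" and B = "\<sigma> b" and B' = "\<sigma> (inv\<^bsub>H\<^esub> b)"])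
      fix g assume g: "g \<in> {\<sigma> a, \<sigma> (inv\<^bsub>H\<^esub> a), \<sigma> b, \<sigma> (inv\<^bsub>H\<^esub> b), \<tau> (1, 0), \<tau> (0, 1)}"
      have "\<tau> z = f (z, \<one>\<^bsub>H\<^esub>)" "\<sigma> h = f (0, h)" for z h by (simp_all add: \<tau>_def \<sigma>_def fun_eq_iff)
      then obtain q where "q \<in> ?Q" "g = f q" using g by blast
      then show "card ((F - g ` F) \<union> (g ` F - F)) \<le> 1 / 1000 * real (card F)" using almost by simp
    qed (use \<sigma>E ab \<sigma>_\<tau> in \<open>simp_all add: \<theta>a \<theta>a' \<theta>b \<theta>b'\<close>)
  next
    case (full m v)
    \<comment> \<open>Every automorphism preserves \<open>m\<close> times Z^2, so this subgroup lies
      in all stabilizers and \<open>(m, 0)\<close> acts trivially.\<close>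
    have "(m, 0) \<in> St x" if xE: "x \<in> E" for x
    proof -
      obtain h where h: "h \<in> carrier H" "\<And>z. \<theta> h z \<in> St x \<longleftrightarrow> z \<in> St v"
        using St_all[OF full(2) xE] by blast
      define w where "w = \<theta> (inv\<^bsub>H\<^esub> h) (1, 0)"
      have "\<theta> h (m * fst w, m * snd w) \<in> St x" using h(2) full(3) by blast
      moreover have "\<theta> h (m * fst w, m * snd w) = (m, 0)"
        using \<theta>_scale[OF h(1), of m w] \<theta>_inv(1)[OF h(1), of "(1, 0)"] by (simp add: w_def)
      ultimately show ?thesis by simp
    qed
    then have "f ((m, 0), \<one>\<^bsub>H\<^esub>) x = x" if "x \<in> E" for x using that by (simp add: St_def \<tau>_def)
    moreover have "((m, 0), \<one>\<^bsub>H\<^esub>) \<in> carrier ?G" by simp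
    ultimately have "((m, 0), \<one>\<^bsub>H\<^esub>) = \<one>\<^bsub>?G\<^esub>" using E(3) unfolding faithful_on_def by blast
    then show False using full(1) by simp
  next
    case line
    \<comment> \<open>By Cramer's rule, two independent vectors with determinant \<open>D\<close>
      span a subgroup containing \<open>D\<close> times Z^2, which is excluded in this case.\<close>
    have det: "x * y' = x' * y" if v: "v \<in> E" "(x, y) \<in> St v" "(x', y') \<in> St v" for v x y x' y'
    proof (rule ccontr)
      assume ne: "x * y' \<noteq> x' * y"
      define D where "D = x * y' - x' * y"
      have "(D * s, D * t) \<in> St v" for s t
      proof -
        let ?k = "s * y' - t * x'" and ?l = "t * x - s * y"
        have "(?k * x, ?k * y) + (?l * x', ?l * y') \<in> St v"
          using St_scale[OF v(1,2), of ?k] St_scale[OF v(1,3), of ?l] v(1) by (intro St_add) simp_all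
        moreover have "?k * x + ?l * x' = D * s" "?k * y + ?l * y' = D * t"
          by (simp_all add: D_def algebra_simps)
        ultimately show ?thesis by (simp only: plus_prod_def fst_conv snd_conv)
      qed
      then show False using line(2)[OF _ v(1), of D] ne by (auto simp: D_def)
    qed
    have St_a: "(x + 3 * y, y) \<in> St (\<sigma> a v)" "(x - 3 * y, y) \<in> St (\<sigma> (inv\<^bsub>H\<^esub> a) v)"
      "(x, y + 3 * x) \<in> St (\<sigma> b v)" "(x, y - 3 * x) \<in> St (\<sigma> (inv\<^bsub>H\<^esub> b) v)"
      if v: "v \<in> E" "(x, y) \<in> St v" for v x y
      using St_\<sigma>[OF v(1), of a "(x, y)"] St_\<sigma>[OF v(1), of "inv\<^bsub>H\<^esub> a" "(x, y)"]
        St_\<sigma>[OF v(1), of b "(x, y)"] St_\<sigma>[OF v(1), of "inv\<^bsub>H\<^esub> b" "(x, y)"] v(2) ab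
        \<theta>a[of x y] \<theta>a'[of x y] \<theta>b[of x y] \<theta>b'[of x y] H.inv_closed by metis+
    \<comment> \<open>Points whose stabilizer spans a line of slope at most 1, respectively at least
      1, in absolute value: the two halves of the projective line, pulled back to
      \<open>E\<close>.\<close>
    define E1 where "E1 = {v \<in> E. \<exists>x y. (x, y) \<in> St v \<and> x \<noteq> 0 \<and> \<bar>y\<bar> \<le> \<bar>x\<bar>}"
    define E2 where "E2 = {v \<in> E. \<exists>x y. (x, y) \<in> St v \<and> y \<noteq> 0 \<and> \<bar>x\<bar> \<le> \<bar>y\<bar>}"
    have E12: "E1 \<subseteq> E" "E2 \<subseteq> E" by (auto simp: E1_def E2_def)
    have fs: "f (0, h) = \<sigma> h" for h by (simp add: \<sigma>_def fun_eq_iff)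
    have c: "(0, a) \<in> carrier ?G" "(0, inv\<^bsub>H\<^esub> a) \<in> carrier ?G" "(0, b) \<in> carrier ?G" "(0, inv\<^bsub>H\<^esub> b) \<in> carrier ?G"
      using ab by auto
    have "3 * \<mu> E2 \<le> 1"
    proof (rule three_disjoint_translates[OF E(5) c(1,2) E12(2)])
      show "f (0, a) ` E2 \<subseteq> E" "f (0, inv\<^bsub>H\<^esub> a) ` E2 \<subseteq> E" using E12 c by auto
      have False if p: "v \<in> E2" "v \<in> \<sigma> a ` E2" for v
      proof -
        obtain u x y x' y' where "v \<in> E" "(x, y) \<in> St v" "y \<noteq> 0" "\<bar>x\<bar> \<le> \<bar>y\<bar>" "v = \<sigma> a u"
          "u \<in> E" "(x', y') \<in> St u" "y' \<noteq> 0" "\<bar>x'\<bar> \<le> \<bar>y'\<bar>" using p unfolding E2_def by blast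
        then show False using det[of v x y "x' + 3 * y'" y'] St_a(1)[of u x' y'] slope_gap[of x y x' y' 3] by simp
      qed
      then show "E2 \<inter> f (0, a) ` E2 = {}" unfolding fs by blast
      have False if p: "v \<in> E2" "v \<in> \<sigma> (inv\<^bsub>H\<^esub> a) ` E2" for v
      proof -
        obtain u x y x' y' where "v \<in> E" "(x, y) \<in> St v" "y \<noteq> 0" "\<bar>x\<bar> \<le> \<bar>y\<bar>" "v = \<sigma> (inv\<^bsub>H\<^esub> a) u"
          "u \<in> E" "(x', y') \<in> St u" "y' \<noteq> 0" "\<bar>x'\<bar> \<le> \<bar>y'\<bar>" using p unfolding E2_def by blast
        then show False using det[of v x y "x' - 3 * y'" y'] St_a(2)[of u x' y'] slope_gap[of x y x' y' "-3"] by simp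
      qed
      then show "E2 \<inter> f (0, inv\<^bsub>H\<^esub> a) ` E2 = {}" unfolding fs by blast
      have False if p: "v \<in> \<sigma> a ` E2" "v \<in> \<sigma> (inv\<^bsub>H\<^esub> a) ` E2" for v
      proof -
        obtain u u' x y x' y' where *: "v = \<sigma> a u" "u \<in> E" "(x, y) \<in> St u" "y \<noteq> 0" "\<bar>x\<bar> \<le> \<bar>y\<bar>"
          "v = \<sigma> (inv\<^bsub>H\<^esub> a) u'" "u' \<in> E" "(x', y') \<in> St u'" "y' \<noteq> 0" "\<bar>x'\<bar> \<le> \<bar>y'\<bar>"
          using p unfolding E2_def by blast
        have "v \<in> E" using * \<sigma>_closed ab by simp
        then have "(x + 3 * y) * y' = (x' - 3 * y') * y"
          using det[of v "x + 3 * y" y "x' - 3 * y'" y'] St_a(1)[of u x y] St_a(2)[of u' x' y'] * by simp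
        \<comment> \<open>Both points have been sheared, in opposite directions, so the relative
          shear is by 6.\<close>
        then have "x * y' = (x' + (- 6) * y') * y" by (simp add: algebra_simps)
        then show False using slope_gap[of x y x' y' "-6"] * by simp
      qed
      then show "f (0, a) ` E2 \<inter> f (0, inv\<^bsub>H\<^esub> a) ` E2 = {}" unfolding fs by blast
    qed
    moreover have "3 * \<mu> E1 \<le> 1"
    proof (rule three_disjoint_translates[OF E(5) c(3,4) E12(1)])
      show "f (0, b) ` E1 \<subseteq> E" "f (0, inv\<^bsub>H\<^esub> b) ` E1 \<subseteq> E" using E12 c by auto
      have False if p: "v \<in> E1" "v \<in> \<sigma> b ` E1" for v
      proof -
        obtain u x y x' y' where "v \<in> E" "(x, y) \<in> St v" "x \<noteq> 0" "\<bar>y\<bar> \<le> \<bar>x\<bar>" "v = \<sigma> b u"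
          "u \<in> E" "(x', y') \<in> St u" "x' \<noteq> 0" "\<bar>y'\<bar> \<le> \<bar>x'\<bar>" using p unfolding E1_def by blast
        then show False
          using det[of v x y x' "y' + 3 * x'"] St_a(3)[of u x' y'] slope_gap[of y x y' x' 3] by (simp add: mult.commute)
      qed
      then show "E1 \<inter> f (0, b) ` E1 = {}" unfolding fs by blast
      have False if p: "v \<in> E1" "v \<in> \<sigma> (inv\<^bsub>H\<^esub> b) ` E1" for v
      proof -
        obtain u x y x' y' where "v \<in> E" "(x, y) \<in> St v" "x \<noteq> 0" "\<bar>y\<bar> \<le> \<bar>x\<bar>" "v = \<sigma> (inv\<^bsub>H\<^esub> b) u"
          "u \<in> E" "(x', y') \<in> St u" "x' \<noteq> 0" "\<bar>y'\<bar> \<le> \<bar>x'\<bar>" using p unfolding E1_def by blast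
        then show False
          using det[of v x y x' "y' - 3 * x'"] St_a(4)[of u x' y'] slope_gap[of y x y' x' "-3"] by (simp add: mult.commute)
      qed
      then show "E1 \<inter> f (0, inv\<^bsub>H\<^esub> b) ` E1 = {}" unfolding fs by blast
      have False if p: "v \<in> \<sigma> b ` E1" "v \<in> \<sigma> (inv\<^bsub>H\<^esub> b) ` E1" for v
      proof -
        obtain u u' x y x' y' where *: "v = \<sigma> b u" "u \<in> E" "(x, y) \<in> St u" "x \<noteq> 0" "\<bar>y\<bar> \<le> \<bar>x\<bar>"
          "v = \<sigma> (inv\<^bsub>H\<^esub> b) u'" "u' \<in> E" "(x', y') \<in> St u'" "x' \<noteq> 0" "\<bar>y'\<bar> \<le> \<bar>x'\<bar>"
          using p unfolding E1_def by blast
        have "v \<in> E" using * \<sigma>_closed ab by simp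
        then have "x * (y' - 3 * x') = x' * (y + 3 * x)"
          using det[of v x "y + 3 * x" x' "y' - 3 * x'"] St_a(3)[of u x y] St_a(4)[of u' x' y'] * by simp
        then have "y * x' = (y' + (- 6) * x') * x" by (simp add: algebra_simps)
        then show False using slope_gap[of y x y' x' "-6"] * by simp
      qed
      then show "f (0, b) ` E1 \<inter> f (0, inv\<^bsub>H\<^esub> b) ` E1 = {}" unfolding fs by blast
    qed
    moreover have "E = E1 \<union> E2"
    proof -
      have "v \<in> E1 \<union> E2" if v: "v \<in> E" for v
      proof -
        have "St v \<noteq> {0}" by (rule nonzero_all[OF x0 v line(1)])
        then obtain x y where "(x, y) \<in> St v" "(x, y) \<noteq> (0, 0)" using St_zero[OF v] zero by fastforce
        then have "(x, y) \<in> St v" "x \<noteq> 0 \<and> \<bar>y\<bar> \<le> \<bar>x\<bar> \<or> y \<noteq> 0 \<and> \<bar>x\<bar> \<le> \<bar>y\<bar>" by auto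
        then show ?thesis using v unfolding E1_def E2_def by blast
      qed
      then show ?thesis using E12 by blast
    qed
    \<comment> \<open>The two halves cover \<open>E\<close>, although each has mean at most
      1/3.\<close>
    then have "1 \<le> \<mu> E1 + \<mu> E2"
      using invariant_mean_subadd[OF E(5) E12] E(5) by (simp add: invariant_mean_def)
    ultimately show False by linarith
  qed
qed

section \<open>Wreath products with \<open>\<int>\<close>\<close>

definition finsupp :: "('a, 'm) monoid_scheme \<Rightarrow> (int \<Rightarrow> 'a) set" where
  "finsupp K = {f. range f \<subseteq> carrier K \<and> finite {i. f i \<noteq> \<one>\<^bsub>K\<^esub>}}"

definition direct_sum :: "('a, 'm) monoid_scheme \<Rightarrow> (int \<Rightarrow> 'a) monoid" where
  "direct_sum K = \<lparr>carrier = finsupp K, monoid.mult = (\<lambda>f g i. f i \<otimes>\<^bsub>K\<^esub> g i), one = (\<lambda>_. \<one>\<^bsub>K\<^esub>)\<rparr>"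

lemma direct_sum_simps [simp]:
  "carrier (direct_sum K) = finsupp K"
  "f \<otimes>\<^bsub>direct_sum K\<^esub> g = (\<lambda>i. f i \<otimes>\<^bsub>K\<^esub> g i)"
  "\<one>\<^bsub>direct_sum K\<^esub> = (\<lambda>_. \<one>\<^bsub>K\<^esub>)"
  by (simp_all add: direct_sum_def)

context group begin

lemma finsupp_closed: "f \<in> finsupp G \<Longrightarrow> f i \<in> carrier G"
  by (auto simp: finsupp_def)

lemma finsupp_one: "(\<lambda>_. \<one>) \<in> finsupp G"
  by (simp add: finsupp_def image_subset_iff)

lemma finsupp_mult:
  assumes "f \<in> finsupp G" "g \<in> finsupp G"
  shows "(\<lambda>i. f i \<otimes> g i) \<in> finsupp G"
proof -
  have "finite ({i. f i \<noteq> \<one>} \<union> {i. g i \<noteq> \<one>})" using assms by (simp add: finsupp_def)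
  then have "finite {i. f i \<otimes> g i \<noteq> \<one>}" by (rule rev_finite_subset) auto
  then show ?thesis using assms by (auto simp: finsupp_def image_subset_iff)
qed

lemma finsupp_inv: "f \<in> finsupp G \<Longrightarrow> (\<lambda>i. inv f i) \<in> finsupp G"
  by (auto simp: finsupp_def image_subset_iff elim!: rev_finite_subset)

lemma finsupp_shift:
  assumes "f \<in> finsupp G" shows "(\<lambda>i. f (i - k)) \<in> finsupp G"
proof -
  have "{i. f (i - k) \<noteq> \<one>} = (\<lambda>i. i + k) ` {i. f i \<noteq> \<one>}"
    by (auto intro!: image_eqI[of _ _ "_ - k"])
  then show ?thesis using assms by (auto simp: finsupp_def)
qed

lemma finsupp_truncate:
  assumes "f \<in> finsupp G" shows "(\<lambda>i. if P i then f i else \<one>) \<in> finsupp G"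
proof -
  have "finite {i. f i \<noteq> \<one>}" using assms by (simp add: finsupp_def)
  then have "finite {i. (if P i then f i else \<one>) \<noteq> \<one>}" by (rule rev_finite_subset) auto
  then show ?thesis using assms by (auto simp: finsupp_def image_subset_iff)
qed

lemma finsupp_single: "x \<in> carrier G \<Longrightarrow> (\<lambda>i. if i = k then x else \<one>) \<in> finsupp G"
  by (auto simp: finsupp_def image_subset_iff intro: rev_finite_subset[of "{k}"])

lemma direct_sum_group: "group (direct_sum G)"
proof (rule groupI)
  fix f assume "f \<in> carrier (direct_sum G)"
  then show "\<exists>g\<in>carrier (direct_sum G). g \<otimes>\<^bsub>direct_sum G\<^esub> f = \<one>\<^bsub>direct_sum G\<^esub>"
    using finsupp_inv finsupp_closed by (intro bexI[of _ "\<lambda>i. inv f i"]) auto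
qed (auto simp: finsupp_mult finsupp_one finsupp_closed m_assoc)

lemma countable_finsupp:
  assumes "countable (carrier G)" shows "countable (finsupp G)"
proof -
  define enc where "enc f = (\<lambda>i. (i, f i)) ` {i :: int. f i \<noteq> \<one>}" for f :: "int \<Rightarrow> 'a"
  have "inj_on enc (finsupp G)"
  proof (rule inj_onI, rule ext)
    fix f g i assume "enc f = enc g"
    then have "\<And>i y. (i, y) \<in> enc f \<longleftrightarrow> (i, y) \<in> enc g" by simp
    then have "\<And>i y. (f i \<noteq> \<one> \<and> y = f i) \<longleftrightarrow> (g i \<noteq> \<one> \<and> y = g i)" by (auto simp: enc_def image_iff)
    then show "f i = g i" by metis
  qed
  moreover have "enc ` finsupp G \<subseteq> {A. A \<subseteq> UNIV \<times> carrier G \<and> finite A}"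
    by (auto simp: enc_def finsupp_def)
  moreover have "countable {A. A \<subseteq> (UNIV :: int set) \<times> carrier G \<and> finite A}"
  proof -
    have "countable ((UNIV :: int set) \<times> carrier G)" using assms by (intro countable_SIGMA) auto
    then show ?thesis
      using countable_Collect_finite_subset[of "(UNIV :: int set) \<times> carrier G"] by (simp add: conj_commute)
  qed
  ultimately show ?thesis by (meson countable_image_inj_on countable_subset)
qed

end

lemma countable_group_direct_sum:
  assumes K: "countable_group K" shows "countable_group (direct_sum K)"
proof -
  interpret group K using K by (simp add: countable_group_def)
  have "inj_on (\<lambda>x i. if i = (0 :: int) then x else \<one>\<^bsub>K\<^esub>) (carrier K)"
    by (rule inj_onI) (metis)
  moreover have "(\<lambda>x i. if i = (0 :: int) then x else \<one>\<^bsub>K\<^esub>) ` carrier K \<subseteq> finsupp K"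
    using finsupp_single by blast
  ultimately have "infinite (finsupp K)"
    using K unfolding countable_group_def by (meson finite_imageD finite_subset)
  then show ?thesis using K direct_sum_group countable_finsupp by (simp add: countable_group_def)
qed

text \<open>Applied in contrapositive form, to which the name refers. The functions supported at
  index 0 form a direct factor; those trivial at 0 are its commuting complement.\<close>

lemma direct_sum_not_class_A:
  assumes K: "countable_group K" and A: "class_A (direct_sum K)"
  shows "class_A K"
proof -
  interpret group K using K by (simp add: countable_group_def)
  let ?i = "\<lambda>x i. if i = (0 :: int) then x else \<one>\<^bsub>K\<^esub>"
  show ?thesis
  proof (rule class_A_commuting_factor[OF A K, where i = ?i and C = "{f \<in> finsupp K. f 0 = \<one>\<^bsub>K\<^esub>}"])
    show "?i \<in> hom K (direct_sum K)"
      using finsupp_single by (auto simp: hom_def fun_eq_iff)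
    show "inj_on ?i (carrier K)" by (rule inj_onI) metis
    fix f assume f: "f \<in> carrier (direct_sum K)"
    have "f = ?i (f 0) \<otimes>\<^bsub>direct_sum K\<^esub> (\<lambda>i. if i \<noteq> 0 then f i else \<one>\<^bsub>K\<^esub>)"
      using f finsupp_closed by (auto simp: fun_eq_iff)
    moreover have "(\<lambda>i. if i \<noteq> 0 then f i else \<one>\<^bsub>K\<^esub>) \<in> finsupp K" using f by (intro finsupp_truncate) simp
    ultimately show "\<exists>n\<in>carrier K. \<exists>c\<in>{f \<in> finsupp K. f 0 = \<one>\<^bsub>K\<^esub>}. f = ?i n \<otimes>\<^bsub>direct_sum K\<^esub> c"
      using f finsupp_closed by (intro bexI[of _ "f 0"] bexI[of _ "\<lambda>i. if i \<noteq> 0 then f i else \<one>\<^bsub>K\<^esub>"]) auto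
  qed (use finsupp_closed in \<open>auto simp: fun_eq_iff\<close>)
qed

text \<open>The action on the cosets of the subgroup of functions supported on \<open>[0, \<infinity>)\<close>; the coset of
  \<open>(g, k)\<close> is represented by \<open>k\<close> and the restriction of \<open>g\<close> to \<open>(-\<infinity>, k)\<close>.\<close>

definition wreath_points :: "('a, 'm) monoid_scheme \<Rightarrow> ((int \<Rightarrow> 'a) \<times> int) set" where
  "wreath_points K = {(f, k). f \<in> finsupp K \<and> (\<forall>i\<ge>k. f i = \<one>\<^bsub>K\<^esub>)}"

text \<open>Left multiplication by \<open>p\<close> on cosets: shift the function, multiply it, then
  cut it off at the new bound to return to the chosen representative.\<close>

definition wreath_act :: "('a, 'm) monoid_scheme \<Rightarrow> (int \<Rightarrow> 'a) \<times> int \<Rightarrow> (int \<Rightarrow> 'a) \<times> int \<Rightarrow> (int \<Rightarrow> 'a) \<times> int" where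
  "wreath_act K p q =
     ((\<lambda>i. if i < snd q + snd p then fst p i \<otimes>\<^bsub>K\<^esub> fst q (i - snd p) else \<one>\<^bsub>K\<^esub>), snd q + snd p)"

text \<open>The function part of a group element has finite support, so on trivial functions cut off
  to the left of that support the element acts as a pure shift; this feeds
  \<open>folner_shiftI\<close>. The isomorphism \<open>d\<close> allows any copy of the direct sum
  as base group.\<close>

lemma class_A_wreath:
  fixes K :: "('a, 'm) monoid_scheme" and N :: "('b, 'n) monoid_scheme"
  assumes K: "countable_group K" and N: "group N" and d: "d \<in> iso N (direct_sum K)"
    and \<theta>: "\<theta> \<in> hom integer_group (AutoGroup N)"
    and shift: "\<And>n k. n \<in> carrier N \<Longrightarrow> d (\<theta> k n) = (\<lambda>i. d n (i - k))"
  shows "class_A (semidirect_product N integer_group \<theta>)"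
proof -
  interpret K: group K using K by (simp add: countable_group_def)
  interpret N: group N by fact
  let ?G = "semidirect_product N integer_group \<theta>"
  interpret G: group ?G using semidirect_product_group[OF N _ \<theta>] by simp
  have d_hom: "d \<in> hom N (direct_sum K)" and d_bij: "bij_betw d (carrier N) (finsupp K)"
    using d by (auto simp: iso_def)
  interpret d: group_hom N "direct_sum K" d
    using N K.direct_sum_group d_hom by (simp add: group_hom_def group_hom_axioms_def)
  have dc: "d n \<in> finsupp K" if "n \<in> carrier N" for n using d.hom_closed[OF that] by simp
  have dcc: "d n i \<in> carrier K" if "n \<in> carrier N" for n i using K.finsupp_closed[OF dc[OF that]] .
  have d_mult: "d (n \<otimes>\<^bsub>N\<^esub> m) i = d n i \<otimes>\<^bsub>K\<^esub> d m i" if "n \<in> carrier N" "m \<in> carrier N" for n m i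
    using d.hom_mult[OF that] by simp
  have \<theta>c: "\<theta> k n \<in> carrier N" if "n \<in> carrier N" for k n
  proof -
    have "\<theta> k \<in> carrier (AutoGroup N)" using \<theta> by (auto simp: hom_def)
    then show ?thesis using that by (auto simp: AutoGroup_def auto_def hom_def)
  qed
  define f where "f p = wreath_act K (d (fst p), snd p)" for p :: "'b \<times> int"
  let ?E = "wreath_points K"
  interpret set_action ?G ?E f
  proof
    fix p q assume p: "p \<in> carrier ?G" and q: "q \<in> ?E"
    have "(\<lambda>i. if i < snd q + snd p then d (fst p) i \<otimes>\<^bsub>K\<^esub> fst q (i - snd p) else \<one>\<^bsub>K\<^esub>) \<in> finsupp K"
      using p q by (intro K.finsupp_truncate K.finsupp_mult K.finsupp_shift dc) (auto simp: wreath_points_def)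
    then show "f p q \<in> ?E" unfolding f_def wreath_act_def fst_conv snd_conv by (auto simp: wreath_points_def)
  next
    fix q assume q: "q \<in> ?E"
    then obtain g k where g: "q = (g, k)" "g \<in> finsupp K" "\<And>i. k \<le> i \<Longrightarrow> g i = \<one>\<^bsub>K\<^esub>"
      by (auto simp: wreath_points_def)
    have "d \<one>\<^bsub>N\<^esub> i = \<one>\<^bsub>K\<^esub>" for i using d.hom_one by simp
    then show "f \<one>\<^bsub>?G\<^esub> q = q"
      using g K.finsupp_closed by (auto simp: f_def wreath_act_def fun_eq_iff)
  next
    fix p p' q assume p: "p \<in> carrier ?G" "p' \<in> carrier ?G" and q: "q \<in> ?E"
    obtain n k n' k' where pp: "p = (n, k)" "p' = (n', k')" "n \<in> carrier N" "n' \<in> carrier N"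
      using p by auto
    obtain g l where g: "q = (g, l)" "g \<in> finsupp K" using q by (auto simp: wreath_points_def)
    show "f (p \<otimes>\<^bsub>?G\<^esub> p') q = f p (f p' q)"
      using pp g \<theta>c[of n' k] dcc K.finsupp_closed[OF g(2)]
      by (auto simp: f_def wreath_act_def fun_eq_iff d_mult shift K.m_assoc algebra_simps)
  qed
  have x0: "((\<lambda>_. \<one>\<^bsub>K\<^esub>), 0) \<in> ?E" using K.finsupp_one by (auto simp: wreath_points_def)
  show ?thesis
  proof (rule class_A_folnerI)
    have "infinite (carrier N)" "countable (carrier N)"
      using countable_group_direct_sum[OF K] d_bij bij_betw_finite
      by (auto simp: countable_group_def bij_betw_def dest: countable_image_inj_on)
    then show "countable_group ?G"
      using G.is_group N.one_closed by (auto simp: countable_group_def finite_cartesian_product_iff)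
    show "transitive_on ?G ?E f"
    proof (rule transitive_onI[OF x0])
      fix q assume "q \<in> ?E"
      then obtain g k where g: "q = (g, k)" "g \<in> finsupp K" "\<And>i. k \<le> i \<Longrightarrow> g i = \<one>\<^bsub>K\<^esub>"
        by (auto simp: wreath_points_def)
      obtain n where n: "n \<in> carrier N" "d n = g" using d_bij g(2) by (metis bij_betw_imp_surj_on imageE)
      then have "f (n, k) ((\<lambda>_. \<one>\<^bsub>K\<^esub>), 0) = q"
        using g K.finsupp_closed by (auto simp: f_def wreath_act_def fun_eq_iff)
      then show "\<exists>p\<in>carrier ?G. f p ((\<lambda>_. \<one>\<^bsub>K\<^esub>), 0) = q" using n by (intro bexI[of _ "(n, k)"]) auto
    qed
    show "faithful_on ?G ?E f"
      unfolding faithful_on_def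
    proof (intro ballI impI)
      fix p assume p: "p \<in> carrier ?G" "\<forall>q\<in>?E. f p q = q"
      obtain n k where pn: "p = (n, k)" "n \<in> carrier N" using p by auto
      have q: "f p ((\<lambda>_. \<one>\<^bsub>K\<^esub>), l) = ((\<lambda>_. \<one>\<^bsub>K\<^esub>), l)" for l
        using p(2) K.finsupp_one by (auto simp: wreath_points_def)
      have k: "k = 0" using q[of 0] by (simp add: pn f_def wreath_act_def)
      have "d n i = \<one>\<^bsub>K\<^esub>" for i
      proof -
        \<comment> \<open>The cut-off \<open>i + 1\<close> is the smallest one that keeps the value
          at \<open>i\<close> visible.\<close>
        have "fst (f p ((\<lambda>_. \<one>\<^bsub>K\<^esub>), i + 1)) i = \<one>\<^bsub>K\<^esub>" unfolding q by simp
        then show ?thesis using dcc[OF pn(2)] by (simp add: pn k f_def wreath_act_def)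
      qed
      then have "d n = d \<one>\<^bsub>N\<^esub>" using d.hom_one by (simp add: fun_eq_iff)
      then have "n = \<one>\<^bsub>N\<^esub>"
        by (rule inj_onD[OF bij_betw_imp_inj_on[OF d_bij] _ pn(2) N.one_closed])
      then show "p = \<one>\<^bsub>?G\<^esub>" using pn k by simp
    qed
    show "folner_action ?G ?E f"
    proof (rule folner_shiftI[where pt = "\<lambda>k. ((\<lambda>_. \<one>\<^bsub>K\<^esub>), k)" and e = snd])
      fix p assume p: "p \<in> carrier ?G"
      define S where "S = {i. d (fst p) i \<noteq> \<one>\<^bsub>K\<^esub>}"
      have finS: "finite S" using dc[of "fst p"] p by (auto simp: finsupp_def S_def)
      have "f p ((\<lambda>_. \<one>\<^bsub>K\<^esub>), k) = ((\<lambda>_. \<one>\<^bsub>K\<^esub>), k + snd p)" if k: "k < - (\<Sum>i\<in>S. \<bar>i\<bar>) - snd p" for k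
      proof -
        have "d (fst p) i = \<one>\<^bsub>K\<^esub>" if i: "i < k + snd p" for i
        proof (rule ccontr)
          assume "d (fst p) i \<noteq> \<one>\<^bsub>K\<^esub>"
          then have "\<bar>i\<bar> \<le> (\<Sum>i\<in>S. \<bar>i\<bar>)" using finS by (intro member_le_sum) (auto simp: S_def)
          then show False using k i by linarith
        qed
        then show ?thesis by (auto simp: f_def wreath_act_def fun_eq_iff)
      qed
      then show "\<exists>b. \<forall>k<b. f p ((\<lambda>_. \<one>\<^bsub>K\<^esub>), k) = ((\<lambda>_. \<one>\<^bsub>K\<^esub>), k + snd p)" by blast
    qed (use K.finsupp_one in \<open>auto simp: wreath_points_def inj_on_def\<close>)
  qed
qed

text \<open>The cosets are the sets \<open>carrier N \<times> {j}\<close>, which the group permutes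
  by shifting \<open>j\<close>; the action factors through the amenable group Z.\<close>

lemma co_amenable_semidirect_int:
  assumes N: "group N" "countable (carrier N)" and \<theta>: "\<theta> \<in> hom integer_group (AutoGroup N)"
  shows "co_amenable (carrier N \<times> {\<one>\<^bsub>integer_group\<^esub>}) (semidirect_product N integer_group \<theta>)"
proof -
  let ?G = "semidirect_product N integer_group \<theta>" and ?H = "carrier N \<times> {0 :: int}"
  interpret N: group N by fact
  interpret G: group ?G using semidirect_product_group[OF N(1) _ \<theta>] by simp
  have aut: "\<theta> k \<in> auto N" for k
    using \<theta> by (auto simp: hom_def AutoGroup_def)
  have \<theta>_img: "\<theta> k ` carrier N = carrier N" for k
    using aut[of k] by (auto simp: auto_def Bij_def bij_betw_def)
  have \<theta>c: "\<theta> k n \<in> carrier N" if "n \<in> carrier N" for k n using \<theta>_img[of k] that by blast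
  have "\<theta> 0 = (\<lambda>x\<in>carrier N. x)"
    using group_hom.hom_one[of integer_group "AutoGroup N" \<theta>] \<theta> N.AutoGroup
    by (simp add: group_hom_def group_hom_axioms_def AutoGroup_def BijGroup_def)
  then have \<theta>0: "\<theta> 0 n = n" if "n \<in> carrier N" for n using that by simp
  have coset: "(n, i) <#\<^bsub>?G\<^esub> (carrier N \<times> {j}) = carrier N \<times> {i + j}" if n: "n \<in> carrier N" for n i j
  proof (intro subset_antisym subsetI)
    fix x assume "x \<in> carrier N \<times> {i + j}"
    then obtain m where m: "m \<in> carrier N" "x = (m, i + j)" by auto
    obtain m' where m': "m' \<in> carrier N" "\<theta> i m' = inv\<^bsub>N\<^esub> n \<otimes>\<^bsub>N\<^esub> m"
      using \<theta>_img[of i] n m by (metis N.inv_closed N.m_closed imageE)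
    then have "x = (n, i) \<otimes>\<^bsub>?G\<^esub> (m', j)" using n m by (simp flip: N.m_assoc)
    then show "x \<in> (n, i) <#\<^bsub>?G\<^esub> (carrier N \<times> {j})" using m' unfolding l_coset_def by blast
  qed (use n \<theta>c in \<open>auto simp: l_coset_def\<close>)
  have H: "subgroup ?H ?G"
  proof (rule G.subgroupI)
    show "inv\<^bsub>?G\<^esub> p \<in> ?H" if p: "p \<in> ?H" for p
    proof -
      obtain n where n: "n \<in> carrier N" "p = (n, 0)" using p by auto
      have "inv\<^bsub>?G\<^esub> p = (inv\<^bsub>N\<^esub> n, 0)"
        by (rule G.inv_equality) (use n in \<open>simp_all add: \<theta>0\<close>)
      then show ?thesis using n by simp
    qed
  qed (use N.one_closed in \<open>auto simp: \<theta>0\<close>)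
  interpret c: set_action ?G "lcosets\<^bsub>?G\<^esub> ?H" "\<lambda>g C. g <#\<^bsub>?G\<^esub> C"
    by (rule G.lcosets_set_action[OF subgroup.subset[OF H]])
  have "folner_action ?G (lcosets\<^bsub>?G\<^esub> ?H) (\<lambda>g C. g <#\<^bsub>?G\<^esub> C)"
  proof (rule c.folner_shiftI[where pt = "\<lambda>j. carrier N \<times> {j}" and e = snd])
    show "carrier N \<times> {j} \<in> lcosets\<^bsub>?G\<^esub> ?H" for j
      using coset[OF N.one_closed, of j 0] N.one_closed unfolding LCOSETS_def by force
    show "inj_on (\<lambda>j. carrier N \<times> {j}) {..<0}" using N.one_closed by (auto simp: inj_on_def)
    show "\<exists>b. \<forall>k<b. p <#\<^bsub>?G\<^esub> (carrier N \<times> {k}) = carrier N \<times> {k + snd p}" if "p \<in> carrier ?G" for p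
      using that coset[of "fst p" "snd p"] by (auto simp: add.commute)
  qed
  then obtain \<mu> where "invariant_mean ?G (lcosets\<^bsub>?G\<^esub> ?H) (\<lambda>g C. g <#\<^bsub>?G\<^esub> C) \<mu>"
    using c.folner_imp_mean N(2) by fastforce
  then show ?thesis
    using H c.amenable_action_restrict_iff unfolding co_amenable_def one_integer_group by blast
qed

text \<open>The direct sum is replaced by a copy on the natural numbers, to which the shift is transported.\<close>

lemma wreath_exists:
  assumes K: "countable_group (K :: ('a, 'm) monoid_scheme)"
  obtains N :: "nat monoid" and \<theta> d where "countable_group N" "d \<in> iso N (direct_sum K)"
    "\<theta> \<in> hom integer_group (AutoGroup N)" "class_A (semidirect_product N integer_group \<theta>)"
proof -
  interpret K: group K using K by (simp add: countable_group_def)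
  interpret D: group "direct_sum K" by (rule K.direct_sum_group)
  obtain N :: "nat monoid" and d where N: "group N" "d \<in> iso N (direct_sum K)" "countable_group N"
    by (rule nat_copy[OF countable_group_direct_sum[OF K]])
  interpret N: group N by fact
  have d_hom: "d \<in> hom N (direct_sum K)" and d_bij: "bij_betw d (carrier N) (finsupp K)"
    using N(2) by (auto simp: iso_def)
  define e where "e = inv_into (carrier N) d"
  have dc: "d n \<in> finsupp K" if "n \<in> carrier N" for n using d_bij that by (auto simp: bij_betw_def)
  have ec: "e f \<in> carrier N" "d (e f) = f" if "f \<in> finsupp K" for f
    using d_bij that by (auto simp: e_def bij_betw_def inv_into_into f_inv_into_f)
  have ed: "e (d n) = n" if "n \<in> carrier N" for n
    using d_bij that by (auto simp: e_def bij_betw_def)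
  have d_inj: "m = n" if "d m = d n" "m \<in> carrier N" "n \<in> carrier N" for m n
    using ed that by metis
  have d_mult: "d (m \<otimes>\<^bsub>N\<^esub> n) = (\<lambda>i. d m i \<otimes>\<^bsub>K\<^esub> d n i)" if "m \<in> carrier N" "n \<in> carrier N" for m n
    using d_hom that by (auto simp: hom_def)
  define \<theta> where "\<theta> k = (\<lambda>n\<in>carrier N. e (\<lambda>i. d n (i - k)))" for k :: int
  have d\<theta>: "d (\<theta> k n) = (\<lambda>i. d n (i - k))" and \<theta>c: "\<theta> k n \<in> carrier N" if "n \<in> carrier N" for k n
    using that ec K.finsupp_shift[OF dc[OF that]] by (simp_all add: \<theta>_def)
  have \<theta>\<theta>: "\<theta> k (\<theta> l n) = \<theta> (k + l) n" if "n \<in> carrier N" for k l n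
    by (rule d_inj) (use that d\<theta> \<theta>c in \<open>simp_all add: algebra_simps\<close>)
  have \<theta>0: "\<theta> 0 n = n" if "n \<in> carrier N" for n
    by (rule d_inj) (use that d\<theta> \<theta>c in simp_all)
  have "bij_betw (\<theta> k) (carrier N) (carrier N)" for k
    by (rule bij_betw_byWitness[where f' = "\<theta> (- k)"]) (use \<theta>\<theta> \<theta>0 \<theta>c in auto)
  moreover have "\<theta> k \<in> hom N N" for k
    by (auto simp: hom_def \<theta>c intro!: d_inj) (simp add: d\<theta> d_mult \<theta>c)
  moreover have "\<theta> k \<in> extensional (carrier N)" for k by (simp add: \<theta>_def)
  ultimately have aut: "\<theta> k \<in> auto N" for k by (simp add: auto_def Bij_def)
  have "\<theta> (k + l) = compose (carrier N) (\<theta> k) (\<theta> l)" for k l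
    using \<theta>\<theta> by (auto simp: compose_def fun_eq_iff) (simp add: \<theta>_def)
  then have \<theta>_hom: "\<theta> \<in> hom integer_group (AutoGroup N)"
    using aut by (auto simp: hom_def AutoGroup_def BijGroup_def auto_def)
  show ?thesis
    by (rule that[OF N(3,2) \<theta>_hom class_A_wreath[OF K N(1,2) \<theta>_hom d\<theta>]])
qed

lemma mon_compose: "f \<in> mon A B \<Longrightarrow> g \<in> mon B C \<Longrightarrow> g \<circ> f \<in> mon A C"
  unfolding mon_def hom_def inj_on_def by (auto simp: Pi_iff)

text \<open>The embedding is a composite of injections: into index 0 of the direct sum, to its copy
  \<open>N\<close>, into the semidirect product, and to the copy of that on
  \<open>nat\<close>.\<close>

lemma embeds_in_class_A:
  assumes K: "countable_group K"
  shows "\<exists>W :: nat monoid. class_A W \<and> mon K W \<noteq> {}"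
proof -
  interpret K: group K using K by (simp add: countable_group_def)
  obtain N :: "nat monoid" and \<theta> d where N: "countable_group N" "d \<in> iso N (direct_sum K)"
    "\<theta> \<in> hom integer_group (AutoGroup N)" and A: "class_A (semidirect_product N integer_group \<theta>)"
    by (rule wreath_exists[OF K])
  let ?G = "semidirect_product N integer_group \<theta>"
  have gN: "group N" using N(1) by (simp add: countable_group_def)
  have cG: "countable_group ?G" using A by (simp add: class_A_def)
  obtain W :: "nat monoid" and h where W: "group W" "h \<in> iso W ?G"
    by (rule nat_copy[OF cG])
  have AW: "class_A W" by (rule class_A_iso[OF A W])
  interpret W: group W by fact
  have "inv_into (carrier W) h \<in> iso ?G W" by (rule W.iso_set_sym[OF W(2)])
  then have 1: "inv_into (carrier W) h \<in> mon ?G W" by (auto simp: iso_iff mon_def)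
  have 2: "(\<lambda>n. (n, 0)) \<in> mon N ?G"
  proof -
    have "\<theta> 0 = (\<lambda>x\<in>carrier N. x)"
      using group_hom.hom_one[of integer_group "AutoGroup N" \<theta>] N(3) group.AutoGroup[OF gN]
      by (simp add: group_hom_def group_hom_axioms_def AutoGroup_def BijGroup_def)
    then show ?thesis by (auto simp: mon_def hom_def inj_on_def)
  qed
  interpret N: group N by (rule gN)
  have "inv_into (carrier N) d \<in> iso (direct_sum K) N" by (rule N.iso_set_sym[OF N(2)])
  then have 3: "inv_into (carrier N) d \<in> mon (direct_sum K) N" by (auto simp: iso_iff mon_def)
  have 4: "(\<lambda>x i. if i = (0 :: int) then x else \<one>\<^bsub>K\<^esub>) \<in> mon K (direct_sum K)"
    using K.finsupp_single by (auto simp: mon_def hom_def fun_eq_iff inj_on_def)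
  show ?thesis using AW mon_compose[OF mon_compose[OF mon_compose[OF 4 3] 2] 1] by blast
qed

section \<open>Thompson's group\<close>

text \<open>The breakpoint clause of \<open>thompson_carrier\<close> with the set \<open>B\<close>
  exposed, so that breakpoints can be followed through composition and inversion.\<close>

definition dyadic_affine :: "(real \<Rightarrow> real) \<Rightarrow> real set \<Rightarrow> bool" where
  "dyadic_affine f B \<longleftrightarrow> finite B \<and> B \<subseteq> dyadic \<and>
     (\<forall>a b. 0 \<le> a \<and> a < b \<and> b \<le> 1 \<and> {a<..<b} \<inter> B = {} \<longrightarrow>
        (\<exists>(k::int) c. \<forall>t\<in>{a..b}. f t = 2 powi k * t + c))"

lemma thompson_carrier_iff:
  "f \<in> thompson_carrier \<longleftrightarrow> f \<in> extensional {0..1} \<and> (\<exists>f'. homeomorphism {0..1} {0..1} f f') \<and>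
     strict_mono_on {0..1} f \<and> (\<exists>B. dyadic_affine f B)"
  unfolding thompson_carrier_def dyadic_affine_def by blast

lemma dyadic_affineE:
  assumes "dyadic_affine f B" "0 \<le> a" "a < b" "b \<le> 1" "{a<..<b} \<inter> B = {}"
  obtains k :: int and c where "\<And>t. t \<in> {a..b} \<Longrightarrow> f t = 2 powi k * t + c"
  using assms unfolding dyadic_affine_def by blast

lemma dyadic_iff: "x \<in> dyadic \<longleftrightarrow> (\<exists>k n. x = real_of_int k / 2 ^ n)"
  by (auto simp: dyadic_def)

lemma dyadic_minus: "x \<in> dyadic \<Longrightarrow> - x \<in> dyadic"
  unfolding dyadic_iff by (metis minus_divide_left of_int_minus)

lemma dyadic_add:
  assumes "x \<in> dyadic" "y \<in> dyadic" shows "x + y \<in> dyadic"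
proof -
  obtain k m l n where "x = real_of_int k / 2 ^ m" "y = real_of_int l / 2 ^ n"
    using assms unfolding dyadic_iff by blast
  then have "x + y = real_of_int (k * 2 ^ n + l * 2 ^ m) / 2 ^ (m + n)"
    by (simp add: add_divide_distrib power_add)
  then show ?thesis unfolding dyadic_iff by blast
qed

lemma dyadic_diff: "x \<in> dyadic \<Longrightarrow> y \<in> dyadic \<Longrightarrow> x - y \<in> dyadic"
  using dyadic_add[of x "- y"] dyadic_minus by simp

lemma dyadic_scale:
  assumes "x \<in> dyadic" shows "2 powi k * x \<in> dyadic"
proof -
  obtain l n where x: "x = real_of_int l / 2 ^ n" using assms unfolding dyadic_iff by blast
  show ?thesis
  proof (cases "0 \<le> k")
    case True
    then have "2 powi k * x = real_of_int (2 ^ nat k * l) / 2 ^ n" by (simp add: x power_int_def)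
    then show ?thesis unfolding dyadic_iff by blast
  next
    case False
    then have "2 powi k * x = real_of_int l / 2 ^ (n + nat (- k))"
      by (simp add: x power_int_def power_add field_simps)
    then show ?thesis unfolding dyadic_iff by blast
  qed
qed

lemma dyadic_scale_iff: "2 powi k * x \<in> dyadic \<longleftrightarrow> x \<in> dyadic"
proof
  assume "2 powi k * x \<in> dyadic"
  then have "2 powi (- k) * (2 powi k * x) \<in> dyadic" by (rule dyadic_scale)
  then show "x \<in> dyadic" by (simp add: power_int_minus flip: mult.assoc)
qed (rule dyadic_scale)

lemma dyadicI: "real_of_int k / 2 ^ n \<in> dyadic"
  unfolding dyadic_iff by blast

lemma dyadic_0 [simp]: "0 \<in> dyadic"
  using dyadicI[of 0 0] by simp

lemma dyadic_1 [simp]: "1 \<in> dyadic"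
  using dyadicI[of 1 0] by simp

lemma countable_dyadic: "countable dyadic"
proof -
  have "dyadic = (\<lambda>(k, n). real_of_int k / 2 ^ n) ` (UNIV \<times> UNIV)" by (auto simp: dyadic_def)
  then show ?thesis by (metis countable_image countableI_type)
qed

lemma dyadic_dense:
  assumes "x < y" obtains d where "d \<in> dyadic" "x < d" "d < y"
proof -
  obtain n where n: "(1 / 2) ^ n < y - x" using real_arch_pow_inv[of "y - x" "1 / 2"] assms by auto
  let ?k = "\<lfloor>x * 2 ^ n\<rfloor> + 1"
  have "x * 2 ^ n < real_of_int ?k" "real_of_int ?k \<le> x * 2 ^ n + 1" by linarith+
  then have "x < real_of_int ?k / 2 ^ n" "real_of_int ?k / 2 ^ n \<le> x + (1 / 2) ^ n"
    by (simp_all add: field_simps)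
  then show ?thesis using n by (intro that[OF dyadicI, of ?k n]) linarith+
qed

lemma thompson_bij:
  assumes "f \<in> thompson_carrier" shows "bij_betw f {0..1} {0..1}"
  using assms unfolding thompson_carrier_iff homeomorphism_def
  by (metis bij_betw_def inj_on_inverseI)

lemma thompson_Bij: "thompson_carrier \<subseteq> Bij {0..1}"
  using thompson_bij by (auto simp: Bij_def thompson_carrier_iff)

lemma thompson_less:
  assumes "f \<in> thompson_carrier" "x \<in> {0..1}" "y \<in> {0..1}"
  shows "f x < f y \<longleftrightarrow> x < y"
  using assms unfolding thompson_carrier_iff by (metis linorder_neqE less_asym strict_mono_onD order_less_irrefl)

lemma thompson_range: "f \<in> thompson_carrier \<Longrightarrow> x \<in> {0..1} \<Longrightarrow> f x \<in> {0..1}"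
  using thompson_bij by (metis bij_betw_apply)

lemma thompson_fixes:
  assumes f: "f \<in> thompson_carrier" shows "f 0 = 0" "f 1 = 1"
proof -
  obtain x where x: "x \<in> {0..1}" "f x = 0" using thompson_bij[OF f] unfolding bij_betw_def
    by (metis atLeastAtMost_iff imageE order_refl zero_le_one)
  then show "f 0 = 0" using thompson_less[OF f, of 0 x] thompson_range[OF f, of 0] by (cases "x = 0") auto
  obtain y where y: "y \<in> {0..1}" "f y = 1" using thompson_bij[OF f] unfolding bij_betw_def
    by (metis atLeastAtMost_iff imageE order_refl zero_le_one)
  then show "f 1 = 1" using thompson_less[OF f, of y 1] thompson_range[OF f, of 1] by (cases "y = 1") auto
qed

text \<open>Induction on the number of breakpoints before \<open>x\<close>. From the last of them
  (or from 0) to \<open>x\<close> the map is affine with slope a power of 2, and its intercept is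
  dyadic because the left end point and its value are.\<close>

lemma dyadic_affine_preserves:
  assumes f0: "f 0 = 0" and B: "dyadic_affine f B" and x: "x \<in> {0..1}"
  shows "f x \<in> dyadic \<longleftrightarrow> x \<in> dyadic"
  using x
proof (induction "card (B \<inter> {0<..<x})" arbitrary: x rule: less_induct)
  case less
  have finB: "finite B" "B \<subseteq> dyadic" using B by (auto simp: dyadic_affine_def)
  show ?case
  proof (cases "x = 0")
    case False
    then have x: "0 < x" "x \<le> 1" using less.prems by auto
    define b where "b = Max (insert 0 (B \<inter> {0<..<x}))"
    have b: "b \<in> insert 0 (B \<inter> {0<..<x})" unfolding b_def using finB by (intro Max_in) auto
    have bmax: "y \<le> b" if "y \<in> B" "0 < y" "y < x" for y
      unfolding b_def using finB that by (intro Max_ge) auto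
    have b01: "0 \<le> b" "b < x" using b x by auto
    have bd: "b \<in> dyadic" using b finB by auto
    have fb: "f b \<in> dyadic"
    proof (cases "b = 0")
      case False
      then have "b \<in> B" "0 < b" using b by auto
      then have "B \<inter> {0<..<b} \<subset> B \<inter> {0<..<x}" using b01 by auto
      then have "card (B \<inter> {0<..<b}) < card (B \<inter> {0<..<x})" using finB by (intro psubset_card_mono) auto
      then show ?thesis using less.hyps[of b] b01 x bd by auto
    qed (simp add: f0)
    have "{b<..<x} \<inter> B = {}" using bmax b01 by force
    then obtain k :: int and c where kc: "\<And>t. t \<in> {b..x} \<Longrightarrow> f t = 2 powi k * t + c"
      by (rule dyadic_affineE[OF B b01 x(2)]) (rule that)
    have fb': "f b = 2 powi k * b + c" and fx: "f x = 2 powi k * x + c" using kc b01 by auto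
    have c: "c \<in> dyadic" using dyadic_diff[OF fb dyadic_scale[OF bd, of k]] fb' by simp
    have "f x \<in> dyadic \<longleftrightarrow> 2 powi k * x \<in> dyadic"
      using dyadic_add[OF _ c, of "2 powi k * x"] dyadic_diff[OF _ c, of "f x"] fx by auto
    then show ?thesis by (simp add: dyadic_scale_iff)
  qed (simp add: f0)
qed

lemma thompson_dyadic:
  "f \<in> thompson_carrier \<Longrightarrow> x \<in> {0..1} \<Longrightarrow> f x \<in> dyadic \<longleftrightarrow> x \<in> dyadic"
  using dyadic_affine_preserves thompson_fixes(1) unfolding thompson_carrier_iff by blast

lemma homeomorphism_restrict:
  assumes "homeomorphism S T f g"
  shows "homeomorphism S T (restrict f S) (restrict g T)"
  using assms by (rule homeomorphism_cong) auto

lemma dyadic_affine_cong: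
  assumes "dyadic_affine f B" "\<And>t. t \<in> {0..1} \<Longrightarrow> f' t = f t" shows "dyadic_affine f' B"
proof -
  have "\<exists>(k::int) c. \<forall>t\<in>{a..b}. f' t = 2 powi k * t + c"
    if ab: "0 \<le> a \<and> a < b \<and> b \<le> 1 \<and> {a<..<b} \<inter> B = {}" for a b
  proof -
    obtain k :: int and c where kc: "\<And>t. t \<in> {a..b} \<Longrightarrow> f t = 2 powi k * t + c"
      using dyadic_affineE[OF assms(1), of a b] ab by metis
    have "f' t = 2 powi k * t + c" if "t \<in> {a..b}" for t
      using kc[OF that] assms(2)[of t] that ab by simp
    then show ?thesis by blast
  qed
  then show ?thesis using assms(1) unfolding dyadic_affine_def by blast
qed

lemma thompson_restrictI:
  assumes "homeomorphism {0..1} {0..1} f f'" "strict_mono_on {0..1} f" "dyadic_affine f B"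
  shows "restrict f {0..1} \<in> thompson_carrier"
  unfolding thompson_carrier_iff
proof (intro conjI)
  show "\<exists>f'. homeomorphism {0..1} {0..1} (restrict f {0..1}) f'"
    using homeomorphism_restrict[OF assms(1)] by blast
  show "strict_mono_on {0..1} (restrict f {0..1})" using assms(2) by (auto simp: strict_mono_on_def)
  show "\<exists>B. dyadic_affine (restrict f {0..1}) B"
    using dyadic_affine_cong[OF assms(3), of "restrict f {0..1}"] by auto
qed simp

text \<open>Breakpoints of the composite are those of \<open>f\<close> and the
  \<open>f\<close>-preimages of those of \<open>g\<close>; the latter are dyadic because a point
  with dyadic image is dyadic.\<close>

lemma thompson_compose:
  assumes f: "f \<in> thompson_carrier" and g: "g \<in> thompson_carrier"
  shows "compose {0..1} g f \<in> thompson_carrier"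
proof -
  obtain f' g' Bf Bg where h: "homeomorphism {0..1} {0..1} f f'" "homeomorphism {0..1} {0..1} g g'"
    and B: "dyadic_affine f Bf" "dyadic_affine g Bg"
    using f g unfolding thompson_carrier_iff by blast
  let ?B = "Bf \<union> {x \<in> {0..1}. f x \<in> Bg}"
  have fin: "finite ?B"
  proof -
    have "inj_on f {x \<in> {0..1}. f x \<in> Bg}"
      using thompson_bij[OF f] by (auto simp: bij_betw_def intro: inj_on_subset)
    moreover have "finite (f ` {x \<in> {0..1}. f x \<in> Bg})"
      using B(2) by (auto simp: dyadic_affine_def intro: finite_subset[of _ Bg])
    ultimately show ?thesis using B(1) finite_imageD by (auto simp: dyadic_affine_def)
  qed
  have "dyadic_affine (g \<circ> f) ?B"
    unfolding dyadic_affine_def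
  proof (intro conjI allI impI)
    show "?B \<subseteq> dyadic" using B thompson_dyadic[OF f] by (auto simp: dyadic_affine_def)
    fix a b :: real assume ab: "0 \<le> a \<and> a < b \<and> b \<le> 1 \<and> {a<..<b} \<inter> ?B = {}"
    then obtain k :: int and c where kc: "\<And>t. t \<in> {a..b} \<Longrightarrow> f t = 2 powi k * t + c"
      using dyadic_affineE[OF B(1), of a b] by auto
    have r: "0 \<le> f a" "f a < f b" "f b \<le> 1"
      using thompson_range[OF f, of a] thompson_range[OF f, of b] thompson_less[OF f, of a b] ab by auto
    have "{f a<..<f b} \<inter> Bg = {}"
    proof -
      have False if y: "f a < y" "y < f b" "y \<in> Bg" for y
      proof -
        obtain t where t: "t \<in> {0..1}" "f t = y"
          using thompson_bij[OF f] y r unfolding bij_betw_def by (metis atLeastAtMost_iff imageE less_le_trans le_less_trans less_imp_le)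
        then have "a < t" "t < b" using thompson_less[OF f, of a t] thompson_less[OF f, of t b] y ab by auto
        then show False using t y ab by auto
      qed
      then show ?thesis by auto
    qed
    then obtain l :: int and d where ld: "\<And>t. t \<in> {f a..f b} \<Longrightarrow> g t = 2 powi l * t + d"
      by (rule dyadic_affineE[OF B(2) r]) (rule that)
    have "(g \<circ> f) t = 2 powi (l + k) * t + (2 powi l * c + d)" if t: "t \<in> {a..b}" for t
    proof -
      have "f t \<in> {f a..f b}"
        using thompson_less[OF f, of a t] thompson_less[OF f, of t b] t ab by (cases "t = a"; cases "t = b") auto
      then show ?thesis using ld kc[OF t] by (simp add: power_int_add algebra_simps)
    qed
    then show "\<exists>(k::int) c. \<forall>t\<in>{a..b}. (g \<circ> f) t = 2 powi k * t + c" by blast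
  qed (rule fin)
  moreover have "strict_mono_on {0..1} (g \<circ> f)"
    using thompson_less[OF f] thompson_less[OF g] thompson_range[OF f] by (auto simp: strict_mono_on_def)
  ultimately have "restrict (g \<circ> f) {0..1} \<in> thompson_carrier"
    by (intro thompson_restrictI[OF homeomorphism_compose[OF h]])
  then show ?thesis by (simp add: compose_def restrict_def comp_def)
qed

text \<open>The breakpoints of the inverse are the images of the breakpoints of \<open>f\<close>,
  and the exponents of the slopes change sign.\<close>

lemma thompson_inverse:
  assumes f: "f \<in> thompson_carrier"
  obtains g where "g \<in> thompson_carrier" "\<And>x. x \<in> {0..1} \<Longrightarrow> g (f x) = x"
proof -
  obtain f' B where h: "homeomorphism {0..1} {0..1} f f'" and B: "dyadic_affine f B"
    using f unfolding thompson_carrier_iff by blast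
  have f'f: "f' (f x) = x" "f (f' x) = x" "f' x \<in> {0..1}" if "x \<in> {0..1}" for x
    using h that unfolding homeomorphism_def by blast+
  have mono: "f' x < f' y" if "x \<in> {0..1}" "y \<in> {0..1}" "x < y" for x y
    using thompson_less[OF f, of "f' x" "f' y"] f'f that by simp
  have "dyadic_affine f' (f ` (B \<inter> {0..1}))"
    unfolding dyadic_affine_def
  proof (intro conjI allI impI)
    show "finite (f ` (B \<inter> {0..1}))" using B by (auto simp: dyadic_affine_def)
    show "f ` (B \<inter> {0..1}) \<subseteq> dyadic" using B thompson_dyadic[OF f] by (auto simp: dyadic_affine_def)
    fix a b :: real assume ab: "0 \<le> a \<and> a < b \<and> b \<le> 1 \<and> {a<..<b} \<inter> f ` (B \<inter> {0..1}) = {}"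
    then have ab01: "a \<in> {0..1}" "b \<in> {0..1}" by auto
    have r: "0 \<le> f' a" "f' a < f' b" "f' b \<le> 1" using f'f ab01 mono ab by auto
    have "{f' a<..<f' b} \<inter> B = {}"
    proof -
      have False if t: "f' a < t" "t < f' b" "t \<in> B" for t
      proof -
        have t01: "t \<in> {0..1}" using t r by auto
        then have "a < f t" "f t < b"
          using thompson_less[OF f, of "f' a" t] thompson_less[OF f, of t "f' b"] t f'f ab01 by auto
        then show False using ab t t01 by auto
      qed
      then show ?thesis by auto
    qed
    then obtain k :: int and c where kc: "\<And>t. t \<in> {f' a..f' b} \<Longrightarrow> f t = 2 powi k * t + c"
      by (rule dyadic_affineE[OF B r]) (rule that)
    have "f' y = 2 powi (- k) * y + - (2 powi (- k) * c)" if y: "y \<in> {a..b}" for y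
    proof -
      have y01: "y \<in> {0..1}" using y ab by auto
      have "f' y \<in> {f' a..f' b}"
        using mono[OF ab01(1) y01] mono[OF y01 ab01(2)] y by (cases "y = a"; cases "y = b") auto
      then have "y = 2 powi k * f' y + c" using kc f'f(2)[OF y01] by metis
      then have "2 powi (- k) * (y - c) = 2 powi (- k) * (2 powi k * f' y)" by simp
      then show ?thesis by (simp add: power_int_minus algebra_simps)
    qed
    then show "\<exists>(k::int) c. \<forall>t\<in>{a..b}. f' t = 2 powi k * t + c" by blast
  qed
  moreover have "strict_mono_on {0..1} f'" using mono by (auto simp: strict_mono_on_def)
  ultimately have "restrict f' {0..1} \<in> thompson_carrier"
    using homeomorphism_symD[OF h] by (intro thompson_restrictI)
  moreover have "restrict f' {0..1} (f x) = x" if "x \<in> {0..1}" for x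
    using that thompson_range[OF f that] f'f by simp
  ultimately show ?thesis by (rule that)
qed

section \<open>Group structure and action on the dyadic points\<close>

lemma thompson_simps:
  "carrier thompson_F = thompson_carrier"
  "f \<in> thompson_carrier \<Longrightarrow> g \<in> thompson_carrier \<Longrightarrow> f \<otimes>\<^bsub>thompson_F\<^esub> g = compose {0..1} f g"
  "\<one>\<^bsub>thompson_F\<^esub> = (\<lambda>x\<in>{0..1}. x)"
  using thompson_Bij by (auto simp: thompson_F_def BijGroup_def)

lemma thompson_id: "(\<lambda>x\<in>{0..1}. x) \<in> thompson_carrier"
proof (rule thompson_restrictI)
  show "homeomorphism {0..1} {0..1} (\<lambda>x. x) (\<lambda>x :: real. x)" by (rule homeomorphism_ident)
  show "dyadic_affine (\<lambda>x. x) {}"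
    unfolding dyadic_affine_def by (auto intro!: exI[of _ "0 :: int"] exI[of _ "0 :: real"])
qed (auto simp: strict_mono_on_def)

lemma thompson_group: "group thompson_F"
proof (rule groupI)
  fix f assume f: "f \<in> carrier thompson_F"
  then have f: "f \<in> thompson_carrier" by (simp add: thompson_simps)
  obtain g where g: "g \<in> thompson_carrier" "\<And>x. x \<in> {0..1} \<Longrightarrow> g (f x) = x" by (rule thompson_inverse[OF f]) blast
  then have "compose {0..1} g f = (\<lambda>x\<in>{0..1}. x)" by (auto simp: compose_def restrict_def)
  then show "\<exists>g\<in>carrier thompson_F. g \<otimes>\<^bsub>thompson_F\<^esub> f = \<one>\<^bsub>thompson_F\<^esub>"
    using g f by (auto simp: thompson_simps)
next
  fix f g h assume "f \<in> carrier thompson_F" "g \<in> carrier thompson_F" "h \<in> carrier thompson_F"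
  then show "f \<otimes>\<^bsub>thompson_F\<^esub> g \<otimes>\<^bsub>thompson_F\<^esub> h = f \<otimes>\<^bsub>thompson_F\<^esub> (g \<otimes>\<^bsub>thompson_F\<^esub> h)"
    using thompson_range[of h] by (simp add: thompson_simps thompson_compose compose_assoc[of h "{0..1}" "{0..1}"] Pi_iff)
next
  fix f assume "f \<in> carrier thompson_F"
  then have f: "f \<in> thompson_carrier" by (simp add: thompson_simps)
  then have "f \<in> extensional {0..1}" by (simp add: thompson_carrier_iff)
  then have "compose {0..1} (\<lambda>x\<in>{0..1}. x) f = f"
    using thompson_range[OF f] by (auto simp: compose_def restrict_def fun_eq_iff extensional_def)
  then show "\<one>\<^bsub>thompson_F\<^esub> \<otimes>\<^bsub>thompson_F\<^esub> f = f" using f thompson_id by (simp add: thompson_simps)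
qed (auto simp: thompson_simps thompson_compose thompson_id)

text \<open>The endpoints are left out because every element fixes them, which would spoil
  transitivity.\<close>

definition unit_dyadics :: "real set" where
  "unit_dyadics = dyadic \<inter> {0<..<1}"

lemma thompson_set_action: "set_action thompson_F unit_dyadics (\<lambda>f x. f x)"
proof -
  interpret group thompson_F by (rule thompson_group)
  show ?thesis
  proof
    fix f x assume f: "f \<in> carrier thompson_F" and x: "x \<in> unit_dyadics"
    have f: "f \<in> thompson_carrier" using f by (simp add: thompson_simps)
    show "f x \<in> unit_dyadics"
      using thompson_dyadic[OF f, of x] thompson_less[OF f, of 0 x] thompson_less[OF f, of x 1] thompson_fixes[OF f] x
      by (auto simp: unit_dyadics_def)
  qed (auto simp: thompson_simps unit_dyadics_def compose_def)
qed

text \<open>Together with \<open>gen_B\<close> this is the standard pair of generators of Thompson's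
  group; \<open>gen_B\<close> is \<open>gen_A\<close> rescaled to the right half of the
  interval.\<close>

definition gen_A :: "real \<Rightarrow> real" where
  "gen_A t = (if t \<le> 1 / 2 then t / 2 else if t \<le> 3 / 4 then t - 1 / 4 else 2 * t - 1)"

definition gen_B :: "real \<Rightarrow> real" where
  "gen_B t = (if t \<le> 1 / 2 then t else if t \<le> 3 / 4 then t / 2 + 1 / 4
     else if t \<le> 7 / 8 then t - 1 / 8 else 2 * t - 1)"

lemma gen_A: "restrict gen_A {0..1} \<in> thompson_carrier"
proof (rule thompson_restrictI)
  let ?g = "\<lambda>y :: real. min (2 * y) (min (y + 1 / 4) ((y + 1) / 2))"
  \<comment> \<open>The slopes increase, so the map is the maximum of its affine pieces and its
    inverse a minimum; this gives continuity without gluing.\<close>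
  have "gen_A = (\<lambda>t. max (t / 2) (max (t - 1 / 4) (2 * t - 1)))"
    by (auto simp: gen_A_def max_def fun_eq_iff)
  moreover have "continuous_on {0..1 :: real} (\<lambda>t. max (t / 2) (max (t - 1 / 4) (2 * t - 1)))"
    by (intro continuous_intros) auto
  ultimately have c: "continuous_on {0..1} gen_A" by (simp only:)
  have g: "?g y = (if y \<le> 1 / 4 then 2 * y else if y \<le> 1 / 2 then y + 1 / 4 else (y + 1) / 2)" for y
    unfolding min_def by argo
  show "homeomorphism {0..1} {0..1} gen_A ?g"
  proof (rule homeomorphismI)
    show "continuous_on {0..1} ?g" by (intro continuous_intros) auto
    show "?g ` {0..1} \<subseteq> {0..1}" unfolding g by auto
    show "?g (gen_A t) = t" if "t \<in> {0..1}" for t unfolding g gen_A_def by (auto simp: field_simps)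
    show "gen_A (?g y) = y" if "y \<in> {0..1}" for y unfolding g gen_A_def by (auto simp: field_simps)
  qed (use c in \<open>auto simp: gen_A_def\<close>)
  show "strict_mono_on {0..1} gen_A"
    by (auto simp: strict_mono_on_def gen_A_def)
  have "1 / 2 \<in> dyadic" "3 / 4 \<in> dyadic" using dyadicI[of 1 1] dyadicI[of 3 2] by simp_all
  moreover have "\<exists>(k::int) c. \<forall>t\<in>{a..b}. gen_A t = 2 powi k * t + c"
    if ab: "a < b" "{a<..<b} \<inter> {1 / 2, 3 / 4} = {}" for a b
  proof -
    consider "b \<le> 1 / 2" | "1 / 2 \<le> a" "b \<le> 3 / 4" | "3 / 4 \<le> a" using ab by force
    then show ?thesis
    proof cases
      case 1
      then have "\<forall>t\<in>{a..b}. gen_A t = 2 powi (- 1) * t + 0" by (auto simp: gen_A_def power_int_minus)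
      then show ?thesis by blast
    next
      case 2
      then have "\<forall>t\<in>{a..b}. gen_A t = 2 powi 0 * t + - 1 / 4" by (auto simp: gen_A_def)
      then show ?thesis by blast
    next
      case 3
      then have "\<forall>t\<in>{a..b}. gen_A t = 2 powi 1 * t + - 1" by (auto simp: gen_A_def)
      then show ?thesis by blast
    qed
  qed
  ultimately show "dyadic_affine gen_A {1 / 2, 3 / 4}"
    unfolding dyadic_affine_def by blast
qed

lemma gen_B: "restrict gen_B {0..1} \<in> thompson_carrier"
proof (rule thompson_restrictI)
  let ?g = "\<lambda>y :: real. max y (min (2 * y - 1 / 2) (min (y + 1 / 8) ((y + 1) / 2)))"
  \<comment> \<open>The identity piece on the left breaks convexity; the outer minimum with
    \<open>t\<close> supplies it.\<close>
  have eq: "gen_B t = min t (max (t / 2 + 1 / 4) (max (t - 1 / 8) (2 * t - 1)))" if "t \<in> {0..1}" for t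
    using that unfolding gen_B_def min_def max_def atLeastAtMost_iff by argo
  have "continuous_on {0..1 :: real} (\<lambda>t. min t (max (t / 2 + 1 / 4) (max (t - 1 / 8) (2 * t - 1))))"
    by (intro continuous_intros) auto
  then have c: "continuous_on {0..1} gen_B" by (subst continuous_on_cong[OF refl eq])
  have g: "?g y = (if y \<le> 1 / 2 then y else if y \<le> 5 / 8 then 2 * y - 1 / 2
      else if y \<le> 3 / 4 then y + 1 / 8 else (y + 1) / 2)" if "y \<in> {0..1}" for y
    using that unfolding min_def max_def atLeastAtMost_iff by argo
  have rB: "gen_B t \<in> {0..1}" if "t \<in> {0..1}" for t using that by (auto simp: gen_B_def)
  show "homeomorphism {0..1} {0..1} gen_B ?g"
  proof (rule homeomorphismI)
    show "continuous_on {0..1} ?g" by (intro continuous_intros) auto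
    show "?g ` {0..1} \<subseteq> {0..1}" using g by (auto simp: image_subset_iff)
    show "?g (gen_B t) = t" if "t \<in> {0..1}" for t
      unfolding g[OF rB[OF that]] using that by (auto simp: gen_B_def field_simps)
    show "gen_B (?g y) = y" if "y \<in> {0..1}" for y
      unfolding g[OF that] using that by (auto simp: gen_B_def field_simps)
    show "continuous_on {0..1} gen_B" by (rule c)
    show "gen_B ` {0..1} \<subseteq> {0..1}" using rB by blast
  qed
  show "strict_mono_on {0..1} gen_B"
    by (auto simp: strict_mono_on_def gen_B_def)
  have "1 / 2 \<in> dyadic" "3 / 4 \<in> dyadic" "7 / 8 \<in> dyadic"
    using dyadicI[of 1 1] dyadicI[of 3 2] dyadicI[of 7 3] by simp_all
  moreover have "\<exists>(k::int) c. \<forall>t\<in>{a..b}. gen_B t = 2 powi k * t + c"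
    if ab: "a < b" "{a<..<b} \<inter> {1 / 2, 3 / 4, 7 / 8} = {}" for a b
  proof -
    consider "b \<le> 1 / 2" | "1 / 2 \<le> a" "b \<le> 3 / 4" | "3 / 4 \<le> a" "b \<le> 7 / 8" | "7 / 8 \<le> a" using ab by force
    then show ?thesis
    proof cases
      case 1
      then have "\<forall>t\<in>{a..b}. gen_B t = 2 powi 0 * t + 0" by (auto simp: gen_B_def)
      then show ?thesis by blast
    next
      case 2
      then have "\<forall>t\<in>{a..b}. gen_B t = 2 powi (- 1) * t + 1 / 4" by (auto simp: gen_B_def power_int_minus)
      then show ?thesis by blast
    next
      case 3
      then have "\<forall>t\<in>{a..b}. gen_B t = 2 powi 0 * t + - 1 / 8" by (auto simp: gen_B_def)
      then show ?thesis by blast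
    next
      case 4
      then have "\<forall>t\<in>{a..b}. gen_B t = 2 powi 1 * t + - 1" by (auto simp: gen_B_def)
      then show ?thesis by blast
    qed
  qed
  ultimately show "dyadic_affine gen_B {1 / 2, 3 / 4, 7 / 8}"
    unfolding dyadic_affine_def by blast
qed

text \<open>Each move lowers the denominator or stays in \<open>unit_dyadics\<close> on the way to a point with a
  smaller one.\<close>

lemma thompson_orbit_half:
  assumes x: "x \<in> unit_dyadics"
  shows "\<exists>g\<in>thompson_carrier. g (1 / 2) = x"
proof -
  interpret set_action thompson_F unit_dyadics "\<lambda>f x. f x" by (rule thompson_set_action)
  define R where "R x \<longleftrightarrow> x \<in> unit_dyadics \<and> (\<exists>g\<in>thompson_carrier. g (1 / 2) = x)" for x
  have half: "1 / 2 \<in> unit_dyadics"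
    using dyadicI[of 1 1] by (simp add: unit_dyadics_def)
  have apply_R: "R (g x)" if g: "g \<in> thompson_carrier" and x: "R x" for g x
  proof -
    obtain h where h: "h \<in> thompson_carrier" "h (1 / 2) = x" using x by (auto simp: R_def)
    have "compose {0..1} g h (1 / 2) = g x" using h by (simp add: compose_def)
    moreover have "g x \<in> unit_dyadics" using closed[of g x] g x by (simp add: R_def thompson_simps)
    ultimately show ?thesis using thompson_compose[OF h(1) g] unfolding R_def by blast
  qed
  have unapply_R: "R x" if g: "g \<in> thompson_carrier" and x: "R (g x)" "x \<in> {0..1}" for g x
  proof -
    obtain h where h: "h \<in> thompson_carrier" "\<And>x. x \<in> {0..1} \<Longrightarrow> h (g x) = x" by (rule thompson_inverse[OF g]) blast
    then show ?thesis using apply_R[OF h(1) x(1)] x(2) by simp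
  qed
  have R_half: "R (1 / 2)"
    unfolding R_def using half thompson_id by (intro conjI bexI[of _ "\<lambda>x\<in>{0..1}. x"]) auto
  \<comment> \<open>Each of the five rules moves a point by a generator or its inverse;
    \<open>low\<close>, \<open>high\<close> and \<open>mid2\<close> double the distance to 0, 1 and
    1/2 respectively.\<close>
  have low: "R x" if "R (2 * x)" "0 < x" "x \<le> 1 / 4" for x
    using apply_R[OF gen_A that(1)] that by (simp add: gen_A_def)
  have high: "R x" if "R (2 * x - 1)" "3 / 4 \<le> x" "x < 1" for x
  proof -
    have "gen_A x = 2 * x - 1" using that(2) by (simp add: gen_A_def)
    then have "R (restrict gen_A {0..1} x)" using that by simp
    then show ?thesis by (rule unapply_R[OF gen_A]) (use that(2,3) in simp)
  qed
  have mid1: "R x" if "R (x + 1 / 4)" "1 / 4 \<le> x" "x \<le> 1 / 2" for x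
  proof -
    have "gen_A (x + 1 / 4) = x" using that(2,3) by (auto simp: gen_A_def field_simps)
    then show ?thesis using apply_R[OF gen_A that(1)] that by simp
  qed
  have mid2: "R x" if "R (2 * x - 1 / 2)" "1 / 2 \<le> x" "x \<le> 5 / 8" for x
  proof -
    have "gen_B (2 * x - 1 / 2) = x" using that(2,3) by (auto simp: gen_B_def field_simps)
    then show ?thesis using apply_R[OF gen_B that(1)] that by simp
  qed
  have mid3: "R x" if "R (x + 1 / 8)" "5 / 8 \<le> x" "x \<le> 3 / 4" for x
  proof -
    have "gen_B (x + 1 / 8) = x" using that(2,3) by (auto simp: gen_B_def field_simps)
    then show ?thesis using apply_R[OF gen_B that(1)] that by simp
  qed
  have quarter: "R (1 / 4)" "R (3 / 4)" using low[of "1 / 4"] high[of "3 / 4"] R_half by simp_all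
  have main: "0 < x \<Longrightarrow> x < 1 \<Longrightarrow> x = real_of_int k / 2 ^ (n + 2) \<Longrightarrow> R x" for n x k
  proof (induction n arbitrary: x k)
    case 0
    have "0 < k" "k < 4" using 0 by (simp_all add: field_simps)
    then have "k = 1 \<or> k = 2 \<or> k = 3" by auto
    then have "x = 1 / 4 \<or> x = 1 / 2 \<or> x = 3 / 4" using 0(3) by auto
    then show ?case using R_half quarter by metis
  next
    case (Suc n)
    note x = Suc.prems
    have two: "2 * x = real_of_int k / 2 ^ (n + 2)" using x(3) by simp
    have shift: "2 * x - real_of_int m / 4 = real_of_int (k - m * 2 ^ n) / 2 ^ (n + 2)" for m :: int
      unfolding two by (simp add: diff_divide_distrib)
    \<comment> \<open>The point in the middle range is \<open>x\<close> itself or, for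
      \<open>x\<close> in the second quarter, \<open>x + 1 / 4\<close>. Either way a doubling brings
      the denominator down to \<open>2 ^ (n + 2)\<close>.\<close>
    have R_mid: "R y" if y: "1 / 2 \<le> y" "y \<le> 3 / 4" "y = x \<or> y = x + 1 / 4" for y
    proof (cases "y \<le> 5 / 8")
      case True
      have "R (2 * y - 1 / 2)"
      proof (cases "y = x")
        case eq: True
        have "2 * y - 1 / 2 = real_of_int (k - 2 * 2 ^ n) / 2 ^ (n + 2)" using shift[of 2] eq by simp
        then show ?thesis by (rule Suc.IH[rotated 2]) (use y True in linarith)+
      next
        case False
        then have "2 * y - 1 / 2 = real_of_int k / 2 ^ (n + 2)" using y two by simp
        then show ?thesis by (rule Suc.IH[rotated 2]) (use y True in linarith)+
      qed
      then show ?thesis using mid2 y True by blast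
    next
      case gt: False
      have bounds: "0 < 2 * (y + 1 / 8) - 1" "2 * (y + 1 / 8) - 1 < 1" using y(1,2) by auto
      have "R (2 * (y + 1 / 8) - 1)"
      proof (cases "y = x")
        case eq: True
        have "2 * (y + 1 / 8) - 1 = real_of_int (k - 3 * 2 ^ n) / 2 ^ (n + 2)" using shift[of 3] eq by simp
        then show ?thesis by (rule Suc.IH[OF bounds])
      next
        case ne: False
        then have "2 * (y + 1 / 8) - 1 = real_of_int (k - 1 * 2 ^ n) / 2 ^ (n + 2)" using shift[of 1] y by simp
        then show ?thesis by (rule Suc.IH[OF bounds])
      qed
      then have "R (y + 1 / 8)" by (rule high) (use y gt in linarith)+
      then show ?thesis by (rule mid3) (use y gt in linarith)+
    qed
    consider "x \<le> 1 / 4" | "1 / 4 < x" "x \<le> 1 / 2" | "1 / 2 < x" "x \<le> 3 / 4" | "3 / 4 < x" by linarith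
    then show ?case
    proof cases
      case 1
      have "R (2 * x)" by (rule Suc.IH[OF _ _ two]) (use x 1 in linarith)+
      then show ?thesis by (rule low) (use x 1 in linarith)+
    next
      case 2
      have "R (x + 1 / 4)" by (rule R_mid) (use 2 in linarith)+
      then show ?thesis by (rule mid1) (use 2 in linarith)+
    next
      case 3
      show ?thesis by (rule R_mid) (use 3 in linarith)+
    next
      case 4
      have "2 * x - 1 = real_of_int (k - 4 * 2 ^ n) / 2 ^ (n + 2)" using shift[of 4] by simp
      then have "R (2 * x - 1)" by (rule Suc.IH[rotated 2]) (use x 4 in linarith)+
      then show ?thesis by (rule high) (use x 4 in linarith)+
    qed
  qed
  obtain k n where kn: "x = real_of_int k / 2 ^ n" using x by (auto simp: unit_dyadics_def dyadic_iff)
  then have "x = real_of_int (k * 4) / 2 ^ (n + 2)" by simp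
  then have "R x" using x by (intro main[of x "k * 4" n]) (auto simp: unit_dyadics_def)
  then show ?thesis by (simp add: R_def)
qed

text \<open>Between neighbouring points of \<open>P\<close> both maps are affine and agree at the
  two ends. \<open>P\<close> contains the breakpoints of both maps in the interval and its
  endpoints.\<close>

lemma thompson_eqI:
  assumes f: "f \<in> thompson_carrier" and g: "g \<in> thompson_carrier"
    and P: "finite P" "0 \<in> P" "1 \<in> P" "P \<subseteq> {0..1}"
    and B: "dyadic_affine f Bf" "dyadic_affine g Bg" "Bf \<inter> {0..1} \<subseteq> P" "Bg \<inter> {0..1} \<subseteq> P"
    and eq: "\<And>p. p \<in> P \<Longrightarrow> f p = g p"
  shows "f = g"
proof (rule extensionalityI)
  show "f \<in> extensional {0..1}" "g \<in> extensional {0..1}" using f g by (auto simp: thompson_carrier_iff)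
  fix x :: real assume x: "x \<in> {0..1}"
  show "f x = g x"
  proof (cases "x = 1")
    case False
    define a where "a = Max {p \<in> P. p \<le> x}"
    define b where "b = Min {p \<in> P. x < p}"
    have a: "a \<in> {p \<in> P. p \<le> x}" unfolding a_def using P x by (intro Max_in) auto
    have b: "b \<in> {p \<in> P. x < p}" unfolding b_def using P x False by (intro Min_in) auto
    have no: "\<not> (a < p \<and> p < b)" if "p \<in> P" for p
      using Max_ge[of "{p \<in> P. p \<le> x}" p] Min_le[of "{p \<in> P. x < p}" p] P(1) that
      unfolding a_def[symmetric] b_def[symmetric] by (cases "p \<le> x") auto
    have ab: "0 \<le> a" "a < b" "b \<le> 1" "a \<le> x" "x \<le> b" using a b P(4) by auto
    have "{a<..<b} \<inter> Bf = {}" using no B(3) ab by fastforce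
    then obtain k :: int and c where f': "\<And>t. t \<in> {a..b} \<Longrightarrow> f t = 2 powi k * t + c"
      by (rule dyadic_affineE[OF B(1) ab(1-3)]) (rule that)
    have "{a<..<b} \<inter> Bg = {}" using no B(4) ab by fastforce
    then obtain l :: int and d where g': "\<And>t. t \<in> {a..b} \<Longrightarrow> g t = 2 powi l * t + d"
      by (rule dyadic_affineE[OF B(2) ab(1-3)]) (rule that)
    have e: "2 powi k * a + c = 2 powi l * a + d" "2 powi k * b + c = 2 powi l * b + d"
      using eq[of a] eq[of b] a b f'[of a] f'[of b] g'[of a] g'[of b] ab by auto
    then have "(2 powi k - 2 powi l) * (b - a) = 0" by (simp add: algebra_simps)
    then have "(2 :: real) powi k = 2 powi l" using ab by simp
    then show ?thesis using e f'[of x] g'[of x] ab by simp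
  qed (use eq P in simp)
qed

text \<open>A map is determined by its graph over the breakpoints and endpoints, and this graph is a
  finite set of pairs of dyadic numbers.\<close>

lemma countable_thompson: "countable thompson_carrier"
proof -
  define Bk where "Bk f = (SOME B. dyadic_affine f B)" for f
  have Bk: "dyadic_affine f (Bk f)" if "f \<in> thompson_carrier" for f
    unfolding Bk_def by (rule someI_ex) (use that in \<open>auto simp: thompson_carrier_iff\<close>)
  define P where "P f = insert 0 (insert 1 (Bk f \<inter> {0..1}))" for f
  define enc where "enc f = (\<lambda>p. (p, f p)) ` P f" for f
  have P: "finite (P f)" "P f \<subseteq> {0..1}" "P f \<subseteq> dyadic" if "f \<in> thompson_carrier" for f
    using Bk[OF that] by (auto simp: P_def dyadic_affine_def)
  have "inj_on enc thompson_carrier"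
  proof (rule inj_onI)
    fix f g assume f: "f \<in> thompson_carrier" and g: "g \<in> thompson_carrier" and eq: "enc f = enc g"
    have Peq: "P f = P g"
    proof -
      have "fst ` enc h = P h" for h by (force simp: enc_def)
      then show ?thesis using eq by metis
    qed
    have fg: "f p = g p" if "p \<in> P f" for p
    proof -
      have "(p, f p) \<in> enc g" using that eq by (auto simp: enc_def)
      then show ?thesis by (auto simp: enc_def)
    qed
    show "f = g"
    proof (rule thompson_eqI[OF f g P(1)[OF f] _ _ P(2)[OF f] Bk[OF f] Bk[OF g]])
      show "f p = g p" if "p \<in> P f" for p by (rule fg[OF that])
      show "0 \<in> P f" "1 \<in> P f" "Bk f \<inter> {0..1} \<subseteq> P f" by (auto simp: P_def)
      show "Bk g \<inter> {0..1} \<subseteq> P f" unfolding Peq by (auto simp: P_def)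
    qed
  qed
  moreover have "enc ` thompson_carrier \<subseteq> {A. finite A \<and> A \<subseteq> dyadic \<times> dyadic}"
  proof
    fix A assume "A \<in> enc ` thompson_carrier"
    then obtain f where f: "f \<in> thompson_carrier" "A = enc f" by blast
    have "p \<in> dyadic \<and> f p \<in> dyadic" if "p \<in> P f" for p
      using thompson_dyadic[OF f(1), of p] P(2,3)[OF f(1)] that by blast
    then show "A \<in> {A. finite A \<and> A \<subseteq> dyadic \<times> dyadic}" using P(1)[OF f(1)] f(2) by (auto simp: enc_def)
  qed
  moreover have "countable {A. finite A \<and> A \<subseteq> dyadic \<times> dyadic}"
    by (intro countable_Collect_finite_subset countable_SIGMA countable_dyadic)
  ultimately have "countable (enc ` thompson_carrier)" using countable_subset by blast
  then show ?thesis using \<open>inj_on enc thompson_carrier\<close> by (rule countable_image_inj_on)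
qed

text \<open>Before the first positive breakpoint the map is linear, since it fixes 0, and its slope
  is a power of 2; on powers of 2 this is a shift of exponents.\<close>

lemma thompson_near_zero:
  assumes f: "f \<in> thompson_carrier"
  shows "\<exists>e :: int. \<exists>b :: int. \<forall>k<b. f (2 powi k) = 2 powi (k + e)"
proof -
  obtain B where B: "dyadic_affine f B" using f by (auto simp: thompson_carrier_iff)
  have fin: "finite (insert 1 (B \<inter> {0<..}))" using B by (auto simp: dyadic_affine_def)
  define b where "b = Min (insert 1 (B \<inter> {0<..}))"
  have b: "0 < b" "b \<le> 1" "\<And>y. y \<in> B \<Longrightarrow> 0 < y \<Longrightarrow> b \<le> y"
    unfolding b_def using fin by auto
  have "{0<..<b} \<inter> B = {}" using b(3) by force
  then obtain e :: int and c where ec: "\<And>t. t \<in> {0..b} \<Longrightarrow> f t = 2 powi e * t + c"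
    by (rule dyadic_affineE[OF B order_refl b(1,2)]) (rule that)
  have "c = 0" using ec[of 0] thompson_fixes(1)[OF f] b by simp
  obtain n where n: "(1 / 2) ^ n < b" using real_arch_pow_inv[of b "1 / 2"] b by auto
  have "f (2 powi k) = 2 powi (k + e)" if k: "k < - int n" for k
  proof -
    have "(2 :: real) powi k \<le> 2 powi (- int n)" using k by (intro power_int_increasing) auto
    also have "\<dots> = (1 / 2) ^ n" by (simp add: power_int_minus power_one_over inverse_eq_divide)
    finally have "2 powi k \<in> {0..b}" using n by auto
    then show ?thesis using ec \<open>c = 0\<close> by (simp add: power_int_add mult.commute)
  qed
  then show ?thesis by blast
qed

lemma class_A_thompson: "class_A thompson_F"
proof -
  interpret set_action thompson_F unit_dyadics "\<lambda>f x. f x" by (rule thompson_set_action)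
  have pt: "(2 :: real) powi k \<in> unit_dyadics" if "k < 0" for k :: int
  proof -
    have "(2 :: real) powi k < 2 powi 0" using that by (intro power_int_strict_increasing) auto
    then show ?thesis using dyadic_scale[OF dyadic_1, of k] by (simp add: unit_dyadics_def)
  qed
  have inj: "inj_on (\<lambda>k :: int. (2 :: real) powi k) {..<0}"
    by (rule inj_onI) (metis less_irrefl linorder_neqE one_less_numeral_iff power_int_strict_increasing semiring_norm(76))
  have half: "1 / 2 \<in> unit_dyadics" using pt[of "-1"] by (simp add: power_int_minus)
  obtain e where e: "\<And>f. f \<in> thompson_carrier \<Longrightarrow> \<exists>b :: int. \<forall>k<b. f (2 powi k) = 2 powi (k + e f)"
    using thompson_near_zero by metis
  show ?thesis
  proof (rule class_A_folnerI)
    show "folner_action thompson_F unit_dyadics (\<lambda>f x. f x)"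
      by (rule folner_shiftI[where pt = "\<lambda>k. 2 powi k" and e = e]) (use pt inj e in \<open>auto simp: thompson_simps\<close>)
    show t: "transitive_on thompson_F unit_dyadics (\<lambda>f x. f x)"
      by (rule transitive_onI[OF half]) (use thompson_orbit_half in \<open>auto simp: thompson_simps\<close>)
    show "faithful_on thompson_F unit_dyadics (\<lambda>f x. f x)"
      unfolding faithful_on_def
    proof (intro ballI impI)
      fix f assume f: "f \<in> carrier thompson_F" and fixed: "\<forall>x\<in>unit_dyadics. f x = x"
      have f: "f \<in> thompson_carrier" using f by (simp add: thompson_simps)
      show "f = \<one>\<^bsub>thompson_F\<^esub>"
        unfolding thompson_simps
      proof (rule extensionalityI)
        show "f \<in> extensional {0..1}" using f by (simp add: thompson_carrier_iff)
        fix x :: real assume x: "x \<in> {0..1}"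
        note fx = thompson_range[OF f x]
        \<comment> \<open>A dyadic point strictly between \<open>x\<close> and \<open>f x\<close>
          would be fixed, contradicting monotonicity.\<close>
        have "\<not> x < f x"
        proof
          assume "x < f x"
          then obtain d where d: "d \<in> dyadic" "x < d" "d < f x" by (rule dyadic_dense)
          then have "d \<in> unit_dyadics" using x fx by (auto simp: unit_dyadics_def)
          then show False using fixed thompson_less[OF f, of x d] d x fx by auto
        qed
        moreover have "\<not> f x < x"
        proof
          assume "f x < x"
          then obtain d where d: "d \<in> dyadic" "f x < d" "d < x" by (rule dyadic_dense)
          then have "d \<in> unit_dyadics" using x fx by (auto simp: unit_dyadics_def)
          then show False using fixed thompson_less[OF f, of d x] d x fx by auto
        qed
        ultimately show "f x = (\<lambda>x\<in>{0..1}. x) x" using x by simp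
      qed simp
    qed
    \<comment> \<open>The orbit of 1/2 contains all negative powers of 2, so the group is
      infinite.\<close>
    have "infinite ((\<lambda>k :: int. (2 :: real) powi k) ` {..<0})"
      using inj infinite_Iio by (simp add: finite_image_iff)
    moreover have "(\<lambda>k :: int. (2 :: real) powi k) ` {..<0} \<subseteq> (\<lambda>g. g (1 / 2)) ` thompson_carrier"
    proof
      fix x assume "x \<in> (\<lambda>k :: int. (2 :: real) powi k) ` {..<0}"
      then have "x \<in> unit_dyadics" using pt by blast
      then show "x \<in> (\<lambda>g. g (1 / 2)) ` thompson_carrier" using thompson_orbit_half by blast
    qed
    ultimately have "infinite thompson_carrier" by (meson finite_imageI finite_subset)
    then show "countable_group thompson_F"
      using countable_thompson thompson_group by (simp add: countable_group_def thompson_simps)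
  qed
qed

section \<open>The permutation representation\<close>

definition sq_summable :: "(nat \<Rightarrow> complex) \<Rightarrow> bool" where
  "sq_summable f \<longleftrightarrow> summable (\<lambda>n. (cmod (f n))\<^sup>2)"

text \<open>Vectors are functions on all of \<open>nat\<close> vanishing outside \<open>E\<close>,
  which places the space in the type over which \<open>relative_property_T\<close>
  quantifies.\<close>

definition ell2 :: "nat set \<Rightarrow> (nat \<Rightarrow> complex) inner_product_space" where
  "ell2 E = \<lparr>carrier = {f. (\<forall>n. n \<notin> E \<longrightarrow> f n = 0) \<and> sq_summable f},
     monoid.mult = (\<lambda>f g. f), one = (\<lambda>_. 0), ring.zero = (\<lambda>_. 0), add = (\<lambda>f g n. f n + g n),
     smult = (\<lambda>a f n. a * f n), cinner = (\<lambda>f g. suminf (\<lambda>n. f n * cnj (g n)))\<rparr>"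

lemma ell2_simps [simp]:
  "f \<in> carrier (ell2 E) \<longleftrightarrow> (\<forall>n. n \<notin> E \<longrightarrow> f n = 0) \<and> sq_summable f"
  "\<zero>\<^bsub>ell2 E\<^esub> = (\<lambda>_. 0)"
  "f \<oplus>\<^bsub>ell2 E\<^esub> g = (\<lambda>n. f n + g n)"
  "a \<odot>\<^bsub>ell2 E\<^esub> f = (\<lambda>n. a * f n)"
  "cinner (ell2 E) f g = (suminf (\<lambda>n. f n * cnj (g n)))"
  by (simp_all add: ell2_def)

lemma sq_norm_add: "(cmod (a + b))\<^sup>2 \<le> 2 * (cmod a)\<^sup>2 + 2 * (cmod b)\<^sup>2"
proof -
  have "(cmod (a + b))\<^sup>2 \<le> (cmod a + cmod b)\<^sup>2" by (intro power_mono norm_triangle_ineq) simp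
  also have "\<dots> = 2 * (cmod a)\<^sup>2 + 2 * (cmod b)\<^sup>2 - (cmod a - cmod b)\<^sup>2"
    by (simp add: power2_eq_square algebra_simps)
  finally show ?thesis by (smt (verit) zero_le_power2)
qed

lemma sq_summable_zero [simp]: "sq_summable (\<lambda>_. 0)"
  by (simp add: sq_summable_def)

lemma sq_summable_add:
  assumes "sq_summable f" "sq_summable g" shows "sq_summable (\<lambda>n. f n + g n)"
  unfolding sq_summable_def
proof (rule summable_comparison_test')
  show "summable (\<lambda>n. 2 * (cmod (f n))\<^sup>2 + 2 * (cmod (g n))\<^sup>2)"
    using assms unfolding sq_summable_def by (intro summable_add summable_mult)
qed (use sq_norm_add in auto)

lemma sq_summable_scale: "sq_summable f \<Longrightarrow> sq_summable (\<lambda>n. a * f n)"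
  by (simp add: sq_summable_def norm_mult power_mult_distrib summable_mult)

lemma sq_summable_minus: "sq_summable f \<Longrightarrow> sq_summable (\<lambda>n. - f n)"
  by (simp add: sq_summable_def)

lemma sq_summable_diff: "sq_summable f \<Longrightarrow> sq_summable g \<Longrightarrow> sq_summable (\<lambda>n. f n - g n)"
  using sq_summable_add[of f "\<lambda>n. - g n"] sq_summable_minus by simp

lemma summable_inner:
  assumes "sq_summable f" "sq_summable g" shows "summable (\<lambda>n. f n * cnj (g n))"
proof (rule summable_comparison_test')
  show "summable (\<lambda>n. (cmod (f n))\<^sup>2 + (cmod (g n))\<^sup>2)"
    using assms unfolding sq_summable_def by (rule summable_add)
  fix n
  have "2 * (cmod (f n) * cmod (g n)) \<le> (cmod (f n))\<^sup>2 + (cmod (g n))\<^sup>2"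
    using sum_squares_bound[of "cmod (f n)" "cmod (g n)"] by simp
  then show "norm (f n * cnj (g n)) \<le> (cmod (f n))\<^sup>2 + (cmod (g n))\<^sup>2"
    by (simp add: norm_mult) (smt (verit) mult_nonneg_nonneg norm_ge_zero)
qed

lemma ell2_self_inner:
  assumes "sq_summable f" shows "(suminf (\<lambda>n. f n * cnj (f n))) = of_real (suminf (\<lambda>n. (cmod (f n))\<^sup>2))"
proof -
  have "(suminf (\<lambda>n. f n * cnj (f n))) = (suminf (\<lambda>n. of_real ((cmod (f n))\<^sup>2)))"
    by (simp only: complex_norm_square)
  also have "\<dots> = of_real (suminf (\<lambda>n. (cmod (f n))\<^sup>2))"
    using assms unfolding sq_summable_def by (rule suminf_of_real[symmetric])
  finally show ?thesis .
qed

lemma cnorm_ell2: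
  assumes "sq_summable f" shows "cnorm (ell2 E) f = sqrt (suminf (\<lambda>n. (cmod (f n))\<^sup>2))"
  by (simp add: cnorm_def ell2_self_inner[OF assms])

lemma ell2_abelian_group: "abelian_group (ell2 E)"
proof (rule abelian_groupI)
  fix f assume f: "f \<in> carrier (ell2 E)"
  show "\<exists>g\<in>carrier (ell2 E). g \<oplus>\<^bsub>ell2 E\<^esub> f = \<zero>\<^bsub>ell2 E\<^esub>"
    by (rule bexI[of _ "\<lambda>n. - f n"]) (use f sq_summable_minus in auto)
qed (auto simp: sq_summable_add add_ac)

lemma ell2_minus:
  assumes "f \<in> carrier (ell2 E)" "g \<in> carrier (ell2 E)"
  shows "f \<ominus>\<^bsub>ell2 E\<^esub> g = (\<lambda>n. f n - g n)"
proof -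
  interpret abelian_group "ell2 E" by (rule ell2_abelian_group)
  have "\<ominus>\<^bsub>ell2 E\<^esub> g = (\<lambda>n. - g n)"
    by (rule minus_equality) (use assms sq_summable_minus in auto)
  then show ?thesis by (simp add: a_minus_def)
qed

lemma field_complex_field: "cring complex_field"
proof (rule cringI)
  show "abelian_group complex_field"
    by (rule abelian_groupI) (auto simp: complex_field_def add_ac intro: exI[of _ "- _"])
  show "Group.comm_monoid complex_field"
    by (rule comm_monoidI) (auto simp: complex_field_def mult_ac)
qed (auto simp: complex_field_def algebra_simps)

lemma ell2_module: "Module.module complex_field (ell2 E)"
  by (rule moduleI[OF field_complex_field ell2_abelian_group])
    (auto simp: complex_field_def sq_summable_scale algebra_simps)

text \<open>The limit is taken pointwise. The Cauchy bound passes to finite partial sums of the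
  squared distance to the limit, and from there to the whole series.\<close>

lemma ell2_complete:
  assumes s: "\<And>k. s k \<in> carrier (ell2 E)"
    and cauchy: "\<And>\<epsilon>. 0 < \<epsilon> \<Longrightarrow> \<exists>N. \<forall>m\<ge>N. \<forall>n\<ge>N. cnorm (ell2 E) (s m \<ominus>\<^bsub>ell2 E\<^esub> s n) < \<epsilon>"
  shows "\<exists>x\<in>carrier (ell2 E). (\<lambda>n. cnorm (ell2 E) (s n \<ominus>\<^bsub>ell2 E\<^esub> x)) \<longlonglongrightarrow> 0"
proof -
  have sq: "sq_summable (s k)" for k using s[of k] by simp
  have diff: "cnorm (ell2 E) (s m \<ominus>\<^bsub>ell2 E\<^esub> s n) = sqrt (suminf (\<lambda>i. (cmod (s m i - s n i))\<^sup>2))" for m n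
    using ell2_minus[OF s s] cnorm_ell2[OF sq_summable_diff[OF sq sq]] by simp
  have sum_le: "(\<Sum>i<K. (cmod (s m i - s n i))\<^sup>2) \<le> (suminf (\<lambda>i. (cmod (s m i - s n i))\<^sup>2))" for K m n
    using sq_summable_diff[OF sq sq, of m n] unfolding sq_summable_def by (intro sum_le_suminf) auto
  have tail: "\<exists>N. \<forall>m\<ge>N. \<forall>n\<ge>N. (suminf (\<lambda>i. (cmod (s m i - s n i))\<^sup>2)) < \<epsilon>\<^sup>2" if e: "0 < \<epsilon>" for \<epsilon>
  proof -
    obtain N where N: "\<And>m n. m \<ge> N \<Longrightarrow> n \<ge> N \<Longrightarrow> sqrt (suminf (\<lambda>i. (cmod (s m i - s n i))\<^sup>2)) < \<epsilon>"
      using cauchy[OF e] unfolding diff by blast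
    have "(suminf (\<lambda>i. (cmod (s m i - s n i))\<^sup>2)) < \<epsilon>\<^sup>2" if "m \<ge> N" "n \<ge> N" for m n
      using N[OF that] e real_sqrt_less_iff[of _ "\<epsilon>\<^sup>2"] by (metis abs_of_pos real_sqrt_abs)
    then show ?thesis by blast
  qed
  have conv: "convergent (\<lambda>k. s k i)" for i
  proof (rule Cauchy_convergent, rule metric_CauchyI)
    fix \<epsilon> :: real assume e: "0 < \<epsilon>"
    obtain N where N: "\<And>m n. m \<ge> N \<Longrightarrow> n \<ge> N \<Longrightarrow> (suminf (\<lambda>i. (cmod (s m i - s n i))\<^sup>2)) < \<epsilon>\<^sup>2"
      using tail[OF e] by blast
    have "dist (s m i) (s n i) < \<epsilon>" if "m \<ge> N" "n \<ge> N" for m n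
    proof -
      have "(cmod (s m i - s n i))\<^sup>2 \<le> (\<Sum>j<Suc i. (cmod (s m j - s n j))\<^sup>2)"
        by (rule member_le_sum) auto
      also have "\<dots> < \<epsilon>\<^sup>2" using sum_le[of m n "Suc i"] N[OF that] by linarith
      finally have "cmod (s m i - s n i) < \<epsilon>" using e by (intro power_less_imp_less_base[of _ 2 \<epsilon>]) auto
      then show ?thesis by (simp add: dist_norm)
    qed
    then show "\<exists>N. \<forall>m\<ge>N. \<forall>n\<ge>N. dist (s m i) (s n i) < \<epsilon>" by blast
  qed
  define x where "x i = lim (\<lambda>k. s k i)" for i
  have x: "(\<lambda>k. s k i) \<longlonglongrightarrow> x i" for i
    using conv[of i] unfolding x_def by (simp add: convergent_LIMSEQ_iff)
  have bound: "summable (\<lambda>i. (cmod (s m i - x i))\<^sup>2) \<and> (suminf (\<lambda>i. (cmod (s m i - x i))\<^sup>2)) \<le> \<epsilon>\<^sup>2"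
    if N: "\<And>m n. m \<ge> N \<Longrightarrow> n \<ge> N \<Longrightarrow> (suminf (\<lambda>i. (cmod (s m i - s n i))\<^sup>2)) < \<epsilon>\<^sup>2" and m: "m \<ge> N" for N m and \<epsilon> :: real
  proof -
    have "(\<Sum>i<K. (cmod (s m i - x i))\<^sup>2) \<le> \<epsilon>\<^sup>2" for K
    proof (rule tendsto_upperbound)
      show "((\<lambda>n. \<Sum>i<K. (cmod (s m i - s n i))\<^sup>2) \<longlongrightarrow> (\<Sum>i<K. (cmod (s m i - x i))\<^sup>2)) sequentially"
        by (intro tendsto_intros x)
      show "\<forall>\<^sub>F n in sequentially. (\<Sum>i<K. (cmod (s m i - s n i))\<^sup>2) \<le> \<epsilon>\<^sup>2"
        using eventually_ge_at_top[of N]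
      proof eventually_elim
        case (elim n)
        then show ?case using sum_le[where K = K and m = m and n = n] N[OF m elim] by linarith
      qed
    qed simp
    then have "summable (\<lambda>i. (cmod (s m i - x i))\<^sup>2)"
      by (intro bounded_imp_summable[where B = "\<epsilon>\<^sup>2"]) (simp_all only: lessThan_Suc_atMost[symmetric] zero_le_power2)
    moreover from this have "(suminf (\<lambda>i. (cmod (s m i - x i))\<^sup>2)) \<le> \<epsilon>\<^sup>2"
      by (rule suminf_le_const) fact
    ultimately show ?thesis by blast
  qed
  obtain N1 where N1: "\<And>m n. m \<ge> N1 \<Longrightarrow> n \<ge> N1 \<Longrightarrow> (suminf (\<lambda>i. (cmod (s m i - s n i))\<^sup>2)) < 1\<^sup>2"
    using tail[of 1] by auto
  have "sq_summable (\<lambda>i. s N1 i - x i)" using bound[of N1 1 N1] N1 by (simp add: sq_summable_def)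
  then have sqx: "sq_summable x" using sq_summable_diff[OF sq[of N1], of "\<lambda>i. s N1 i - x i"] by simp
  have "x i = 0" if "i \<notin> E" for i
    using x[of i] s that by (simp add: LIMSEQ_const_iff)
  then have xc: "x \<in> carrier (ell2 E)" using sqx by simp
  have "(\<lambda>n. cnorm (ell2 E) (s n \<ominus>\<^bsub>ell2 E\<^esub> x)) \<longlonglongrightarrow> 0"
  proof (rule LIMSEQ_I)
    fix \<epsilon> :: real assume e: "0 < \<epsilon>"
    then have e2: "0 < \<epsilon> / 2" by simp
    obtain N where N: "\<And>m n. m \<ge> N \<Longrightarrow> n \<ge> N \<Longrightarrow> (suminf (\<lambda>i. (cmod (s m i - s n i))\<^sup>2)) < (\<epsilon> / 2)\<^sup>2"
      using tail[OF e2] by blast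
    have "norm (cnorm (ell2 E) (s n \<ominus>\<^bsub>ell2 E\<^esub> x) - 0) < \<epsilon>" if n: "n \<ge> N" for n
    proof -
      have b: "summable (\<lambda>i. (cmod (s n i - x i))\<^sup>2)" "(suminf (\<lambda>i. (cmod (s n i - x i))\<^sup>2)) \<le> (\<epsilon> / 2)\<^sup>2"
        using bound[OF N n] by auto
      have "cnorm (ell2 E) (s n \<ominus>\<^bsub>ell2 E\<^esub> x) = sqrt (suminf (\<lambda>i. (cmod (s n i - x i))\<^sup>2))"
        using ell2_minus[OF s xc] cnorm_ell2[OF sq_summable_diff[OF sq sqx]] by simp
      moreover have "sqrt (suminf (\<lambda>i. (cmod (s n i - x i))\<^sup>2)) \<le> \<epsilon> / 2"
        using real_sqrt_le_mono[OF b(2)] e by simp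
      moreover have "0 \<le> (suminf (\<lambda>i. (cmod (s n i - x i))\<^sup>2))" using b(1) by (intro suminf_nonneg) auto
      ultimately show ?thesis using e by simp
    qed
    then show "\<exists>N. \<forall>n\<ge>N. norm (cnorm (ell2 E) (s n \<ominus>\<^bsub>ell2 E\<^esub> x) - 0) < \<epsilon>" by blast
  qed
  then show ?thesis using xc by blast
qed

lemma ell2_hilbert: "complex_hilbert_space (ell2 E)"
  unfolding complex_hilbert_space_def
proof (intro conjI allI ballI impI)
  show "Module.module complex_field (ell2 E)" by (rule ell2_module)
next
  fix f g h assume "f \<in> carrier (ell2 E)" "g \<in> carrier (ell2 E)" "h \<in> carrier (ell2 E)"
  then show "cinner (ell2 E) (f \<oplus>\<^bsub>ell2 E\<^esub> g) h = cinner (ell2 E) f h + cinner (ell2 E) g h"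
    by (simp add: suminf_add summable_inner distrib_right)
next
  fix a f g assume "f \<in> carrier (ell2 E)" "g \<in> carrier (ell2 E)"
  then show "cinner (ell2 E) (a \<odot>\<^bsub>ell2 E\<^esub> f) g = a * cinner (ell2 E) f g"
    using suminf_mult[OF summable_inner, of f g a] by (simp add: mult.assoc)
next
  fix f g assume "f \<in> carrier (ell2 E)" "g \<in> carrier (ell2 E)"
  then have "(\<lambda>n. f n * cnj (g n)) sums (suminf (\<lambda>n. f n * cnj (g n)))" by (simp add: summable_inner summable_sums)
  then have "(\<lambda>n. cnj (f n * cnj (g n))) sums cnj (suminf (\<lambda>n. f n * cnj (g n)))" by (simp only: sums_cnj)
  then show "cinner (ell2 E) g f = cnj (cinner (ell2 E) f g)"
    by (simp add: sums_iff mult.commute)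
next
  fix f assume f: "f \<in> carrier (ell2 E)" "f \<noteq> \<zero>\<^bsub>ell2 E\<^esub>"
  then obtain i where i: "f i \<noteq> 0" by (auto simp: fun_eq_iff)
  have "0 < (suminf (\<lambda>n. (cmod (f n))\<^sup>2))"
    using f i by (intro suminf_pos2[of _ i]) (auto simp: sq_summable_def)
  then show "0 < Re (cinner (ell2 E) f f)" using f ell2_self_inner[of f] by simp
next
  fix s :: "nat \<Rightarrow> nat \<Rightarrow> complex"
  assume "range s \<subseteq> carrier (ell2 E) \<and> (\<forall>\<epsilon>>0. \<exists>N. \<forall>m\<ge>N. \<forall>n\<ge>N. cnorm (ell2 E) (s m \<ominus>\<^bsub>ell2 E\<^esub> s n) < \<epsilon>)"
  then show "\<exists>x\<in>carrier (ell2 E). (\<lambda>n. cnorm (ell2 E) (s n \<ominus>\<^bsub>ell2 E\<^esub> x)) \<longlonglongrightarrow> 0"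
    by (intro ell2_complete) (blast, meson)
qed

text \<open>Absolute convergence allows the terms to be permuted; passing through
  \<open>has_sum\<close> over \<open>E\<close> removes the order of summation.\<close>

lemma sums_reindex:
  fixes u :: "nat \<Rightarrow> 'b::banach"
  assumes p: "bij_betw p E E" and u: "summable (\<lambda>n. norm (u n))" and E: "\<And>n. n \<notin> E \<Longrightarrow> u n = 0"
  shows "(\<lambda>n. if n \<in> E then u (p n) else 0) sums suminf u"
proof -
  have "(u has_sum suminf u) UNIV"
    by (rule norm_summable_imp_has_sum[OF u]) (rule summable_sums[OF summable_norm_cancel[OF u]])
  also have "(u has_sum suminf u) UNIV \<longleftrightarrow> (u has_sum suminf u) E"
    by (rule has_sum_cong_neutral) (use E in auto)
  also have "\<dots> \<longleftrightarrow> ((\<lambda>n. u (p n)) has_sum suminf u) E"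
    by (rule has_sum_reindex_bij_betw[OF p, symmetric])
  also have "\<dots> \<longleftrightarrow> ((\<lambda>n. if n \<in> E then u (p n) else 0) has_sum suminf u) UNIV"
    by (rule has_sum_cong_neutral) auto
  finally show ?thesis by (rule has_sum_imp_sums)
qed

lemma summable_norm_inner:
  assumes "sq_summable v" "sq_summable w" shows "summable (\<lambda>n. norm (v n * cnj (w n)))"
proof -
  have "sq_summable (\<lambda>n. of_real (cmod (v n)))" "sq_summable (\<lambda>n. of_real (cmod (w n)))"
    using assms by (simp_all add: sq_summable_def)
  from summable_inner[OF this] have "summable (\<lambda>n. of_real (cmod (v n) * cmod (w n)) :: complex)" by simp
  then show ?thesis by (simp only: summable_of_real_iff norm_mult complex_mod_cnj)
qed

section \<open>Translation of functions and the permutation representation\<close>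

context set_action begin

definition translate :: "'a \<Rightarrow> ('x \<Rightarrow> complex) \<Rightarrow> 'x \<Rightarrow> complex" where
  "translate g v = (\<lambda>x. if x \<in> E then v (f (inv g) x) else 0)"

lemma translate_mult:
  "g \<in> carrier G \<Longrightarrow> h \<in> carrier G \<Longrightarrow> translate (g \<otimes> h) v = translate g (translate h v)"
  by (auto simp: translate_def fun_eq_iff inv_mult_group act_mult)

lemma translate_indicator:
  assumes "g \<in> carrier G" "A \<subseteq> E"
  shows "translate g (\<lambda>x. of_bool (x \<in> A)) = (\<lambda>x. of_bool (x \<in> f g ` A))"
proof
  fix x
  have "f (inv g) x \<in> A \<longleftrightarrow> x \<in> f g ` A" if "x \<in> E"
    using that assms by (auto intro!: image_eqI[of x _ "f (inv g) x"])
  moreover have "x \<in> E" if "x \<in> f g ` A" using that assms by auto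
  ultimately show "translate g (\<lambda>x. of_bool (x \<in> A)) x = of_bool (x \<in> f g ` A)"
    by (auto simp: translate_def)
qed

end

lemma sq_summable_indicator: "finite A \<Longrightarrow> sq_summable (\<lambda>n. of_bool (n \<in> A))"
  unfolding sq_summable_def by (rule summable_finite[of A]) auto

lemma suminf_finite_of_bool:
  assumes "finite A" shows "suminf (\<lambda>n. of_bool (n \<in> A) :: real) = card A"
  using suminf_finite[OF assms, of "\<lambda>n. of_bool (n \<in> A) :: real"] by simp

context
  fixes G :: "('a, 'm) monoid_scheme" and E :: "nat set" and f :: "'a \<Rightarrow> nat \<Rightarrow> nat"
  assumes act: "set_action G E f"
begin

interpretation set_action G E f by (rule act)

lemma translate_closed:
  assumes g: "g \<in> carrier G" and v: "v \<in> carrier (ell2 E)"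
  shows "translate g v \<in> carrier (ell2 E)"
proof -
  have "(\<lambda>n. if n \<in> E then (cmod (v (f (inv\<^bsub>G\<^esub> g) n)))\<^sup>2 else 0) sums suminf (\<lambda>n. (cmod (v n))\<^sup>2)"
    by (rule sums_reindex[OF act_bij]) (use g v in \<open>auto simp: sq_summable_def\<close>)
  then have "summable (\<lambda>n. if n \<in> E then (cmod (v (f (inv\<^bsub>G\<^esub> g) n)))\<^sup>2 else 0)" by (rule sums_summable)
  moreover have "(\<lambda>n. if n \<in> E then (cmod (v (f (inv\<^bsub>G\<^esub> g) n)))\<^sup>2 else 0) = (\<lambda>n. (cmod (translate g v n))\<^sup>2)"
    by (auto simp: translate_def fun_eq_iff)
  ultimately show ?thesis by (simp add: sq_summable_def translate_def)
qed

lemma translate_inner: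
  assumes g: "g \<in> carrier G" and v: "v \<in> carrier (ell2 E)" "w \<in> carrier (ell2 E)"
  shows "cinner (ell2 E) (translate g v) (translate g w) = cinner (ell2 E) v w"
proof -
  have "(\<lambda>n. if n \<in> E then v (f (inv\<^bsub>G\<^esub> g) n) * cnj (w (f (inv\<^bsub>G\<^esub> g) n)) else 0) sums
      suminf (\<lambda>n. v n * cnj (w n))"
    by (rule sums_reindex[OF act_bij]) (use g v in \<open>auto intro: summable_norm_inner\<close>)
  moreover have "(\<lambda>n. if n \<in> E then v (f (inv\<^bsub>G\<^esub> g) n) * cnj (w (f (inv\<^bsub>G\<^esub> g) n)) else 0) =
      (\<lambda>n. translate g v n * cnj (translate g w n))"
    by (auto simp: translate_def fun_eq_iff)
  ultimately show ?thesis by (simp add: sums_iff)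
qed

lemma translate_set_action: "set_action G (carrier (ell2 E)) translate"
proof
  show "translate g v \<in> carrier (ell2 E)" if "g \<in> carrier G" "v \<in> carrier (ell2 E)" for g v
    using that by (rule translate_closed)
  show "translate \<one>\<^bsub>G\<^esub> v = v" if "v \<in> carrier (ell2 E)" for v
    using that by (auto simp: translate_def fun_eq_iff)
qed (rule translate_mult)

abbreviation (input) perm_rep :: "'a \<Rightarrow> (nat \<Rightarrow> complex) \<Rightarrow> nat \<Rightarrow> complex" where
  "perm_rep \<equiv> \<lambda>g. restrict (translate g) (carrier (ell2 E))"

lemma perm_rep_unitary: "unitary_representation G (ell2 E) perm_rep"
  unfolding unitary_representation_def
proof (intro conjI ballI allI)
  show "complex_hilbert_space (ell2 E)" by (rule ell2_hilbert)
  show "group_action G (carrier (ell2 E)) perm_rep"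
    by (rule set_action.restrict_group_action[OF translate_set_action])
next
  fix g v w assume "g \<in> carrier G" and v: "v \<in> carrier (ell2 E)" "w \<in> carrier (ell2 E)"
  moreover have "v \<oplus>\<^bsub>ell2 E\<^esub> w \<in> carrier (ell2 E)" using v by (simp add: sq_summable_add)
  ultimately show "perm_rep g (v \<oplus>\<^bsub>ell2 E\<^esub> w) = perm_rep g v \<oplus>\<^bsub>ell2 E\<^esub> perm_rep g w"
    by (simp only: restrict_apply' ell2_simps) (auto simp: translate_def fun_eq_iff)
next
  fix g a v assume "g \<in> carrier G" and v: "v \<in> carrier (ell2 E)"
  moreover have "a \<odot>\<^bsub>ell2 E\<^esub> v \<in> carrier (ell2 E)" using v by (simp add: sq_summable_scale)
  ultimately show "perm_rep g (a \<odot>\<^bsub>ell2 E\<^esub> v) = a \<odot>\<^bsub>ell2 E\<^esub> perm_rep g v"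
    by (simp only: restrict_apply' ell2_simps) (auto simp: translate_def fun_eq_iff)
next
  fix g v w assume "g \<in> carrier G" "v \<in> carrier (ell2 E)" "w \<in> carrier (ell2 E)"
  then show "cinner (ell2 E) (perm_rep g v) (perm_rep g w) = cinner (ell2 E) v w"
    by (simp only: restrict_apply' translate_inner)
qed

lemma perm_rep_almost_invariant:
  assumes F: "folner_action G E f" shows "almost_invariant_vectors G (ell2 E) perm_rep"
  unfolding almost_invariant_vectors_def
proof (intro allI impI)
  fix Q and \<epsilon> :: real assume Q: "finite Q \<and> Q \<subseteq> carrier G \<and> 0 < \<epsilon>"
  \<comment> \<open>The squared norm of the displacement is twice the boundary, so
    \<open>\<epsilon>\<^sup>2 / 4\<close> leaves a factor 2 for the strict inequality.\<close>
  then have Q': "finite Q" "Q \<subseteq> carrier G" "0 < \<epsilon>\<^sup>2 / 4" by simp_all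
  obtain A where A: "finite A" "A \<noteq> {}" "A \<subseteq> E"
    "\<And>g. g \<in> Q \<Longrightarrow> real (card (f g ` A - A)) \<le> \<epsilon>\<^sup>2 / 4 * real (card A)"
    by (rule folner_actionD[OF F Q']) (rule that)
  define v :: "nat \<Rightarrow> complex" where "v = (\<lambda>n. of_bool (n \<in> A))"
  have vc: "v \<in> carrier (ell2 E)" using A sq_summable_indicator[OF A(1)] by (auto simp: v_def)
  have normv: "cnorm (ell2 E) v = sqrt (card A)"
  proof -
    have "(\<lambda>n. (cmod (v n))\<^sup>2) = (\<lambda>n. of_bool (n \<in> A))" by (auto simp: v_def fun_eq_iff)
    then show ?thesis using cnorm_ell2[of v E] vc suminf_finite_of_bool[OF A(1)] by simp
  qed
  have cA: "0 < real (card A)" using A by (simp add: card_gt_0_iff)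
  have "cnorm (ell2 E) (perm_rep g v \<ominus>\<^bsub>ell2 E\<^esub> v) < \<epsilon> * cnorm (ell2 E) v" if g: "g \<in> Q" for g
  proof -
    have gG: "g \<in> carrier G" using g Q by blast
    let ?D = "(A - f g ` A) \<union> (f g ` A - A)"
    have tc: "translate g v \<in> carrier (ell2 E)" by (rule translate_closed[OF gG vc])
    have "perm_rep g v \<ominus>\<^bsub>ell2 E\<^esub> v = (\<lambda>n. translate g v n - v n)"
      unfolding restrict_apply'[OF vc] by (rule ell2_minus[OF tc vc])
    moreover have "(\<lambda>n. (cmod (translate g v n - v n))\<^sup>2) = (\<lambda>n. of_bool (n \<in> ?D))"
      using translate_indicator[OF gG A(3)] by (auto simp: v_def fun_eq_iff)
    moreover have "sq_summable (\<lambda>n. translate g v n - v n)"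
      using tc vc by (intro sq_summable_diff) simp_all
    ultimately have "cnorm (ell2 E) (perm_rep g v \<ominus>\<^bsub>ell2 E\<^esub> v) = sqrt (card ?D)"
      using cnorm_ell2[of "\<lambda>n. translate g v n - v n" E] suminf_finite_of_bool[of ?D] A(1) by simp
    also have "card ?D = 2 * card (f g ` A - A)"
      by (rule card_symdiff_image[OF A(1) act_inj_on[OF gG A(3)]])
    also have "sqrt (2 * card (f g ` A - A)) < sqrt (\<epsilon>\<^sup>2 * card A)"
    proof (rule real_sqrt_less_mono)
      have "0 < \<epsilon>\<^sup>2 * card A" using cA Q by simp
      then show "real (2 * card (f g ` A - A)) < \<epsilon>\<^sup>2 * real (card A)" using A(4)[OF g] by simp
    qed
    also have "\<dots> = \<epsilon> * cnorm (ell2 E) v" using Q by (simp add: normv real_sqrt_mult)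
    finally show ?thesis .
  qed
  moreover have "v \<noteq> \<zero>\<^bsub>ell2 E\<^esub>" using A(2) by (auto simp: v_def fun_eq_iff)
  ultimately show "\<exists>v\<in>carrier (ell2 E). v \<noteq> \<zero>\<^bsub>ell2 E\<^esub> \<and>
      (\<forall>g\<in>Q. cnorm (ell2 E) (perm_rep g v \<ominus>\<^bsub>ell2 E\<^esub> v) < \<epsilon> * cnorm (ell2 E) v)"
    using vc by blast
qed

text \<open>An invariant vector is constant along \<open>H\<close>-orbits, and a square-summable
  function takes a given non-zero value only finitely often; so the orbit of any point of its
  support is finite.\<close>

lemma relative_property_T_finite_orbit:
  assumes T: "relative_property_T H G" and F: "folner_action G E f" and H: "H \<subseteq> carrier G"
  obtains x where "x \<in> E" "finite ((\<lambda>h. f h x) ` H)"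
proof -
  have "\<exists>v\<in>carrier (ell2 E). v \<noteq> \<zero>\<^bsub>ell2 E\<^esub> \<and> (\<forall>h\<in>H. perm_rep h v = v)"
    by (rule T[unfolded relative_property_T_def, THEN spec, THEN spec, THEN mp])
      (rule conjI[OF perm_rep_unitary perm_rep_almost_invariant[OF F]])
  then obtain v where v: "v \<in> carrier (ell2 E)" "v \<noteq> \<zero>\<^bsub>ell2 E\<^esub>" and fixed: "\<forall>h\<in>H. perm_rep h v = v"
    by (elim bexE conjE)
  then obtain x where x: "v x \<noteq> 0" by (auto simp: fun_eq_iff)
  then have xE: "x \<in> E" using v(1) by auto
  have const: "v (f h x) = v x" if h: "h \<in> H" for h
  proof -
    have "translate h v = v" using bspec[OF fixed h] unfolding restrict_apply'[OF v(1)] .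
    then have "v (f h x) = translate h v (f h x)" by simp
    also have "\<dots> = v x" using h H xE by (auto simp: translate_def)
    finally show ?thesis .
  qed
  have "(\<lambda>n. (cmod (v n))\<^sup>2) \<longlonglongrightarrow> 0" using v(1) by (intro summable_LIMSEQ_zero) (simp add: sq_summable_def)
  then have "\<forall>\<^sub>F n in sequentially. (cmod (v n))\<^sup>2 < (cmod (v x))\<^sup>2"
    by (rule order_tendstoD) (use x in simp)
  then obtain N where N: "\<And>n. n \<ge> N \<Longrightarrow> (cmod (v n))\<^sup>2 < (cmod (v x))\<^sup>2"
    by (auto simp: eventually_sequentially)
  have "f h x < N" if "h \<in> H" for h
    using N[of "f h x"] const[OF that] by (cases "N \<le> f h x") simp_all
  then have "finite ((\<lambda>h. f h x) ` H)" by (meson finite_lessThan finite_subset image_subsetI lessThan_iff)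
  with xE show ?thesis by (rule that)
qed

end

text \<open>Here the finite orbit is all of \<open>E\<close>, and an infinite group cannot act
  faithfully on a finite set.\<close>

lemma property_T_not_class_A:
  assumes "countable_group G" "property_T G" shows "\<not> class_A G"
proof
  assume A: "class_A G"
  obtain E :: "nat set" and f where E: "set_action G E f" "transitive_on G E f"
    "faithful_on G E f" "folner_action G E f" using class_AE[OF A] by metis
  interpret set_action G E f by fact
  obtain x where x: "x \<in> E" "finite ((\<lambda>g. f g x) ` carrier G)"
    using relative_property_T_finite_orbit[OF E(1) _ E(4)] assms(2) unfolding property_T_def by blast
  have "E \<subseteq> (\<lambda>g. f g x) ` carrier G" using E(2) x(1) by (fastforce elim: transitive_onD)
  then have "finite E" using x(2) finite_subset by blast
  then show False using finite_carrier_if_faithful[OF E(3)] assms(1) by (simp add: countable_group_def)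
qed

text \<open>By normality all \<open>H\<close>-orbits of a transitive action of \<open>G\<close> have the same size \<open>n\<close>. If \<open>n\<close> is
  finite, then \<open>h\<close> to the power \<open>n!\<close> acts trivially for all \<open>h\<close> in \<open>H\<close>.\<close>

lemma (in set_action) finite_exponent_if_finite_orbit:
  assumes H: "H \<lhd> G" and t: "transitive_on G E f" and fa: "faithful_on G E f"
    and x: "x \<in> E" "finite ((\<lambda>h. f h x) ` H)"
  shows "finite_exponent (G\<lparr>carrier := H\<rparr>)"
proof -
  interpret normal H G by fact
  let ?N = "card ((\<lambda>h. f h x) ` H)"
  have orbit: "finite ((\<lambda>h. f h y) ` H) \<and> card ((\<lambda>h. f h y) ` H) \<le> ?N" if y: "y \<in> E" for y
  proof -
    obtain g where g: "g \<in> carrier G" "f g x = y" using transitive_onD[OF t x(1) y] .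
    \<comment> \<open>By normality \<open>h g x = g (inv g h g) x\<close>, so the orbit of
      \<open>g x\<close> lies in the \<open>g\<close>-image of the orbit of
      \<open>x\<close>.\<close>
    have "(\<lambda>h. f h y) ` H \<subseteq> f g ` (\<lambda>h. f h x) ` H"
    proof
      fix z assume "z \<in> (\<lambda>h. f h y) ` H"
      then obtain h where h: "h \<in> H" "z = f h y" by blast
      have hG: "h \<in> carrier G" using h(1) subset by blast
      have "f g (f (inv g \<otimes> h \<otimes> g) x) = f (g \<otimes> (inv g \<otimes> h \<otimes> g)) x"
        using g hG x by (simp add: act_mult)
      also have "g \<otimes> (inv g \<otimes> h \<otimes> g) = h \<otimes> g" using g hG by (simp flip: m_assoc)
      also have "f (h \<otimes> g) x = z" using g h hG x by (simp add: act_mult)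
      finally have "z = f g (f (inv g \<otimes> h \<otimes> g) x)" by simp
      moreover have "inv g \<otimes> h \<otimes> g \<in> H" using inv_op_closed1[OF g(1) h(1)] .
      ultimately show "z \<in> f g ` (\<lambda>h. f h x) ` H" by blast
    qed
    then show ?thesis using x(2) by (meson card_image_le card_mono finite_imageI finite_subset order_trans)
  qed
  have "h [^] (fact ?N :: nat) = \<one>" if h: "h \<in> H" for h
  proof -
    have hG: "h \<in> carrier G" using h subset by blast
    have pH: "h [^] i \<in> H" for i :: nat
      by (induction i) (use h in auto)
    have pG: "h [^] i \<in> carrier G" for i :: nat using hG by simp
    have "f (h [^] (fact ?N :: nat)) y = y" if y: "y \<in> E" for y
    proof -
      let ?p = "\<lambda>i :: nat. f (h [^] i) y"
      \<comment> \<open>Pigeonhole: the \<open>?N + 1\<close> listed points lie in an orbit of at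
        most \<open>?N\<close> points, and the period found divides the factorial.\<close>
      have "\<not> inj_on ?p {..?N}"
      proof
        assume "inj_on ?p {..?N}"
        then have "card {..?N} \<le> card ((\<lambda>h. f h y) ` H)"
          by (rule card_inj_on_le) (use pH orbit[OF y] in auto)
        then show False using orbit[OF y] by simp
      qed
      then obtain i j where ij: "i < j" "j \<le> ?N" "?p i = ?p j"
        unfolding inj_on_def by (metis atMost_iff nat_neq_iff)
      have "?p j = f (h [^] i) (?p (j - i))"
        using act_mult[OF pG pG y, of i "j - i"] nat_pow_mult[OF hG, of i "j - i"] ij(1) by simp
      with ij(3) have fixed: "?p (j - i) = y"
        using act_inj[OF pG closed[OF pG y] y, of i] by simp
      have "j - i dvd fact ?N" using ij by (intro dvd_fact) auto
      then obtain k where k: "fact ?N = (j - i) * k" ..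
      have "?p ((j - i) * m) = y" for m
      proof (induction m)
        case (Suc m)
        have "?p ((j - i) * Suc m) = f (h [^] (j - i)) (?p ((j - i) * m))"
          using act_mult[OF pG pG y, of "j - i" "(j - i) * m"] nat_pow_mult[OF hG, of "j - i" "(j - i) * m"]
          by simp
        then show ?case using Suc fixed by simp
      qed (use y in simp)
      then show ?thesis unfolding k .
    qed
    then show ?thesis using fa pG unfolding faithful_on_def by blast
  qed
  then show ?thesis unfolding finite_exponent_def
    using nat_pow_consistent by (intro exI[of _ "fact ?N"]) (auto simp: Suc_leI)
qed

lemma relative_property_T_not_class_A:
  assumes "H \<lhd> G" "\<not> finite_exponent (G\<lparr>carrier := H\<rparr>)" "relative_property_T H G"
  shows "\<not> class_A G"
proof
  assume A: "class_A G"
  obtain E :: "nat set" and f where E: "set_action G E f" "transitive_on G E f"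
    "faithful_on G E f" "folner_action G E f" using class_AE[OF A] by metis
  interpret set_action G E f by fact
  interpret normal H G by fact
  obtain x where "x \<in> E" "finite ((\<lambda>h. f h x) ` H)"
    using relative_property_T_finite_orbit[OF E(1) assms(3) E(4) subset] .
  then show False using finite_exponent_if_finite_orbit[OF assms(1) E(2,3)] assms(2) by blast
qed

section \<open>The counterexamples\<close>

lemma infinite_if_faithful:
  assumes "countable_group G" "set_action G E f" "faithful_on G E f" shows "infinite E"
  using set_action.finite_carrier_if_faithful[OF assms(2,3)] assms(1) by (auto simp: countable_group_def)

lemma class_A_free_productI:
  assumes A: "class_A G" and B: "class_A H" shows "class_A (free_product G H)"
proof -
  obtain S :: "nat set" and f where S: "set_action G S f" "countable_group G" "transitive_on G S f"
    "faithful_on G S f" "folner_action G S f" using class_AE[OF A] by metis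
  obtain T :: "nat set" and f' where T: "set_action H T f'" "countable_group H" "transitive_on H T f'"
    "faithful_on H T f'" "folner_action H T f'" using class_AE[OF B] by metis
  show ?thesis
    by (rule class_A_free_product[OF S(2) T(2) S(1,3) infinite_if_faithful[OF S(2,1,4)] S(5)
          T(1,3) infinite_if_faithful[OF T(2,1,4)] T(5)])
qed

text \<open>The pulled-back action need not be faithful, but \<open>class_A_free_product\<close>
  gets faithfulness from its second piece, the free product itself; this lets a factor outside the
  class take part.\<close>

lemma pullback_folner_transitive:
  assumes \<phi>: "\<phi> \<in> hom K H" "\<phi> ` carrier K = carrier H"
    and S: "transitive_on H S f" "folner_action H S f"
  shows "transitive_on K S (\<lambda>k. f (\<phi> k))" "folner_action K S (\<lambda>k. f (\<phi> k))"
proof -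
  show "transitive_on K S (\<lambda>k. f (\<phi> k))"
    unfolding transitive_on_def
  proof (intro ballI)
    fix x y assume "x \<in> S" "y \<in> S"
    then obtain h where "h \<in> carrier H" "f h x = y" by (rule transitive_onD[OF S(1)])
    then show "\<exists>k\<in>carrier K. f (\<phi> k) x = y" using \<phi>(2) by (metis imageE)
  qed
  show "folner_action K S (\<lambda>k. f (\<phi> k))"
    unfolding folner_action_def
  proof (intro allI impI)
    fix Q and \<epsilon> :: real assume Q: "finite Q \<and> Q \<subseteq> carrier K \<and> 0 < \<epsilon>"
    then have Q': "finite (\<phi> ` Q)" "\<phi> ` Q \<subseteq> carrier H" "0 < \<epsilon>" using \<phi> by auto
    obtain A where "finite A" "A \<noteq> {}" "A \<subseteq> S"
      "\<And>g. g \<in> \<phi> ` Q \<Longrightarrow> real (card (f g ` A - A)) \<le> \<epsilon> * real (card A)"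
      by (rule folner_actionD[OF S(2) Q']) (rule that)
    then show "\<exists>A. finite A \<and> A \<noteq> {} \<and> A \<subseteq> S \<and>
        (\<forall>g\<in>Q. real (card (f (\<phi> g) ` A - A)) \<le> \<epsilon> * real (card A))" by blast
  qed
qed

text \<open>The \<open>k\<close>-th power of a shear, so that each shear gives an action of the
  integers. The entry 3 is the one required by \<open>Zsq_semidirect_not_class_A\<close>.\<close>

definition shear_left :: "int \<Rightarrow> int \<times> int \<Rightarrow> int \<times> int" where
  "shear_left k p = (fst p + 3 * k * snd p, snd p)"

definition shear_right :: "int \<Rightarrow> int \<times> int \<Rightarrow> int \<times> int" where
  "shear_right k p = (fst p, snd p + 3 * k * fst p)"

lemma set_action_shear:
  "set_action integer_group UNIV shear_left" "set_action integer_group UNIV shear_right"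
proof -
  interpret group integer_group by simp
  show "set_action integer_group UNIV shear_left" "set_action integer_group UNIV shear_right"
    by (unfold_locales; auto simp: shear_left_def shear_right_def algebra_simps)+
qed

lemma shear_word_add:
  "foldr (case_sum shear_left shear_right) w (p + q) =
     foldr (case_sum shear_left shear_right) w p + foldr (case_sum shear_left shear_right) w q"
  by (induction w) (auto simp: shear_left_def shear_right_def algebra_simps split: sum.split)

text \<open>The group is a copy of Z * Z, which is in the class as a free product; its letters
  \<open>Inl 1\<close> and \<open>Inr 1\<close> act as the two shears.\<close>

lemma free_group_shears:
  obtains H :: "nat monoid" and \<theta> a b where "class_A H"
    "\<theta> \<in> hom H (AutoGroup (integer_group \<times>\<times> integer_group))" "a \<in> carrier H" "b \<in> carrier H"
    "\<And>x y. \<theta> a (x, y) = (x + 3 * y, y)" "\<And>x y. \<theta> b (x, y) = (x, y + 3 * x)"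
proof -
  let ?F = "free_product integer_group integer_group"
  let ?w = "foldr (case_sum shear_left shear_right)"
  have AF: "class_A ?F" by (intro class_A_free_productI class_A_integer_group)
  then have cF: "countable_group ?F" by (simp add: class_A_def)
  obtain H :: "nat monoid" and h where H: "group H" "h \<in> iso H ?F" by (rule nat_copy[OF cF])
  interpret F: set_action ?F UNIV ?w
    by (rule set_action_free_product) (simp_all add: set_action_shear)
  have h: "h \<in> hom H ?F" "h ` carrier H = carrier ?F" using H(2) by (auto simp: iso_def bij_betw_def)
  interpret s: set_action H UNIV "\<lambda>g. ?w (h g)"
    by (rule set_action_iso[OF F.set_action_axioms H(1) h(1)])
  have aut: "?w (h g) \<in> auto (integer_group \<times>\<times> integer_group)" if "g \<in> carrier H" for g
    using s.act_bij[OF that] by (simp add: auto_def hom_def Bij_def shear_word_add del: split_paired_All)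
  have \<theta>: "(\<lambda>g. ?w (h g)) \<in> hom H (AutoGroup (integer_group \<times>\<times> integer_group))"
  proof (rule homI)
    fix g assume "g \<in> carrier H"
    then show "?w (h g) \<in> carrier (AutoGroup (integer_group \<times>\<times> integer_group))"
      using aut by (simp add: AutoGroup_def)
  next
    fix g g' assume g: "g \<in> carrier H" "g' \<in> carrier H"
    have "?w (h (g \<otimes>\<^bsub>H\<^esub> g')) p = ?w (h g) (?w (h g') p)" for p
      using s.act_mult[OF g, of p] by simp
    then show "?w (h (g \<otimes>\<^bsub>H\<^esub> g')) =
        ?w (h g) \<otimes>\<^bsub>AutoGroup (integer_group \<times>\<times> integer_group)\<^esub> ?w (h g')"
      using aut[OF g(1)] aut[OF g(2)] by (simp add: AutoGroup_def BijGroup_def auto_def compose_def fun_eq_iff)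
  qed
  have letters: "[Inl 1] \<in> carrier ?F" "[Inr 1] \<in> carrier ?F" by (simp_all add: reduced_words_Cons)
  obtain a where a: "a \<in> carrier H" "h a = [Inl 1]" using letters(1) h(2) by (metis imageE)
  obtain b where b: "b \<in> carrier H" "h b = [Inr 1]" using letters(2) h(2) by (metis imageE)
  show ?thesis
    by (rule that[OF class_A_iso[OF AF H] \<theta> a(1) b(1)])
      (simp_all add: a(2) b(2) shear_left_def shear_right_def)
qed

lemma semidirect_counterexample:
  obtains H :: "nat monoid" and \<theta> where "class_A H"
    "\<theta> \<in> hom H (AutoGroup (integer_group \<times>\<times> integer_group))"
    "countable_group (semidirect_product (integer_group \<times>\<times> integer_group) H \<theta>)"
    "\<not> class_A (semidirect_product (integer_group \<times>\<times> integer_group) H \<theta>)"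
proof -
  obtain H :: "nat monoid" and \<theta> a b where H: "class_A H"
    and \<theta>: "\<theta> \<in> hom H (AutoGroup (integer_group \<times>\<times> integer_group))"
    and ab: "a \<in> carrier H" "b \<in> carrier H"
    "\<And>x y. \<theta> a (x, y) = (x + 3 * y, y)" "\<And>x y. \<theta> b (x, y) = (x, y + 3 * x)"
    by (rule free_group_shears) (rule that)
  have cH: "countable_group H" using H by (simp add: class_A_def)
  then have gH: "group H" by (simp add: countable_group_def)
  have "group (semidirect_product (integer_group \<times>\<times> integer_group) H \<theta>)"
    by (intro semidirect_product_group DirProd_group gH \<theta>) simp_all
  then have "countable_group (semidirect_product (integer_group \<times>\<times> integer_group) H \<theta>)"
    using cH by (auto simp: countable_group_def finite_cartesian_product_iff)
  then show ?thesis
    using that[OF H \<theta>] Zsq_semidirect_not_class_A[OF gH \<theta> ab] by blast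
qed

text \<open>\<open>K\<close> is the semidirect product copied onto \<open>nat\<close>, and
  \<open>\<phi>\<close> is the projection to the acting group.\<close>

lemma not_class_A_with_quotient_in_class_A:
  obtains K :: "nat monoid" and H :: "nat monoid" and \<phi> where "countable_group K" "\<not> class_A K"
    "class_A H" "\<phi> \<in> hom K H" "\<phi> ` carrier K = carrier H"
proof -
  let ?Z = "integer_group \<times>\<times> integer_group"
  obtain H :: "nat monoid" and \<theta> where H: "class_A H"
    and S: "countable_group (semidirect_product ?Z H \<theta>)" "\<not> class_A (semidirect_product ?Z H \<theta>)"
    by (rule semidirect_counterexample) (rule that)
  obtain K :: "nat monoid" and h where K: "group K" "h \<in> iso K (semidirect_product ?Z H \<theta>)" "countable_group K"
    by (rule nat_copy[OF S(1)])
  interpret K: group K by fact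
  have "group (semidirect_product ?Z H \<theta>)" using S(1) by (simp add: countable_group_def)
  then have "\<not> class_A K" using class_A_iso[OF _ _ K.iso_set_sym[OF K(2)]] S(2) by blast
  moreover have "(\<lambda>k. snd (h k)) \<in> hom K H" "(\<lambda>k. snd (h k)) ` carrier K = carrier H"
  proof -
    have h: "h \<in> hom K (semidirect_product ?Z H \<theta>)" "h ` carrier K = UNIV \<times> carrier H"
      using K(2) by (auto simp: iso_def bij_betw_def)
    have snd_mult: "snd (p \<otimes>\<^bsub>semidirect_product ?Z H \<theta>\<^esub> q) = snd p \<otimes>\<^bsub>H\<^esub> snd q" for p q
      by (cases p; cases q) simp
    have "snd (h k) \<in> carrier H" if "k \<in> carrier K" for k
      using h(2) that by (metis SigmaD2 imageI prod.collapse)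
    then show "(\<lambda>k. snd (h k)) \<in> hom K H"
      by (intro homI) (simp_all only: hom_mult[OF h(1)] snd_mult)
    have "snd ` h ` carrier K = carrier H" unfolding h(2) by force
    then show "(\<lambda>k. snd (h k)) ` carrier K = carrier H" by (simp add: image_image)
  qed
  ultimately show ?thesis using that K(3) H by blast
qed

lemma free_product_counterexample:
  "\<exists>(G :: nat monoid) (H :: nat monoid). countable_group G \<and> countable_group H \<and>
     class_A (free_product G H) \<and> \<not> (class_A G \<and> class_A H)"
proof -
  obtain K :: "nat monoid" and H :: "nat monoid" and \<phi> where K: "countable_group K" "\<not> class_A K"
    and H: "class_A H" and \<phi>: "\<phi> \<in> hom K H" "\<phi> ` carrier K = carrier H"
    by (rule not_class_A_with_quotient_in_class_A) (rule that)
  obtain S :: "nat set" and f where S: "set_action H S f" "countable_group H" "transitive_on H S f"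
    "faithful_on H S f" "folner_action H S f" using class_AE[OF H] by metis
  have "group K" using K(1) by (simp add: countable_group_def)
  note a = set_action_iso[OF S(1) this \<phi>(1)] and b = pullback_folner_transitive[OF \<phi> S(3,5)]
  \<comment> \<open>Both copies of \<open>K\<close> act through \<open>\<phi>\<close> on a set taken
    from the quotient \<open>H\<close>.\<close>
  have "class_A (free_product K K)"
    by (rule class_A_free_product[OF K(1) K(1)])
      (rule a b infinite_if_faithful[OF S(2,1,4)])+
  then show ?thesis using K by blast
qed

lemma co_amenable_counterexample:
  "\<exists>(G :: (nat \<times> int) monoid) H.
     class_A G \<and> subgroup H G \<and> countable_group (G\<lparr>carrier := H\<rparr>) \<and>
     co_amenable H G \<and> \<not> class_A (G\<lparr>carrier := H\<rparr>) \<and>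
     (\<exists>(N :: nat monoid) \<theta>. group N \<and> \<theta> \<in> hom integer_group (AutoGroup N) \<and>
        G = semidirect_product N integer_group \<theta> \<and>
        H = carrier N \<times> {\<one>\<^bsub>integer_group\<^esub>})"
proof -
  obtain K :: "nat monoid" where K: "countable_group K" "\<not> class_A K"
    by (rule not_class_A_with_quotient_in_class_A) (rule that)
  obtain N :: "nat monoid" and \<theta> d where N: "countable_group N" "d \<in> iso N (direct_sum K)"
    and \<theta>: "\<theta> \<in> hom integer_group (AutoGroup N)" and A: "class_A (semidirect_product N integer_group \<theta>)"
    by (rule wreath_exists[OF K(1)]) (rule that)
  have gN: "group N" and countN: "countable (carrier N)" using N(1) by (simp_all add: countable_group_def)
  interpret N: group N by (rule gN)
  have gD: "group (direct_sum K)" using K(1) by (simp add: countable_group_def group.direct_sum_group)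
  have nN: "\<not> class_A N"
    using class_A_iso[OF _ gD N.iso_set_sym[OF N(2)]] direct_sum_not_class_A[OF K(1)] K(2) by blast
  let ?G = "semidirect_product N integer_group \<theta>" and ?H = "carrier N \<times> {\<one>\<^bsub>integer_group\<^esub>}"
  have co: "co_amenable ?H ?G" by (rule co_amenable_semidirect_int[OF gN countN \<theta>])
  then have sub: "subgroup ?H ?G" by (simp add: co_amenable_def)
  have "group ?G" by (rule semidirect_product_group[OF gN _ \<theta>]) simp
  then have gH: "group (?G\<lparr>carrier := ?H\<rparr>)" using sub by (rule subgroup.subgroup_is_group[rotated])
  have "\<theta> 0 = (\<lambda>x\<in>carrier N. x)"
    using group_hom.hom_one[of integer_group "AutoGroup N" \<theta>] \<theta> N.AutoGroup
    by (simp add: group_hom_def group_hom_axioms_def AutoGroup_def BijGroup_def)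
  then have iso: "(\<lambda>n. (n, 0)) \<in> iso N (?G\<lparr>carrier := ?H\<rparr>)"
    by (auto simp: iso_def hom_def bij_betw_def inj_on_def)
  have "\<not> class_A (?G\<lparr>carrier := ?H\<rparr>)" using class_A_iso[OF _ gN iso] nN by blast
  moreover have "countable_group (?G\<lparr>carrier := ?H\<rparr>)"
    using N(1) gH by (auto simp: countable_group_def finite_cartesian_product_iff)
  ultimately show ?thesis
    using A sub co gN \<theta> by blast
qed

theorem theorem1p7:
  shows
    "(\<forall>G :: 'a monoid. countable_group G \<and> amenable_group G \<longrightarrow> class_A G)
   \<and>
    (\<forall>(G :: 'a monoid) (H :: 'b monoid). countable_group G \<and> countable_group H \<longrightarrow>
       (class_A G \<and> class_A H \<longleftrightarrow> class_A (G \<times>\<times> H)))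
   \<and>
    ((\<forall>(G :: 'a monoid) (H :: 'b monoid). countable_group G \<and> countable_group H \<longrightarrow>
        class_A G \<and> class_A H \<longrightarrow> class_A (free_product G H)) \<and>
     (\<exists>(G :: nat monoid) (H :: nat monoid). countable_group G \<and> countable_group H \<and>
        class_A (free_product G H) \<and> \<not> (class_A G \<and> class_A H)))
   \<and>
    (\<exists>(G :: (int \<times> int) monoid) (H :: nat monoid) \<theta>.
       countable_group G \<and> countable_group H \<and> class_A G \<and> class_A H \<and>
       \<theta> \<in> hom H (AutoGroup G) \<and> \<not> class_A (semidirect_product G H \<theta>) \<and>
       G = integer_group \<times>\<times> integer_group)
   \<and>
    (\<forall>G :: 'a monoid. countable_group G \<longrightarrow>
       (\<exists>K :: nat monoid. class_A K \<and> mon G K \<noteq> {}))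
   \<and>
    ((\<forall>(G :: 'a monoid) H. countable_group G \<and> subgroup H G \<and>
        countable_group (G\<lparr>carrier := H\<rparr>) \<and> co_amenable H G \<longrightarrow>
        class_A (G\<lparr>carrier := H\<rparr>) \<longrightarrow> class_A G) \<and>
     (\<exists>(G :: (nat \<times> int) monoid) H.
        class_A G \<and> subgroup H G \<and> countable_group (G\<lparr>carrier := H\<rparr>) \<and>
        co_amenable H G \<and> \<not> class_A (G\<lparr>carrier := H\<rparr>) \<and>
        (\<exists>(N :: nat monoid) \<theta>. group N \<and> \<theta> \<in> hom integer_group (AutoGroup N) \<and>
           G = semidirect_product N integer_group \<theta> \<and>
           H = carrier N \<times> {\<one>\<^bsub>integer_group\<^esub>})))
   \<and>
    (\<forall>G :: 'a monoid. countable_group G \<and> property_T G \<longrightarrow> \<not> class_A G)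
   \<and>
    (\<forall>(G :: 'a monoid) H. countable_group G \<and> H \<lhd> G \<and>
       \<not> finite_exponent (G\<lparr>carrier := H\<rparr>) \<and> relative_property_T H G \<longrightarrow> \<not> class_A G)
   \<and>
    (class_A thompson_F \<and>
     (\<forall>G :: 'a monoid. tarski_monster G \<and> \<not> amenable_group G \<longrightarrow> \<not> class_A G))"
proof (intro conjI allI impI; (elim conjE)?)
  fix G :: "'a monoid" and H :: "'b monoid"
  assume "countable_group G" "countable_group H"
  then show "class_A G \<and> class_A H \<longleftrightarrow> class_A (G \<times>\<times> H)"
    using class_A_DirProd_iff by blast
next
  fix G :: "'a monoid" and H :: "'b monoid"
  assume "class_A G" "class_A H"
  then show "class_A (free_product G H)" by (rule class_A_free_productI)
next
  obtain H :: "nat monoid" and \<theta> where H: "class_A H"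
    and S: "\<theta> \<in> hom H (AutoGroup (integer_group \<times>\<times> integer_group))"
      "\<not> class_A (semidirect_product (integer_group \<times>\<times> integer_group) H \<theta>)"
    by (rule semidirect_counterexample) (rule that)
  have "class_A (integer_group \<times>\<times> integer_group)" by (intro class_A_DirProd class_A_integer_group)
  then show "\<exists>(G :: (int \<times> int) monoid) (H :: nat monoid) \<theta>.
       countable_group G \<and> countable_group H \<and> class_A G \<and> class_A H \<and>
       \<theta> \<in> hom H (AutoGroup G) \<and> \<not> class_A (semidirect_product G H \<theta>) \<and>
       G = integer_group \<times>\<times> integer_group"
    using H S by (metis class_A_def)
qed (rule class_A_amenable free_product_counterexample embeds_in_class_A class_A_co_amenable
  co_amenable_counterexample property_T_not_class_A relative_property_T_not_class_A
  class_A_thompson tarski_monster_not_class_A; assumption)+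

end
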